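(* Let $\beta\in\mathbb{R}\setminus\{0\}$, $\mu>0$, $s>\frac32$, and let $u_0:\mathbb{R}\to\mathbb{R}$ with $u_0\in H^s(\mathbb{R})$. Let $u\in\mathcal{C}([0,T_0],H^s(\mathbb{R}))$ be the unique local-in-time solution of $$\partial_t u+u\,\partial_x u+(\mathcal{H}u)\,\partial_x(\mathcal{H}u)+\beta\,\mathcal{H}u-\mu\,\partial_x^2u=0,\qquad u(0,\cdot)=u_0,$$ and let $T_0<T_*<+\infty$ be a time such that $u$ extends to a solution in $\mathcal{C}([0,T_* ),H^s(\mathbb{R}))$. Then $$\lim_{t\to T_*}\|u(t,\cdot)\|_{H^s}=+\infty\quad\text{if and only if}\quad\int_0^{T_*}\|\partial_xu(t,\cdot)\|_{L^\infty}\,dt=+\infty .$$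
   Context: $\mathcal{H}$ is the Hilbert transform in the spatial variable, defined by $\widehat{\mathcal{H}\varphi}(\xi)=-i\,\mathrm{sign}(\xi)\,\widehat{\varphi}(\xi)$, where $\mathrm{sign}(\xi)=-1,0,1$ for $\xi<0$, $\xi=0$, $\xi>0$ respectively. A solution on $[0,T]$ (or $[0,T)$) is a real-valued function in $\mathcal{C}([0,T],H^s(\mathbb{R}))$ (or $\mathcal{C}([0,T),H^s(\mathbb{R}))$) with $u(0,\cdot)=u_0$ satisfying the equation in the sense of distributions on $(0,T)\times\mathbb{R}$ (equivalently, in Duhamel/mild form). For $u_0\in H^s(\mathbb{R})$ with $s>\frac32$ there exist $T_0=T_0(u_0)>0$ and a unique solution in $\mathcal{C}([0,T_0],H^s(\mathbb{R}))$. *)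

theory Defs
  imports "HOL-Analysis.Analysis" "HOL-Probability.Essential_Supremum"
begin

text \<open>
  Elements of the spaces of functions modulo equality almost everywhere are given by Borel
  representatives; every notion below is insensitive to the choice of the representative.
\<close>

definition square_integrable :: "(real \<Rightarrow> 'b::{real_normed_vector, second_countable_topology}) \<Rightarrow> bool"
  where "square_integrable f \<longleftrightarrow>
    f \<in> borel_measurable lborel \<and> integrable lborel (\<lambda>x. (norm (f x))\<^sup>2)"

text \<open>
  The Fourier transform on \<open>L\<^sup>2\<close>, with kernel \<open>exp (- i x \<xi>)\<close>: the limit in \<open>L\<^sup>2\<close>, as
  \<open>R \<rightarrow> \<infinity>\<close>, of the transforms of the truncations of \<open>f\<close> to \<open>[-R, R]\<close>. It exists by Plancherel's
  theorem and is unique almost everywhere.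
\<close>

definition is_fourier :: "(real \<Rightarrow> complex) \<Rightarrow> (real \<Rightarrow> complex) \<Rightarrow> bool"
  where "is_fourier f g \<longleftrightarrow> square_integrable g \<and>
    ((\<lambda>R. \<integral>\<^sup>+\<xi>. ennreal ((cmod (g \<xi> - (LINT x:{-R..R}|lborel. cis (- (x * \<xi>)) * f x)))\<^sup>2) \<partial>lborel)
       \<longlongrightarrow> 0) at_top"

definition fourier :: "(real \<Rightarrow> real) \<Rightarrow> real \<Rightarrow> complex"
  where "fourier f = (SOME g. is_fourier (\<lambda>x. complex_of_real (f x)) g)"

text \<open>The Sobolev space \<open>H\<^sup>s(\<real>)\<close> of real-valued functions, for \<open>s \<ge> 0\<close> (so that \<open>H\<^sup>s \<subseteq> L\<^sup>2\<close>).\<close>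

definition in_sobolev :: "real \<Rightarrow> (real \<Rightarrow> real) \<Rightarrow> bool"
  where "in_sobolev s f \<longleftrightarrow> square_integrable f \<and>
    integrable lborel (\<lambda>\<xi>. (1 + \<xi>\<^sup>2) powr s * (cmod (fourier f \<xi>))\<^sup>2)"

definition sobolev_norm :: "real \<Rightarrow> (real \<Rightarrow> real) \<Rightarrow> real"
  where "sobolev_norm s f = sqrt (LINT \<xi>|lborel. (1 + \<xi>\<^sup>2) powr s * (cmod (fourier f \<xi>))\<^sup>2)"

definition sobolev_continuous_on :: "real \<Rightarrow> real set \<Rightarrow> (real \<Rightarrow> real \<Rightarrow> real) \<Rightarrow> bool"
  where "sobolev_continuous_on s I u \<longleftrightarrow> (\<forall>t\<in>I. in_sobolev s (u t) \<and>
    ((\<lambda>\<tau>. sobolev_norm s (\<lambda>x. u \<tau> x - u t x)) \<longlongrightarrow> 0) (at t within I))"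

text \<open>
  The Hilbert transform of a real-valued \<open>L\<^sup>2\<close> function. The multiplier is odd and purely
  imaginary, so the transform is again real-valued.
\<close>

definition hilbert :: "(real \<Rightarrow> real) \<Rightarrow> real \<Rightarrow> real"
  where "hilbert f = (SOME g. square_integrable g \<and>
    (AE \<xi> in lborel. fourier g \<xi> = - \<i> * complex_of_real (sgn \<xi>) * fourier f \<xi>))"

primrec C_k :: "nat \<Rightarrow> ('a::euclidean_space \<Rightarrow> real) \<Rightarrow> bool"
  where
    "C_k 0 f \<longleftrightarrow> continuous_on UNIV f"
  | "C_k (Suc k) f \<longleftrightarrow> (\<exists>f'. (\<forall>x. (f has_derivative f' x) (at x)) \<and> (\<forall>v. C_k k (\<lambda>x. f' x v)))"

definition test_function :: "'a::euclidean_space set \<Rightarrow> ('a \<Rightarrow> real) \<Rightarrow> bool"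
  where "test_function \<Omega> \<phi> \<longleftrightarrow>
    (\<forall>k. C_k k \<phi>) \<and> compact (closure {x. \<phi> x \<noteq> 0}) \<and> closure {x. \<phi> x \<noteq> 0} \<subseteq> \<Omega>"

definition is_weak_deriv :: "(real \<Rightarrow> real) \<Rightarrow> (real \<Rightarrow> real) \<Rightarrow> bool"
  where "is_weak_deriv f g \<longleftrightarrow> (\<forall>K. compact K \<longrightarrow> set_integrable lborel K g) \<and>
    (\<forall>\<phi>. test_function UNIV \<phi> \<longrightarrow>
      (LINT x|lborel. f x * deriv \<phi> x) = - (LINT x|lborel. g x * \<phi> x))"

definition weak_deriv :: "(real \<Rightarrow> real) \<Rightarrow> real \<Rightarrow> real"
  where "weak_deriv f = (SOME g. is_weak_deriv f g)"

definition Linfty_norm :: "(real \<Rightarrow> real) \<Rightarrow> ennreal"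
  where "Linfty_norm f = esssup lborel (\<lambda>x. ennreal \<bar>f x\<bar>)"

text \<open>
  The equation \<open>\<partial>\<^sub>t u + u \<partial>\<^sub>x u + (H u) \<partial>\<^sub>x (H u) + \<beta> H u - \<mu> \<partial>\<^sub>x\<^sup>2 u = 0\<close> in the sense of distributions on
  \<open>J \<times> \<real>\<close>. The pairing is an iterated integral, since representatives chosen separately for each
  time need not be jointly measurable; for \<open>u\<close> continuous into \<open>H\<^sup>s\<close>, \<open>s > 3/2\<close>, the inner integral
  is continuous and compactly supported in \<open>t\<close>.
\<close>

definition solves_distributionally ::
    "real \<Rightarrow> real \<Rightarrow> real set \<Rightarrow> (real \<Rightarrow> real \<Rightarrow> real) \<Rightarrow> bool"
  where "solves_distributionally \<beta> \<mu> J u \<longleftrightarrow>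
    (\<forall>\<phi>. test_function (J \<times> UNIV) \<phi> \<longrightarrow>
      (LINT t:J|lborel. LINT x|lborel.
         - u t x * deriv (\<lambda>\<tau>. \<phi> (\<tau>, x)) t
         + (u t x * weak_deriv (u t) x
            + hilbert (u t) x * weak_deriv (hilbert (u t)) x
            + \<beta> * hilbert (u t) x) * \<phi> (t, x)
         - \<mu> * u t x * deriv (deriv (\<lambda>y. \<phi> (t, y))) x) = 0)"

definition solution_on ::
    "real \<Rightarrow> real \<Rightarrow> real \<Rightarrow> (real \<Rightarrow> real) \<Rightarrow> real set \<Rightarrow> (real \<Rightarrow> real \<Rightarrow> real) \<Rightarrow> bool"
  where "solution_on \<beta> \<mu> s u\<^sub>0 I u \<longleftrightarrow>
    sobolev_continuous_on s I u \<and>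
    (AE x in lborel. u 0 x = u\<^sub>0 x) \<and>
    solves_distributionally \<beta> \<mu> (interior I) u"

end

theory Submission
  imports Defs "HOL-Probability.Characteristic_Functions"
begin

text \<open>
  Let \<open>U\<close> be the Fourier transform of \<open>u\<close>, \<open>v = H u\<close>, \<open>N\<close> the transform of \<open>u\<^sup>2 + v\<^sup>2\<close> and
  \<open>\<lambda> = \<mu> \<xi>\<^sup>2 - i \<beta> sgn \<xi>\<close>. The equation becomes the Duhamel formula
  \<open>U(t) = e\<^bsup>- \<lambda> (t - r)\<^esup> U(r) - (i \<xi> / 2) \<integral>\<^bsub>r\<^esub>\<^bsup>t\<^esup> e\<^bsup>- \<lambda> (t - \<tau>)\<^esup> N(\<tau>) d\<tau>\<close>. Since \<open>\<bar>N\<bar> \<le> 2 \<parallel>u\<parallel>\<^sup>2\<close> in terms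
  of the \<open>L\<^sup>2\<close> norm and viscosity gains two derivatives, the \<open>L\<^sup>2\<close> norm controls everything: a bound in
  \<open>L\<^sup>2\<close> up to \<open>T\<close> bootstraps to a bound in \<open>H\<^sup>s\<close> in steps of a quarter of a derivative, and if the \<open>L\<^sup>2\<close> norm
  is at most \<open>M\<close> at a time close enough to \<open>T\<close>, then it stays at most \<open>M + 1\<close> from there on.
  Hence if the \<open>H\<^sup>s\<close> norm does not tend to infinity, then it is bounded, and so is \<open>\<parallel>\<partial>\<^sub>x u\<parallel>\<close> in \<open>L\<^sup>\<infinity>\<close>.
  Conversely, the dissipation being nonnegative and \<open>\<beta> H\<close> skew, \<open>y = \<parallel>u\<parallel>\<^sup>2\<close> satisfies
  \<open>y' \<le> \<integral> (\<partial>\<^sub>x u) (u\<^sup>2 + v\<^sup>2) dx \<le> 2 \<parallel>\<partial>\<^sub>x u\<parallel> y\<close>, and Gronwall's inequality bounds \<open>y\<close> if \<open>\<parallel>\<partial>\<^sub>x u\<parallel>\<close> is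
  integrable in time.
\<close>

section \<open>Square integrable functions\<close>

text \<open>The operators \<open>fourier\<close>, \<open>hilbert\<close> and
  \<open>weak_deriv\<close> choose a representative for each function separately, so neither
  \<open>u\<close> nor its transform is known to be jointly measurable in time and the other
  variable, and identities hold only off null sets that depend on the times involved. Moreover the
  equation may be tested only with compactly supported functions, and exponentials are not among
  them. Duhamel's formula is therefore reached through spatial cut-offs, and the obstacle is the
  commutator of a cut-off with the nonlocal Hilbert transform: it is controlled merely in mean
  square, so the passage to the limit is made after integrating over bounded frequency windows. The
  right-hand side \<open>mild_rhs\<close> of the formula is, for a fixed starting time, an explicit
  function that is jointly measurable and differentiable in time. It stands in for the transform of
  \<open>u\<close> in the energy estimate, where a time derivative is taken frequency by frequency
  and Fubini's theorem is applied. The equation is available on the open time interval only, so the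
  estimates start at a positive time and continuity in H^s covers the times before it.\<close>

definition L2 :: "(real \<Rightarrow> 'b::{real_normed_vector, second_countable_topology}) \<Rightarrow> real"
  where "L2 f = sqrt (LINT x|lborel. (norm (f x))\<^sup>2)"

lemma square_integrable_measurable:
  "square_integrable f \<Longrightarrow> f \<in> borel_measurable lborel"
  by (simp add: square_integrable_def)

lemma square_integrable_sq: "square_integrable f \<Longrightarrow> integrable lborel (\<lambda>x. (norm (f x))\<^sup>2)"
  by (simp add: square_integrable_def)

lemma square_integrable_bound:
  assumes "f \<in> borel_measurable lborel" "square_integrable g" "AE x in lborel. norm (f x) \<le> norm (g x)"
  shows "square_integrable f"
proof -
  have "integrable lborel (\<lambda>x. (norm (f x))\<^sup>2)"
  proof (rule Bochner_Integration.integrable_bound[OF square_integrable_sq[OF assms(2)]])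
    show "(\<lambda>x. (norm (f x))\<^sup>2) \<in> borel_measurable lborel" using assms(1) by measurable
    show "AE x in lborel. norm ((norm (f x))\<^sup>2) \<le> norm ((norm (g x))\<^sup>2)"
      using assms(3) by eventually_elim (simp add: power_mono)
  qed
  then show ?thesis using assms(1) by (simp add: square_integrable_def)
qed

lemma square_integrable_norm: "square_integrable f \<Longrightarrow> square_integrable (\<lambda>x. norm (f x))"
  by (auto simp: square_integrable_def)

lemma square_integrable_cong_AE:
  assumes "square_integrable f" "g \<in> borel_measurable lborel" "AE x in lborel. f x = g x"
  shows "square_integrable g"
  by (rule square_integrable_bound[OF assms(2,1)]) (use assms(3) in \<open>eventually_elim, simp\<close>)

lemma square_integrable_zero [simp]: "square_integrable (\<lambda>x. 0)"
  by (simp add: square_integrable_def)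

lemma norm_add_sq_le: "(norm (a + b))\<^sup>2 \<le> 2 * (norm a)\<^sup>2 + 2 * (norm (b::'b::real_normed_vector))\<^sup>2"
proof -
  have "(norm (a + b))\<^sup>2 \<le> (norm a + norm b)\<^sup>2" by (intro power_mono norm_triangle_ineq) auto
  also have "\<dots> \<le> 2 * (norm a)\<^sup>2 + 2 * (norm b)\<^sup>2"
    using sum_squares_ge_zero[of "norm a - norm b" 0] by (simp add: power2_eq_square algebra_simps)
  finally show ?thesis .
qed

lemma square_integrable_add:
  fixes f g :: "real \<Rightarrow> 'b::{real_normed_vector, second_countable_topology}"
  assumes f: "square_integrable f" and g: "square_integrable g"
  shows "square_integrable (\<lambda>x. f x + g x)"
proof -
  have [measurable]: "f \<in> borel_measurable lborel" "g \<in> borel_measurable lborel"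
    using assms by (auto dest: square_integrable_measurable)
  have "integrable lborel (\<lambda>x. (norm (f x + g x))\<^sup>2)"
  proof (rule Bochner_Integration.integrable_bound)
    show "integrable lborel (\<lambda>x. 2 * (norm (f x))\<^sup>2 + 2 * (norm (g x))\<^sup>2)"
      using assms by (auto intro!: Bochner_Integration.integrable_add dest: square_integrable_sq)
    show "AE x in lborel. norm ((norm (f x + g x))\<^sup>2) \<le> norm (2 * (norm (f x))\<^sup>2 + 2 * (norm (g x))\<^sup>2)"
      using norm_add_sq_le by auto
  qed measurable
  then show ?thesis by (simp add: square_integrable_def)
qed

lemma square_integrable_scaleR: "square_integrable f \<Longrightarrow> square_integrable (\<lambda>x. c *\<^sub>R f x)"
  by (auto simp: square_integrable_def power_mult_distrib)

lemma square_integrable_mult_left: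
  fixes f :: "real \<Rightarrow> 'b::{real_normed_div_algebra, second_countable_topology}"
  shows "square_integrable f \<Longrightarrow> square_integrable (\<lambda>x. c * f x)"
  by (auto simp: square_integrable_def power_mult_distrib norm_mult)

lemma square_integrable_diff:
  assumes "square_integrable f" "square_integrable g"
  shows "square_integrable (\<lambda>x. f x - g x)"
  using square_integrable_add[OF assms(1) square_integrable_scaleR[OF assms(2), of "-1"]] by simp

lemma square_integrable_mult_bounded:
  fixes f :: "real \<Rightarrow> 'b::{real_normed_algebra, second_countable_topology}"
  assumes f: "square_integrable f" and b: "b \<in> borel_measurable lborel" "\<And>x. norm (b x) \<le> C"
  shows "square_integrable (\<lambda>x. b x * f x)" "square_integrable (\<lambda>x. f x * b x)"
proof -
  have [measurable]: "f \<in> borel_measurable borel" "b \<in> borel_measurable borel"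
    using b(1) square_integrable_measurable[OF f] by auto
  have *: "norm (b x) * norm (f x) \<le> \<bar>C\<bar> * norm (f x)" for x
    using b(2)[of x] by (intro mult_right_mono) auto
  have "norm (b x * f x) \<le> \<bar>C\<bar> * norm (f x)" "norm (f x * b x) \<le> \<bar>C\<bar> * norm (f x)" for x
    using norm_mult_ineq[of "b x" "f x"] norm_mult_ineq[of "f x" "b x"] *[of x] by (auto simp: mult.commute)
  then show "square_integrable (\<lambda>x. b x * f x)" "square_integrable (\<lambda>x. f x * b x)"
    by (auto intro!: square_integrable_bound[OF _ square_integrable_scaleR[OF f, of C]])
qed

lemma square_integrable_norm_mult:
  assumes f: "square_integrable f" and g: "square_integrable g"
  shows "integrable lborel (\<lambda>x. norm (f x) * norm (g x))"
proof (rule Bochner_Integration.integrable_bound)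
  have [measurable]: "f \<in> borel_measurable borel" "g \<in> borel_measurable borel"
    using square_integrable_measurable[OF f] square_integrable_measurable[OF g] by auto
  show "(\<lambda>x. norm (f x) * norm (g x)) \<in> borel_measurable lborel" by simp
  show "integrable lborel (\<lambda>x. (norm (f x))\<^sup>2 + (norm (g x))\<^sup>2)"
    using assms by (auto intro!: Bochner_Integration.integrable_add dest: square_integrable_sq)
  have "a * b \<le> a\<^sup>2 + b\<^sup>2" if "a \<ge> 0" "b \<ge> 0" for a b :: real
    using sum_squares_bound[of a b] mult_nonneg_nonneg[OF that] by linarith
  then show "AE x in lborel. norm (norm (f x) * norm (g x)) \<le> norm ((norm (f x))\<^sup>2 + (norm (g x))\<^sup>2)"
    by auto
qed

lemma square_integrable_mult:
  fixes f g :: "real \<Rightarrow> 'b::{real_normed_algebra, second_countable_topology, banach}"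
  assumes f: "square_integrable f" and g: "square_integrable g"
  shows "integrable lborel (\<lambda>x. f x * g x)"
  using square_integrable_measurable[OF f] square_integrable_measurable[OF g]
  by (intro Bochner_Integration.integrable_bound[OF square_integrable_norm_mult[OF f g]])
     (auto intro!: AE_I2 simp: norm_mult_ineq)

lemma L2_nonneg [simp]: "0 \<le> L2 f"
  by (simp add: L2_def)

lemma L2_sq: "(L2 f)\<^sup>2 = (LINT x|lborel. (norm (f x))\<^sup>2)"
  by (simp add: L2_def)

lemma nn_integral_L2:
  "square_integrable f \<Longrightarrow> (\<integral>\<^sup>+x. ennreal ((norm (f x))\<^sup>2) \<partial>lborel) = ennreal ((L2 f)\<^sup>2)"
  by (subst nn_integral_eq_integral) (auto simp: L2_sq square_integrable_sq)

lemma square_integrableI_nn: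
  assumes "f \<in> borel_measurable lborel" "(\<integral>\<^sup>+x. ennreal ((norm (f x))\<^sup>2) \<partial>lborel) < \<infinity>"
  shows "square_integrable f"
  using assms by (auto simp: square_integrable_def intro!: integrableI_bounded)

lemma square_integrable_nn_le:
  assumes "f \<in> borel_measurable lborel" "(\<integral>\<^sup>+x. ennreal ((norm (f x))\<^sup>2) \<partial>lborel) \<le> ennreal (c\<^sup>2)" "0 \<le> c"
  shows "square_integrable f" "L2 f \<le> c"
proof -
  show s: "square_integrable f"
    using le_less_trans[OF assms(2)] by (intro square_integrableI_nn assms(1)) auto
  have "ennreal ((L2 f)\<^sup>2) \<le> ennreal (c\<^sup>2)"
    using nn_integral_L2[OF s] assms(2) by simp
  then have "(L2 f)\<^sup>2 \<le> c\<^sup>2" by simp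
  then show "L2 f \<le> c" using assms(3) by (rule power2_le_imp_le)
qed

text \<open>If the smaller square fails to be integrable, its Bochner integral takes the default
  value 0 and the inequality still holds; so only the larger function has to be controlled.\<close>

lemma L2_mono_AE:
  assumes "square_integrable g" "AE x in lborel. norm (f x) \<le> norm (g x)"
  shows "L2 f \<le> L2 g"
  unfolding L2_def
proof (intro real_sqrt_le_mono integral_mono_AE' square_integrable_sq[OF assms(1)])
  show "AE x in lborel. (norm (f x))\<^sup>2 \<le> (norm (g x))\<^sup>2"
    using assms(2) by eventually_elim (simp add: power_mono)
qed simp

lemma L2_cong_AE:
  assumes "AE x in lborel. f x = g x" "f \<in> borel_measurable lborel" "g \<in> borel_measurable lborel"
  shows "L2 f = L2 g"
proof -
  have "(LINT x|lborel. (norm (f x))\<^sup>2) = (LINT x|lborel. (norm (g x))\<^sup>2)"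
    by (rule integral_cong_AE) (use assms in auto)
  then show ?thesis by (simp add: L2_def)
qed

lemma L2_scaleR: "L2 (\<lambda>x. c *\<^sub>R f x) = \<bar>c\<bar> * L2 f"
  by (simp add: L2_def power_mult_distrib real_sqrt_mult)

lemma L2_mult_left: "L2 (\<lambda>x. c * f x) = norm c * L2 f"
  for f :: "real \<Rightarrow> 'b::{real_normed_div_algebra, second_countable_topology}"
  by (simp add: L2_def power_mult_distrib real_sqrt_mult norm_mult)

lemma L2_minus_commute: "L2 (\<lambda>x. f x - g x) = L2 (\<lambda>x. g x - f x)"
  by (simp add: L2_def norm_minus_commute)

lemma L2_eq_0_AE:
  assumes "square_integrable f" "L2 f = 0"
  shows "AE x in lborel. f x = 0"
proof -
  have "(LINT x|lborel. (norm (f x))\<^sup>2) = 0" using assms(2) by (simp add: L2_def)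
  then have "AE x in lborel. (norm (f x))\<^sup>2 = 0"
    using square_integrable_sq[OF assms(1)] by (subst (asm) integral_nonneg_eq_0_iff_AE) auto
  then show ?thesis by eventually_elim simp
qed

text \<open>The integral of \<open>(c * norm (f x) - norm (g x))\<^sup>2\<close> is a nonnegative
  quadratic polynomial in c. Its value at the minimizer \<open>I / A\<close> gives the inequality;
  if A = 0, the polynomial is affine, which forces I = 0. Norms are multiplied rather than values,
  so that f and g may live in different spaces, as in the pairing of a real weight with a complex
  transform.\<close>

lemma cauchy_schwarz:
  fixes f :: "real \<Rightarrow> 'b::{real_normed_vector, second_countable_topology}"
    and g :: "real \<Rightarrow> 'c::{real_normed_vector, second_countable_topology}"
  assumes f: "square_integrable f" and g: "square_integrable g"
  shows "(LINT x|lborel. norm (f x) * norm (g x)) \<le> L2 f * L2 g"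
proof -
  define A B I where "A = (L2 f)\<^sup>2" and "B = (L2 g)\<^sup>2" and "I = (LINT x|lborel. norm (f x) * norm (g x))"
  note i = square_integrable_sq[OF f] square_integrable_sq[OF g] square_integrable_norm_mult[OF f g]
  have I0: "0 \<le> I" unfolding I_def by (intro integral_nonneg_AE) auto
  have q: "2 * I * c \<le> c\<^sup>2 * A + B" for c :: real
  proof -
    have "0 \<le> (LINT x|lborel. (c * norm (f x) - norm (g x))\<^sup>2)" by (intro integral_nonneg_AE) auto
    also have "\<dots> = (LINT x|lborel. c\<^sup>2 * (norm (f x))\<^sup>2 + (norm (g x))\<^sup>2 - 2 * c * (norm (f x) * norm (g x)))"
      by (rule Bochner_Integration.integral_cong) (auto simp: power2_eq_square algebra_simps)
    also have "\<dots> = c\<^sup>2 * A + B - 2 * c * I"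
      using i by (simp add: A_def B_def I_def L2_sq)
    finally show ?thesis by (simp add: algebra_simps)
  qed
  have "I\<^sup>2 \<le> A * B"
  proof (cases "A = 0")
    case True
    have "I = 0"
    proof (rule ccontr)
      assume "I \<noteq> 0"
      \<comment> \<open>This value of c makes the left side of \<open>q\<close> equal to B + 1,
        while the right side is B.\<close>
      with q[of "(B + 1) / (2 * I)"] True show False by (simp add: power2_eq_square)
    qed
    then show ?thesis by (simp add: A_def B_def)
  next
    case False
    then have "A > 0" by (simp add: A_def)
    with q[of "I / A"] have "2 * I\<^sup>2 / A \<le> I\<^sup>2 / A + B" by (simp add: power2_eq_square field_simps)
    then have "I\<^sup>2 / A \<le> B" by simp
    with \<open>A > 0\<close> show ?thesis by (simp add: field_simps)
  qed
  then have "I\<^sup>2 \<le> (L2 f * L2 g)\<^sup>2" by (simp add: A_def B_def power_mult_distrib)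
  then show ?thesis unfolding I_def by (rule power2_le_imp_le) simp
qed

lemma cauchy_schwarz_mult:
  fixes f g :: "real \<Rightarrow> 'b::{real_normed_algebra, second_countable_topology, banach}"
  assumes f: "square_integrable f" and g: "square_integrable g"
  shows "norm (LINT x|lborel. f x * g x) \<le> L2 f * L2 g"
proof -
  have "norm (LINT x|lborel. f x * g x) \<le> (LINT x|lborel. norm (f x * g x))"
    by (rule integral_norm_bound)
  also have "\<dots> \<le> (LINT x|lborel. norm (f x) * norm (g x))"
    using square_integrable_mult[OF f g]
    by (intro integral_mono square_integrable_norm_mult[OF f g]) (auto simp: norm_mult_ineq)
  also note cauchy_schwarz[OF f g]
  finally show ?thesis .
qed

lemma L2_triangle:
  assumes f: "square_integrable f" and g: "square_integrable g"
  shows "L2 (\<lambda>x. f x + g x) \<le> L2 f + L2 g"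
proof (rule power2_le_imp_le)
  note i = square_integrable_sq[OF f] square_integrable_sq[OF g] square_integrable_norm_mult[OF f g]
  have "(L2 (\<lambda>x. f x + g x))\<^sup>2 = (LINT x|lborel. (norm (f x + g x))\<^sup>2)" by (rule L2_sq)
  also have "\<dots> \<le> (LINT x|lborel. (norm (f x))\<^sup>2 + (norm (g x))\<^sup>2 + 2 * (norm (f x) * norm (g x)))"
  proof (rule integral_mono)
    show "integrable lborel (\<lambda>x. (norm (f x + g x))\<^sup>2)"
      by (rule square_integrable_sq[OF square_integrable_add[OF f g]])
    show "integrable lborel (\<lambda>x. (norm (f x))\<^sup>2 + (norm (g x))\<^sup>2 + 2 * (norm (f x) * norm (g x)))"
      using i by (intro Bochner_Integration.integrable_add) auto
    show "(norm (f x + g x))\<^sup>2 \<le> (norm (f x))\<^sup>2 + (norm (g x))\<^sup>2 + 2 * (norm (f x) * norm (g x))" for x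
      using power_mono[OF norm_triangle_ineq[of "f x" "g x"], of 2] by (simp add: power2_eq_square algebra_simps)
  qed
  also have "\<dots> = (L2 f)\<^sup>2 + (L2 g)\<^sup>2 + 2 * (LINT x|lborel. norm (f x) * norm (g x))"
    using i by (simp add: L2_sq)
  also have "\<dots> \<le> (L2 f)\<^sup>2 + (L2 g)\<^sup>2 + 2 * (L2 f * L2 g)" using cauchy_schwarz[OF f g] by simp
  also have "\<dots> = (L2 f + L2 g)\<^sup>2" by (simp add: power2_eq_square algebra_simps)
  finally show "(L2 (\<lambda>x. f x + g x))\<^sup>2 \<le> (L2 f + L2 g)\<^sup>2" .
qed simp

lemma L2_triangle_diff:
  assumes f: "square_integrable f" and g: "square_integrable g" and h: "square_integrable h"
  shows "L2 (\<lambda>x. f x - h x) \<le> L2 (\<lambda>x. f x - g x) + L2 (\<lambda>x. g x - h x)"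
  using L2_triangle[OF square_integrable_diff[OF f g] square_integrable_diff[OF g h]] by simp

lemma L2_diff_abs:
  assumes f: "square_integrable f" and g: "square_integrable g"
  shows "\<bar>L2 f - L2 g\<bar> \<le> L2 (\<lambda>x. f x - g x)"
  using L2_triangle[OF square_integrable_diff[OF f g] g] L2_triangle[OF square_integrable_diff[OF g f] f]
  by (simp add: L2_minus_commute[of f g] abs_le_iff)

lemma L2_dominated:
  fixes f :: "real \<Rightarrow> 'b::{real_normed_vector, second_countable_topology}"
  assumes f: "square_integrable f" and m: "\<And>n. g n \<in> borel_measurable lborel"
    and b: "\<And>n x. norm (g n x) \<le> C * norm (f x)"
    and l: "\<And>x. ((\<lambda>n. g n x) \<longlonglongrightarrow> 0)"
  shows "(\<lambda>n. L2 (g n :: real \<Rightarrow> 'b)) \<longlonglongrightarrow> 0"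
proof -
  have "(\<lambda>n. LINT x|lborel. (norm (g n x))\<^sup>2) \<longlonglongrightarrow> (LINT x::real|lborel. 0)"
  proof (rule integral_dominated_convergence)
    show "integrable lborel (\<lambda>x. (C * norm (f x))\<^sup>2)"
      using square_integrable_sq[OF f] by (simp add: power_mult_distrib)
    show "AE x in lborel. (\<lambda>n. (norm (g n x))\<^sup>2) \<longlonglongrightarrow> 0"
      using tendsto_power[OF tendsto_norm[OF l], of _ 2] by simp
    show "AE x in lborel. norm ((norm (g n x))\<^sup>2) \<le> (C * norm (f x))\<^sup>2" for n
      using power_mono[OF b, of n _ 2] by simp
  qed (use m in auto)
  then show ?thesis unfolding L2_def using tendsto_real_sqrt by fastforce
qed

section \<open>The Plancherel theorem\<close>

text \<open>For a function that is not integrable, the left side is the default value 0. Estimates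
  by nonnegative integrals can thus start before integrability has been settled.\<close>

lemma integral_norm_bound_nn:
  fixes f :: "'a \<Rightarrow> 'b::{banach, second_countable_topology}"
  shows "ennreal (norm (integral\<^sup>L M f)) \<le> (\<integral>\<^sup>+x. ennreal (norm (f x)) \<partial>M)"
  by (cases "integrable M f") (auto intro: integral_norm_bound_ennreal simp: not_integrable_integral_eq)

section \<open>The Fourier integral of an integrable function\<close>

definition ft :: "(real \<Rightarrow> complex) \<Rightarrow> real \<Rightarrow> complex"
  where "ft f \<xi> = (LINT x|lborel. cis (- (x * \<xi>)) * f x)"

lemma borel_measurable_cis [measurable]: "cis \<in> borel_measurable borel"
  by (intro borel_measurable_continuous_onI continuous_intros)

lemma borel_measurable_cnj [measurable]: "cnj \<in> borel_measurable borel"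
  by (intro borel_measurable_continuous_onI continuous_intros)

lemma integrable_cis_mult:
  fixes f :: "real \<Rightarrow> complex"
  assumes "integrable lborel f" "g \<in> borel_measurable lborel"
  shows "integrable lborel (\<lambda>x. cis (g x) * f x)"
proof (rule Bochner_Integration.integrable_bound[OF assms(1)])
  have [measurable]: "f \<in> borel_measurable borel" "g \<in> borel_measurable borel"
    using assms by auto
  show "(\<lambda>x. cis (g x) * f x) \<in> borel_measurable lborel" by simp
qed (simp add: norm_mult)

lemma ft_bound: "norm (ft f \<xi>) \<le> (LINT x|lborel. norm (f x))"
proof -
  have "norm (ft f \<xi>) \<le> (LINT x|lborel. norm (cis (- (x * \<xi>)) * f x))"
    unfolding ft_def by (rule integral_norm_bound)
  then show ?thesis by (simp add: norm_mult)
qed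

lemma isCont_ft:
  assumes "integrable lborel f"
  shows "isCont (ft f) \<xi>"
  unfolding continuous_at_sequentially comp_def
proof (intro allI impI)
  fix X assume X: "X \<longlonglongrightarrow> \<xi>"
  have [measurable]: "f \<in> borel_measurable borel" using assms by auto
  show "(\<lambda>n. ft f (X n)) \<longlonglongrightarrow> ft f \<xi>"
    unfolding ft_def
  proof (rule integral_dominated_convergence[where w="\<lambda>x. norm (f x)"])
    show "AE x in lborel. (\<lambda>n. cis (- (x * X n)) * f x) \<longlonglongrightarrow> cis (- (x * \<xi>)) * f x"
      using X unfolding cis_conv_exp by (intro AE_I2 tendsto_intros)
  qed (use assms in \<open>auto simp: norm_mult\<close>)
qed

lemma continuous_on_ft: "integrable lborel f \<Longrightarrow> continuous_on S (ft f)"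
  by (intro continuous_at_imp_continuous_on ballI isCont_ft)

lemma borel_measurable_ft [measurable]:
  "integrable lborel f \<Longrightarrow> ft f \<in> borel_measurable borel"
  by (intro borel_measurable_continuous_onI continuous_on_ft)

text \<open>The kernel is symmetric in its two variables, so Fubini's theorem moves the transform
  from one factor to the other. Inversion and the Parseval identity are drawn from this
  formula.\<close>

lemma ft_mult_formula:
  assumes f: "integrable lborel f" and g: "integrable lborel g"
  shows "(LINT \<xi>|lborel. ft f \<xi> * g \<xi>) = (LINT x|lborel. f x * ft g x)"
proof -
  have [measurable]: "f \<in> borel_measurable borel" "g \<in> borel_measurable borel" using f g by auto
  have "integrable (lborel \<Otimes>\<^sub>M lborel) (\<lambda>(\<xi>, x). cis (- (x * \<xi>)) * f x * g \<xi>)"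
  proof (rule lborel_pair.Fubini_integrable)
    show "integrable lborel (\<lambda>\<xi>. LINT x|lborel. norm (case (\<xi>, x) of (\<xi>, x) \<Rightarrow> cis (- (x * \<xi>)) * f x * g \<xi>))"
      using g by (simp add: norm_mult)
    show "AE \<xi> in lborel. integrable lborel (\<lambda>x. case (\<xi>, x) of (\<xi>, x) \<Rightarrow> cis (- (x * \<xi>)) * f x * g \<xi>)"
      using integrable_cis_mult[OF f] by simp
  qed simp
  from lborel_pair.Fubini_integral[OF this]
  have "(LINT x|lborel. LINT \<xi>|lborel. cis (- (x * \<xi>)) * f x * g \<xi>)
      = (LINT \<xi>|lborel. LINT x|lborel. cis (- (x * \<xi>)) * f x * g \<xi>)" .
  moreover have "(LINT \<xi>|lborel. cis (- (x * \<xi>)) * f x * g \<xi>) = f x * ft g x" for x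
  proof -
    have "f x * ft g x = (LINT \<xi>|lborel. f x * (cis (- (\<xi> * x)) * g \<xi>))" by (simp add: ft_def)
    then show ?thesis by (simp only: mult_ac)
  qed
  moreover have "(LINT x|lborel. cis (- (x * \<xi>)) * f x * g \<xi>) = ft f \<xi> * g \<xi>" for \<xi>
    by (simp add: ft_def)
  ultimately show ?thesis by (simp only:)
qed

lemma ft_cnj: "ft (\<lambda>x. cnj (f x)) \<xi> = cnj (ft f (- \<xi>))"
proof -
  have "ft (\<lambda>x. cnj (f x)) \<xi> = (LINT x|lborel. cnj (cis (- (x * - \<xi>)) * f x))"
    unfolding ft_def by (simp add: cis_cnj)
  then show ?thesis unfolding ft_def by (simp only: Bochner_Integration.integral_cnj)
qed

lemma ft_modulate: "ft (\<lambda>x. cis (a * x) * f x) \<xi> = ft f (\<xi> - a)"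
proof -
  have "cis (- (x * \<xi>)) * (cis (a * x) * f x) = cis (- (x * (\<xi> - a))) * f x" for x
  proof -
    have "cis (- (x * \<xi>)) * cis (a * x) = cis (- (x * (\<xi> - a)))" by (simp add: cis_mult algebra_simps)
    then show ?thesis by (simp flip: mult.assoc)
  qed
  then show ?thesis by (simp only: ft_def)
qed

section \<open>Gaussian regularization and the L2 bound\<close>

definition gauss :: "real \<Rightarrow> real \<Rightarrow> real"
  where "gauss \<sigma> \<xi> = exp (- ((\<sigma> * \<xi>)\<^sup>2) / 2)"

lemma gauss_std: "gauss \<sigma> \<xi> = sqrt (2 * pi) * std_normal_density (\<sigma> * \<xi>)"
  by (simp add: gauss_def std_normal_density_def)

lemma gauss_bounds: "0 < gauss \<sigma> \<xi>" "gauss \<sigma> \<xi> \<le> 1"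
  by (simp_all add: gauss_def)

lemma borel_measurable_gauss [measurable]: "gauss \<sigma> \<in> borel_measurable borel"
  unfolding gauss_def by measurable

lemma integrable_gauss: "\<sigma> > 0 \<Longrightarrow> integrable lborel (gauss \<sigma>)"
  using lborel_integrable_real_affine[where f="std_normal_density" and c=\<sigma> and t=0]
  unfolding gauss_std[abs_def] by (intro integrable_mult_right) (simp del: std_normal_density_def)

text \<open>Read off from the characteristic function of the standard normal law, at
  \<open>- \<xi>\<close> because \<open>ft\<close> has the kernel
  \<open>cis (- (x * \<xi>))\<close>.\<close>

lemma ft_std_normal: "ft (\<lambda>x. of_real (std_normal_density x)) \<xi> = exp (- (\<xi>\<^sup>2) / 2)"
proof -
  have "char std_normal_distribution (- \<xi>) = (LINT x|lborel. std_normal_density x *\<^sub>R iexp (- \<xi> * x))"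
    unfolding char_def by (subst integral_density) auto
  also have "\<dots> = ft (\<lambda>x. of_real (std_normal_density x)) \<xi>"
    unfolding ft_def by (intro Bochner_Integration.integral_cong) (auto simp: cis_conv_exp scaleR_conv_of_real mult_ac)
  finally show ?thesis by (simp add: char_std_normal_distribution)
qed

text \<open>The transform of \<open>\<xi> \<mapsto> gauss \<sigma> \<xi>\<close>, an approximate identity of mass \<open>2\<pi>\<close> as \<open>\<sigma> \<rightarrow> 0\<close>.\<close>

definition gauss_kernel :: "real \<Rightarrow> real \<Rightarrow> real"
  where "gauss_kernel \<sigma> w = 2 * pi / \<sigma> * std_normal_density (w / \<sigma>)"

lemma gauss_kernel_nonneg: "\<sigma> > 0 \<Longrightarrow> 0 \<le> gauss_kernel \<sigma> w"
  by (simp add: gauss_kernel_def)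

lemma gauss_kernel_minus: "gauss_kernel \<sigma> (- w) = gauss_kernel \<sigma> w"
  by (simp add: gauss_kernel_def std_normal_density_def)

lemma borel_measurable_gauss_kernel [measurable]: "gauss_kernel \<sigma> \<in> borel_measurable borel"
  unfolding gauss_kernel_def by measurable

lemma ft_gauss:
  assumes "\<sigma> > 0"
  shows "ft (\<lambda>x. of_real (gauss \<sigma> x)) w = of_real (gauss_kernel \<sigma> w)"
proof -
  have "ft (\<lambda>x. of_real (std_normal_density x)) (w / \<sigma>)
      = \<bar>\<sigma>\<bar> *\<^sub>R (LINT x|lborel. cis (- ((0 + \<sigma> * x) * (w / \<sigma>))) * of_real (std_normal_density (0 + \<sigma> * x)))"
    unfolding ft_def using assms by (intro lborel_integral_real_affine) auto
  also have "\<dots> = (\<sigma> / sqrt (2 * pi)) *\<^sub>R ft (\<lambda>x. of_real (gauss \<sigma> x)) w"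
    unfolding ft_def using assms
    by (simp add: gauss_std scaleR_conv_of_real mult_ac flip: integral_mult_right_zero)
  finally have "of_real (exp (- ((w / \<sigma>)\<^sup>2) / 2)) = (\<sigma> / sqrt (2 * pi)) *\<^sub>R ft (\<lambda>x. of_real (gauss \<sigma> x)) w"
    by (simp add: ft_std_normal)
  then have "ft (\<lambda>x. of_real (gauss \<sigma> x)) w = (sqrt (2 * pi) / \<sigma>) *\<^sub>R of_real (exp (- ((w / \<sigma>)\<^sup>2) / 2))"
    using assms by (simp add: scaleR_conv_of_real)
  also have "\<dots> = of_real (sqrt (2 * pi) / \<sigma> * exp (- ((w / \<sigma>)\<^sup>2) / 2))"
    by (simp add: scaleR_conv_of_real)
  also have "sqrt (2 * pi) / \<sigma> * exp (- ((w / \<sigma>)\<^sup>2) / 2) = gauss_kernel \<sigma> w"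
  proof -
    have "2 * pi / \<sigma> * (1 / sqrt (2 * pi) * exp (- ((w / \<sigma>)\<^sup>2) / 2))
        = (2 * pi / sqrt (2 * pi)) / \<sigma> * exp (- ((w / \<sigma>)\<^sup>2) / 2)" by simp
    also have "2 * pi / sqrt (2 * pi) = sqrt (2 * pi)" by (rule real_div_sqrt) simp
    finally show ?thesis by (simp add: gauss_kernel_def std_normal_density_def)
  qed
  finally show ?thesis .
qed

lemma nn_integral_gauss_kernel:
  assumes "\<sigma> > 0"
  shows "(\<integral>\<^sup>+y. ennreal (gauss_kernel \<sigma> (x - y)) \<partial>lborel) = ennreal (2 * pi)"
proof -
  have "(\<integral>\<^sup>+z. ennreal (2 * pi * std_normal_density z) \<partial>lborel) = ennreal (2 * pi)"
    by (subst nn_integral_eq_integral) auto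
  moreover have "(\<integral>\<^sup>+z. ennreal (2 * pi * std_normal_density z) \<partial>lborel)
      = \<bar>- 1 / \<sigma>\<bar> * (\<integral>\<^sup>+y. ennreal (2 * pi * std_normal_density (x / \<sigma> + (- 1 / \<sigma>) * y)) \<partial>lborel)"
    using assms by (intro nn_integral_real_affine) auto
  moreover have "\<dots> = (\<integral>\<^sup>+y. ennreal (\<bar>- 1 / \<sigma>\<bar> * (2 * pi * std_normal_density (x / \<sigma> + (- 1 / \<sigma>) * y))) \<partial>lborel)"
    by (subst nn_integral_cmult[symmetric]) (auto intro!: nn_integral_cong simp flip: ennreal_mult)
  moreover have "\<bar>- 1 / \<sigma>\<bar> * (2 * pi * std_normal_density (x / \<sigma> + (- 1 / \<sigma>) * y)) = gauss_kernel \<sigma> (x - y)" for y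
    using assms by (simp add: gauss_kernel_def diff_divide_distrib)
  ultimately show ?thesis by simp
qed

text \<open>The multiplication formula is used twice: on the outside to take the transform off f,
  and on the inside to take the one off h and put it on a modulated Gaussian, whose transform is a
  translate of \<open>gauss_kernel\<close>. The Gaussian weight makes the frequency integrand
  absolutely integrable before any L2 theory is at hand.\<close>

lemma ft_gauss_regularized:
  assumes f: "integrable lborel f" and h: "integrable lborel h" and s: "\<sigma> > 0"
  shows "(LINT \<xi>|lborel. ft f \<xi> * (cnj (ft h \<xi>) * of_real (gauss \<sigma> \<xi>)))
       = (LINT x|lborel. f x * cnj (LINT y|lborel. h y * of_real (gauss_kernel \<sigma> (x - y))))"
proof -
  have [measurable]: "f \<in> borel_measurable borel" "h \<in> borel_measurable borel"
    "ft h \<in> borel_measurable borel" using f h by (auto intro: borel_measurable_ft)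
  have gi: "integrable lborel (\<lambda>\<xi>. complex_of_real (gauss \<sigma> \<xi>))" using integrable_gauss[OF s] by simp
  have k: "integrable lborel (\<lambda>\<xi>. cnj (ft h \<xi>) * of_real (gauss \<sigma> \<xi>))"
  proof (rule Bochner_Integration.integrable_bound)
    show "integrable lborel (\<lambda>\<xi>. (LINT x|lborel. norm (h x)) * gauss \<sigma> \<xi>)"
      using integrable_gauss[OF s] by simp
    show "AE \<xi> in lborel. norm (cnj (ft h \<xi>) * of_real (gauss \<sigma> \<xi>)) \<le> norm ((LINT x|lborel. norm (h x)) * gauss \<sigma> \<xi>)"
    proof (rule AE_I2)
      fix \<xi>
      have "norm (cnj (ft h \<xi>) * of_real (gauss \<sigma> \<xi>)) = norm (ft h \<xi>) * gauss \<sigma> \<xi>"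
        using gauss_bounds(1)[of \<sigma> \<xi>] by (simp add: norm_mult)
      also have "\<dots> \<le> (LINT x|lborel. norm (h x)) * gauss \<sigma> \<xi>"
        using gauss_bounds(1)[of \<sigma> \<xi>] by (intro mult_right_mono ft_bound) simp
      finally show "norm (cnj (ft h \<xi>) * of_real (gauss \<sigma> \<xi>)) \<le> norm ((LINT x|lborel. norm (h x)) * gauss \<sigma> \<xi>)"
        by simp
    qed
  qed simp
  have "ft (\<lambda>\<xi>. cnj (ft h \<xi>) * of_real (gauss \<sigma> \<xi>)) x = cnj (LINT y|lborel. h y * of_real (gauss_kernel \<sigma> (x - y)))" for x
  proof -
    have "ft (\<lambda>\<xi>. cnj (ft h \<xi>) * of_real (gauss \<sigma> \<xi>)) x = (LINT \<xi>|lborel. cnj (ft h \<xi> * (cis (x * \<xi>) * of_real (gauss \<sigma> \<xi>))))"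
      unfolding ft_def[of _ x] by (intro Bochner_Integration.integral_cong) (auto simp: cis_cnj mult_ac)
    also have "\<dots> = cnj (LINT \<xi>|lborel. ft h \<xi> * (cis (x * \<xi>) * of_real (gauss \<sigma> \<xi>)))"
      by (rule Bochner_Integration.integral_cnj)
    also have "(LINT \<xi>|lborel. ft h \<xi> * (cis (x * \<xi>) * of_real (gauss \<sigma> \<xi>)))
        = (LINT y|lborel. h y * ft (\<lambda>\<xi>. cis (x * \<xi>) * of_real (gauss \<sigma> \<xi>)) y)"
      by (intro ft_mult_formula h integrable_cis_mult gi) simp
    finally show ?thesis
      using gauss_kernel_minus[of \<sigma> "_ - x"] by (simp add: ft_modulate ft_gauss[OF s])
  qed
  then show ?thesis using ft_mult_formula[OF f k] by simp
qed

text \<open>With h = f the regularized identity becomes a quadratic form with kernel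
  \<open>gauss_kernel \<sigma> (x - y)\<close>. Splitting \<open>norm (f x) * norm (f y)\<close>
  into half the sum of the squares, as in Schur's test, each half contributes \<pi> times the
  squared norm, since the kernel has mass 2 \<pi> in either variable.\<close>

lemma plancherel_bound_aux:
  assumes f: "integrable lborel f" and f2: "square_integrable f" and s: "\<sigma> > 0"
  shows "(\<integral>\<^sup>+\<xi>. ennreal ((norm (ft f \<xi>))\<^sup>2 * gauss \<sigma> \<xi>) \<partial>lborel) \<le> ennreal (2 * pi * (L2 f)\<^sup>2)"
proof -
  have [measurable]: "f \<in> borel_measurable borel" "ft f \<in> borel_measurable borel"
    using f by (auto intro: borel_measurable_ft)
  define B where "B = (LINT x|lborel. norm (f x))"
  have B: "norm (ft f \<xi>) \<le> B" for \<xi> using ft_bound[of f] by (simp add: B_def)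
  have int: "integrable lborel (\<lambda>\<xi>. (norm (ft f \<xi>))\<^sup>2 * gauss \<sigma> \<xi>)"
  proof (rule Bochner_Integration.integrable_bound)
    show "integrable lborel (\<lambda>\<xi>. B\<^sup>2 * gauss \<sigma> \<xi>)" using integrable_gauss[OF s] by simp
    show "AE \<xi> in lborel. norm ((norm (ft f \<xi>))\<^sup>2 * gauss \<sigma> \<xi>) \<le> norm (B\<^sup>2 * gauss \<sigma> \<xi>)"
      using gauss_bounds(1)[of \<sigma>] by (auto simp: abs_mult less_imp_le intro!: mult_right_mono power_mono B)
  qed simp
  have eq: "(LINT \<xi>|lborel. ft f \<xi> * (cnj (ft f \<xi>) * of_real (gauss \<sigma> \<xi>)))
      = of_real (LINT \<xi>|lborel. (norm (ft f \<xi>))\<^sup>2 * gauss \<sigma> \<xi>)"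
    by (subst integral_complex_of_real[symmetric], rule Bochner_Integration.integral_cong)
      (auto simp: complex_norm_square simp del: of_real_power)
  let ?K = "\<lambda>x y. gauss_kernel \<sigma> (x - y)"
  have K0: "0 \<le> ?K x y" for x y using gauss_kernel_nonneg[OF s] .
  have "ennreal (LINT \<xi>|lborel. (norm (ft f \<xi>))\<^sup>2 * gauss \<sigma> \<xi>)
      \<le> ennreal (norm (LINT x|lborel. f x * cnj (LINT y|lborel. f y * of_real (?K x y))))"
    using ft_gauss_regularized[OF f f s] unfolding eq
    by (intro ennreal_leI) (metis abs_ge_self norm_of_real)
  also have "\<dots> \<le> (\<integral>\<^sup>+x. norm (f x * cnj (LINT y|lborel. f y * of_real (?K x y))) \<partial>lborel)"
    by (rule integral_norm_bound_nn)
  also have "\<dots> \<le> (\<integral>\<^sup>+x. \<integral>\<^sup>+y. ennreal (norm (f x) * norm (f y) * ?K x y) \<partial>lborel \<partial>lborel)"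
  proof (rule nn_integral_mono)
    fix x
    have "ennreal (norm (f x * cnj (LINT y|lborel. f y * of_real (?K x y))))
        = ennreal (norm (f x)) * ennreal (norm (LINT y|lborel. f y * of_real (?K x y)))"
      by (simp add: norm_mult ennreal_mult)
    also have "\<dots> \<le> ennreal (norm (f x)) * (\<integral>\<^sup>+y. norm (f y * of_real (?K x y)) \<partial>lborel)"
      by (intro mult_left_mono integral_norm_bound_nn) auto
    also have "\<dots> = (\<integral>\<^sup>+y. ennreal (norm (f x) * norm (f y) * ?K x y) \<partial>lborel)"
      using K0 by (subst nn_integral_cmult[symmetric])
        (auto simp: norm_mult ennreal_mult[symmetric] mult.assoc intro!: nn_integral_cong)
    finally show "ennreal (norm (f x * cnj (LINT y|lborel. f y * of_real (?K x y))))
        \<le> (\<integral>\<^sup>+y. ennreal (norm (f x) * norm (f y) * ?K x y) \<partial>lborel)" .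
  qed
  also have "\<dots> \<le> (\<integral>\<^sup>+x. \<integral>\<^sup>+y. ennreal ((norm (f x))\<^sup>2 / 2) * ennreal (?K x y) + ennreal ((norm (f y))\<^sup>2 / 2) * ennreal (?K x y) \<partial>lborel \<partial>lborel)"
  proof (intro nn_integral_mono)
    fix x y
    have "norm (f x) * norm (f y) * ?K x y \<le> ((norm (f x))\<^sup>2 / 2 + (norm (f y))\<^sup>2 / 2) * ?K x y"
      using sum_squares_bound[of "norm (f x)" "norm (f y)"] K0 by (intro mult_right_mono) auto
    then have le: "ennreal (norm (f x) * norm (f y) * ?K x y) \<le> ennreal ((norm (f x))\<^sup>2 / 2 * ?K x y + (norm (f y))\<^sup>2 / 2 * ?K x y)"
      by (intro ennreal_leI) (simp add: ring_distribs)
    have *: "ennreal (a * k + b * k) = ennreal a * ennreal k + ennreal b * ennreal k" if "0 \<le> a" "0 \<le> b" "0 \<le> k" for a b k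
      using that by (simp add: ennreal_mult)
    show "ennreal (norm (f x) * norm (f y) * ?K x y) \<le> ennreal ((norm (f x))\<^sup>2 / 2) * ennreal (?K x y) + ennreal ((norm (f y))\<^sup>2 / 2) * ennreal (?K x y)"
      by (rule ord_le_eq_trans[OF le *]) (use K0 in auto)
  qed
  also have "\<dots> = (\<integral>\<^sup>+x. \<integral>\<^sup>+y. ennreal ((norm (f x))\<^sup>2 / 2) * ennreal (?K x y) \<partial>lborel \<partial>lborel)
      + (\<integral>\<^sup>+x. \<integral>\<^sup>+y. ennreal ((norm (f y))\<^sup>2 / 2) * ennreal (?K x y) \<partial>lborel \<partial>lborel)"
    by (simp add: nn_integral_add)
  \<comment> \<open>The second half equals the first: exchange the order of integration and use that
    the kernel is even.\<close>
  also have "(\<integral>\<^sup>+x. \<integral>\<^sup>+y. ennreal ((norm (f y))\<^sup>2 / 2) * ennreal (?K x y) \<partial>lborel \<partial>lborel)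
      = (\<integral>\<^sup>+y. \<integral>\<^sup>+x. ennreal ((norm (f y))\<^sup>2 / 2) * ennreal (?K x y) \<partial>lborel \<partial>lborel)"
    by (rule lborel_pair.Fubini') simp
  also have "\<dots> = (\<integral>\<^sup>+x. \<integral>\<^sup>+y. ennreal ((norm (f x))\<^sup>2 / 2) * ennreal (?K x y) \<partial>lborel \<partial>lborel)"
  proof -
    have "?K x y = ?K y x" for x y using gauss_kernel_minus[of \<sigma> "x - y"] by simp
    then show ?thesis by (intro nn_integral_cong) metis
  qed
  also have "(\<integral>\<^sup>+x. \<integral>\<^sup>+y. ennreal ((norm (f x))\<^sup>2 / 2) * ennreal (?K x y) \<partial>lborel \<partial>lborel)
      = (\<integral>\<^sup>+x. ennreal pi * ennreal ((norm (f x))\<^sup>2) \<partial>lborel)"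
  proof (rule nn_integral_cong)
    fix x
    have "(\<integral>\<^sup>+y. ennreal ((norm (f x))\<^sup>2 / 2) * ennreal (?K x y) \<partial>lborel) = ennreal ((norm (f x))\<^sup>2 / 2) * ennreal (2 * pi)"
      by (subst nn_integral_cmult) (auto simp: nn_integral_gauss_kernel[OF s])
    also have "\<dots> = ennreal pi * ennreal ((norm (f x))\<^sup>2)"
      by (subst (1 2) ennreal_mult[symmetric]) auto
    finally show "(\<integral>\<^sup>+y. ennreal ((norm (f x))\<^sup>2 / 2) * ennreal (?K x y) \<partial>lborel) = ennreal pi * ennreal ((norm (f x))\<^sup>2)" .
  qed
  also have "\<dots> = ennreal pi * ennreal ((L2 f)\<^sup>2)"
    by (subst nn_integral_cmult) (auto simp: nn_integral_L2[OF f2])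
  also have "ennreal pi * ennreal ((L2 f)\<^sup>2) + ennreal pi * ennreal ((L2 f)\<^sup>2) = ennreal (2 * pi * (L2 f)\<^sup>2)"
    by (subst (1 2) ennreal_mult[symmetric]) (auto simp flip: ennreal_plus)
  finally show ?thesis
    using int gauss_bounds(1)[of \<sigma>] by (subst nn_integral_eq_integral) (auto simp: less_imp_le)
qed

text \<open>Fatou's lemma as \<sigma> tends to 0 and the Gaussian weight tends to 1. The inequality
  alone suffices to extend the transform to L2; equality is recovered in
  \<open>fourier_plancherel\<close>.\<close>

lemma plancherel_bound:
  assumes f: "integrable lborel f" and f2: "square_integrable f"
  shows "square_integrable (ft f)" "L2 (ft f) \<le> sqrt (2 * pi) * L2 f"
proof -
  have [measurable]: "ft f \<in> borel_measurable borel" using borel_measurable_ft[OF f] .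
  have lim: "(\<lambda>n. ennreal ((norm (ft f \<xi>))\<^sup>2 * gauss (1 / Suc n) \<xi>)) \<longlonglongrightarrow> ennreal ((norm (ft f \<xi>))\<^sup>2)" for \<xi>
  proof (rule tendsto_ennrealI)
    have "(\<lambda>n. (norm (ft f \<xi>))\<^sup>2 * exp (- ((1 / real (Suc n) * \<xi>)\<^sup>2) / 2)) \<longlonglongrightarrow> (norm (ft f \<xi>))\<^sup>2 * exp (- ((0 * \<xi>)\<^sup>2) / 2)"
      using LIMSEQ_inverse_real_of_nat by (intro tendsto_intros) (simp_all add: inverse_eq_divide)
    then show "(\<lambda>n. (norm (ft f \<xi>))\<^sup>2 * gauss (1 / Suc n) \<xi>) \<longlonglongrightarrow> (norm (ft f \<xi>))\<^sup>2"
      by (simp add: gauss_def)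
  qed
  have "(\<integral>\<^sup>+\<xi>. ennreal ((norm (ft f \<xi>))\<^sup>2) \<partial>lborel)
      = (\<integral>\<^sup>+\<xi>. liminf (\<lambda>n. ennreal ((norm (ft f \<xi>))\<^sup>2 * gauss (1 / Suc n) \<xi>)) \<partial>lborel)"
    using lim_imp_Liminf[OF _ lim] by (intro nn_integral_cong) simp
  also have "\<dots> \<le> liminf (\<lambda>n. \<integral>\<^sup>+\<xi>. ennreal ((norm (ft f \<xi>))\<^sup>2 * gauss (1 / Suc n) \<xi>) \<partial>lborel)"
    by (rule nn_integral_liminf) simp
  also have "\<dots> \<le> liminf (\<lambda>n::nat. ennreal (2 * pi * (L2 f)\<^sup>2))"
    using plancherel_bound_aux[OF f f2] by (intro Liminf_mono always_eventually) simp
  also have "\<dots> = ennreal ((sqrt (2 * pi) * L2 f)\<^sup>2)" by (simp add: Liminf_const power_mult_distrib)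
  finally have *: "(\<integral>\<^sup>+\<xi>. ennreal ((norm (ft f \<xi>))\<^sup>2) \<partial>lborel) \<le> ennreal ((sqrt (2 * pi) * L2 f)\<^sup>2)" .
  show "square_integrable (ft f)" "L2 (ft f) \<le> sqrt (2 * pi) * L2 f"
    using square_integrable_nn_le[OF _ *] by auto
qed

lemma integrable_indicator_interval: "integrable lborel (indicator {a..b::real} :: real \<Rightarrow> complex)"
proof -
  have "integrable lborel (\<lambda>x. complex_of_real (indicator {a..b} x))"
    by (intro integrable_of_real integrable_real_indicator) (auto simp: emeasure_lborel_Icc_eq)
  then show ?thesis by (simp add: of_real_indicator)
qed

text \<open>Testing against indicators of intervals is enough to identify an \<open>L\<^sup>2\<close> function.\<close>

lemma ft_parseval_interval:
  fixes a b :: real and f :: "real \<Rightarrow> complex"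
  assumes f: "integrable lborel f" and f2: "square_integrable f"
  shows "(LINT \<xi>|lborel. ft f \<xi> * cnj (ft (indicator {a..b}) \<xi>)) = 2 * pi * (LINT x|lborel. f x * indicator {a..b} x)"
proof -
  let ?h = "indicator {a..b} :: real \<Rightarrow> complex"
  have h: "integrable lborel ?h"
    by (rule integrable_indicator_interval)
  have h2: "square_integrable ?h"
    unfolding square_integrable_def by (auto simp: indicator_def power2_eq_square intro!: Bochner_Integration.integrable_bound[OF h])
  have [measurable]: "f \<in> borel_measurable borel" "ft f \<in> borel_measurable borel" "ft ?h \<in> borel_measurable borel"
    using f h by (auto intro: borel_measurable_ft)
  define sg where "sg n = 1 / real (Suc n)" for n
  have s0: "sg \<longlonglongrightarrow> 0" using LIMSEQ_inverse_real_of_nat by (simp add: sg_def[abs_def] inverse_eq_divide)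
  have sg: "sg n > 0" for n by (simp add: sg_def)
  have L: "(\<lambda>n. LINT \<xi>|lborel. ft f \<xi> * (cnj (ft ?h \<xi>) * of_real (gauss (sg n) \<xi>)))
      \<longlonglongrightarrow> (LINT \<xi>|lborel. ft f \<xi> * cnj (ft ?h \<xi>))"
  proof (rule integral_dominated_convergence[where w="\<lambda>\<xi>. norm (ft f \<xi>) * norm (ft ?h \<xi>)"])
    show "integrable lborel (\<lambda>\<xi>. norm (ft f \<xi>) * norm (ft ?h \<xi>))"
      by (intro square_integrable_norm_mult plancherel_bound f f2 h h2)
    show "AE \<xi> in lborel. (\<lambda>n. ft f \<xi> * (cnj (ft ?h \<xi>) * of_real (gauss (sg n) \<xi>))) \<longlonglongrightarrow> ft f \<xi> * cnj (ft ?h \<xi>)"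
    proof (rule AE_I2)
      fix \<xi>
      have "(\<lambda>n. ft f \<xi> * (cnj (ft ?h \<xi>) * of_real (exp (- ((sg n * \<xi>)\<^sup>2) / 2)))) \<longlonglongrightarrow> ft f \<xi> * (cnj (ft ?h \<xi>) * of_real (exp (- ((0 * \<xi>)\<^sup>2) / 2)))"
        using s0 by (intro tendsto_intros) simp_all
      then show "(\<lambda>n. ft f \<xi> * (cnj (ft ?h \<xi>) * of_real (gauss (sg n) \<xi>))) \<longlonglongrightarrow> ft f \<xi> * cnj (ft ?h \<xi>)"
        by (simp add: gauss_def)
    qed
    show "AE \<xi> in lborel. norm (ft f \<xi> * (cnj (ft ?h \<xi>) * of_real (gauss (sg n) \<xi>))) \<le> norm (ft f \<xi>) * norm (ft ?h \<xi>)" for n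
      using gauss_bounds[of "sg n"]
      by (auto simp: norm_mult less_imp_le simp del: of_nat_Suc intro!: mult_left_mono mult_left_le AE_I2)
  qed simp_all
  define k where "k n x = (LINT y|lborel. ?h y * of_real (gauss_kernel (sg n) (x - y)))" for n x
  have subst: "(LINT y|lborel. ?h y * of_real (gauss_kernel \<sigma> (x - y))) = (LINT z|lborel. of_real (2 * pi * std_normal_density z) * ?h (x - \<sigma> * z))"
    if "\<sigma> > 0" for x \<sigma>
  proof -
    have "(LINT y|lborel. ?h y * of_real (gauss_kernel \<sigma> (x - y))) = \<bar>- \<sigma>\<bar> *\<^sub>R (LINT z|lborel. ?h (x + (- \<sigma>) * z) * of_real (gauss_kernel \<sigma> (x - (x + (- \<sigma>) * z))))"
      using that by (intro lborel_integral_real_affine) simp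
    also have "\<dots> = (LINT z|lborel. of_real \<sigma> * (?h (x + (- \<sigma>) * z) * of_real (gauss_kernel \<sigma> (x - (x + (- \<sigma>) * z)))))"
      using that by (simp add: scaleR_conv_of_real)
    also have "\<dots> = (LINT z|lborel. of_real (2 * pi * std_normal_density z) * ?h (x - \<sigma> * z))"
      using that by (intro Bochner_Integration.integral_cong) (auto simp: gauss_kernel_def)
    finally show ?thesis .
  qed
  have k_eq: "k n x = (LINT z|lborel. of_real (2 * pi * std_normal_density z) * ?h (x - sg n * z))" for n x
    unfolding k_def by (rule subst[OF sg])
  have i2: "integrable lborel (\<lambda>z. 2 * pi * std_normal_density z)" by simp
  have km [measurable]: "k n \<in> borel_measurable borel" for n
    unfolding k_eq[abs_def] by measurable
  have kb: "norm (k n x) \<le> 2 * pi" for n x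
  proof -
    have "norm (k n x) \<le> (LINT z|lborel. norm (of_real (2 * pi * std_normal_density z) * ?h (x - sg n * z)))"
      unfolding k_eq by (rule integral_norm_bound)
    also have "\<dots> \<le> (LINT z|lborel. 2 * pi * std_normal_density z)"
      by (rule integral_mono_AE'[OF i2]) (auto simp: norm_mult indicator_def)
    finally show ?thesis by simp
  qed
  \<comment> \<open>The rescaled Gaussian average of the indicator converges to its value wherever
    the indicator is continuous; the two jumps form a null set.\<close>
  have kl: "(\<lambda>n. k n x) \<longlonglongrightarrow> 2 * pi * ?h x" if ne: "x \<noteq> a" "x \<noteq> b" for x
  proof -
    have "(\<lambda>n. k n x) \<longlonglongrightarrow> (LINT z|lborel. of_real (2 * pi * std_normal_density z) * ?h x)"
      unfolding k_eq
    proof (rule integral_dominated_convergence[OF _ _ i2])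
      have "(\<lambda>n. ?h (x - sg n * z)) \<longlonglongrightarrow> ?h x" for z
      proof (rule tendsto_eventually)
        have l: "(\<lambda>n. x - sg n * z) \<longlonglongrightarrow> x" using s0 by (auto intro!: tendsto_eq_intros)
        consider "x < a" | "a < x \<and> x < b" | "b < x" using ne by linarith
        then show "eventually (\<lambda>n. ?h (x - sg n * z) = ?h x) sequentially"
        proof cases
          case 1 from order_tendstoD(2)[OF l 1] show ?thesis by eventually_elim (use 1 in \<open>auto simp: indicator_def\<close>)
        next
          case 2
          from order_tendstoD(1)[OF l conjunct1[OF 2]] order_tendstoD(2)[OF l conjunct2[OF 2]]
          show ?thesis by eventually_elim (use 2 in \<open>auto simp: indicator_def\<close>)
        next
          case 3 from order_tendstoD(1)[OF l 3] show ?thesis by eventually_elim (use 3 in \<open>auto simp: indicator_def\<close>)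
        qed
      qed
      then show "AE z in lborel. (\<lambda>n. of_real (2 * pi * std_normal_density z) * ?h (x - sg n * z)) \<longlonglongrightarrow> of_real (2 * pi * std_normal_density z) * ?h x"
        by (intro AE_I2 tendsto_intros)
      show "AE z in lborel. norm (of_real (2 * pi * std_normal_density z) * ?h (x - sg n * z)) \<le> 2 * pi * std_normal_density z" for n
        by (auto simp: norm_mult indicator_def)
    qed simp_all
    then show ?thesis by simp
  qed
  have R: "(\<lambda>n. LINT x|lborel. f x * cnj (k n x)) \<longlonglongrightarrow> (LINT x|lborel. f x * cnj (2 * pi * ?h x))"
  proof (rule integral_dominated_convergence[where w="\<lambda>x. norm (f x) * (2 * pi)"])
    have "AE x in lborel. x \<noteq> a" "AE x in lborel. x \<noteq> b" by (auto intro: AE_lborel_singleton)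
    then show "AE x in lborel. (\<lambda>n. f x * cnj (k n x)) \<longlonglongrightarrow> f x * cnj (2 * pi * ?h x)"
      by eventually_elim (intro tendsto_intros kl)
    show "AE x in lborel. norm (f x * cnj (k n x)) \<le> norm (f x) * (2 * pi)" for n
      using kb by (auto simp: norm_mult intro!: mult_left_mono)
  qed (use f in simp_all)
  have "(LINT \<xi>|lborel. ft f \<xi> * (cnj (ft ?h \<xi>) * of_real (gauss (sg n) \<xi>))) = (LINT x|lborel. f x * cnj (k n x))" for n
    unfolding k_def by (rule ft_gauss_regularized[OF f h sg])
  with L have "(\<lambda>n. LINT x|lborel. f x * cnj (k n x)) \<longlonglongrightarrow> (LINT \<xi>|lborel. ft f \<xi> * cnj (ft ?h \<xi>))" by simp
  then have "(LINT \<xi>|lborel. ft f \<xi> * cnj (ft ?h \<xi>)) = (LINT x|lborel. f x * cnj (2 * pi * ?h x))"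
    using R by (rule LIMSEQ_unique)
  also have "\<dots> = (LINT x|lborel. (2 * pi) * (f x * ?h x))"
    by (intro Bochner_Integration.integral_cong) (auto simp: indicator_def)
  also have "\<dots> = 2 * pi * (LINT x|lborel. f x * ?h x)" by (rule integral_mult_right_zero)
  finally show ?thesis .
qed

section \<open>Identification by integrals over intervals, and completeness of L2\<close>

lemma locally_integrable_measurable:
  fixes g :: "real \<Rightarrow> real"
  assumes i: "\<And>a b. set_integrable lborel {a..b} g"
  shows "g \<in> borel_measurable borel"
proof (rule borel_measurable_LIMSEQ_metric)
  show "(\<lambda>x. indicator {- real n..real n} x *\<^sub>R g x) \<in> borel_measurable borel" for n
    using i[of "- real n" "real n"] by (auto simp: set_integrable_def dest: borel_measurable_integrable)
  show "(\<lambda>n. indicator {- real n..real n} x *\<^sub>R g x) \<longlonglongrightarrow> g x" for x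
  proof (rule tendsto_eventually)
    obtain N where "\<bar>x\<bar> \<le> real N" using real_arch_simple by blast
    then have "indicator {- real n..real n} x *\<^sub>R g x = g x" if "n \<ge> N" for n
      using that by (auto simp: indicator_def abs_le_iff)
    then show "\<forall>\<^sub>F n in sequentially. indicator {- real n..real n} x *\<^sub>R g x = g x"
      unfolding eventually_sequentially by blast
  qed
qed

text \<open>The measures whose densities are the positive and the negative part of g have equal and
  finite values on compact intervals. These form an intersection-stable generator of the Borel sets,
  so the measures coincide, and hence their densities do almost everywhere.\<close>

lemma AE_zero_if_integrals_zero:
  fixes g :: "real \<Rightarrow> real"
  assumes i: "\<And>a b. set_integrable lborel {a..b} g" and z: "\<And>a b. (LINT x:{a..b}|lborel. g x) = 0"
  shows "AE x in lborel. g x = 0"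
proof -
  have gm [measurable]: "g \<in> borel_measurable borel" by (rule locally_integrable_measurable[OF i])
  have eq: "emeasure (density lborel (\<lambda>x. ennreal (g x))) {a..b} = emeasure (density lborel (\<lambda>x. ennreal (- g x))) {a..b}"
    and fin: "emeasure (density lborel (\<lambda>x. ennreal (g x))) {a..b} \<noteq> \<infinity>" for a b
  proof -
    let ?f = "\<lambda>x. indicator {a..b} x *\<^sub>R g x"
    have int: "integrable lborel ?f" using i by (simp add: set_integrable_def)
    then have f: "(\<integral>\<^sup>+x. ennreal (?f x) \<partial>lborel) \<noteq> \<infinity>" "(\<integral>\<^sup>+x. ennreal (- ?f x) \<partial>lborel) \<noteq> \<infinity>"
      unfolding real_integrable_def by blast+
    have "enn2real (\<integral>\<^sup>+x. ennreal (?f x) \<partial>lborel) - enn2real (\<integral>\<^sup>+x. ennreal (- ?f x) \<partial>lborel) = 0"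
      using z[of a b] real_lebesgue_integral_def[OF int] by (simp add: set_lebesgue_integral_def)
    then have e: "(\<integral>\<^sup>+x. ennreal (?f x) \<partial>lborel) = (\<integral>\<^sup>+x. ennreal (- ?f x) \<partial>lborel)"
    proof -
      have "ennreal (enn2real (\<integral>\<^sup>+x. ennreal (?f x) \<partial>lborel)) = (\<integral>\<^sup>+x. ennreal (?f x) \<partial>lborel)"
        "ennreal (enn2real (\<integral>\<^sup>+x. ennreal (- ?f x) \<partial>lborel)) = (\<integral>\<^sup>+x. ennreal (- ?f x) \<partial>lborel)"
        using f by (auto intro!: ennreal_enn2real simp: less_top)
      moreover assume "enn2real (\<integral>\<^sup>+x. ennreal (?f x) \<partial>lborel) - enn2real (\<integral>\<^sup>+x. ennreal (- ?f x) \<partial>lborel) = 0"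
      then have "enn2real (\<integral>\<^sup>+x. ennreal (?f x) \<partial>lborel) = enn2real (\<integral>\<^sup>+x. ennreal (- ?f x) \<partial>lborel)" by linarith
      ultimately show ?thesis by metis
    qed
    have 1: "(\<integral>\<^sup>+x. ennreal (?f x) \<partial>lborel) = emeasure (density lborel (\<lambda>x. ennreal (g x))) {a..b}"
      by (subst emeasure_density) (auto intro!: nn_integral_cong simp: indicator_def)
    have 2: "(\<integral>\<^sup>+x. ennreal (- ?f x) \<partial>lborel) = emeasure (density lborel (\<lambda>x. ennreal (- g x))) {a..b}"
      by (subst emeasure_density) (auto intro!: nn_integral_cong simp: indicator_def)
    show "emeasure (density lborel (\<lambda>x. ennreal (g x))) {a..b} = emeasure (density lborel (\<lambda>x. ennreal (- g x))) {a..b}"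
      "emeasure (density lborel (\<lambda>x. ennreal (g x))) {a..b} \<noteq> \<infinity>"
      using e f 1 2 by simp_all
  qed
  have "density lborel (\<lambda>x. ennreal (g x)) = density lborel (\<lambda>x. ennreal (- g x))"
  proof (rule measure_eqI_generator_eq)
    let ?E = "range (\<lambda>(a, b). {a..b::real})"
    show "Int_stable ?E"
      by (auto simp: Int_stable_def Int_atLeastAtMost)
    show "?E \<subseteq> Pow UNIV" by simp
    show "sets (density lborel (\<lambda>x. ennreal (g x))) = sigma_sets UNIV ?E"
      "sets (density lborel (\<lambda>x. ennreal (- g x))) = sigma_sets UNIV ?E"
      by (simp_all add: borel_eq_atLeastAtMost)
    show "range (\<lambda>n::nat. {- real n..real n}) \<subseteq> ?E" by auto
    show "(\<Union>n. {- real n..real n}) = UNIV"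
    proof (intro equalityI subsetI UNIV_I)
      fix x :: real
      obtain N where "\<bar>x\<bar> \<le> real N" using real_arch_simple by blast
      then show "x \<in> (\<Union>n. {- real n..real n})" by (auto simp: abs_le_iff intro!: exI[of _ N])
    qed
  qed (use eq fin in auto)
  \<comment> \<open>\<open>ennreal\<close> sends negative reals to 0, so this equates the positive
    and the negative part of g; one of them is always 0.\<close>
  then have "AE x in lborel. ennreal (g x) = ennreal (- g x)"
    by (intro sigma_finite_measure.density_unique[OF lborel.sigma_finite_measure_axioms]) auto
  then show ?thesis
  proof eventually_elim
    case (elim x)
    then show ?case by (cases "g x" "0::real" rule: linorder_cases) (auto simp: ennreal_neg)
  qed
qed

lemma square_integrable_indicator: "square_integrable (indicator {a..b::real} :: real \<Rightarrow> complex)"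
  unfolding square_integrable_def
  by (auto simp: indicator_def power2_eq_square intro!: Bochner_Integration.integrable_bound[OF integrable_indicator_interval[of a b]])

lemma AE_eq_if_integrals_eq:
  fixes f g :: "real \<Rightarrow> complex"
  assumes f: "square_integrable f" and g: "square_integrable g"
    and eq: "\<And>a b. (LINT x|lborel. f x * indicator {a..b} x) = (LINT x|lborel. g x * indicator {a..b} x)"
  shows "AE x in lborel. f x = g x"
proof -
  define h where "h x = f x - g x" for x
  have hi: "integrable lborel (\<lambda>x. h x * indicator {a..b} x)" for a b
    unfolding h_def by (intro square_integrable_mult square_integrable_diff f g square_integrable_indicator)
  have h0: "(LINT x|lborel. h x * indicator {a..b} x) = 0" for a b
    using eq[of a b] unfolding h_def left_diff_distrib
    by (subst Bochner_Integration.integral_diff) (auto intro!: square_integrable_mult f g square_integrable_indicator)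
  have "AE x in lborel. Re (h x) = 0"
  proof (rule AE_zero_if_integrals_zero)
    have e: "indicator {a..b} x *\<^sub>R Re (h x) = Re (h x * indicator {a..b} x)" for a b x
      by (simp add: indicator_def)
    show "set_integrable lborel {a..b} (\<lambda>x. Re (h x))" for a b
      unfolding set_integrable_def e by (intro integrable_Re hi)
    show "(LINT x:{a..b}|lborel. Re (h x)) = 0" for a b
      unfolding set_lebesgue_integral_def e using integral_Re[OF hi[of a b]] h0[of a b] by simp
  qed
  moreover have "AE x in lborel. Im (h x) = 0"
  proof (rule AE_zero_if_integrals_zero)
    have e: "indicator {a..b} x *\<^sub>R Im (h x) = Im (h x * indicator {a..b} x)" for a b x
      by (simp add: indicator_def)
    show "set_integrable lborel {a..b} (\<lambda>x. Im (h x))" for a b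
      unfolding set_integrable_def e by (intro integrable_Im hi)
    show "(LINT x:{a..b}|lborel. Im (h x)) = 0" for a b
      unfolding set_lebesgue_integral_def e using integral_Im[OF hi[of a b]] h0[of a b] by simp
  qed
  ultimately show ?thesis by eventually_elim (simp add: h_def complex_eq_iff)
qed

text \<open>Riesz-Fischer. Along a subsequence whose increments \<open>d k\<close> have norm at most
  4^(-k), the sum of the squares weighted by 2^k is integrable, hence finite almost everywhere.
  There the increments are at most a constant times 2^(-k/2) and therefore summable. Working with
  weighted squares means that only sums of nonnegative integrals have to be interchanged.\<close>

lemma L2_complete:
  fixes F :: "nat \<Rightarrow> real \<Rightarrow> complex"
  assumes sq: "\<And>n. square_integrable (F n)"
    and cauchy: "\<And>e. e > 0 \<Longrightarrow> \<exists>N. \<forall>m\<ge>N. \<forall>n\<ge>N. L2 (\<lambda>x. F m x - F n x) < e"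
  obtains g where "square_integrable g" "(\<lambda>n. L2 (\<lambda>x. g x - F n x)) \<longlonglongrightarrow> 0"
proof -
  have [measurable]: "F n \<in> borel_measurable borel" for n using square_integrable_measurable[OF sq] by simp
  have "\<exists>N. \<forall>m\<ge>N. \<forall>n\<ge>N. L2 (\<lambda>x. F m x - F n x) < (1/4) ^ k" for k by (rule cauchy) simp
  then obtain N where N: "\<And>k m n. m \<ge> N k \<Longrightarrow> n \<ge> N k \<Longrightarrow> L2 (\<lambda>x. F m x - F n x) < (1/4) ^ k" by metis
  \<comment> \<open>The partial sums place both \<open>r k\<close> and \<open>r (Suc k)\<close>
    beyond \<open>N k\<close>, and the summand k makes r tend to infinity.\<close>
  define r where "r k = k + (\<Sum>i\<le>k. N i)" for k
  have rN: "r k \<ge> N k" for k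
  proof -
    have "N k \<le> (\<Sum>i\<le>k. N i)" by (rule member_le_sum) auto
    then show ?thesis by (simp add: r_def)
  qed
  have rS: "r (Suc k) \<ge> N k" for k
    using rN[of k] by (simp add: r_def)
  have rk: "r k \<ge> k" for k by (simp add: r_def)
  define d where "d k x = F (r (Suc k)) x - F (r k) x" for k x
  have [measurable]: "d k \<in> borel_measurable borel" for k unfolding d_def by measurable
  have dsq: "square_integrable (d k)" for k unfolding d_def by (intro square_integrable_diff sq)
  have dL: "(L2 (d k))\<^sup>2 \<le> (1/16) ^ k" for k
  proof -
    have "L2 (d k) \<le> (1/4) ^ k" unfolding d_def using N[OF rS rN] by (simp add: less_imp_le)
    then have "(L2 (d k))\<^sup>2 \<le> ((1/4) ^ k)\<^sup>2" by (intro power_mono) auto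
    also have "((1/4) ^ k)\<^sup>2 = ((1/16) ^ k :: real)" by (simp add: power2_eq_square flip: power_mult_distrib)
    finally show ?thesis .
  qed
  have "(\<integral>\<^sup>+x. (\<Sum>k. ennreal (2 ^ k * (norm (d k x))\<^sup>2)) \<partial>lborel) = (\<Sum>k. \<integral>\<^sup>+x. ennreal (2 ^ k * (norm (d k x))\<^sup>2) \<partial>lborel)"
    by (rule nn_integral_suminf) simp
  also have "\<dots> \<le> (\<Sum>k. ennreal ((1/8) ^ k))"
  proof (intro suminf_le)
    fix k
    have "(\<integral>\<^sup>+x. ennreal (2 ^ k * (norm (d k x))\<^sup>2) \<partial>lborel) = ennreal (2 ^ k) * ennreal ((L2 (d k))\<^sup>2)"
      by (simp add: ennreal_mult nn_integral_cmult nn_integral_L2[OF dsq])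
    also have "\<dots> \<le> ennreal (2 ^ k) * ennreal ((1/16) ^ k)" by (intro mult_left_mono ennreal_leI dL) simp
    also have "\<dots> = ennreal (2 ^ k * (1/16) ^ k)" by (simp add: ennreal_mult)
    also have "2 ^ k * (1/16::real) ^ k = (1/8) ^ k" by (simp flip: power_mult_distrib)
    finally show "(\<integral>\<^sup>+x. ennreal (2 ^ k * (norm (d k x))\<^sup>2) \<partial>lborel) \<le> ennreal ((1/8) ^ k)" .
  qed auto
  also have "\<dots> = ennreal (\<Sum>k. (1/8) ^ k)" by (intro suminf_ennreal2) auto
  also have "\<dots> < \<infinity>" by simp
  finally have "AE x in lborel. (\<Sum>k. ennreal (2 ^ k * (norm (d k x))\<^sup>2)) \<noteq> \<infinity>"
    by (intro nn_integral_PInf_AE) auto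
  then have conv: "AE x in lborel. convergent (\<lambda>k. F (r k) x)"
  proof eventually_elim
    case (elim x)
    then have "summable (\<lambda>k. 2 ^ k * (norm (d k x))\<^sup>2)"
      by (intro summable_suminf_not_top) (auto simp: top_ennreal_def)
    then have "Bseq (\<lambda>k. 2 ^ k * (norm (d k x))\<^sup>2)" by (rule summable_imp_Bseq)
    then obtain C where C: "C > 0" "\<And>k. 2 ^ k * (norm (d k x))\<^sup>2 \<le> C"
      by (auto simp: Bseq_def)
    have "summable (\<lambda>k. norm (d k x))"
    proof (rule summable_comparison_test')
      show "summable (\<lambda>k. sqrt C * (sqrt (1/2)) ^ k)"
        by (intro summable_mult summable_geometric) (simp add: real_sqrt_divide)
      fix k :: nat
      have "(norm (d k x))\<^sup>2 \<le> C * (1/2) ^ k" using C(2)[of k] by (simp add: field_simps power_divide)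
      then have "norm (d k x) \<le> sqrt (C * (1/2) ^ k)" by (simp add: real_le_rsqrt)
      then show "norm (norm (d k x)) \<le> sqrt C * (sqrt (1/2)) ^ k" by (simp add: real_sqrt_mult real_sqrt_power)
    qed
    then have "summable (\<lambda>k. d k x)" by (rule summable_norm_cancel)
    then have "convergent (\<lambda>n. \<Sum>k<n. d k x)" by (simp add: summable_iff_convergent)
    moreover have "(\<Sum>k<n. d k x) = F (r n) x - F (r 0) x" for n
      unfolding d_def by (rule sum_lessThan_telescope)
    ultimately have "convergent (\<lambda>n. F (r n) x - F (r 0) x + F (r 0) x)"
      by (intro convergent_add) (auto simp: convergent_const)
    then show ?case by simp
  qed
  define g where "g x = lim (\<lambda>k. F (r k) x)" for x
  have [measurable]: "g \<in> borel_measurable borel" unfolding g_def by measurable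
  \<comment> \<open>Fatou's lemma along the subsequence: the Cauchy bound for two members of the
    sequence survives when one of them is replaced by the limit.\<close>
  have Fb: "(\<integral>\<^sup>+x. ennreal ((norm (g x - F n x))\<^sup>2) \<partial>lborel) \<le> ennreal (e\<^sup>2)"
    if e: "e > 0" and M: "\<And>m. m \<ge> M \<Longrightarrow> L2 (\<lambda>x. F m x - F n x) < e" for e n M
  proof -
    have "(\<integral>\<^sup>+x. ennreal ((norm (g x - F n x))\<^sup>2) \<partial>lborel)
        = (\<integral>\<^sup>+x. liminf (\<lambda>k. ennreal ((norm (F (r k) x - F n x))\<^sup>2)) \<partial>lborel)"
    proof (intro nn_integral_cong_AE)
      show "AE x in lborel. ennreal ((norm (g x - F n x))\<^sup>2) = liminf (\<lambda>k. ennreal ((norm (F (r k) x - F n x))\<^sup>2))"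
        using conv
      proof eventually_elim
        case (elim x)
        then have "(\<lambda>k. F (r k) x) \<longlonglongrightarrow> g x" unfolding g_def by (simp add: convergent_LIMSEQ_iff)
        then have "(\<lambda>k. ennreal ((norm (F (r k) x - F n x))\<^sup>2)) \<longlonglongrightarrow> ennreal ((norm (g x - F n x))\<^sup>2)"
          by (intro tendsto_intros tendsto_ennrealI)
        then show ?case by (rule lim_imp_Liminf[OF sequentially_bot, symmetric])
      qed
    qed
    also have "\<dots> \<le> liminf (\<lambda>k. \<integral>\<^sup>+x. ennreal ((norm (F (r k) x - F n x))\<^sup>2) \<partial>lborel)"
      by (rule nn_integral_liminf) simp
    also have "\<dots> \<le> liminf (\<lambda>k. ennreal (e\<^sup>2))"
    proof (rule Liminf_mono)
      show "\<forall>\<^sub>F k in sequentially. (\<integral>\<^sup>+x. ennreal ((norm (F (r k) x - F n x))\<^sup>2) \<partial>lborel) \<le> ennreal (e\<^sup>2)"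
        using eventually_ge_at_top[of M]
      proof eventually_elim
        case (elim k)
        then have "L2 (\<lambda>x. F (r k) x - F n x) < e" using rk[of k] by (intro M) simp
        then have "(L2 (\<lambda>x. F (r k) x - F n x))\<^sup>2 \<le> e\<^sup>2" by (intro power_mono) auto
        then show ?case
          by (simp add: nn_integral_L2[OF square_integrable_diff[OF sq sq]])
      qed
    qed
    finally show ?thesis by (simp add: Liminf_const)
  qed
  have gF: "square_integrable (\<lambda>x. g x - F n x)" "L2 (\<lambda>x. g x - F n x) \<le> e"
    if e: "e > 0" and M: "\<And>m. m \<ge> M \<Longrightarrow> L2 (\<lambda>x. F m x - F n x) < e" for e n M
    using square_integrable_nn_le[OF _ Fb[OF e M]] e by auto
  show thesis
  proof (rule that)
    obtain M where M: "\<And>m n. m \<ge> M \<Longrightarrow> n \<ge> M \<Longrightarrow> L2 (\<lambda>x. F m x - F n x) < 1"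
      using cauchy[of 1] by auto
    have "square_integrable (\<lambda>x. (g x - F M x) + F M x)"
      by (intro square_integrable_add sq gF(1)[of 1 M M] M) auto
    then show "square_integrable g" by simp
    show "(\<lambda>n. L2 (\<lambda>x. g x - F n x)) \<longlonglongrightarrow> 0"
    proof (rule LIMSEQ_I)
      fix e :: real assume e: "e > 0"
      obtain M where M: "\<And>m n. m \<ge> M \<Longrightarrow> n \<ge> M \<Longrightarrow> L2 (\<lambda>x. F m x - F n x) < e / 2"
        using cauchy[of "e / 2"] e by auto
      have "norm (L2 (\<lambda>x. g x - F n x) - 0) < e" if "n \<ge> M" for n
        using gF(2)[of "e / 2" M n] M that e by auto
      then show "\<exists>no. \<forall>n\<ge>no. norm (L2 (\<lambda>x. g x - F n x) - 0) < e" by blast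
    qed
  qed
qed

section \<open>Extension of the transform to L2\<close>

definition trunc :: "real \<Rightarrow> (real \<Rightarrow> complex) \<Rightarrow> real \<Rightarrow> complex"
  where "trunc R f x = indicator {- R..R} x *\<^sub>R f x"

lemma trunc_eq: "trunc R f x = indicator {- R..R} x * f x"
  by (simp add: trunc_def indicator_def)

lemma square_integrable_trunc: "square_integrable f \<Longrightarrow> square_integrable (trunc R f)"
  by (rule square_integrable_bound[where g=f])
    (auto simp: trunc_def[abs_def] indicator_def dest!: square_integrable_measurable)

lemma integrable_trunc: "square_integrable f \<Longrightarrow> integrable lborel (trunc R f)"
  unfolding trunc_eq[abs_def] by (intro square_integrable_mult square_integrable_indicator)

lemma LINT_trunc: "(LINT x:{- R..R}|lborel. cis (- (x * \<xi>)) * f x) = ft (trunc R f) \<xi>"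
  unfolding set_lebesgue_integral_def ft_def trunc_def
  by (intro Bochner_Integration.integral_cong) auto

lemma square_integrable_ft_trunc: "square_integrable f \<Longrightarrow> square_integrable (ft (trunc R f))"
  by (intro plancherel_bound integrable_trunc square_integrable_trunc)

lemma L2_trunc_tendsto:
  assumes f: "square_integrable f"
  shows "((\<lambda>R. L2 (\<lambda>x. f x - trunc R f x)) \<longlongrightarrow> 0) at_top"
proof (rule tendsto_at_topI_sequentially)
  fix X :: "nat \<Rightarrow> real" assume X: "filterlim X at_top sequentially"
  have [measurable]: "f \<in> borel_measurable borel" using square_integrable_measurable[OF f] by simp
  show "(\<lambda>n. L2 (\<lambda>x. f x - trunc (X n) f x)) \<longlonglongrightarrow> 0"
  proof (rule L2_dominated[OF f, where C=1])
    show "(\<lambda>n. f x - trunc (X n) f x) \<longlonglongrightarrow> 0" for x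
    proof (rule tendsto_eventually)
      have "\<forall>\<^sub>F n in sequentially. X n \<ge> \<bar>x\<bar>" using X by (auto simp: filterlim_at_top)
      then show "\<forall>\<^sub>F n in sequentially. f x - trunc (X n) f x = 0"
        by eventually_elim (auto simp: trunc_def indicator_def)
    qed
  qed (auto simp: trunc_def indicator_def)
qed

lemma is_fourier_iff:
  assumes f: "square_integrable f"
  shows "is_fourier f g \<longleftrightarrow> square_integrable g \<and> ((\<lambda>R. L2 (\<lambda>\<xi>. g \<xi> - ft (trunc R f) \<xi>)) \<longlongrightarrow> 0) at_top"
proof -
  have "((\<lambda>R. ennreal ((L2 (\<lambda>\<xi>. g \<xi> - ft (trunc R f) \<xi>))\<^sup>2)) \<longlongrightarrow> 0) at_top
    \<longleftrightarrow> ((\<lambda>R. L2 (\<lambda>\<xi>. g \<xi> - ft (trunc R f) \<xi>)) \<longlongrightarrow> 0) at_top" (is "?A \<longleftrightarrow> ?B")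
  proof
    assume ?A
    then have "((\<lambda>R. (L2 (\<lambda>\<xi>. g \<xi> - ft (trunc R f) \<xi>))\<^sup>2) \<longlongrightarrow> 0) at_top"
      by (simp add: tendsto_ennreal_iff[of _ _ 0, simplified])
    then show ?B using tendsto_real_sqrt by fastforce
  next
    assume ?B
    then have "((\<lambda>R. (L2 (\<lambda>\<xi>. g \<xi> - ft (trunc R f) \<xi>))\<^sup>2) \<longlongrightarrow> 0\<^sup>2) at_top" by (intro tendsto_intros)
    then show ?A using tendsto_ennrealI by fastforce
  qed
  then show ?thesis
    unfolding is_fourier_def LINT_trunc
    by (auto simp: nn_integral_L2[OF square_integrable_diff[OF _ square_integrable_ft_trunc[OF f]]])
qed

lemma is_fourier_sq: "is_fourier f g \<Longrightarrow> square_integrable g"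
  by (simp add: is_fourier_def)

lemma ft_diff:
  assumes "integrable lborel f" "integrable lborel g"
  shows "ft (\<lambda>x. f x - g x) \<xi> = ft f \<xi> - ft g \<xi>"
  unfolding ft_def right_diff_distrib
  by (intro Bochner_Integration.integral_diff integrable_cis_mult assms) simp_all

lemma L2_ft_diff:
  assumes "integrable lborel f" "integrable lborel g" "square_integrable f" "square_integrable g"
  shows "L2 (\<lambda>\<xi>. ft f \<xi> - ft g \<xi>) \<le> sqrt (2 * pi) * L2 (\<lambda>x. f x - g x)"
proof -
  have "(\<lambda>\<xi>. ft f \<xi> - ft g \<xi>) = ft (\<lambda>x. f x - g x)" by (rule ext) (simp add: ft_diff assms)
  then show ?thesis using plancherel_bound(2)[of "\<lambda>x. f x - g x"] assms by (simp add: square_integrable_diff)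
qed

text \<open>By \<open>plancherel_bound\<close> the transforms of the truncations are Cauchy, with
  distances controlled by the tails \<open>D\<close>; completeness supplies a limit along the
  integers.\<close>

lemma ex_is_fourier:
  assumes f: "square_integrable f"
  shows "\<exists>g. is_fourier f g"
proof -
  define D where "D R = sqrt (2 * pi) * L2 (\<lambda>x. f x - trunc R f x)" for R
  have D: "(D \<longlongrightarrow> 0) at_top"
    unfolding D_def using tendsto_mult[OF tendsto_const L2_trunc_tendsto[OF f]] by simp
  have b: "L2 (\<lambda>\<xi>. ft (trunc Q f) \<xi> - ft (trunc R f) \<xi>) \<le> D Q + D R" for Q R
  proof -
    have "L2 (\<lambda>\<xi>. ft (trunc Q f) \<xi> - ft (trunc R f) \<xi>) \<le> sqrt (2 * pi) * L2 (\<lambda>x. trunc Q f x - trunc R f x)"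
      by (intro L2_ft_diff integrable_trunc square_integrable_trunc f)
    also have "\<dots> \<le> sqrt (2 * pi) * (L2 (\<lambda>x. trunc Q f x - f x) + L2 (\<lambda>x. f x - trunc R f x))"
      by (intro mult_left_mono L2_triangle_diff square_integrable_trunc f) simp
    finally show ?thesis by (simp add: D_def ring_distribs L2_minus_commute[of "trunc Q f" f])
  qed
  obtain g where g: "square_integrable g" "(\<lambda>n. L2 (\<lambda>\<xi>. g \<xi> - ft (trunc (real n) f) \<xi>)) \<longlonglongrightarrow> 0"
  proof (rule L2_complete[where F="\<lambda>n. ft (trunc (real n) f)"])
    fix e :: real assume e: "e > 0"
    have "(\<lambda>n. D (real n)) \<longlonglongrightarrow> 0" by (rule filterlim_compose[OF D filterlim_real_sequentially])
    then have "\<forall>\<^sub>F n in sequentially. D (real n) < e / 2" using e by (intro order_tendstoD) auto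
    then obtain N where N: "\<And>n. n \<ge> N \<Longrightarrow> D (real n) < e / 2" by (auto simp: eventually_sequentially)
    show "\<exists>N. \<forall>m\<ge>N. \<forall>n\<ge>N. L2 (\<lambda>x. ft (trunc (real m) f) x - ft (trunc (real n) f) x) < e"
    proof (intro exI[of _ N] allI impI)
      fix m n assume "N \<le> m" "N \<le> n"
      from N[OF this(1)] N[OF this(2)] b[of "real m" "real n"]
      show "L2 (\<lambda>x. ft (trunc (real m) f) x - ft (trunc (real n) f) x) < e" by linarith
    qed
  qed (use f in \<open>auto intro: square_integrable_ft_trunc\<close>)
  \<comment> \<open>Comparison with large integer truncations extends the tail estimate to every
    real radius R.\<close>
  have le: "L2 (\<lambda>\<xi>. g \<xi> - ft (trunc R f) \<xi>) \<le> D R" for R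
  proof (rule LIMSEQ_le_const)
    have "(\<lambda>n. L2 (\<lambda>\<xi>. g \<xi> - ft (trunc (real n) f) \<xi>) + (D (real n) + D R)) \<longlonglongrightarrow> 0 + (0 + D R)"
      by (intro tendsto_intros g filterlim_compose[OF D filterlim_real_sequentially])
    then show "(\<lambda>n. L2 (\<lambda>\<xi>. g \<xi> - ft (trunc (real n) f) \<xi>) + (D (real n) + D R)) \<longlonglongrightarrow> D R" by simp
    show "\<exists>N. \<forall>n\<ge>N. L2 (\<lambda>\<xi>. g \<xi> - ft (trunc R f) \<xi>) \<le> L2 (\<lambda>\<xi>. g \<xi> - ft (trunc (real n) f) \<xi>) + (D (real n) + D R)"
      by (intro exI allI impI order_trans[OF L2_triangle_diff add_left_mono[OF b]] g square_integrable_ft_trunc f)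
  qed
  have "((\<lambda>R. L2 (\<lambda>\<xi>. g \<xi> - ft (trunc R f) \<xi>)) \<longlongrightarrow> 0) at_top"
    by (rule tendsto_sandwich[OF _ _ tendsto_const D]) (use le in auto)
  then show ?thesis using g is_fourier_iff[OF f] by blast
qed

lemma is_fourier_unique:
  assumes f: "square_integrable f" and g: "is_fourier f g" "is_fourier f g'"
  shows "AE \<xi> in lborel. g \<xi> = g' \<xi>"
proof -
  have sq: "square_integrable g" "square_integrable g'" using g by (auto dest: is_fourier_sq)
  have "((\<lambda>R. L2 (\<lambda>\<xi>. g \<xi> - ft (trunc R f) \<xi>) + L2 (\<lambda>\<xi>. g' \<xi> - ft (trunc R f) \<xi>)) \<longlongrightarrow> 0 + 0) at_top"
    using g unfolding is_fourier_iff[OF f] by (intro tendsto_add) auto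
  moreover have "L2 (\<lambda>\<xi>. g \<xi> - g' \<xi>) \<le> L2 (\<lambda>\<xi>. g \<xi> - ft (trunc R f) \<xi>) + L2 (\<lambda>\<xi>. g' \<xi> - ft (trunc R f) \<xi>)" for R
    using L2_triangle_diff[OF sq(1) square_integrable_ft_trunc[OF f, of R] sq(2)] by (simp add: L2_minus_commute[of g'])
  ultimately have "L2 (\<lambda>\<xi>. g \<xi> - g' \<xi>) \<le> 0"
    by (intro tendsto_lowerbound[where F=at_top]) auto
  then have "AE \<xi> in lborel. g \<xi> - g' \<xi> = 0"
    using L2_nonneg[of "\<lambda>\<xi>. g \<xi> - g' \<xi>"] by (intro L2_eq_0_AE square_integrable_diff sq) auto
  then show ?thesis by simp
qed

lemma is_fourier_ft:
  assumes f: "integrable lborel f" "square_integrable f"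
  shows "is_fourier f (ft f)"
  unfolding is_fourier_iff[OF f(2)]
proof
  show "square_integrable (ft f)" by (rule plancherel_bound[OF f])
  have "((\<lambda>R. sqrt (2 * pi) * L2 (\<lambda>x. f x - trunc R f x)) \<longlongrightarrow> sqrt (2 * pi) * 0) at_top"
    by (intro tendsto_mult tendsto_const L2_trunc_tendsto f)
  then have D: "((\<lambda>R. sqrt (2 * pi) * L2 (\<lambda>x. f x - trunc R f x)) \<longlongrightarrow> 0) at_top" by simp
  show "((\<lambda>R. L2 (\<lambda>\<xi>. ft f \<xi> - ft (trunc R f) \<xi>)) \<longlongrightarrow> 0) at_top"
  proof (rule tendsto_sandwich[OF _ _ tendsto_const D])
    show "\<forall>\<^sub>F R in at_top. L2 (\<lambda>\<xi>. ft f \<xi> - ft (trunc R f) \<xi>) \<le> sqrt (2 * pi) * L2 (\<lambda>x. f x - trunc R f x)"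
      using f by (intro always_eventually allI L2_ft_diff integrable_trunc square_integrable_trunc)
  qed simp
qed

lemma is_fourier_cong_AE:
  assumes fg: "is_fourier f g" and f: "square_integrable f" "f' \<in> borel_measurable lborel" "AE x in lborel. f x = f' x"
    and g: "g' \<in> borel_measurable lborel" "AE \<xi> in lborel. g \<xi> = g' \<xi>"
  shows "is_fourier f' g'"
proof -
  have f'sq: "square_integrable f'" by (rule square_integrable_cong_AE[OF f(1,2,3)])
  have gsq: "square_integrable g" using is_fourier_sq[OF fg] .
  have g'sq: "square_integrable g'" by (rule square_integrable_cong_AE[OF gsq g])
  have [measurable]: "f \<in> borel_measurable borel" "f' \<in> borel_measurable borel"
    using f square_integrable_measurable[OF f(1)] by auto
  have "ft (trunc R f) \<xi> = ft (trunc R f') \<xi>" for R \<xi>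
    unfolding ft_def by (rule integral_cong_AE) (use f(3) in \<open>auto simp: trunc_def elim: eventually_mono\<close>)
  moreover have "L2 (\<lambda>\<xi>. g \<xi> - ft (trunc R f) \<xi>) = L2 (\<lambda>\<xi>. g' \<xi> - ft (trunc R f) \<xi>)" for R
  proof (rule L2_cong_AE)
    show "AE x in lborel. g x - ft (trunc R f) x = g' x - ft (trunc R f) x" using g(2) by eventually_elim simp
  qed (intro square_integrable_measurable square_integrable_diff gsq g'sq square_integrable_ft_trunc[OF f(1)])+
  ultimately show ?thesis
    using fg g'sq unfolding is_fourier_iff[OF f(1)] is_fourier_iff[OF f'sq] by simp
qed

text \<open>Insert the mixed term \<open>F R x * g x\<close> and apply Cauchy-Schwarz to both
  differences. Through this continuity the identities for \<open>ft\<close> pass from truncations to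
  all of L2.\<close>

lemma L2_mult_tendsto:
  fixes f g :: "real \<Rightarrow> complex"
  assumes f: "square_integrable f" "\<And>R. square_integrable (F R)" "((\<lambda>R. L2 (\<lambda>x. f x - F R x)) \<longlongrightarrow> 0) A"
    and g: "square_integrable g" "\<And>R. square_integrable (G R)" "((\<lambda>R. L2 (\<lambda>x. g x - G R x)) \<longlongrightarrow> 0) A"
  shows "((\<lambda>R. LINT x|lborel. F R x * G R x) \<longlongrightarrow> (LINT x|lborel. f x * g x)) A"
proof -
  define B where "B R = L2 (\<lambda>x. f x - F R x) * L2 g + (L2 f + L2 (\<lambda>x. f x - F R x)) * L2 (\<lambda>x. g x - G R x)" for R
  have le: "norm ((LINT x|lborel. F R x * G R x) - (LINT x|lborel. f x * g x)) \<le> B R" for R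
  proof -
    have sq: "square_integrable (\<lambda>x. f x - F R x)" "square_integrable (\<lambda>x. g x - G R x)"
      using f g by (auto intro: square_integrable_diff)
    have "(LINT x|lborel. f x * g x) - (LINT x|lborel. F R x * G R x)
        = (LINT x|lborel. f x * g x - F R x * G R x)"
      using f g by (intro Bochner_Integration.integral_diff[symmetric] square_integrable_mult)
    also have "\<dots> = (LINT x|lborel. (f x - F R x) * g x + F R x * (g x - G R x))"
      by (intro Bochner_Integration.integral_cong) (auto simp: algebra_simps)
    also have "\<dots> = (LINT x|lborel. (f x - F R x) * g x) + (LINT x|lborel. F R x * (g x - G R x))"
      using f g sq by (intro Bochner_Integration.integral_add square_integrable_mult)
    finally have "norm ((LINT x|lborel. f x * g x) - (LINT x|lborel. F R x * G R x))
      \<le> norm (LINT x|lborel. (f x - F R x) * g x) + norm (LINT x|lborel. F R x * (g x - G R x))"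
      by (simp add: norm_triangle_ineq)
    also have "\<dots> \<le> L2 (\<lambda>x. f x - F R x) * L2 g + L2 (F R) * L2 (\<lambda>x. g x - G R x)"
      using f g sq by (intro add_mono cauchy_schwarz_mult)
    also have "\<dots> \<le> B R"
      using L2_diff_abs[OF f(1) f(2)[of R]] unfolding B_def by (intro add_left_mono mult_right_mono) auto
    finally show ?thesis by (simp add: norm_minus_commute)
  qed
  have "(B \<longlongrightarrow> 0 * L2 g + (L2 f + 0) * 0) A" unfolding B_def by (intro tendsto_intros f g)
  then have "(B \<longlongrightarrow> 0) A" by simp
  then have "((\<lambda>R. (LINT x|lborel. F R x * G R x) - (LINT x|lborel. f x * g x)) \<longlongrightarrow> 0) A"
    by (rule Lim_null_comparison[rotated]) (use le in auto)
  then show ?thesis by (simp add: LIM_zero_iff)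
qed

lemma fourier_mult_formula:
  assumes a: "square_integrable a" "is_fourier a A" and b: "square_integrable b" "is_fourier b B"
  shows "(LINT \<xi>|lborel. A \<xi> * b \<xi>) = (LINT x|lborel. a x * B x)"
proof -
  have "((\<lambda>R. LINT \<xi>|lborel. ft (trunc R a) \<xi> * trunc R b \<xi>) \<longlongrightarrow> (LINT \<xi>|lborel. A \<xi> * b \<xi>)) at_top"
    using a b unfolding is_fourier_iff[OF a(1)]
    by (intro L2_mult_tendsto square_integrable_ft_trunc square_integrable_trunc L2_trunc_tendsto) auto
  moreover have "((\<lambda>R. LINT \<xi>|lborel. trunc R a \<xi> * ft (trunc R b) \<xi>) \<longlongrightarrow> (LINT \<xi>|lborel. a \<xi> * B \<xi>)) at_top"
    using a b unfolding is_fourier_iff[OF b(1)]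
    by (intro L2_mult_tendsto square_integrable_ft_trunc square_integrable_trunc L2_trunc_tendsto) auto
  moreover have "(LINT \<xi>|lborel. ft (trunc R a) \<xi> * trunc R b \<xi>) = (LINT \<xi>|lborel. trunc R a \<xi> * ft (trunc R b) \<xi>)" for R
    by (intro ft_mult_formula integrable_trunc a b)
  ultimately show ?thesis by (simp add: tendsto_unique[OF trivial_limit_at_top_linorder])
qed

lemma fourier_parseval_interval:
  fixes a b :: real and f :: "real \<Rightarrow> complex"
  assumes f: "square_integrable f" "is_fourier f g"
  shows "(LINT \<xi>|lborel. g \<xi> * cnj (ft (indicator {a..b}) \<xi>)) = 2 * pi * (LINT x|lborel. f x * indicator {a..b} x)"
proof -
  let ?I = "indicator {a..b} :: real \<Rightarrow> complex"
  have I: "square_integrable ?I" by (rule square_integrable_indicator)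
  have "square_integrable (ft ?I)" by (intro plancherel_bound I integrable_indicator_interval)
  then have F: "square_integrable (\<lambda>\<xi>. cnj (ft ?I \<xi>))"
    by (rule square_integrable_bound[rotated]) (use \<open>square_integrable (ft ?I)\<close>[THEN square_integrable_measurable] in auto)
  have z: "((\<lambda>R::real. L2 (\<lambda>x. h x - h x :: complex)) \<longlongrightarrow> 0) at_top" for h by (simp add: L2_def)
  have "((\<lambda>R. LINT \<xi>|lborel. ft (trunc R f) \<xi> * cnj (ft ?I \<xi>)) \<longlongrightarrow> (LINT \<xi>|lborel. g \<xi> * cnj (ft ?I \<xi>))) at_top"
    using f F z unfolding is_fourier_iff[OF f(1)]
    by (intro L2_mult_tendsto square_integrable_ft_trunc) auto
  moreover have "((\<lambda>R. 2 * pi * (LINT x|lborel. trunc R f x * ?I x)) \<longlongrightarrow> 2 * pi * (LINT x|lborel. f x * ?I x)) at_top"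
    using f I z by (intro tendsto_mult tendsto_const L2_mult_tendsto square_integrable_trunc L2_trunc_tendsto) auto
  ultimately show ?thesis
    by (simp add: ft_parseval_interval integrable_trunc square_integrable_trunc f tendsto_unique[OF trivial_limit_at_top_linorder])
qed

section \<open>Symmetries, inversion and the Parseval identity\<close>

lemma square_integrable_reflect: "square_integrable f \<Longrightarrow> square_integrable (\<lambda>x. f (- x))"
  using lborel_integrable_real_affine[of "\<lambda>x. (norm (f x))\<^sup>2" "-1" 0]
  by (auto simp: square_integrable_def)

lemma L2_reflect: "L2 (\<lambda>x. f (- x)) = L2 f"
  using lborel_integral_real_affine[of "-1" "\<lambda>x. (norm (f x))\<^sup>2" 0] by (simp add: L2_def)

lemma square_integrable_translate: "square_integrable f \<Longrightarrow> square_integrable (\<lambda>x. f (x - a))"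
  using lborel_integrable_real_affine[of "\<lambda>x. (norm (f x))\<^sup>2" 1 "- a"]
  by (auto simp: square_integrable_def)

lemma L2_translate: "L2 (\<lambda>x. f (x - a)) = L2 f"
  using lborel_integral_real_affine[of 1 "\<lambda>x. (norm (f x))\<^sup>2" "- a"] by (simp add: L2_def)

lemma square_integrable_cnj: "square_integrable f \<Longrightarrow> square_integrable (\<lambda>x. cnj (f x))"
  by (auto simp: square_integrable_def)

lemma is_fourier_reflect:
  assumes f: "square_integrable f" "is_fourier f g"
  shows "is_fourier (\<lambda>x. f (- x)) (\<lambda>\<xi>. g (- \<xi>))"
proof -
  have e: "ft (trunc R (\<lambda>x. f (- x))) \<xi> = ft (trunc R f) (- \<xi>)" for R \<xi>
  proof -
    have "ft (trunc R f) (- \<xi>) = (LINT x|lborel. cis (- ((0 + -1 * x) * - \<xi>)) * trunc R f (0 + -1 * x))"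
      unfolding ft_def by (subst lborel_integral_real_affine[of "-1" _ 0]) auto
    also have "\<dots> = ft (trunc R (\<lambda>x. f (- x))) \<xi>"
      unfolding ft_def by (intro Bochner_Integration.integral_cong) (auto simp: trunc_def indicator_def)
    finally show ?thesis by simp
  qed
  show ?thesis
    using f(2) L2_reflect[of "\<lambda>\<xi>. g \<xi> - ft (trunc _ f) \<xi>"]
    unfolding is_fourier_iff[OF square_integrable_reflect[OF f(1)]] is_fourier_iff[OF f(1)] e
    by (simp add: square_integrable_reflect)
qed

lemma is_fourier_cnj:
  assumes f: "square_integrable f" "is_fourier f g"
  shows "is_fourier (\<lambda>x. cnj (f x)) (\<lambda>\<xi>. cnj (g (- \<xi>)))"
proof -
  have e: "ft (trunc R (\<lambda>x. cnj (f x))) \<xi> = cnj (ft (trunc R f) (- \<xi>))" for R \<xi>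
    unfolding ft_cnj[symmetric] by (simp add: trunc_def[abs_def] indicator_def if_distrib cong: if_cong)
  have "L2 (\<lambda>\<xi>. cnj (g (- \<xi>)) - cnj (ft (trunc R f) (- \<xi>))) = L2 (\<lambda>\<xi>. g \<xi> - ft (trunc R f) \<xi>)" for R
  proof -
    have "L2 (\<lambda>\<xi>. cnj (g (- \<xi>)) - cnj (ft (trunc R f) (- \<xi>))) = L2 (\<lambda>\<xi>. g (- \<xi>) - ft (trunc R f) (- \<xi>))"
      unfolding L2_def complex_cnj_diff[symmetric] complex_mod_cnj ..
    then show ?thesis using L2_reflect[of "\<lambda>\<xi>. g \<xi> - ft (trunc R f) \<xi>"] by simp
  qed
  then show ?thesis
    using f(2)
    unfolding is_fourier_iff[OF square_integrable_cnj[OF f(1)]] is_fourier_iff[OF f(1)] e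
    by (simp add: square_integrable_reflect square_integrable_cnj)
qed

lemma square_integrable_cis_mult:
  fixes f :: "real \<Rightarrow> complex"
  shows "square_integrable f \<Longrightarrow> square_integrable (\<lambda>x. cis (a * x) * f x)"
  by (rule square_integrable_mult_bounded(1)[where C=1]) simp_all

lemma is_fourier_modulate:
  assumes f: "square_integrable f" "is_fourier f g"
  shows "is_fourier (\<lambda>x. cis (a * x) * f x) (\<lambda>\<xi>. g (\<xi> - a))"
proof -
  have e: "ft (trunc R (\<lambda>x. cis (a * x) * f x)) \<xi> = ft (trunc R f) (\<xi> - a)" for R \<xi>
    unfolding ft_modulate[symmetric] by (simp add: trunc_eq[abs_def] mult.left_commute)
  show ?thesis
    using f(2) L2_translate[of "\<lambda>\<xi>. g \<xi> - ft (trunc _ f) \<xi>" a]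
    unfolding is_fourier_iff[OF square_integrable_cis_mult[OF f(1)]] is_fourier_iff[OF f(1)] e
    by (simp add: square_integrable_translate)
qed

lemma is_fourier_mult_left:
  assumes f: "square_integrable f" "is_fourier f g"
  shows "is_fourier (\<lambda>x. c * f x) (\<lambda>\<xi>. c * g \<xi>)"
proof -
  have e: "ft (trunc R (\<lambda>x. c * f x)) \<xi> = c * ft (trunc R f) \<xi>" for R \<xi>
    unfolding ft_def trunc_eq by (subst integral_mult_right_zero[symmetric]) (simp add: mult_ac)
  have "((\<lambda>R. norm c * L2 (\<lambda>\<xi>. g \<xi> - ft (trunc R f) \<xi>)) \<longlongrightarrow> norm c * 0) at_top"
    using f(2) unfolding is_fourier_iff[OF f(1)] by (intro tendsto_intros) auto
  then show ?thesis
    using f(2) L2_mult_left[of c "\<lambda>\<xi>. g \<xi> - ft (trunc _ f) \<xi>"]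
    unfolding is_fourier_iff[OF square_integrable_mult_left[OF f(1)]] is_fourier_iff[OF f(1)] e
    by (simp add: square_integrable_mult_left right_diff_distrib)
qed

lemma is_fourier_diff:
  assumes f: "square_integrable f" "is_fourier f F" and g: "square_integrable g" "is_fourier g G"
  shows "is_fourier (\<lambda>x. f x - g x) (\<lambda>\<xi>. F \<xi> - G \<xi>)"
proof -
  have e: "ft (trunc R (\<lambda>x. f x - g x)) \<xi> = ft (trunc R f) \<xi> - ft (trunc R g) \<xi>" for R \<xi>
    unfolding ft_diff[OF integrable_trunc[OF f(1)] integrable_trunc[OF g(1)], symmetric]
    by (simp add: trunc_def[abs_def] scaleR_diff_right)
  have sq: "square_integrable F" "square_integrable G" using f g by (auto dest: is_fourier_sq)
  have "((\<lambda>R. L2 (\<lambda>\<xi>. F \<xi> - ft (trunc R f) \<xi>) + L2 (\<lambda>\<xi>. G \<xi> - ft (trunc R g) \<xi>)) \<longlongrightarrow> 0 + 0) at_top"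
    using f(2) g(2) unfolding is_fourier_iff[OF f(1)] is_fourier_iff[OF g(1)] by (intro tendsto_add) auto
  then have D: "((\<lambda>R. L2 (\<lambda>\<xi>. F \<xi> - ft (trunc R f) \<xi>) + L2 (\<lambda>\<xi>. G \<xi> - ft (trunc R g) \<xi>)) \<longlongrightarrow> 0) at_top"
    by simp
  have le: "L2 (\<lambda>\<xi>. F \<xi> - G \<xi> - (ft (trunc R f) \<xi> - ft (trunc R g) \<xi>))
      \<le> L2 (\<lambda>\<xi>. F \<xi> - ft (trunc R f) \<xi>) + L2 (\<lambda>\<xi>. G \<xi> - ft (trunc R g) \<xi>)" for R
    using L2_triangle[of "\<lambda>\<xi>. F \<xi> - ft (trunc R f) \<xi>" "\<lambda>\<xi>. ft (trunc R g) \<xi> - G \<xi>"]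
    by (simp add: square_integrable_diff square_integrable_ft_trunc sq f g L2_minus_commute[of G] algebra_simps)
  have "((\<lambda>R. L2 (\<lambda>\<xi>. F \<xi> - G \<xi> - (ft (trunc R f) \<xi> - ft (trunc R g) \<xi>))) \<longlongrightarrow> 0) at_top"
    by (rule tendsto_sandwich[OF _ _ tendsto_const D]) (use le in auto)
  then show ?thesis
    unfolding is_fourier_iff[OF square_integrable_diff[OF f(1) g(1)]] e
    by (simp add: square_integrable_diff sq)
qed

text \<open>Let p be the transform of the reflected g. Paired with the indicator of an interval, the
  multiplication formula moves the transform onto the indicator, and Parseval against indicators
  returns 2 \<pi> times the integral of f. As this holds for all intervals, p is 2 \<pi> f almost
  everywhere; reflecting once more gives the claim.\<close>

theorem fourier_inversion:
  fixes f :: "real \<Rightarrow> complex"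
  assumes f: "square_integrable f" "is_fourier f g"
  shows "is_fourier g (\<lambda>x. 2 * pi * f (- x))"
proof -
  have g: "square_integrable g" using is_fourier_sq[OF f(2)] .
  have g': "square_integrable (\<lambda>\<xi>. g (- \<xi>))" by (rule square_integrable_reflect[OF g])
  obtain p where p: "is_fourier (\<lambda>\<xi>. g (- \<xi>)) p" using ex_is_fourier[OF g'] by blast
  have "AE x in lborel. p x = 2 * pi * f x"
  proof (rule AE_eq_if_integrals_eq)
    show "square_integrable p" using is_fourier_sq[OF p] .
    show "square_integrable (\<lambda>x. 2 * pi * f x)" by (rule square_integrable_mult_left[OF f(1)])
    fix a b :: real
    let ?I = "indicator {a..b} :: real \<Rightarrow> complex"
    have I: "square_integrable ?I" "is_fourier ?I (ft ?I)"
      by (auto intro: is_fourier_ft square_integrable_indicator integrable_indicator_interval)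
    have "(LINT x|lborel. p x * ?I x) = (LINT \<xi>|lborel. g (- \<xi>) * ft ?I \<xi>)"
      by (rule fourier_mult_formula[OF g' p I])
    also have "\<dots> = (LINT \<xi>|lborel. g \<xi> * ft ?I (- \<xi>))"
      by (subst lborel_integral_real_affine[of "-1" _ 0]) auto
    also have "\<dots> = (LINT \<xi>|lborel. g \<xi> * cnj (ft ?I \<xi>))"
    proof -
      have "ft ?I (- \<xi>) = cnj (ft ?I \<xi>)" for \<xi>
      proof -
        have "(\<lambda>x. cnj (?I x)) = ?I" by (auto simp: indicator_def)
        then show ?thesis using ft_cnj[of ?I "- \<xi>"] by simp
      qed
      then show ?thesis by simp
    qed
    also have "\<dots> = 2 * pi * (LINT x|lborel. f x * ?I x)" by (rule fourier_parseval_interval[OF f])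
    also have "\<dots> = (LINT x|lborel. 2 * pi * f x * ?I x)" by (simp only: mult.assoc integral_mult_right_zero)
    finally show "(LINT x|lborel. p x * ?I x) = (LINT x|lborel. 2 * pi * f x * ?I x)" .
  qed
  then have "is_fourier (\<lambda>\<xi>. g (- \<xi>)) (\<lambda>x. 2 * pi * f x)"
    using square_integrable_measurable[OF g'] square_integrable_measurable[OF square_integrable_mult_left[OF f(1), of "2 * pi"]]
    by (intro is_fourier_cong_AE[OF p g']) auto
  from is_fourier_reflect[OF g' this] show ?thesis by simp
qed

text \<open>By inversion, the conjugate of G has the transform 2 \<pi> times the conjugate of g, so
  this is an instance of the multiplication formula.\<close>

theorem fourier_parseval:
  assumes f: "square_integrable f" "is_fourier f F" and g: "square_integrable g" "is_fourier g G"
  shows "(LINT \<xi>|lborel. F \<xi> * cnj (G \<xi>)) = 2 * pi * (LINT x|lborel. f x * cnj (g x))"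
proof -
  have G: "square_integrable G" using is_fourier_sq[OF g(2)] .
  have "is_fourier (\<lambda>\<xi>. cnj (G \<xi>)) (\<lambda>x. cnj (2 * pi * g (- (- x))))"
    by (rule is_fourier_cnj[OF G fourier_inversion[OF g]])
  from fourier_mult_formula[OF f square_integrable_cnj[OF G] this]
  have "(LINT \<xi>|lborel. F \<xi> * cnj (G \<xi>)) = (LINT x|lborel. 2 * pi * (f x * cnj (g x)))"
    by (simp add: mult_ac)
  then show ?thesis by (simp only: integral_mult_right_zero)
qed

theorem fourier_plancherel:
  assumes f: "square_integrable f" "is_fourier f F"
  shows "(L2 F)\<^sup>2 = 2 * pi * (L2 f)\<^sup>2"
proof -
  have "of_real ((L2 F)\<^sup>2) = (LINT \<xi>|lborel. F \<xi> * cnj (F \<xi>))"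
    by (simp add: L2_sq complex_norm_square[symmetric] flip: integral_complex_of_real of_real_power)
  also have "\<dots> = 2 * pi * (LINT x|lborel. f x * cnj (f x))" by (rule fourier_parseval[OF f f])
  also have "(LINT x|lborel. f x * cnj (f x)) = of_real ((L2 f)\<^sup>2)"
    by (simp add: L2_sq complex_norm_square[symmetric] flip: integral_complex_of_real of_real_power)
  finally have "complex_of_real ((L2 F)\<^sup>2) = of_real (2 * pi * (L2 f)\<^sup>2)" by simp
  then show ?thesis using of_real_eq_iff by blast
qed

section \<open>Test functions\<close>

lemma C_k_continuous: "C_k k f \<Longrightarrow> continuous_on UNIV f"
  by (cases k) (auto intro!: continuous_at_imp_continuous_on dest: has_derivative_continuous)

lemma C_k_Suc_imp: "C_k (Suc k) f \<Longrightarrow> C_k k f"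
proof (induction k arbitrary: f)
  case 0
  then show ?case by (auto intro!: C_k_continuous[of "Suc 0"] simp del: C_k.simps(2))
next
  case (Suc k)
  from Suc.prems obtain f' where "\<forall>x. (f has_derivative f' x) (at x)" "\<forall>v. C_k (Suc k) (\<lambda>x. f' x v)"
    unfolding C_k.simps(2)[of "Suc k"] by blast
  then show ?case using Suc.IH unfolding C_k.simps(2)[of k] by blast
qed

lemma C_k_SucI:
  "(\<And>x. (f has_derivative f' x) (at x)) \<Longrightarrow> (\<And>v. C_k k (\<lambda>x. f' x v)) \<Longrightarrow> C_k (Suc k) f"
  unfolding C_k.simps(2) by blast

lemma C_k_SucE:
  assumes "C_k (Suc k) f"
  obtains f' where "\<And>x. (f has_derivative f' x) (at x)" "\<And>v. C_k k (\<lambda>x. f' x v)"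
  using assms unfolding C_k.simps(2) by blast

lemma C_k_const [simp]: "C_k k (\<lambda>x. c)"
  by (induction k arbitrary: c) (auto simp del: C_k.simps(2) intro!: C_k_SucI[where f'="\<lambda>x v. 0"] simp: C_k.simps(1))

lemma C_k_add: "C_k k f \<Longrightarrow> C_k k g \<Longrightarrow> C_k k (\<lambda>x. f x + g x)"
proof (induction k arbitrary: f g)
  case 0 then show ?case by (auto intro: continuous_intros)
next
  case (Suc k)
  obtain f' g' where "\<And>x. (f has_derivative f' x) (at x)" "\<And>v. C_k k (\<lambda>x. f' x v)"
    "\<And>x. (g has_derivative g' x) (at x)" "\<And>v. C_k k (\<lambda>x. g' x v)"
    using Suc.prems by (elim C_k_SucE) blast
  then show ?case
    by (intro C_k_SucI[where f'="\<lambda>x v. f' x v + g' x v"] has_derivative_add Suc.IH)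
qed

lemma C_k_mult: "C_k k f \<Longrightarrow> C_k k g \<Longrightarrow> C_k k (\<lambda>x. f x * g x)"
proof (induction k arbitrary: f g)
  case 0 then show ?case by (auto intro: continuous_intros)
next
  case (Suc k)
  obtain f' g' where d: "\<And>x. (f has_derivative f' x) (at x)" "\<And>v. C_k k (\<lambda>x. f' x v)"
    "\<And>x. (g has_derivative g' x) (at x)" "\<And>v. C_k k (\<lambda>x. g' x v)"
    using Suc.prems by (elim C_k_SucE) blast
  show ?case
    by (intro C_k_SucI[where f'="\<lambda>x v. f x * g' x v + f' x v * g x"] has_derivative_mult d C_k_add Suc.IH
        C_k_Suc_imp[OF Suc.prems(1)] C_k_Suc_imp[OF Suc.prems(2)])
qed

text \<open>Domain and codomain of L may differ: the lemma serves the coordinate projections of the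
  plane, needed for products of test functions, as well as the dilations and reflections of the
  line.\<close>

lemma C_k_compose_affine:
  fixes L :: "'a::euclidean_space \<Rightarrow> 'b::euclidean_space"
  assumes L: "bounded_linear L"
  shows "C_k k g \<Longrightarrow> C_k k (\<lambda>x. g (L x + c))"
proof (induction k arbitrary: g)
  case 0
  have "continuous_on UNIV (\<lambda>x. L x + c)"
    by (intro continuous_intros linear_continuous_on[OF L])
  then show ?case
    using 0 continuous_on_compose2[of UNIV g UNIV "\<lambda>x. L x + c"] by auto
next
  case (Suc k)
  obtain g' where d: "\<And>x. (g has_derivative g' x) (at x)" "\<And>v. C_k k (\<lambda>x. g' x v)"
    using Suc.prems by (elim C_k_SucE) blast
  have a: "((\<lambda>x. L x + c) has_derivative L) (at x)" for x
    using has_derivative_add[OF bounded_linear_imp_has_derivative[OF L] has_derivative_const[of c]] by simp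
  show ?case
  proof (rule C_k_SucI[where f'="\<lambda>x v. g' (L x + c) (L v)"])
    show "((\<lambda>x. g (L x + c)) has_derivative (\<lambda>v. g' (L x + c) (L v))) (at x)" for x
      using diff_chain_at[OF a d(1)] by (simp add: o_def)
    show "C_k k (\<lambda>x. g' (L x + c) (L v))" for v
      using Suc.IH[OF d(2)[of "L v"]] .
  qed
qed

lemma C_k_Suc_real:
  fixes f D :: "real \<Rightarrow> real"
  assumes "\<And>x. (f has_real_derivative D x) (at x)" "C_k k D"
  shows "C_k (Suc k) f"
  using assms C_k_mult[OF assms(2) C_k_const]
  by (intro C_k_SucI[where f'="\<lambda>x v. D x * v"]) (auto simp: has_field_derivative_def)

lemma C_k_deriv:
  fixes f :: "real \<Rightarrow> real"
  assumes "C_k (Suc k) f"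
  shows "(f has_real_derivative deriv f x) (at x)" "C_k k (deriv f)"
proof -
  obtain f' where d: "\<And>x. (f has_derivative f' x) (at x)" "\<And>v. C_k k (\<lambda>x. f' x v)"
    using assms by (elim C_k_SucE) blast
  have *: "(f has_real_derivative f' x 1) (at x)" for x
  proof -
    have "f' x h = f' x 1 * h" for h
      using linear_cmul[OF has_derivative_linear[OF d(1)[of x]], of h 1] by (simp only: real_scaleR_def mult_1_right mult.commute[of h])
    then have "f' x = (\<lambda>h. f' x 1 * h)" by (rule ext)
    then show ?thesis using d(1)[of x] unfolding has_field_derivative_def by (simp only:)
  qed
  have "deriv f = (\<lambda>x. f' x 1)" using DERIV_imp_deriv[OF *] by (rule ext)
  then show "(f has_real_derivative deriv f x) (at x)" "C_k k (deriv f)" using * d(2) by auto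
qed

text \<open>The span of cosine and sine at a fixed frequency is closed under differentiation, so the
  induction runs over arbitrary coefficients.\<close>

lemma C_k_trig:
  fixes \<xi> c d :: real
  shows "C_k k (\<lambda>x. c * cos (x * \<xi>) + d * sin (x * \<xi>))"
proof (induction k arbitrary: c d)
  case 0 then show ?case by (auto intro!: continuous_intros)
next
  case (Suc k)
  show ?case
  proof (rule C_k_Suc_real)
    show "((\<lambda>x. c * cos (x * \<xi>) + d * sin (x * \<xi>)) has_real_derivative ((d * \<xi>) * cos (x * \<xi>) + (- c * \<xi>) * sin (x * \<xi>))) (at x)" for x
      by (auto intro!: derivative_eq_intros)
    show "C_k k (\<lambda>x. (d * \<xi>) * cos (x * \<xi>) + (- c * \<xi>) * sin (x * \<xi>))" by (rule Suc.IH)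
  qed
qed

section \<open>Smooth cut-offs with explicit flanks\<close>

definition flat :: "nat \<Rightarrow> real \<Rightarrow> real"
  where "flat n x = (if x > 0 then (1 / x) ^ n * exp (- 1 / x) else 0)"

lemma flat_nonneg: "0 \<le> flat n x"
  by (simp add: flat_def)

lemma flat_0_le_1: "flat 0 x \<le> 1"
  by (simp add: flat_def)

lemma flat_eq_0: "x \<le> 0 \<Longrightarrow> flat n x = 0"
  by (simp add: flat_def)

lemma flat_tendsto_0: "(flat n \<longlongrightarrow> 0) (at_right 0)"
proof -
  have "((\<lambda>x::real. x ^ n / exp x) \<longlongrightarrow> 0) at_top" by (rule tendsto_power_div_exp_0)
  then have "((\<lambda>x. (inverse x) ^ n / exp (inverse x)) \<longlongrightarrow> 0) (at_right (0::real))"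
    by (rule filterlim_compose[OF _ filterlim_inverse_at_top_right])
  then show ?thesis
    by (rule Lim_transform_eventually)
      (auto simp: flat_def eventually_at_filter exp_minus divide_inverse)
qed

lemma flat_DERIV: "(flat n has_real_derivative flat (n + 2) x - real n * flat (n + 1) x) (at x)"
proof -
  consider "x > 0" | "x < 0" | "x = 0" by linarith
  then show ?thesis
  proof cases
    case 1
    have F: "((\<lambda>y. y ^ n * exp (- y)) has_real_derivative (real n * y ^ (n - 1) - y ^ n) * exp (- y)) (at y)" for y :: real
      by (auto intro!: derivative_eq_intros simp: algebra_simps)
    have "((\<lambda>x. inverse x) has_real_derivative - (inverse x)\<^sup>2) (at x)"
      using DERIV_inverse[of x UNIV] 1 by (simp add: power2_eq_square)
    from DERIV_chain2[OF F this]
    have "((\<lambda>x. inverse x ^ n * exp (- inverse x)) has_real_derivative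
        (real n * inverse x ^ (n - 1) - inverse x ^ n) * exp (- inverse x) * - (inverse x)\<^sup>2) (at x)" .
    also have "(real n * inverse x ^ (n - 1) - inverse x ^ n) * exp (- inverse x) * - (inverse x)\<^sup>2 = flat (n + 2) x - real n * flat (n + 1) x"
      using 1 by (cases n) (simp_all add: flat_def inverse_eq_divide power2_eq_square algebra_simps add_divide_distrib)
    finally have "((\<lambda>x. (1 / x) ^ n * exp (- 1 / x)) has_real_derivative flat (n + 2) x - real n * flat (n + 1) x) (at x)"
      by (simp add: inverse_eq_divide)
    then show ?thesis
      by (rule DERIV_cong_ev[THEN iffD1, rotated -1, OF _ refl _ refl])
         (use eventually_gt_at_top eventually_nhds_in_open[of "{0<..}" x] 1 in \<open>auto simp: flat_def elim!: eventually_mono\<close>)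
  next
    case 2
    have "((\<lambda>x. 0) has_real_derivative flat (n + 2) x - real n * flat (n + 1) x) (at x)"
      using 2 by (simp add: flat_def)
    then show ?thesis
      by (rule DERIV_cong_ev[THEN iffD1, rotated -1, OF _ refl _ refl])
         (use eventually_nhds_in_open[of "{..<0}" x] 2 in \<open>auto simp: flat_def elim!: eventually_mono\<close>)
  next
    case 3
    \<comment> \<open>From the right the difference quotient is \<open>flat (Suc n)\<close>, which
      tends to 0; from the left it vanishes.\<close>
    have "((\<lambda>h. (flat n (0 + h) - flat n 0) / h) \<longlongrightarrow> 0) (at 0)"
    proof (rule filterlim_split_at)
      show "((\<lambda>h. (flat n (0 + h) - flat n 0) / h) \<longlongrightarrow> 0) (at_left 0)"
        by (rule tendsto_eventually) (auto simp: flat_def eventually_at_filter)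
      show "((\<lambda>h. (flat n (0 + h) - flat n 0) / h) \<longlongrightarrow> 0) (at_right 0)"
        by (rule Lim_transform_eventually[OF flat_tendsto_0[of "Suc n"]]) (auto simp: flat_def eventually_at_filter)
    qed
    then show ?thesis using 3 by (simp add: DERIV_def flat_def)
  qed
qed

text \<open>The derivative of \<open>flat n\<close> is a combination of \<open>flat (n + 1)\<close>
  and \<open>flat (n + 2)\<close>, so the induction runs over all n at once. The powers of 1 / x in
  \<open>flat\<close> are there for this closure.\<close>

lemma C_k_flat: "C_k k (flat n)"
proof (induction k arbitrary: n)
  case 0
  have "continuous_on UNIV (flat n)"
    by (intro continuous_at_imp_continuous_on ballI DERIV_isCont[OF flat_DERIV])
  then show ?case by simp
next
  case (Suc k)
  show ?case
  proof (rule C_k_Suc_real[OF flat_DERIV])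
    have "C_k k (\<lambda>x. flat (n + 2) x + (- real n) * flat (n + 1) x)"
      by (intro C_k_add C_k_mult C_k_const Suc.IH)
    then show "C_k k (\<lambda>x. flat (n + 2) x - real n * flat (n + 1) x)" by simp
  qed
qed

lemma borel_measurable_flat [measurable]: "flat n \<in> borel_measurable borel"
  using C_k_continuous[OF C_k_flat] by (rule borel_measurable_continuous_onI)

lemma test_functionI:
  assumes "\<And>k. C_k k \<phi>" "compact K" "\<And>x. \<phi> x \<noteq> 0 \<Longrightarrow> x \<in> K" "K \<subseteq> \<Omega>"
  shows "test_function \<Omega> \<phi>"
proof -
  have "closure {x. \<phi> x \<noteq> 0} \<subseteq> K"
    using assms by (intro closure_minimal compact_imp_closed) auto
  then have "compact (closure {x. \<phi> x \<noteq> 0})"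
    using assms(2) by (metis closed_closure compact_closure bounded_subset compact_imp_bounded compact_eq_bounded_closed)
  with assms \<open>closure _ \<subseteq> K\<close> show ?thesis unfolding test_function_def by blast
qed

text \<open>A product of a rising and a falling smooth step. The parameter m is the steepness: for
  growing m the values tend to 1 inside (a, b), and the derivative concentrates at the two end
  points.\<close>

definition plateau :: "real \<Rightarrow> real \<Rightarrow> real \<Rightarrow> real \<Rightarrow> real"
  where "plateau m a b x = flat 0 (m * (x - a)) * flat 0 (m * (b - x))"

lemma plateau_bounds: "0 \<le> plateau m a b x" "plateau m a b x \<le> 1"
  by (auto simp: plateau_def flat_nonneg flat_0_le_1 intro!: mult_le_one)

lemma plateau_support: "m > 0 \<Longrightarrow> plateau m a b x \<noteq> 0 \<Longrightarrow> a < x \<and> x < b"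
  by (auto simp: plateau_def flat_def mult_less_0_iff zero_less_mult_iff split: if_splits)

lemma C_k_plateau: "C_k k (plateau m a b)"
proof -
  have 1: "C_k k (\<lambda>x. flat 0 (m * x + (- m * a)))"
    by (rule C_k_compose_affine[OF bounded_linear_mult_right C_k_flat])
  have 2: "C_k k (\<lambda>x. flat 0 ((- m) * x + m * b))"
    by (rule C_k_compose_affine[OF bounded_linear_mult_right C_k_flat])
  show ?thesis using C_k_mult[OF 1 2] by (simp add: plateau_def[abs_def] algebra_simps)
qed

lemma test_function_plateau: "m > 0 \<Longrightarrow> {a..b} \<subseteq> \<Omega> \<Longrightarrow> test_function \<Omega> (plateau m a b)"
  by (rule test_functionI[OF C_k_plateau, of "{a..b}"]) (auto dest: plateau_support)

lemma flat_scaled_tendsto: "x > 0 \<Longrightarrow> (\<lambda>n. flat 0 (real (Suc n) * x)) \<longlonglongrightarrow> 1"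
proof -
  assume x: "x > 0"
  have "(\<lambda>n. exp (- (inverse (real (Suc n)) * (1 / x)))) \<longlonglongrightarrow> exp (- (0 * (1 / x)))"
    by (intro tendsto_intros LIMSEQ_inverse_real_of_nat)
  moreover have "flat 0 (real (Suc n) * x) = exp (- (inverse (real (Suc n)) * (1 / x)))" for n
    using x by (simp add: flat_def inverse_eq_divide)
  ultimately show ?thesis by simp
qed

lemma plateau_tendsto:
  assumes "x \<noteq> a" "x \<noteq> b"
  shows "(\<lambda>n. plateau (real (Suc n)) a b x) \<longlonglongrightarrow> indicator {a..b} x"
proof (cases "a < x \<and> x < b")
  case True
  then have "(\<lambda>n. flat 0 (real (Suc n) * (x - a)) * flat 0 (real (Suc n) * (b - x))) \<longlonglongrightarrow> 1 * 1"
    by (intro tendsto_mult flat_scaled_tendsto) auto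
  then show ?thesis using True by (simp add: plateau_def)
next
  case False
  then have "plateau (real (Suc n)) a b x = 0" for n using plateau_support[of "real (Suc n)" a b x] by auto
  then show ?thesis using False assms by (auto simp: indicator_def)
qed

lemma borel_measurable_plateau [measurable]: "plateau m a b \<in> borel_measurable borel"
  using C_k_continuous[OF C_k_plateau] by (rule borel_measurable_continuous_onI)

text \<open>Steepening plateaus stay below the indicator of [a, b] and tend to it off the end
  points; dominated convergence carries the hypothesis over to integrals on intervals.\<close>

lemma fundamental_lemma:
  fixes g :: "real \<Rightarrow> real"
  assumes i: "\<And>a b. set_integrable lborel {a..b} g"
    and z: "\<And>\<phi>. test_function UNIV \<phi> \<Longrightarrow> (LINT x|lborel. g x * \<phi> x) = 0"
  shows "AE x in lborel. g x = 0"
proof (rule AE_zero_if_integrals_zero[OF i])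
  fix a b :: real
  have [measurable]: "g \<in> borel_measurable borel" by (rule locally_integrable_measurable[OF i])
  have "(\<lambda>n. LINT x|lborel. g x * plateau (real (Suc n)) a b x) \<longlonglongrightarrow> (LINT x|lborel. indicator {a..b} x *\<^sub>R g x)"
  proof (rule integral_dominated_convergence)
    show "integrable lborel (\<lambda>x. norm (indicator {a..b} x *\<^sub>R g x))"
      using i[of a b] unfolding set_integrable_def by (rule integrable_norm)
    have "AE x in lborel. x \<noteq> a" "AE x in lborel. x \<noteq> b" by (auto intro: AE_lborel_singleton)
    then show "AE x in lborel. (\<lambda>n. g x * plateau (real (Suc n)) a b x) \<longlonglongrightarrow> indicator {a..b} x *\<^sub>R g x"
    proof eventually_elim
      case (elim x)
      from tendsto_mult[OF tendsto_const plateau_tendsto[OF elim], of "g x"] show ?case by (simp add: mult.commute)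
    qed
    show "AE x in lborel. norm (g x * plateau (real (Suc n)) a b x) \<le> norm (indicator {a..b} x *\<^sub>R g x)" for n
    proof (rule AE_I2)
      fix x
      show "norm (g x * plateau (real (Suc n)) a b x) \<le> norm (indicator {a..b} x *\<^sub>R g x)"
        using plateau_support[of "real (Suc n)" a b x] plateau_bounds[of "real (Suc n)" a b x]
        by (cases "plateau (real (Suc n)) a b x = 0") (auto simp: abs_mult indicator_def mult_left_le)
    qed
  qed simp_all
  moreover have "(LINT x|lborel. g x * plateau (real (Suc n)) a b x) = 0" for n
    by (intro z test_function_plateau) auto
  ultimately show "(LINT x:{a..b}|lborel. g x) = 0"
    unfolding set_lebesgue_integral_def by (simp add: LIMSEQ_const_iff)
qed

lemma test_function_prod:
  fixes \<theta> \<psi> :: "real \<Rightarrow> real"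
  assumes "test_function J \<theta>" "test_function UNIV \<psi>"
  shows "test_function (J \<times> UNIV) (\<lambda>p. \<theta> (fst p) * \<psi> (snd p))"
proof (rule test_functionI)
  let ?A = "closure {x. \<theta> x \<noteq> 0}" and ?B = "closure {x. \<psi> x \<noteq> 0}"
  show "C_k k (\<lambda>p. \<theta> (fst p) * \<psi> (snd p))" for k
    using C_k_compose_affine[OF bounded_linear_fst, of k \<theta> 0] C_k_compose_affine[OF bounded_linear_snd, of k \<psi> 0] assms
    by (intro C_k_mult) (auto simp: test_function_def)
  show "compact (?A \<times> ?B)" using assms by (intro compact_Times) (auto simp: test_function_def)
  show "?A \<times> ?B \<subseteq> J \<times> UNIV" using assms by (auto simp: test_function_def)
  show "p \<in> ?A \<times> ?B" if "\<theta> (fst p) * \<psi> (snd p) \<noteq> 0" for p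
    using that closure_subset[of "{x. \<theta> x \<noteq> 0}"] closure_subset[of "{x. \<psi> x \<noteq> 0}"] by (cases p) auto
qed

lemma test_function_bounded_support:
  fixes \<psi> :: "real \<Rightarrow> real"
  assumes "test_function UNIV \<psi>"
  obtains R where "R > 0" "\<And>x. \<bar>x\<bar> \<ge> R \<Longrightarrow> \<psi> x = 0"
proof -
  have "bounded {x. \<psi> x \<noteq> 0}"
    using assms unfolding test_function_def by (meson bounded_closure_image bounded_subset closure_subset compact_imp_bounded)
  then obtain B where B: "\<And>x. \<psi> x \<noteq> 0 \<Longrightarrow> \<bar>x\<bar> \<le> B" by (auto simp: bounded_iff)
  then show thesis
    by (intro that[of "\<bar>B\<bar> + 1"]) force+
qed

text \<open>\<open>flat 2\<close> is the derivative of \<open>flat 0\<close>, which climbs from 0 to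
  1 on the half-line. Its rescalings are thus a one-sided approximate identity, which is what the
  flank of a plateau becomes.\<close>

lemma flat_mass:
  "integrable lborel (flat 2)" "(LINT x|lborel. flat 2 x) = 1"
proof -
  have D: "DERIV (flat 0) x :> flat 2 x" for x
    using flat_DERIV[of 0 x] by (simp add: numeral_2_eq_2)
  have "((\<lambda>x. exp (- inverse x)) \<longlongrightarrow> exp (- 0)) (at_top :: real filter)"
    by (intro tendsto_intros tendsto_inverse_0_at_top filterlim_ident)
  then have "((\<lambda>x. exp (- inverse x)) \<longlongrightarrow> 1) (at_top :: real filter)" by simp
  then have "(flat 0 \<longlongrightarrow> 1) at_top"
    by (rule Lim_transform_eventually)
      (use eventually_gt_at_top[of 0] in \<open>auto simp: flat_def inverse_eq_divide elim!: eventually_mono\<close>)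
  then have "(\<integral>\<^sup>+x. ennreal (flat 2 x) * indicator {0..} x \<partial>lborel) = ennreal (1 - flat 0 0)"
    by (intro nn_integral_FTC_atLeast D flat_nonneg borel_measurable_flat)
  moreover have "ennreal (flat 2 x) * indicator {0..} x = ennreal (flat 2 x)" for x
    by (auto simp: flat_def indicator_def)
  ultimately have "(\<integral>\<^sup>+x. ennreal (flat 2 x) \<partial>lborel) = ennreal 1" by (simp add: flat_eq_0)
  then have "has_bochner_integral lborel (flat 2) 1"
    by (intro has_bochner_integral_nn_integral) (auto simp: flat_nonneg)
  then show "integrable lborel (flat 2)" "(LINT x|lborel. flat 2 x) = 1"
    by (auto simp: has_bochner_integral_iff)
qed

text \<open>The substitution x = a + y / (n + 1) turns the flank into \<open>flat 2 y\<close>, of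
  mass 1, while the argument of A tends to a and the other step of the plateau tends to 1.\<close>

lemma plateau_flank:
  fixes A :: "real \<Rightarrow> real"
  assumes ab: "a < b" and A: "continuous_on {a..b} A"
  shows "(\<lambda>n. LINT x:{a..b}|lborel. A x * (real (Suc n) * flat 2 (real (Suc n) * (x - a)) * flat 0 (real (Suc n) * (b - x)))) \<longlonglongrightarrow> A a"
proof -
  \<comment> \<open>Extension by zero, so that the substitution can be made on the whole
    line.\<close>
  define A' where "A' x = indicator {a..b} x * A x" for x
  have A'm [measurable]: "A' \<in> borel_measurable borel"
    using borel_measurable_continuous_on_indicator[OF _ A] unfolding A'_def[abs_def] by simp
  obtain C where C: "\<forall>x\<in>{a..b}. \<bar>A x\<bar> \<le> C"
    using compact_continuous_image[OF A compact_Icc] by (auto dest!: compact_imp_bounded simp: bounded_iff)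
  have A'C: "\<bar>A' x\<bar> \<le> \<bar>C\<bar>" for x using bspec[OF C, of x] by (auto simp: A'_def indicator_def)
  define q where "q n y = A' (a + y / real (Suc n)) * (flat 2 y * flat 0 (real (Suc n) * (b - a) - y))" for n y
  have "(\<lambda>n. LINT y|lborel. q n y) \<longlonglongrightarrow> (LINT y|lborel. A a * flat 2 y)"
  proof (rule integral_dominated_convergence[where w="\<lambda>y. \<bar>C\<bar> * flat 2 y"])
    show "integrable lborel (\<lambda>y. \<bar>C\<bar> * flat 2 y)" using flat_mass(1) by simp
    show "AE y in lborel. norm (q n y) \<le> \<bar>C\<bar> * flat 2 y" for n
      unfolding q_def using flat_nonneg flat_0_le_1
      by (intro AE_I2) (auto simp: abs_mult abs_of_nonneg simp del: of_nat_Suc intro!: mult_mono A'C mult_left_le)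
    show "AE y in lborel. (\<lambda>n. q n y) \<longlonglongrightarrow> A a * flat 2 y"
    proof (rule AE_I2)
      fix y :: real
      show "(\<lambda>n. q n y) \<longlonglongrightarrow> A a * flat 2 y"
      proof (cases "y > 0")
        case True
        have l: "(\<lambda>n. a + y / real (Suc n)) \<longlonglongrightarrow> a"
        proof -
          have "(\<lambda>n. a + y * inverse (real (Suc n))) \<longlonglongrightarrow> a + y * 0"
            by (intro tendsto_intros LIMSEQ_inverse_real_of_nat)
          then show ?thesis by (simp add: divide_inverse)
        qed
        have ev: "\<forall>\<^sub>F n in sequentially. a + y / real (Suc n) \<in> {a..b}"
          using order_tendstoD(2)[OF l ab] by eventually_elim (use True in \<open>auto simp del: of_nat_Suc\<close>)
        have "(\<lambda>n. A (a + y / real (Suc n))) \<longlonglongrightarrow> A a"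
          by (rule continuous_on_tendsto_compose[OF A l _ ev]) (use ab in auto)
        then have 1: "(\<lambda>n. A' (a + y / real (Suc n))) \<longlonglongrightarrow> A a"
          by (rule Lim_transform_eventually) (use ev in \<open>auto simp: A'_def elim!: eventually_mono\<close>)
        have "filterlim (\<lambda>n. - y + (b - a) * real (Suc n)) at_top sequentially"
          using ab by (intro filterlim_tendsto_add_at_top[OF tendsto_const] filterlim_tendsto_pos_mult_at_top[OF tendsto_const])
            (use filterlim_compose[OF filterlim_real_sequentially filterlim_Suc] in \<open>auto simp del: of_nat_Suc\<close>)
        then have t: "filterlim (\<lambda>n. real (Suc n) * (b - a) - y) at_top sequentially" by (simp add: mult.commute)
        have "(\<lambda>n. exp (- inverse (real (Suc n) * (b - a) - y))) \<longlonglongrightarrow> exp (- 0)"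
          by (intro tendsto_intros tendsto_inverse_0_at_top t)
        then have "(\<lambda>n. exp (- inverse (real (Suc n) * (b - a) - y))) \<longlonglongrightarrow> 1"
          by (simp only: minus_zero exp_zero)
        then have 2: "(\<lambda>n. flat 0 (real (Suc n) * (b - a) - y)) \<longlonglongrightarrow> 1"
        proof (rule Lim_transform_eventually)
          have "\<forall>\<^sub>F n in sequentially. real (Suc n) * (b - a) - y > 0"
            using t unfolding filterlim_at_top_dense by blast
          then show "\<forall>\<^sub>F n in sequentially. exp (- inverse (real (Suc n) * (b - a) - y)) = flat 0 (real (Suc n) * (b - a) - y)"
            by eventually_elim (simp add: flat_def inverse_eq_divide del: of_nat_Suc)
        qed
        show ?thesis unfolding q_def using tendsto_mult[OF 1 tendsto_mult[OF tendsto_const[of "flat 2 y"] 2]] by simp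
      qed (simp add: q_def flat_eq_0)
    qed
  qed (simp_all add: q_def[abs_def])
  moreover have "(LINT y|lborel. A a * flat 2 y) = A a" using flat_mass(2) by simp
  moreover have "(LINT x:{a..b}|lborel. A x * (real (Suc n) * flat 2 (real (Suc n) * (x - a)) * flat 0 (real (Suc n) * (b - x))))
      = (LINT y|lborel. q n y)" for n
  proof -
    define m where "m = real (Suc n)"
    have m: "m > 0" by (simp add: m_def)
    have "(LINT x:{a..b}|lborel. A x * (m * flat 2 (m * (x - a)) * flat 0 (m * (b - x))))
       = (LINT x|lborel. A' x * (m * flat 2 (m * (x - a)) * flat 0 (m * (b - x))))"
      unfolding set_lebesgue_integral_def by (intro Bochner_Integration.integral_cong) (auto simp: A'_def)
    also have "\<dots> = \<bar>1 / m\<bar> *\<^sub>R (LINT y|lborel. A' (a + 1 / m * y) * (m * flat 2 (m * ((a + 1 / m * y) - a)) * flat 0 (m * (b - (a + 1 / m * y)))))"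
      using m by (intro lborel_integral_real_affine) simp
    also have "\<dots> = (LINT y|lborel. 1 / m * (A' (a + 1 / m * y) * (m * flat 2 (m * ((a + 1 / m * y) - a)) * flat 0 (m * (b - (a + 1 / m * y))))))"
      using m by (subst integral_mult_right_zero) simp
    also have "\<dots> = (LINT y|lborel. q n y)"
    proof (rule Bochner_Integration.integral_cong[OF refl])
      fix y
      have e: "m * ((a + 1 / m * y) - a) = y" "m * (b - (a + 1 / m * y)) = m * (b - a) - y"
        using m by (auto simp: field_simps)
      show "1 / m * (A' (a + 1 / m * y) * (m * flat 2 (m * ((a + 1 / m * y) - a)) * flat 0 (m * (b - (a + 1 / m * y))))) = q n y"
        unfolding e q_def m_def[symmetric] using m by simp
    qed
    finally show ?thesis unfolding m_def .
  qed
  ultimately show ?thesis by (simp add: flat_mass)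
qed

text \<open>The test functions are plateaus over \<open>[r, t]\<close> whose flanks steepen to jumps at \<open>r\<close> and \<open>t\<close>.\<close>

lemma weak_ode:
  fixes A B :: "real \<Rightarrow> real"
  assumes A: "continuous_on {0<..<T} A" and B: "continuous_on {0<..<T} B"
    and weak: "\<And>\<theta>. test_function {0<..<T} \<theta> \<Longrightarrow> (LINT t:{0<..<T}|lborel. - A t * deriv \<theta> t + B t * \<theta> t) = 0"
    and r: "0 < r" "r < t" "t < T"
  shows "A t - A r = - (LINT x:{r..t}|lborel. B x)"
proof -
  have sub: "{r..t} \<subseteq> {0<..<T}" using r by auto
  have Ac: "continuous_on {r..t} A" and Bc: "continuous_on {r..t} B"
    using A B sub by (auto intro: continuous_on_subset)
  \<comment> \<open>The derivative of the plateau is \<open>L n - R n\<close>: a bump concentrating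
    at r minus one concentrating at t.\<close>
  define L where "L n x = real (Suc n) * flat 2 (real (Suc n) * (x - r)) * flat 0 (real (Suc n) * (t - x))" for n x
  define R where "R n x = real (Suc n) * flat 2 (real (Suc n) * (t - x)) * flat 0 (real (Suc n) * (x - r))" for n x
  have LRc: "continuous_on UNIV (L n)" "continuous_on UNIV (R n)" for n
  proof -
    have c: "continuous_on UNIV (\<lambda>x. flat k (g x))" if "continuous_on UNIV g" for k and g :: "real \<Rightarrow> real"
      using continuous_on_compose2[OF C_k_continuous[OF C_k_flat[of 0 k]] that] by simp
    show "continuous_on UNIV (L n)" "continuous_on UNIV (R n)"
      unfolding L_def[abs_def] R_def[abs_def] by (intro continuous_intros c)+
  qed
  have D: "(plateau (real (Suc n)) r t has_real_derivative L n x - R n x) (at x)" for n x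
  proof -
    have f0: "(flat 0 has_real_derivative flat 2 y) (at y)" for y
      using flat_DERIV[of 0 y] by (simp add: numeral_2_eq_2)
    have 1: "((\<lambda>x. flat 0 (m * (x - r))) has_real_derivative flat 2 (m * (x - r)) * m) (at x)" for m
      by (rule DERIV_chain2[OF f0]) (auto intro!: derivative_eq_intros)
    have 2: "((\<lambda>x. flat 0 (m * (t - x))) has_real_derivative flat 2 (m * (t - x)) * (- m)) (at x)" for m
      by (rule DERIV_chain2[OF f0]) (auto intro!: derivative_eq_intros)
    from DERIV_mult[OF 1 2] show ?thesis
      unfolding plateau_def[abs_def] L_def R_def by (rule DERIV_cong) (simp add: algebra_simps)
  qed
  have z: "L n x = 0" "R n x = 0" "plateau (real (Suc n)) r t x = 0" if "x \<notin> {r..t}" for n x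
  proof -
    have "x - r \<le> 0 \<or> t - x \<le> 0" using that by auto
    then have "real (Suc n) * (x - r) \<le> 0 \<or> real (Suc n) * (t - x) \<le> 0"
      by (metis mult_nonneg_nonpos of_nat_0_le_iff)
    then show "L n x = 0" "R n x = 0" "plateau (real (Suc n)) r t x = 0"
      by (auto simp: L_def R_def plateau_def flat_eq_0 simp del: of_nat_Suc)
  qed
  have eq: "(LINT x:{r..t}|lborel. A x * L n x) - (LINT x:{r..t}|lborel. A x * R n x)
      = (LINT x:{r..t}|lborel. B x * plateau (real (Suc n)) r t x)" for n
  proof -
    have i: "set_integrable lborel {r..t} (\<lambda>x. A x * L n x)" "set_integrable lborel {r..t} (\<lambda>x. A x * R n x)"
      "set_integrable lborel {r..t} (\<lambda>x. B x * plateau (real (Suc n)) r t x)"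
      by (intro borel_integrable_atLeastAtMost' continuous_on_mult Ac Bc
          continuous_on_subset[OF LRc(1) subset_UNIV] continuous_on_subset[OF LRc(2) subset_UNIV]
          continuous_on_subset[OF C_k_continuous[OF C_k_plateau[of 0]] subset_UNIV])+
    have "0 = (LINT x:{0<..<T}|lborel. - A x * deriv (plateau (real (Suc n)) r t) x + B x * plateau (real (Suc n)) r t x)"
      by (rule weak[symmetric], rule test_function_plateau) (use sub in auto)
    also have "\<dots> = (LINT x:{r..t}|lborel. - (A x * L n x) + A x * R n x + B x * plateau (real (Suc n)) r t x)"
      unfolding set_lebesgue_integral_def DERIV_imp_deriv[OF D]
    proof (rule Bochner_Integration.integral_cong[OF refl])
      fix x
      show "indicator {0<..<T} x *\<^sub>R (- A x * (L n x - R n x) + B x * plateau (real (Suc n)) r t x)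
          = indicator {r..t} x *\<^sub>R (- (A x * L n x) + A x * R n x + B x * plateau (real (Suc n)) r t x)"
        using z[of x n] sub by (cases "x \<in> {r..t}") (auto simp: algebra_simps indicator_def)
    qed
    also have "\<dots> = - (LINT x:{r..t}|lborel. A x * L n x) + (LINT x:{r..t}|lborel. A x * R n x)
        + (LINT x:{r..t}|lborel. B x * plateau (real (Suc n)) r t x)"
      using i by (simp add: set_integral_add set_integral_uminus)
    finally show ?thesis by simp
  qed
  have 1: "(\<lambda>n. LINT x:{r..t}|lborel. A x * L n x) \<longlonglongrightarrow> A r"
    unfolding L_def by (rule plateau_flank[OF r(2) Ac])
  \<comment> \<open>The right flank is the mirror image of the left one under x \<mapsto> r + t - x,
    so the same limit lemma applies.\<close>
  have 2: "(\<lambda>n. LINT x:{r..t}|lborel. A x * R n x) \<longlonglongrightarrow> A t"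
  proof -
    have "continuous_on {r..t} (\<lambda>x. A (r + t - x))"
      by (rule continuous_on_compose2[OF Ac]) (auto intro!: continuous_intros)
    from plateau_flank[OF r(2) this]
    have "(\<lambda>n. LINT x:{r..t}|lborel. A (r + t - x) * L n x) \<longlonglongrightarrow> A t" by (simp add: L_def)
    moreover have "(LINT x:{r..t}|lborel. A x * R n x) = (LINT x:{r..t}|lborel. A (r + t - x) * L n x)" for n
    proof -
      have "(LINT x:{r..t}|lborel. A x * R n x) = (LINT x|lborel. indicator {r..t} ((r + t) + (-1) * x) *\<^sub>R (A ((r + t) + (-1) * x) * R n ((r + t) + (-1) * x)))"
        unfolding set_lebesgue_integral_def by (subst lborel_integral_real_affine[of "-1" _ "r + t"]) auto
      also have "\<dots> = (LINT x:{r..t}|lborel. A (r + t - x) * L n x)"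
        unfolding set_lebesgue_integral_def
        by (intro Bochner_Integration.integral_cong) (auto simp: L_def R_def indicator_def algebra_simps)
      finally show ?thesis .
    qed
    ultimately show ?thesis by simp
  qed
  have 3: "(\<lambda>n. LINT x:{r..t}|lborel. B x * plateau (real (Suc n)) r t x) \<longlonglongrightarrow> (LINT x:{r..t}|lborel. B x)"
    unfolding set_lebesgue_integral_def
  proof (rule integral_dominated_convergence[where w="\<lambda>x. norm (indicator {r..t} x *\<^sub>R B x)"])
    have Bi: "integrable lborel (\<lambda>x. indicator {r..t} x *\<^sub>R B x)"
      using borel_integrable_atLeastAtMost'[OF Bc] by (simp add: set_integrable_def)
    then show "integrable lborel (\<lambda>x. norm (indicator {r..t} x *\<^sub>R B x))" by (rule integrable_norm)
    show "(\<lambda>x. indicator {r..t} x *\<^sub>R B x) \<in> borel_measurable lborel" using Bi by auto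
    have "(\<lambda>x. (indicator {r..t} x *\<^sub>R B x) * plateau (real (Suc n)) r t x) \<in> borel_measurable lborel" for n
      using borel_measurable_integrable[OF Bi] by simp
    then show "(\<lambda>x. indicator {r..t} x *\<^sub>R (B x * plateau (real (Suc n)) r t x)) \<in> borel_measurable lborel" for n
      by (simp add: mult.assoc)
    have "AE x in lborel. x \<noteq> r" "AE x in lborel. x \<noteq> t" by (auto intro: AE_lborel_singleton)
    then show "AE x in lborel. (\<lambda>n. indicator {r..t} x *\<^sub>R (B x * plateau (real (Suc n)) r t x)) \<longlonglongrightarrow> indicator {r..t} x *\<^sub>R B x"
    proof eventually_elim
      case (elim x)
      have "(\<lambda>n. indicator {r..t} x *\<^sub>R (B x * plateau (real (Suc n)) r t x)) \<longlonglongrightarrow> indicator {r..t} x *\<^sub>R (B x * indicator {r..t} x)"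
        by (intro tendsto_intros plateau_tendsto elim)
      also have "indicator {r..t} x *\<^sub>R (B x * indicator {r..t} x) = indicator {r..t} x *\<^sub>R B x"
        by (simp add: indicator_def)
      finally show ?case .
    qed
    show "AE x in lborel. norm (indicator {r..t} x *\<^sub>R (B x * plateau (real (Suc n)) r t x)) \<le> norm (indicator {r..t} x *\<^sub>R B x)" for n
      using plateau_bounds by (intro AE_I2) (auto simp: indicator_def abs_mult abs_of_nonneg intro!: mult_left_le)
  qed
  have "A r - A t = (LINT x:{r..t}|lborel. B x)"
    using tendsto_diff[OF 1 2] 3 unfolding eq by (rule LIMSEQ_unique)
  then show ?thesis by simp
qed

section \<open>Sobolev spaces and the Hilbert transform\<close>

text \<open>The Japanese bracket of \<xi> to the power \<sigma>. The exponent is halved because the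
  Sobolev weight is applied to the transform itself, so that every Sobolev norm becomes an
  \<open>L2\<close> norm.\<close>

definition bracket :: "real \<Rightarrow> real \<Rightarrow> real"
  where "bracket \<sigma> \<xi> = (1 + \<xi>\<^sup>2) powr (\<sigma> / 2)"

lemma one_plus_sq_pos: "0 < 1 + (\<xi>::real)\<^sup>2" "1 \<le> 1 + (\<xi>::real)\<^sup>2" "1 + (\<xi>::real)\<^sup>2 \<noteq> 0"
  using add_pos_nonneg[OF zero_less_one zero_le_power2[of \<xi>]] by simp_all

lemma bracket_pos: "0 < bracket \<sigma> \<xi>"
  using one_plus_sq_pos[of \<xi>] by (simp add: bracket_def)

lemma bracket_nonneg [simp]: "0 \<le> bracket \<sigma> \<xi>"
  using bracket_pos[of \<sigma> \<xi>] by simp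

lemma bracket_mult: "bracket \<sigma> \<xi> * bracket \<tau> \<xi> = bracket (\<sigma> + \<tau>) \<xi>"
  by (simp add: bracket_def powr_add add_divide_distrib)

lemma bracket_0 [simp]: "bracket 0 \<xi> = 1"
  using one_plus_sq_pos[of \<xi>] by (simp add: bracket_def)

lemma bracket_mono: "\<sigma> \<le> \<tau> \<Longrightarrow> bracket \<sigma> \<xi> \<le> bracket \<tau> \<xi>"
  using one_plus_sq_pos[of \<xi>] by (simp add: bracket_def powr_mono)

lemma bracket_ge_1: "0 \<le> \<sigma> \<Longrightarrow> 1 \<le> bracket \<sigma> \<xi>"
  using bracket_mono[of 0 \<sigma> \<xi>] by simp

lemma bracket_sq: "(bracket \<sigma> \<xi>)\<^sup>2 = (1 + \<xi>\<^sup>2) powr \<sigma>"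
  using one_plus_sq_pos[of \<xi>] by (simp add: bracket_def power2_eq_square flip: powr_add)

lemma bracket_1: "bracket 1 \<xi> = sqrt (1 + \<xi>\<^sup>2)"
  using one_plus_sq_pos[of \<xi>] by (simp add: bracket_def powr_half_sqrt less_imp_le)

lemma abs_le_bracket: "\<bar>\<xi>\<bar> \<le> bracket 1 \<xi>"
  unfolding bracket_1 by (rule real_le_rsqrt) simp

lemma borel_measurable_bracket [measurable]: "bracket \<sigma> \<in> borel_measurable borel"
  unfolding bracket_def by measurable

text \<open>Bounded by 1 on [-1, 1] and by |x| to the power \<sigma> outside, where \<sigma> < - 1
  makes both tails integrable.\<close>

lemma integrable_bracket:
  assumes "\<sigma> < - 1"
  shows "integrable lborel (bracket \<sigma>)"
proof (rule Bochner_Integration.integrable_bound)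
  let ?t = "\<lambda>x::real. indicator {1..} x * x powr \<sigma>"
  have t: "integrable lborel ?t"
  proof (rule integrableI_nonneg)
    have "(\<integral>\<^sup>+x. ennreal (x powr \<sigma>) * indicator {1..} x \<partial>lborel) = ennreal (- (1 powr (\<sigma> + 1)) / (\<sigma> + 1))"
      by (rule nn_integral_has_integral_lebesgue') (use assms has_integral_powr_to_inf[of \<sigma> 1] in auto)
    moreover have "ennreal (?t x) = ennreal (x powr \<sigma>) * indicator {1..} x" for x
      by (auto simp: indicator_def)
    ultimately show "(\<integral>\<^sup>+x. ennreal (?t x) \<partial>lborel) < \<infinity>" by simp
  qed auto
  have t': "integrable lborel (\<lambda>x. ?t (- x))"
    using lborel_integrable_real_affine[OF t, of "-1" 0] by simp
  have i: "integrable lborel (indicator {-1..1::real} :: real \<Rightarrow> real)"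
    by (intro integrable_real_indicator) (auto simp: emeasure_lborel_Icc_eq)
  show "integrable lborel (\<lambda>x. indicator {-1..1} x + (?t x + ?t (- x)) :: real)"
    by (intro Bochner_Integration.integrable_add t t' i)
  show "AE x in lborel. norm (bracket \<sigma> x) \<le> norm (indicator {-1..1} x + (?t x + ?t (- x)) :: real)"
  proof (rule AE_I2)
    fix x :: real
    have n: "0 \<le> indicator {-1..1} x + (?t x + ?t (- x))" by (auto simp: indicator_def)
    have "bracket \<sigma> x \<le> indicator {-1..1} x + (?t x + ?t (- x))"
    proof (cases "\<bar>x\<bar> \<le> 1")
      case True
      have "bracket \<sigma> x \<le> 1" using bracket_mono[of \<sigma> 0 x] assms by simp
      then show ?thesis using True by (auto simp: indicator_def abs_le_iff)
    next
      case False
      have "bracket \<sigma> x \<le> (x\<^sup>2) powr (\<sigma> / 2)"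
        unfolding bracket_def using False assms by (intro powr_mono2') auto
      also have "\<dots> = \<bar>x\<bar> powr \<sigma>"
      proof -
        have "x\<^sup>2 = \<bar>x\<bar> powr 2" using False by simp
        then show ?thesis by (simp only: powr_powr) simp
      qed
      also have "\<dots> \<le> indicator {-1..1} x + (?t x + ?t (- x))" using False by (auto simp: indicator_def abs_if)
      finally show ?thesis .
    qed
    then show "norm (bracket \<sigma> x) \<le> norm (indicator {-1..1} x + (?t x + ?t (- x)) :: real)" using n by simp
  qed
qed simp

lemma square_integrable_bracket: "\<sigma> < - 1 / 2 \<Longrightarrow> square_integrable (bracket \<sigma>)"
  using integrable_bracket[of "2 * \<sigma>"] unfolding square_integrable_def
  by (simp add: power2_eq_square bracket_mult)

section \<open>Transforms of real functions and Sobolev norms\<close>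

lemma square_integrable_of_real:
  "square_integrable f \<Longrightarrow> square_integrable (\<lambda>x. complex_of_real (f x))"
  by (auto simp: square_integrable_def)

lemma L2_of_real [simp]: "L2 (\<lambda>x. complex_of_real (f x)) = L2 f"
  by (simp add: L2_def)

lemma is_fourier_fourier:
  "square_integrable f \<Longrightarrow> is_fourier (\<lambda>x. complex_of_real (f x)) (fourier f)"
  using someI_ex[OF ex_is_fourier[OF square_integrable_of_real]] unfolding fourier_def by blast

lemma square_integrable_fourier: "square_integrable f \<Longrightarrow> square_integrable (fourier f)"
  by (rule is_fourier_sq[OF is_fourier_fourier])

lemma fourier_AE_eq:
  "square_integrable f \<Longrightarrow> is_fourier (\<lambda>x. complex_of_real (f x)) g \<Longrightarrow> AE \<xi> in lborel. fourier f \<xi> = g \<xi>"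
  by (rule is_fourier_unique[OF square_integrable_of_real is_fourier_fourier])

lemma L2_fourier: "square_integrable f \<Longrightarrow> L2 (fourier f) = sqrt (2 * pi) * L2 f"
  using fourier_plancherel[OF square_integrable_of_real is_fourier_fourier, of f]
  by (metis L2_nonneg L2_of_real real_sqrt_mult real_sqrt_unique)

lemma fourier_diff_AE:
  assumes "square_integrable f" "square_integrable g"
  shows "AE \<xi> in lborel. fourier (\<lambda>x. f x - g x) \<xi> = fourier f \<xi> - fourier g \<xi>"
  using is_fourier_diff[OF square_integrable_of_real is_fourier_fourier square_integrable_of_real is_fourier_fourier] assms
  by (intro fourier_AE_eq square_integrable_diff) auto

text \<open>Plancherel applied to the difference. This is how identities proved on the Fourier side
  return to the functions themselves.\<close>

lemma is_fourier_injective: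
  assumes f: "square_integrable f" "is_fourier f F" and g: "square_integrable g" "is_fourier g G"
    and eq: "AE \<xi> in lborel. F \<xi> = G \<xi>"
  shows "AE x in lborel. f x = g x"
proof -
  have sq: "square_integrable (\<lambda>x. f x - g x)" by (intro square_integrable_diff f g)
  have "L2 (\<lambda>\<xi>. F \<xi> - G \<xi>) = L2 (\<lambda>\<xi>::real. 0 :: complex)"
  proof (rule L2_cong_AE)
    show "AE \<xi> in lborel. F \<xi> - G \<xi> = 0" using eq by simp
  qed (intro square_integrable_measurable square_integrable_diff square_integrable_zero is_fourier_sq[OF f(2)] is_fourier_sq[OF g(2)])+
  then have "L2 (\<lambda>x. f x - g x) = 0"
    using fourier_plancherel[OF sq is_fourier_diff[OF f g]] by (simp add: L2_def)
  then have "AE x in lborel. f x - g x = 0" by (rule L2_eq_0_AE[OF sq])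
  then show ?thesis by simp
qed

lemma fourier_hermitian:
  assumes "square_integrable f"
  shows "AE \<xi> in lborel. cnj (fourier f (- \<xi>)) = fourier f \<xi>"
  using fourier_AE_eq[OF assms, of "\<lambda>\<xi>. cnj (fourier f (- \<xi>))"]
    is_fourier_cnj[OF square_integrable_of_real[OF assms] is_fourier_fourier[OF assms]]
  by (auto elim: eventually_mono)

lemma in_sobolev_iff:
  "in_sobolev s f \<longleftrightarrow> square_integrable f \<and> square_integrable (\<lambda>\<xi>. bracket s \<xi> *\<^sub>R fourier f \<xi>)"
proof -
  have "(norm (bracket s \<xi> *\<^sub>R fourier f \<xi>))\<^sup>2 = (1 + \<xi>\<^sup>2) powr s * (cmod (fourier f \<xi>))\<^sup>2" for \<xi>
    by (simp add: power_mult_distrib bracket_sq)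
  moreover have "(\<lambda>\<xi>. bracket s \<xi> *\<^sub>R fourier f \<xi>) \<in> borel_measurable lborel" if "square_integrable f"
    using square_integrable_measurable[OF square_integrable_fourier[OF that]] by simp
  ultimately show ?thesis unfolding in_sobolev_def square_integrable_def by auto
qed

lemma sobolev_norm_eq: "sobolev_norm s f = L2 (\<lambda>\<xi>. bracket s \<xi> *\<^sub>R fourier f \<xi>)"
  unfolding sobolev_norm_def L2_def by (simp add: power_mult_distrib bracket_sq)

lemma sobolev_norm_nonneg [simp]: "0 \<le> sobolev_norm s f"
  by (simp add: sobolev_norm_eq)

lemma L2_le_sobolev_norm:
  assumes "in_sobolev s f" "0 \<le> s"
  shows "L2 (fourier f) \<le> sobolev_norm s f" "L2 f \<le> sobolev_norm s f"
proof -
  show 1: "L2 (fourier f) \<le> sobolev_norm s f"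
    unfolding sobolev_norm_eq using assms bracket_ge_1[OF assms(2)]
    by (intro L2_mono_AE) (auto simp: in_sobolev_iff mult_le_cancel_right1)
  have "1 * L2 f \<le> sqrt (2 * pi) * L2 f"
    using pi_ge_two by (intro mult_right_mono) auto
  then show "L2 f \<le> sobolev_norm s f"
    using 1 L2_fourier assms(1) by (simp add: in_sobolev_iff)
qed

text \<open>The transform is chosen anew for each function, so it is additive only almost
  everywhere. The second part exchanges the transform of the difference for the difference of the
  transforms once and for all.\<close>

lemma in_sobolev_diff:
  assumes f: "in_sobolev s f" and g: "in_sobolev s g"
  shows "in_sobolev s (\<lambda>x. f x - g x)"
    and "sobolev_norm s (\<lambda>x. f x - g x) = L2 (\<lambda>\<xi>. bracket s \<xi> *\<^sub>R fourier f \<xi> - bracket s \<xi> *\<^sub>R fourier g \<xi>)"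
proof -
  have sq: "square_integrable f" "square_integrable g" "square_integrable (\<lambda>x. f x - g x)"
    "square_integrable (\<lambda>\<xi>. bracket s \<xi> *\<^sub>R fourier f \<xi> - bracket s \<xi> *\<^sub>R fourier g \<xi>)"
    using f g by (auto simp: in_sobolev_iff intro: square_integrable_diff)
  have m: "(\<lambda>\<xi>. bracket s \<xi> *\<^sub>R fourier (\<lambda>x. f x - g x) \<xi>) \<in> borel_measurable lborel"
    using square_integrable_measurable[OF square_integrable_fourier[OF sq(3)]] by simp
  have eq: "AE \<xi> in lborel. bracket s \<xi> *\<^sub>R fourier f \<xi> - bracket s \<xi> *\<^sub>R fourier g \<xi> = bracket s \<xi> *\<^sub>R fourier (\<lambda>x. f x - g x) \<xi>"
    using fourier_diff_AE[OF sq(1,2)] by eventually_elim (simp add: scaleR_diff_right)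
  show "in_sobolev s (\<lambda>x. f x - g x)"
    unfolding in_sobolev_iff using sq(3) square_integrable_cong_AE[OF sq(4) m eq] by blast
  show "sobolev_norm s (\<lambda>x. f x - g x) = L2 (\<lambda>\<xi>. bracket s \<xi> *\<^sub>R fourier f \<xi> - bracket s \<xi> *\<^sub>R fourier g \<xi>)"
    unfolding sobolev_norm_eq by (rule L2_cong_AE[OF _ m square_integrable_measurable[OF sq(4)], THEN sym, THEN sym])
      (use eq in eventually_elim, simp)
qed

lemma sobolev_norm_diff_abs:
  assumes f: "in_sobolev s f" and g: "in_sobolev s g"
  shows "\<bar>sobolev_norm s f - sobolev_norm s g\<bar> \<le> sobolev_norm s (\<lambda>x. f x - g x)"
  unfolding in_sobolev_diff(2)[OF f g] unfolding sobolev_norm_eq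
  using f g by (intro L2_diff_abs) (auto simp: in_sobolev_iff)

text \<open>The constant of the embedding of H^s into the bounded C^1 functions. The condition s >
  3/2 is exactly what puts \<open>bracket (1 - s)\<close> into L2.\<close>

definition sobolev_const :: "real \<Rightarrow> real"
  where "sobolev_const s = L2 (bracket (1 - s))"

text \<open>Cauchy-Schwarz with the weight \<open>bracket 1\<close> split into
  \<open>bracket (1 - s)\<close> and \<open>bracket s\<close>.\<close>

lemma sobolev_L1:
  assumes f: "in_sobolev s f" and s: "s > 3 / 2"
  shows "integrable lborel (\<lambda>\<xi>. bracket 1 \<xi> * norm (fourier f \<xi>))"
    "(LINT \<xi>|lborel. bracket 1 \<xi> * norm (fourier f \<xi>)) \<le> sobolev_const s * sobolev_norm s f"
    "integrable lborel (fourier f)" "integrable lborel (\<lambda>\<xi>. \<i> * of_real \<xi> * fourier f \<xi>)"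
proof -
  have b: "square_integrable (bracket (1 - s))" using s by (intro square_integrable_bracket) simp
  have g: "square_integrable (\<lambda>\<xi>. bracket s \<xi> *\<^sub>R fourier f \<xi>)" using f by (simp add: in_sobolev_iff)
  have e: "norm (bracket (1 - s) \<xi>) * norm (bracket s \<xi> *\<^sub>R fourier f \<xi>) = bracket 1 \<xi> * norm (fourier f \<xi>)" for \<xi>
    using bracket_mult[of "1 - s" \<xi> s] by (simp flip: mult.assoc)
  show i: "integrable lborel (\<lambda>\<xi>. bracket 1 \<xi> * norm (fourier f \<xi>))"
    using square_integrable_norm_mult[OF b g] unfolding e .
  show "(LINT \<xi>|lborel. bracket 1 \<xi> * norm (fourier f \<xi>)) \<le> sobolev_const s * sobolev_norm s f"
    using cauchy_schwarz[OF b g] unfolding e sobolev_const_def sobolev_norm_eq .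
  have [measurable]: "fourier f \<in> borel_measurable borel"
    using f square_integrable_measurable[OF square_integrable_fourier] by (auto simp: in_sobolev_iff)
  show "integrable lborel (fourier f)"
    using bracket_ge_1[of 1] by (intro Bochner_Integration.integrable_bound[OF i]) (auto simp: mult_le_cancel_right1)
  show "integrable lborel (\<lambda>\<xi>. \<i> * of_real \<xi> * fourier f \<xi>)"
    using abs_le_bracket by (intro Bochner_Integration.integrable_bound[OF i]) (auto simp: norm_mult intro!: mult_right_mono)
qed

section \<open>The Hilbert transform\<close>

lemma L2_cong_norm_AE:
  assumes "AE x in lborel. norm (f x) = norm (g x)" "f \<in> borel_measurable lborel" "g \<in> borel_measurable lborel"
  shows "L2 f = L2 g"
  using L2_cong_AE[OF assms(1)] assms(2,3) by (simp add: L2_def)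

text \<open>The multiplier is bounded, so the inverse transform h of the product exists in L2. As
  the multiplier preserves Hermitian symmetry, h agrees almost everywhere with its conjugate, and
  its real part is the witness.\<close>

lemma hilbert_exists:
  fixes f :: "real \<Rightarrow> real"
  assumes f: "square_integrable f"
  shows "\<exists>g. square_integrable g \<and> (AE \<xi> in lborel. fourier g \<xi> = - \<i> * complex_of_real (sgn \<xi>) * fourier f \<xi>)"
proof -
  define m where "m \<xi> = - \<i> * complex_of_real (sgn \<xi>) * fourier f \<xi>" for \<xi>
  have fm: "fourier f \<in> borel_measurable borel"
    using square_integrable_measurable[OF square_integrable_fourier[OF f]] by simp
  have m: "square_integrable m"
    unfolding m_def[abs_def]
  proof (rule square_integrable_mult_bounded(1)[OF square_integrable_fourier[OF f], where C=1])
    show "(\<lambda>\<xi>. - \<i> * complex_of_real (sgn \<xi>)) \<in> borel_measurable lborel" by simp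
  qed (auto simp: norm_mult sgn_if)
  obtain p where p: "is_fourier m p" using ex_is_fourier[OF m] by blast
  note p2 = is_fourier_sq[OF p]
  define h where "h x = (1 / (2 * pi)) * p (- x)" for x
  have h: "square_integrable h"
    unfolding h_def[abs_def] by (intro square_integrable_mult_left square_integrable_reflect p2)
  have "is_fourier (\<lambda>x. p (- x)) (\<lambda>\<xi>. 2 * pi * m (- (- \<xi>)))"
    by (rule is_fourier_reflect[OF p2 fourier_inversion[OF m p]])
  from is_fourier_mult_left[OF square_integrable_reflect[OF p2] this, of "1 / (2 * pi)"]
  have hm: "is_fourier h m" by (simp add: h_def[abs_def])
  have "AE \<xi> in lborel. cnj (m (- \<xi>)) = m \<xi>"
    using fourier_hermitian[OF f]
  proof eventually_elim
    case (elim \<xi>)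
    have "cnj (m (- \<xi>)) = - \<i> * complex_of_real (sgn \<xi>) * cnj (fourier f (- \<xi>))"
      by (simp add: m_def)
    then show ?case using elim by (simp add: m_def)
  qed
  then have "AE x in lborel. cnj (h x) = h x"
    by (rule is_fourier_injective[OF square_integrable_cnj[OF h] is_fourier_cnj[OF h hm] h hm])
  then have real: "AE x in lborel. h x = complex_of_real (Re (h x))"
    by eventually_elim (metis Reals_cnj_iff of_real_Re)
  have hmeas: "h \<in> borel_measurable borel" using square_integrable_measurable[OF h] by simp
  have "square_integrable (\<lambda>x. complex_of_real (Re (h x)))"
    by (rule square_integrable_cong_AE[OF h _ real]) (use hmeas in simp)
  then have R: "square_integrable (\<lambda>x. Re (h x))" using hmeas by (simp add: square_integrable_def)
  have "is_fourier (\<lambda>x. complex_of_real (Re (h x))) m"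
    by (rule is_fourier_cong_AE[OF hm h _ real]) (use hmeas square_integrable_measurable[OF m] in auto)
  from fourier_AE_eq[OF R this] R show ?thesis unfolding m_def by blast
qed

lemma hilbert:
  assumes "square_integrable f"
  shows "square_integrable (hilbert f)"
    "AE \<xi> in lborel. fourier (hilbert f) \<xi> = - \<i> * complex_of_real (sgn \<xi>) * fourier f \<xi>"
  using someI_ex[OF hilbert_exists[OF assms]] unfolding hilbert_def by auto

lemma hilbert_norm_AE:
  assumes "square_integrable f"
  shows "AE \<xi> in lborel. norm (fourier (hilbert f) \<xi>) = norm (fourier f \<xi>)"
  using hilbert(2)[OF assms] AE_lborel_singleton[of 0]
  by eventually_elim (simp add: norm_mult sgn_if)

text \<open>The three representatives come from separate choices; they are compared on the Fourier
  side, where the operator is a multiplication, and injectivity brings the equality back.\<close>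

lemma hilbert_diff_AE:
  assumes f: "square_integrable f" and g: "square_integrable g"
  shows "AE x in lborel. hilbert (\<lambda>x. f x - g x) x = hilbert f x - hilbert g x"
proof -
  have d: "square_integrable (\<lambda>x. f x - g x)" by (intro square_integrable_diff f g)
  have h: "square_integrable (\<lambda>x. hilbert f x - hilbert g x)" by (intro square_integrable_diff hilbert f g)
  have "AE \<xi> in lborel. fourier (hilbert (\<lambda>x. f x - g x)) \<xi> = fourier (\<lambda>x. hilbert f x - hilbert g x) \<xi>"
    using hilbert(2)[OF d] hilbert(2)[OF f] hilbert(2)[OF g] fourier_diff_AE[OF f g] fourier_diff_AE[OF hilbert(1)[OF f] hilbert(1)[OF g]]
    by eventually_elim (simp only: right_diff_distrib)
  from is_fourier_injective[OF square_integrable_of_real[OF hilbert(1)[OF d]] is_fourier_fourier[OF hilbert(1)[OF d]]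
      square_integrable_of_real[OF h] is_fourier_fourier[OF h] this]
  show ?thesis by eventually_elim (metis of_real_eq_iff)
qed

lemma L2_hilbert:
  assumes f: "square_integrable f"
  shows "L2 (hilbert f) = L2 f"
proof -
  have "L2 (fourier (hilbert f)) = L2 (fourier f)"
    by (intro L2_cong_norm_AE hilbert_norm_AE square_integrable_measurable square_integrable_fourier hilbert f)
  then show ?thesis by (simp add: L2_fourier hilbert f)
qed

lemma in_sobolev_hilbert:
  assumes f: "in_sobolev s f"
  shows "in_sobolev s (hilbert f)" "sobolev_norm s (hilbert f) = sobolev_norm s f"
proof -
  have sq: "square_integrable f" using f by (simp add: in_sobolev_iff)
  have m: "fourier (hilbert f) \<in> borel_measurable borel" "fourier f \<in> borel_measurable borel"
    using square_integrable_measurable[OF square_integrable_fourier] hilbert(1)[OF sq] sq by auto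
  have e: "AE \<xi> in lborel. norm (bracket s \<xi> *\<^sub>R fourier (hilbert f) \<xi>) = norm (bracket s \<xi> *\<^sub>R fourier f \<xi>)"
    using hilbert_norm_AE[OF sq] by eventually_elim simp
  show "in_sobolev s (hilbert f)"
    unfolding in_sobolev_iff
  proof (intro conjI hilbert(1) sq)
    show "square_integrable (\<lambda>\<xi>. bracket s \<xi> *\<^sub>R fourier (hilbert f) \<xi>)"
    proof (rule square_integrable_bound[where g="\<lambda>\<xi>. bracket s \<xi> *\<^sub>R fourier f \<xi>"])
      show "square_integrable (\<lambda>\<xi>. bracket s \<xi> *\<^sub>R fourier f \<xi>)" using f by (simp add: in_sobolev_iff)
      show "AE \<xi> in lborel. norm (bracket s \<xi> *\<^sub>R fourier (hilbert f) \<xi>) \<le> norm (bracket s \<xi> *\<^sub>R fourier f \<xi>)"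
        using e by eventually_elim (rule eq_refl)
    qed (use m in simp)
  qed
  show "sobolev_norm s (hilbert f) = sobolev_norm s f"
    unfolding sobolev_norm_eq by (rule L2_cong_norm_AE[OF e]) (use m in simp_all)
qed

section \<open>Classical representatives and their derivatives\<close>

lemma ft_hermitian_real:
  assumes g: "integrable lborel g" and h: "AE \<xi> in lborel. cnj (g (- \<xi>)) = g \<xi>"
  shows "complex_of_real (Re (ft g x)) = ft g x"
proof -
  have [measurable]: "g \<in> borel_measurable borel" using g by auto
  have "cnj (ft g x) = ft (\<lambda>\<xi>. cnj (g \<xi>)) (- x)" using ft_cnj[of g "- x"] by simp
  also have "\<dots> = (LINT \<xi>|lborel. cis (- ((0 + -1 * \<xi>) * - x)) * cnj (g (0 + -1 * \<xi>)))"
    unfolding ft_def by (subst lborel_integral_real_affine[of "-1" _ 0]) auto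
  also have "\<dots> = ft g x"
    unfolding ft_def
  proof (rule integral_cong_AE)
    show "AE \<xi> in lborel. cis (- ((0 + -1 * \<xi>) * - x)) * cnj (g (0 + -1 * \<xi>)) = cis (- (\<xi> * x)) * g \<xi>"
      using h by eventually_elim simp
  qed simp_all
  finally show ?thesis by (metis Reals_cnj_iff of_real_Re)
qed

text \<open>Inversion for an integrable g: the preimage is given by an absolutely convergent
  integral, hence has values at every point and can be differentiated.\<close>

lemma fourier_of_inverse:
  assumes g: "integrable lborel g" "square_integrable g"
  shows "square_integrable (\<lambda>x. ft g (- x) / (2 * pi))" "is_fourier (\<lambda>x. ft g (- x) / (2 * pi)) g"
proof -
  have sq: "square_integrable (ft g)" by (rule plancherel_bound[OF g])
  have i: "is_fourier (\<lambda>x. ft g (- x)) (\<lambda>\<xi>. 2 * pi * g (- (- \<xi>)))"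
    by (rule is_fourier_reflect[OF sq fourier_inversion[OF g(2) is_fourier_ft[OF g]]])
  show "square_integrable (\<lambda>x. ft g (- x) / (2 * pi))"
    using square_integrable_mult_left[OF square_integrable_reflect[OF sq], of "1 / (2 * pi)"] by simp
  show "is_fourier (\<lambda>x. ft g (- x) / (2 * pi)) g"
    using is_fourier_mult_left[OF square_integrable_reflect[OF sq] i, of "1 / (2 * pi)"] by simp
qed

lemma norm_cis_diff_le: "norm (cis a - cis b) \<le> \<bar>a - b\<bar>"
proof -
  have "cis a - cis b = cis b * (cis (a - b) - 1)" by (simp add: right_diff_distrib cis_mult)
  then have "norm (cis a - cis b) = norm (cis (a - b) - 1)" by (simp add: norm_mult)
  also have "\<dots> \<le> \<bar>a - b\<bar>" using iexp_approx1[of "a - b" 0] by (simp add: cis_conv_exp)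
  finally show ?thesis .
qed

text \<open>The \<open>C\<^sup>1\<close> representative of a function in \<open>H\<^sup>s\<close>, \<open>s > 3/2\<close>, and its derivative, by Fourier inversion.\<close>

definition smooth_rep :: "(real \<Rightarrow> real) \<Rightarrow> real \<Rightarrow> real"
  where "smooth_rep f x = Re (ft (fourier f) (- x)) / (2 * pi)"

definition smooth_deriv :: "(real \<Rightarrow> real) \<Rightarrow> real \<Rightarrow> real"
  where "smooth_deriv f x = Re (ft (\<lambda>\<xi>. \<i> * of_real \<xi> * fourier f \<xi>) (- x)) / (2 * pi)"

context
  fixes s :: real and f :: "real \<Rightarrow> real"
  assumes f: "in_sobolev s f" and s: "s > 3 / 2"
begin

lemma sobolev_sq: "square_integrable f" "square_integrable (fourier f)" "fourier f \<in> borel_measurable borel"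
  using f square_integrable_measurable[OF square_integrable_fourier[of f]] by (auto simp: in_sobolev_iff intro: square_integrable_fourier)

lemma square_integrable_i_fourier: "square_integrable (\<lambda>\<xi>. \<i> * of_real \<xi> * fourier f \<xi>)"
proof (rule square_integrable_bound)
  show "square_integrable (\<lambda>\<xi>. bracket s \<xi> *\<^sub>R fourier f \<xi>)" using f by (simp add: in_sobolev_iff)
  have "\<bar>\<xi>\<bar> \<le> bracket s \<xi>" for \<xi> using abs_le_bracket[of \<xi>] bracket_mono[of 1 s \<xi>] s by linarith
  then show "AE \<xi> in lborel. norm (\<i> * of_real \<xi> * fourier f \<xi>) \<le> norm (bracket s \<xi> *\<^sub>R fourier f \<xi>)"
    by (auto simp: norm_mult intro!: mult_right_mono)
qed (use sobolev_sq in simp)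

lemma smooth_rep_AE: "AE x in lborel. f x = smooth_rep f x"
proof -
  note i = fourier_of_inverse[OF sobolev_L1(3)[OF f s] sobolev_sq(2)]
  from is_fourier_injective[OF square_integrable_of_real[OF sobolev_sq(1)] is_fourier_fourier[OF sobolev_sq(1)] i]
  have "AE x in lborel. complex_of_real (f x) = ft (fourier f) (- x) / (2 * pi)" by simp
  then show ?thesis
  proof eventually_elim
    case (elim x)
    have "f x = Re (ft (fourier f) (- x) / complex_of_real (2 * pi))" using arg_cong[OF elim, of Re] by simp
    also have "\<dots> = smooth_rep f x" unfolding smooth_rep_def by (rule Re_divide_of_real)
    finally show ?case .
  qed
qed

text \<open>An inverse Fourier integral is bounded by the L1 norm of its integrand; both integrands
  are dominated by \<open>bracket 1\<close> times the transform, to which \<open>sobolev_L1\<close>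
  applies. The factor 1 / (2 \<pi>) is dropped.\<close>

lemma smooth_rep_bound: "\<bar>smooth_rep f x\<bar> \<le> sobolev_const s * sobolev_norm s f"
  and smooth_deriv_bound: "\<bar>smooth_deriv f x\<bar> \<le> sobolev_const s * sobolev_norm s f"
proof -
  have *: "\<bar>Re z / (2 * pi)\<bar> \<le> c" if "norm z \<le> c" for z c
  proof -
    have "\<bar>Re z / (2 * pi)\<bar> \<le> norm z / (2 * pi)"
      using abs_Re_le_cmod[of z] by (simp add: divide_right_mono)
    also have "\<dots> \<le> norm z / 1" using pi_ge_two by (intro divide_left_mono) auto
    finally show ?thesis using that by simp
  qed
  note L1 = sobolev_L1[OF f s]
  have "norm (ft (fourier f) (- x)) \<le> (LINT \<xi>|lborel. bracket 1 \<xi> * norm (fourier f \<xi>))"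
    using bracket_ge_1[of 1] by (intro order_trans[OF ft_bound] integral_mono L1 integrable_norm) (auto simp: mult_le_cancel_right1)
  then show "\<bar>smooth_rep f x\<bar> \<le> sobolev_const s * sobolev_norm s f"
    unfolding smooth_rep_def using L1(2) by (intro *) linarith
  have "norm (ft (\<lambda>\<xi>. \<i> * of_real \<xi> * fourier f \<xi>) (- x)) \<le> (LINT \<xi>|lborel. bracket 1 \<xi> * norm (fourier f \<xi>))"
  proof (intro order_trans[OF ft_bound] integral_mono L1 integrable_norm)
    show "norm (\<i> * of_real \<xi> * fourier f \<xi>) \<le> bracket 1 \<xi> * norm (fourier f \<xi>)" for \<xi>
      using abs_le_bracket[of \<xi>] by (auto simp: norm_mult intro!: mult_right_mono)
  qed
  then show "\<bar>smooth_deriv f x\<bar> \<le> sobolev_const s * sobolev_norm s f"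
    unfolding smooth_deriv_def using L1(2) by (intro *) linarith
qed

lemma continuous_smooth_deriv: "continuous_on S (smooth_deriv f)"
proof -
  have "continuous_on S (\<lambda>x. ft (\<lambda>\<xi>. \<i> * of_real \<xi> * fourier f \<xi>) (- x))"
    by (rule continuous_on_compose2[OF continuous_on_ft[OF sobolev_L1(4)[OF f s], of UNIV]]) (auto intro!: continuous_intros)
  then show ?thesis unfolding smooth_deriv_def[abs_def] by (intro continuous_intros) auto
qed

text \<open>Multiplication by \<open>\<i> * \<xi>\<close> keeps the Hermitian symmetry, so the
  inverse integral is real and taking its real part in \<open>smooth_deriv\<close> loses
  nothing.\<close>

lemma smooth_deriv_fourier:
  "is_fourier (\<lambda>x. complex_of_real (smooth_deriv f x)) (\<lambda>\<xi>. \<i> * of_real \<xi> * fourier f \<xi>)"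
  "square_integrable (smooth_deriv f)"
proof -
  let ?g = "\<lambda>\<xi>. \<i> * of_real \<xi> * fourier f \<xi>"
  note L1 = sobolev_L1(4)[OF f s]
  have "AE \<xi> in lborel. cnj (?g (- \<xi>)) = ?g \<xi>"
    using fourier_hermitian[OF sobolev_sq(1)] by eventually_elim simp
  note r = ft_hermitian_real[OF L1 this]
  have e: "(\<lambda>x. ft ?g (- x) / (2 * pi)) = (\<lambda>x. complex_of_real (smooth_deriv f x))"
    by (rule ext) (simp add: smooth_deriv_def r)
  note i = fourier_of_inverse[OF L1 square_integrable_i_fourier]
  show "is_fourier (\<lambda>x. complex_of_real (smooth_deriv f x)) ?g" using i(2) unfolding e .
  show "square_integrable (smooth_deriv f)"
    using i(1) borel_measurable_continuous_onI[OF continuous_smooth_deriv]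
    unfolding e by (simp add: square_integrable_def)
qed

text \<open>Differentiation under the integral: the difference quotients of
  \<open>cis (\<xi> * x)\<close> in x are at most |\<xi>|, and \<open>bracket 1\<close> times the
  modulus of the transform is an integrable majorant.\<close>

lemma smooth_rep_DERIV: "(smooth_rep f has_real_derivative smooth_deriv f x) (at x)"
proof -
  let ?F = "fourier f"
  note L1 = sobolev_L1[OF f s]
  have ReI: "Re (ft g (- y)) = (LINT \<xi>|lborel. Re (cis (\<xi> * y) * g \<xi>))" if "integrable lborel g" for g y
    unfolding ft_def using integral_Re[OF integrable_cis_mult[OF that, of "\<lambda>\<xi>. \<xi> * y"]] by simp
  have i: "integrable lborel (\<lambda>\<xi>. Re (cis (\<xi> * y) * ?F \<xi>))" for y
    by (intro integrable_Re integrable_cis_mult L1) simp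
  have "((\<lambda>y. Re (ft ?F (- y))) has_real_derivative Re (ft (\<lambda>\<xi>. \<i> * of_real \<xi> * ?F \<xi>) (- x))) (at x)"
    unfolding DERIV_def tendsto_at_iff_sequentially comp_def
  proof (intro allI impI)
    fix X :: "nat \<Rightarrow> real" assume X: "\<forall>i. X i \<in> UNIV - {0}" "X \<longlonglongrightarrow> 0"
    have "(Re (ft ?F (- (x + X n))) - Re (ft ?F (- x))) / X n = (LINT \<xi>|lborel. (Re (cis (\<xi> * (x + X n)) * ?F \<xi>) - Re (cis (\<xi> * x) * ?F \<xi>)) / X n)" for n
      unfolding ReI[OF L1(3)] using i by simp
    moreover have "(\<lambda>n. LINT \<xi>|lborel. (Re (cis (\<xi> * (x + X n)) * ?F \<xi>) - Re (cis (\<xi> * x) * ?F \<xi>)) / X n)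
      \<longlonglongrightarrow> (LINT \<xi>|lborel. Re (cis (\<xi> * x) * (\<i> * of_real \<xi> * ?F \<xi>)))"
    proof (rule integral_dominated_convergence[OF _ _ L1(1)])
      show "AE \<xi> in lborel. (\<lambda>n. (Re (cis (\<xi> * (x + X n)) * ?F \<xi>) - Re (cis (\<xi> * x) * ?F \<xi>)) / X n) \<longlonglongrightarrow> Re (cis (\<xi> * x) * (\<i> * of_real \<xi> * ?F \<xi>))"
      proof (rule AE_I2)
        fix \<xi>
        have "((\<lambda>y. cos (\<xi> * y) * Re (?F \<xi>) - sin (\<xi> * y) * Im (?F \<xi>)) has_real_derivative
            - (\<xi> * sin (\<xi> * x)) * Re (?F \<xi>) - \<xi> * cos (\<xi> * x) * Im (?F \<xi>)) (at x)"
          by (auto intro!: derivative_eq_intros)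
        moreover have "Re (cis (\<xi> * y) * ?F \<xi>) = cos (\<xi> * y) * Re (?F \<xi>) - sin (\<xi> * y) * Im (?F \<xi>)" for y
          by simp
        moreover have "Re (cis (\<xi> * x) * (\<i> * of_real \<xi> * ?F \<xi>)) = - (\<xi> * sin (\<xi> * x)) * Re (?F \<xi>) - \<xi> * cos (\<xi> * x) * Im (?F \<xi>)"
          by (simp add: algebra_simps)
        ultimately have "((\<lambda>y. Re (cis (\<xi> * y) * ?F \<xi>)) has_real_derivative Re (cis (\<xi> * x) * (\<i> * of_real \<xi> * ?F \<xi>))) (at x)"
          by (simp only:)
        then show "(\<lambda>n. (Re (cis (\<xi> * (x + X n)) * ?F \<xi>) - Re (cis (\<xi> * x) * ?F \<xi>)) / X n) \<longlonglongrightarrow> Re (cis (\<xi> * x) * (\<i> * of_real \<xi> * ?F \<xi>))"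
          using X unfolding DERIV_def tendsto_at_iff_sequentially comp_def by blast
      qed
      show "AE \<xi> in lborel. norm ((Re (cis (\<xi> * (x + X n)) * ?F \<xi>) - Re (cis (\<xi> * x) * ?F \<xi>)) / X n) \<le> bracket 1 \<xi> * norm (?F \<xi>)" for n
      proof (rule AE_I2)
        fix \<xi>
        have X0: "X n \<noteq> 0" using X by auto
        have "\<bar>Re (cis (\<xi> * (x + X n)) * ?F \<xi>) - Re (cis (\<xi> * x) * ?F \<xi>)\<bar> \<le> norm ((cis (\<xi> * (x + X n)) - cis (\<xi> * x)) * ?F \<xi>)"
          using abs_Re_le_cmod[of "(cis (\<xi> * (x + X n)) - cis (\<xi> * x)) * ?F \<xi>"] by (simp only: left_diff_distrib minus_complex.simps)
        also have "\<dots> \<le> \<bar>\<xi> * X n\<bar> * norm (?F \<xi>)"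
        proof -
          have "norm (cis (\<xi> * (x + X n)) - cis (\<xi> * x)) \<le> \<bar>\<xi> * X n\<bar>"
            using norm_cis_diff_le[of "\<xi> * (x + X n)" "\<xi> * x"] by (simp add: right_diff_distrib distrib_left)
          then show ?thesis unfolding norm_mult by (rule mult_right_mono) simp
        qed
        also have "\<dots> \<le> (bracket 1 \<xi> * \<bar>X n\<bar>) * norm (?F \<xi>)"
          using abs_le_bracket[of \<xi>] by (auto simp: abs_mult intro!: mult_right_mono)
        finally show "norm ((Re (cis (\<xi> * (x + X n)) * ?F \<xi>) - Re (cis (\<xi> * x) * ?F \<xi>)) / X n) \<le> bracket 1 \<xi> * norm (?F \<xi>)"
          using X0 by (simp add: field_simps)
      qed
    qed (use sobolev_sq(3) in measurable)
    ultimately show "(\<lambda>n. (Re (ft ?F (- (x + X n))) - Re (ft ?F (- x))) / X n) \<longlonglongrightarrow> Re (ft (\<lambda>\<xi>. \<i> * of_real \<xi> * ?F \<xi>) (- x))"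
      unfolding ReI[OF L1(4)] by (simp only:)
  qed
  then show ?thesis unfolding smooth_rep_def[abs_def] smooth_deriv_def by (intro DERIV_cdivide)
qed

end

section \<open>Weak derivatives and the supremum norm\<close>

lemma integrable_compact_support:
  fixes h :: "real \<Rightarrow> 'b::{banach, second_countable_topology}"
  assumes "continuous_on UNIV h" "\<And>x. \<bar>x\<bar> \<ge> R \<Longrightarrow> h x = 0"
  shows "integrable lborel h"
proof -
  have "integrable lborel (\<lambda>x. indicator {- R..R} x *\<^sub>R h x)"
    using borel_integrable_atLeastAtMost'[OF continuous_on_subset[OF assms(1)], of "-R" R] by (simp add: set_integrable_def)
  moreover have "indicator {- R..R} x *\<^sub>R h x = h x" for x
    using assms(2)[of x] by (auto simp: indicator_def)
  ultimately show ?thesis by simp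
qed

lemma test_functionD:
  fixes \<phi> :: "real \<Rightarrow> real"
  assumes "test_function UNIV \<phi>"
  shows "continuous_on UNIV \<phi>" "(\<phi> has_real_derivative deriv \<phi> x) (at x)" "test_function UNIV (deriv \<phi>)"
proof -
  have C: "C_k k \<phi>" for k using assms by (simp add: test_function_def)
  show "continuous_on UNIV \<phi>" by (rule C_k_continuous[OF C[of 0]])
  show "(\<phi> has_real_derivative deriv \<phi> x) (at x)" by (rule C_k_deriv(1)[OF C])
  obtain R where R: "R > 0" "\<And>x. \<bar>x\<bar> \<ge> R \<Longrightarrow> \<phi> x = 0" using test_function_bounded_support[OF assms] by blast
  show "test_function UNIV (deriv \<phi>)"
  proof (rule test_functionI[where K="{- R..R}"])
    show "C_k k (deriv \<phi>)" for k by (rule C_k_deriv(2)[OF C])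
    fix x assume *: "deriv \<phi> x \<noteq> 0"
    show "x \<in> {- R..R}"
    proof (rule ccontr)
      assume "x \<notin> {- R..R}"
      then have x: "x \<in> - {- R..R}" by simp
      have "((\<lambda>x. 0) has_real_derivative 0) (at x)" by simp
      then have "(\<phi> has_real_derivative 0) (at x)"
        by (rule has_field_derivative_transform_within_open[OF _ _ x]) (auto simp: R(2))
      then show False using * DERIV_imp_deriv by blast
    qed
  qed auto
qed

lemma ibp_test:
  fixes F F' \<phi> :: "real \<Rightarrow> real"
  assumes F: "\<And>x. (F has_real_derivative F' x) (at x)" "continuous_on UNIV F'" and \<phi>: "test_function UNIV \<phi>"
  shows "(LINT x|lborel. F x * deriv \<phi> x) = - (LINT x|lborel. F' x * \<phi> x)"
    "integrable lborel (\<lambda>x. F x * deriv \<phi> x)" "integrable lborel (\<lambda>x. F' x * \<phi> x)"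
proof -
  note t = test_functionD[OF \<phi>]
  have Fc: "continuous_on UNIV F" by (intro continuous_at_imp_continuous_on ballI DERIV_isCont[OF F(1)])
  note c = Fc F(2) t(1) test_functionD(1)[OF t(3)]
  obtain R1 where R1: "R1 > 0" "\<And>x. \<bar>x\<bar> \<ge> R1 \<Longrightarrow> \<phi> x = 0" using test_function_bounded_support[OF \<phi>] by blast
  obtain R2 where R2: "R2 > 0" "\<And>x. \<bar>x\<bar> \<ge> R2 \<Longrightarrow> deriv \<phi> x = 0" using test_function_bounded_support[OF t(3)] by blast
  define R where "R = max R1 R2"
  have R: "R > 0" "\<And>x. \<bar>x\<bar> \<ge> R \<Longrightarrow> \<phi> x = 0" "\<And>x. \<bar>x\<bar> \<ge> R \<Longrightarrow> deriv \<phi> x = 0" using R1 R2 by (auto simp: R_def)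
  show i: "integrable lborel (\<lambda>x. F x * deriv \<phi> x)" "integrable lborel (\<lambda>x. F' x * \<phi> x)"
    by (rule integrable_compact_support[of _ R], intro continuous_intros c, simp add: R)+
  have "(LINT x|lborel. indicator {- R..R} x *\<^sub>R (F' x * \<phi> x + F x * deriv \<phi> x)) = F R * \<phi> R - F (- R) * \<phi> (- R)"
  proof (rule integral_FTC_atLeastAtMost)
    show "((\<lambda>x. F x * \<phi> x) has_vector_derivative F' x * \<phi> x + F x * deriv \<phi> x) (at x within {- R..R})" for x
      using DERIV_mult[OF F(1) t(2), of x]
      by (auto simp: has_real_derivative_iff_has_vector_derivative mult.commute add.commute intro: has_vector_derivative_at_within)
    show "continuous_on {- R..R} (\<lambda>x. F' x * \<phi> x + F x * deriv \<phi> x)"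
      by (rule continuous_on_subset[of UNIV], intro continuous_intros c) simp
  qed (use R in simp)
  also have "\<dots> = 0" using R by simp
  also have "(LINT x|lborel. indicator {- R..R} x *\<^sub>R (F' x * \<phi> x + F x * deriv \<phi> x)) = (LINT x|lborel. F' x * \<phi> x + F x * deriv \<phi> x)"
  proof (rule Bochner_Integration.integral_cong[OF refl])
    fix x show "indicator {- R..R} x *\<^sub>R (F' x * \<phi> x + F x * deriv \<phi> x) = F' x * \<phi> x + F x * deriv \<phi> x"
      using R(2)[of x] R(3)[of x] by (cases "x \<in> {- R..R}") auto
  qed
  finally show "(LINT x|lborel. F x * deriv \<phi> x) = - (LINT x|lborel. F' x * \<phi> x)" using i by simp
qed

lemma integrable_mult_test:
  fixes g \<phi> :: "real \<Rightarrow> real"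
  assumes g: "\<And>a b. set_integrable lborel {a..b} g" and \<phi>: "test_function UNIV \<phi>"
  shows "integrable lborel (\<lambda>x. g x * \<phi> x)"
proof -
  obtain R where R: "R > 0" "\<And>x. \<bar>x\<bar> \<ge> R \<Longrightarrow> \<phi> x = 0" using test_function_bounded_support[OF \<phi>] by blast
  note c = test_functionD(1)[OF \<phi>]
  have "bounded (\<phi> ` {- R..R})"
    by (intro compact_imp_bounded compact_continuous_image continuous_on_subset[OF c]) auto
  then obtain C where C: "\<forall>x\<in>{- R..R}. \<bar>\<phi> x\<bar> \<le> C" by (auto simp: bounded_iff)
  show ?thesis
  proof (rule Bochner_Integration.integrable_bound)
    show "integrable lborel (\<lambda>x. C * (indicator {- R..R} x *\<^sub>R g x))"
      using g[of "-R" R] by (simp add: set_integrable_def)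
    show "(\<lambda>x. g x * \<phi> x) \<in> borel_measurable lborel"
      using locally_integrable_measurable[OF g] borel_measurable_continuous_onI[OF c] by simp
    show "AE x in lborel. norm (g x * \<phi> x) \<le> norm (C * (indicator {- R..R} x *\<^sub>R g x))"
    proof (rule AE_I2)
      fix x show "norm (g x * \<phi> x) \<le> norm (C * (indicator {- R..R} x *\<^sub>R g x))"
      proof (cases "x \<in> {- R..R}")
        case True
        then have "\<bar>g x\<bar> * \<bar>\<phi> x\<bar> \<le> \<bar>g x\<bar> * \<bar>C\<bar>"
          by (intro mult_left_mono order_trans[OF bspec[OF C True]]) auto
        then show ?thesis using True by (simp add: abs_mult mult.commute)
      next
        case False
        then have "\<bar>x\<bar> \<ge> R" by auto
        then show ?thesis using R(2)[of x] by simp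
      qed
    qed
  qed
qed

lemma weak_deriv_unique:
  assumes "is_weak_deriv f g" "is_weak_deriv f h"
  shows "AE x in lborel. g x = h x"
proof -
  have s: "set_integrable lborel {a..b} g" "set_integrable lborel {a..b} h" for a b
    using assms by (auto simp: is_weak_deriv_def)
  have "AE x in lborel. g x - h x = 0"
  proof (rule fundamental_lemma)
    show "set_integrable lborel {a..b} (\<lambda>x. g x - h x)" for a b by (intro set_integral_diff s)
    fix \<phi> :: "real \<Rightarrow> real" assume \<phi>: "test_function UNIV \<phi>"
    have "(LINT x|lborel. f x * deriv \<phi> x) = - (LINT x|lborel. g x * \<phi> x)"
      "(LINT x|lborel. f x * deriv \<phi> x) = - (LINT x|lborel. h x * \<phi> x)"
      using assms \<phi> by (auto simp: is_weak_deriv_def)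
    then have "(LINT x|lborel. g x * \<phi> x) = (LINT x|lborel. h x * \<phi> x)" by linarith
    then show "(LINT x|lborel. (g x - h x) * \<phi> x) = 0"
      using integrable_mult_test[OF s(1) \<phi>] integrable_mult_test[OF s(2) \<phi>] by (simp add: left_diff_distrib)
  qed
  then show ?thesis by simp
qed

context
  fixes s :: real and f :: "real \<Rightarrow> real"
  assumes f: "in_sobolev s f" and s: "s > 3 / 2"
begin

lemma is_weak_deriv_smooth: "is_weak_deriv f (smooth_deriv f)"
  unfolding is_weak_deriv_def
proof (intro conjI allI impI)
  fix K :: "real set" assume "compact K"
  then show "set_integrable lborel K (smooth_deriv f)"
    using borel_integrable_compact[OF _ continuous_smooth_deriv[OF f s]] by (simp add: set_integrable_def)
next
  fix \<phi> :: "real \<Rightarrow> real" assume \<phi>: "test_function UNIV \<phi>"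
  note i = ibp_test[OF smooth_rep_DERIV[OF f s] continuous_smooth_deriv[OF f s] \<phi>]
  have "(LINT x|lborel. f x * deriv \<phi> x) = (LINT x|lborel. smooth_rep f x * deriv \<phi> x)"
  proof (rule integral_cong_AE)
    show "AE x in lborel. f x * deriv \<phi> x = smooth_rep f x * deriv \<phi> x"
      using smooth_rep_AE[OF f s] by eventually_elim simp
    show "(\<lambda>x. f x * deriv \<phi> x) \<in> borel_measurable lborel"
      using square_integrable_measurable[OF sobolev_sq(1)[OF f s]] borel_measurable_continuous_onI[OF test_functionD(1)[OF test_functionD(3)[OF \<phi>]]] by simp
  qed (use i(2) in simp)
  then show "(LINT x|lborel. f x * deriv \<phi> x) = - (LINT x|lborel. smooth_deriv f x * \<phi> x)" using i(1) by simp
qed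

text \<open>The chosen weak derivative and \<open>smooth_deriv\<close> both satisfy the defining
  identity, and the fundamental lemma makes it unique up to null sets.\<close>

lemma weak_deriv:
  "AE x in lborel. weak_deriv f x = smooth_deriv f x" "weak_deriv f \<in> borel_measurable borel"
proof -
  have w: "is_weak_deriv f (weak_deriv f)"
    unfolding weak_deriv_def by (rule someI[where P="is_weak_deriv f", OF is_weak_deriv_smooth])
  show "AE x in lborel. weak_deriv f x = smooth_deriv f x"
    by (rule weak_deriv_unique[OF w is_weak_deriv_smooth])
  show "weak_deriv f \<in> borel_measurable borel"
    using w by (intro locally_integrable_measurable) (auto simp: is_weak_deriv_def)
qed

lemma Linfty_bound: "Linfty_norm (weak_deriv f) \<le> ennreal (sobolev_const s * sobolev_norm s f)"
  unfolding Linfty_norm_def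
proof (rule esssup_I)
  show "(\<lambda>x. ennreal \<bar>weak_deriv f x\<bar>) \<in> borel_measurable lborel" using weak_deriv(2) by simp
  show "AE x in lborel. ennreal \<bar>weak_deriv f x\<bar> \<le> ennreal (sobolev_const s * sobolev_norm s f)"
    using weak_deriv(1)
  proof eventually_elim
    case (elim x)
    show ?case unfolding elim by (rule ennreal_leI[OF smooth_deriv_bound[OF f s]])
  qed
qed

lemma smooth_deriv_le_Linfty: "AE x in lborel. \<bar>smooth_deriv f x\<bar> \<le> enn2real (Linfty_norm (weak_deriv f))"
proof -
  have fin: "Linfty_norm (weak_deriv f) < top" using Linfty_bound by (rule le_less_trans) simp
  have "AE x in lborel. ennreal \<bar>weak_deriv f x\<bar> \<le> Linfty_norm (weak_deriv f)"
    unfolding Linfty_norm_def by (rule esssup_AE)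
  then show ?thesis using weak_deriv(1)
  proof eventually_elim
    case (elim x)
    show ?case using enn2real_mono[OF elim(1) fin] unfolding elim(2) by simp
  qed
qed

end

lemma smooth_deriv_diff:
  assumes f: "in_sobolev s f" and g: "in_sobolev s g" and s: "s > 3 / 2"
  shows "smooth_deriv (\<lambda>x. f x - g x) x = smooth_deriv f x - smooth_deriv g x"
proof -
  note sq = sobolev_sq[OF f s] sobolev_sq[OF g s] sobolev_sq[OF in_sobolev_diff(1)[OF f g] s]
  have "ft (\<lambda>\<xi>. \<i> * of_real \<xi> * fourier (\<lambda>x. f x - g x) \<xi>) (- x)
      = ft (\<lambda>\<xi>. \<i> * of_real \<xi> * fourier f \<xi> - \<i> * of_real \<xi> * fourier g \<xi>) (- x)"
    unfolding ft_def
  proof (rule integral_cong_AE)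
    show "AE \<xi> in lborel. cis (- (\<xi> * - x)) * (\<i> * of_real \<xi> * fourier (\<lambda>x. f x - g x) \<xi>)
        = cis (- (\<xi> * - x)) * (\<i> * of_real \<xi> * fourier f \<xi> - \<i> * of_real \<xi> * fourier g \<xi>)"
      using fourier_diff_AE[OF sq(1,4)] by eventually_elim (simp only: right_diff_distrib)
  qed (use sq in simp_all)
  then show ?thesis
    unfolding smooth_deriv_def by (simp add: ft_diff sobolev_L1(4)[OF f s] sobolev_L1(4)[OF g s] diff_divide_distrib)
qed

text \<open>By the triangle inequality and the Sobolev bound for the derivative of the difference.
  The Lipschitz estimate makes the essential supremum of the derivative continuous in time along a
  solution.\<close>

lemma Linfty_diff:
  assumes f: "in_sobolev s f" and g: "in_sobolev s g" and s: "s > 3 / 2"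
  shows "\<bar>enn2real (Linfty_norm (weak_deriv f)) - enn2real (Linfty_norm (weak_deriv g))\<bar> \<le> sobolev_const s * sobolev_norm s (\<lambda>x. f x - g x)"
proof -
  have *: "enn2real (Linfty_norm (weak_deriv f)) \<le> enn2real (Linfty_norm (weak_deriv g)) + sobolev_const s * sobolev_norm s (\<lambda>x. f x - g x)"
    if f: "in_sobolev s f" and g: "in_sobolev s g" for f g
  proof (rule enn2real_leI)
    show "Linfty_norm (weak_deriv f) \<le> ennreal (enn2real (Linfty_norm (weak_deriv g)) + sobolev_const s * sobolev_norm s (\<lambda>x. f x - g x))"
      unfolding Linfty_norm_def[of "weak_deriv f"]
    proof (rule esssup_I)
      show "(\<lambda>x. ennreal \<bar>weak_deriv f x\<bar>) \<in> borel_measurable lborel" using weak_deriv(2)[OF f s] by simp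
      show "AE x in lborel. ennreal \<bar>weak_deriv f x\<bar> \<le> ennreal (enn2real (Linfty_norm (weak_deriv g)) + sobolev_const s * sobolev_norm s (\<lambda>x. f x - g x))"
        using weak_deriv(1)[OF f s] smooth_deriv_le_Linfty[OF g s]
      proof eventually_elim
        case (elim x)
        then show ?case
          using smooth_deriv_bound[OF in_sobolev_diff(1)[OF f g] s, of x] smooth_deriv_diff[OF f g s, of x]
          by (intro ennreal_leI) linarith
      qed
    qed
    show "0 \<le> enn2real (Linfty_norm (weak_deriv g)) + sobolev_const s * sobolev_norm s (\<lambda>x. f x - g x)"
      by (simp add: sobolev_const_def)
  qed
  have "sobolev_norm s (\<lambda>x. g x - f x) = sobolev_norm s (\<lambda>x. f x - g x)"
    unfolding in_sobolev_diff(2)[OF f g] in_sobolev_diff(2)[OF g f] by (rule L2_minus_commute)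
  then show ?thesis using *[OF f g] *[OF g f] by (simp only: abs_le_iff) linarith
qed

section \<open>The mild formulation\<close>

lemma square_integrable_test:
  assumes "test_function UNIV (\<psi> :: real \<Rightarrow> real)"
  shows "square_integrable \<psi>"
proof -
  obtain R where R: "R > 0" "\<And>x. \<bar>x\<bar> \<ge> R \<Longrightarrow> \<psi> x = 0" using test_function_bounded_support[OF assms] by blast
  note c = test_functionD(1)[OF assms]
  have "integrable lborel (\<lambda>x. (norm (\<psi> x))\<^sup>2)"
    by (rule integrable_compact_support[of _ R]) (auto intro!: continuous_intros c simp: R)
  then show ?thesis using borel_measurable_continuous_onI[OF c] by (simp add: square_integrable_def)
qed

lemma test_function_bounded:
  assumes "test_function UNIV (\<psi> :: real \<Rightarrow> real)"
  obtains C where "C > 0" "\<And>x. \<bar>\<psi> x\<bar> \<le> C"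
proof -
  obtain R where R: "R > 0" "\<And>x. \<bar>x\<bar> \<ge> R \<Longrightarrow> \<psi> x = 0" using test_function_bounded_support[OF assms] by blast
  have "bounded (\<psi> ` {- R..R})"
    by (intro compact_imp_bounded compact_continuous_image continuous_on_subset[OF test_functionD(1)[OF assms]]) auto
  then obtain C where C: "\<forall>x\<in>{- R..R}. \<bar>\<psi> x\<bar> \<le> C" by (auto simp: bounded_iff)
  show thesis
  proof (rule that[of "\<bar>C\<bar> + 1"])
    show "\<bar>\<psi> x\<bar> \<le> \<bar>C\<bar> + 1" for x
    proof (cases "x \<in> {- R..R}")
      case True then show ?thesis using bspec[OF C True] by linarith
    next
      case False
      then have "\<bar>x\<bar> \<ge> R" by auto
      then show ?thesis using R(2)[of x] by simp
    qed
  qed simp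
qed

text \<open>From \<open>f\<^sup>2 - g\<^sup>2 = (f - g) * ((f - g) + 2 * g)\<close>. The bound
  involves f only through f - g, so that in proofs of continuity its constant depends on the fixed
  time alone.\<close>

lemma integral_sq_diff_le:
  fixes f g :: "real \<Rightarrow> real"
  assumes f: "square_integrable f" and g: "square_integrable g"
  shows "integrable lborel (\<lambda>x. \<bar>(f x)\<^sup>2 - (g x)\<^sup>2\<bar>)"
    "(LINT x|lborel. \<bar>(f x)\<^sup>2 - (g x)\<^sup>2\<bar>) \<le> (L2 (\<lambda>x. f x - g x))\<^sup>2 + 2 * L2 g * L2 (\<lambda>x. f x - g x)"
proof -
  have d: "square_integrable (\<lambda>x. f x - g x)" by (intro square_integrable_diff f g)
  show i: "integrable lborel (\<lambda>x. \<bar>(f x)\<^sup>2 - (g x)\<^sup>2\<bar>)"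
    using square_integrable_sq[OF f] square_integrable_sq[OF g] by (intro integrable_abs Bochner_Integration.integrable_diff) auto
  have j: "integrable lborel (\<lambda>x. (norm (f x - g x))\<^sup>2 + 2 * (norm (g x) * norm (f x - g x)))"
    by (intro Bochner_Integration.integrable_add square_integrable_sq integrable_mult_right square_integrable_norm_mult d g)
  have "(LINT x|lborel. \<bar>(f x)\<^sup>2 - (g x)\<^sup>2\<bar>) \<le> (LINT x|lborel. (norm (f x - g x))\<^sup>2 + 2 * (norm (g x) * norm (f x - g x)))"
  proof (rule integral_mono[OF i j])
    fix x
    have "\<bar>(f x)\<^sup>2 - (g x)\<^sup>2\<bar> = \<bar>f x - g x\<bar> * \<bar>(f x - g x) + 2 * g x\<bar>"
      by (simp add: power2_eq_square square_diff_square_factored[symmetric] algebra_simps flip: abs_mult)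
    also have "\<dots> \<le> \<bar>f x - g x\<bar> * (\<bar>f x - g x\<bar> + 2 * \<bar>g x\<bar>)"
      by (intro mult_left_mono order_trans[OF abs_triangle_ineq]) (auto simp: abs_mult)
    finally show "\<bar>(f x)\<^sup>2 - (g x)\<^sup>2\<bar> \<le> (norm (f x - g x))\<^sup>2 + 2 * (norm (g x) * norm (f x - g x))"
      by (simp add: power2_eq_square algebra_simps)
  qed
  also have "\<dots> = (L2 (\<lambda>x. f x - g x))\<^sup>2 + 2 * (LINT x|lborel. norm (g x) * norm (f x - g x))"
    using square_integrable_sq[OF d] square_integrable_norm_mult[OF g d] by (simp add: L2_sq)
  also have "\<dots> \<le> (L2 (\<lambda>x. f x - g x))\<^sup>2 + 2 * (L2 g * L2 (\<lambda>x. f x - g x))"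
    using cauchy_schwarz[OF g d] by simp
  finally show "(LINT x|lborel. \<bar>(f x)\<^sup>2 - (g x)\<^sup>2\<bar>) \<le> (L2 (\<lambda>x. f x - g x))\<^sup>2 + 2 * L2 g * L2 (\<lambda>x. f x - g x)"
    by (simp add: mult.assoc)
qed

text \<open>Continuity holds up to time 0, the equation only on the open interval. Arguments that
  use the equation therefore start from a time r > 0.\<close>

locale flow =
  fixes \<beta> \<mu> s T :: real and u :: "real \<Rightarrow> real \<Rightarrow> real"
  assumes mu: "\<mu> > 0" and s: "s > 3 / 2"
    and continuous: "sobolev_continuous_on s {0..<T} u"
    and weak: "solves_distributionally \<beta> \<mu> {0<..<T} u"
begin

section \<open>Continuity in time of linear and quadratic pairings\<close>

definition v :: "real \<Rightarrow> real \<Rightarrow> real"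
  where "v t = hilbert (u t)"

definition D :: "real \<Rightarrow> real \<Rightarrow> real"
  where "D \<tau> t = sobolev_norm s (\<lambda>x. u \<tau> x - u t x)"

text \<open>Twice the primitive of the nonlinear term: \<open>u * u_x + v * v_x\<close> is half the
  space derivative of Q, which puts the equation into conservation form.\<close>

definition Q :: "real \<Rightarrow> real \<Rightarrow> real"
  where "Q t x = (u t x)\<^sup>2 + (v t x)\<^sup>2"

lemma sobolev_u: "t \<in> {0..<T} \<Longrightarrow> in_sobolev s (u t)"
  using continuous by (simp add: sobolev_continuous_on_def)

lemma sobolev_v: "t \<in> {0..<T} \<Longrightarrow> in_sobolev s (v t)"
  unfolding v_def by (intro in_sobolev_hilbert sobolev_u)

lemma D_tendsto: "t \<in> {0..<T} \<Longrightarrow> ((\<lambda>\<tau>. D \<tau> t) \<longlongrightarrow> 0) (at t within {0..<T})"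
  using continuous by (simp add: sobolev_continuous_on_def D_def)

lemma D_nonneg [simp]: "0 \<le> D \<tau> t"
  by (simp add: D_def)

lemma sq_u: "t \<in> {0..<T} \<Longrightarrow> square_integrable (u t)"
  and sq_v: "t \<in> {0..<T} \<Longrightarrow> square_integrable (v t)"
  using sobolev_u sobolev_v by (auto simp: in_sobolev_iff)

lemma measurable_u: "t \<in> {0..<T} \<Longrightarrow> u t \<in> borel_measurable borel"
  and measurable_v: "t \<in> {0..<T} \<Longrightarrow> v t \<in> borel_measurable borel"
  using square_integrable_measurable[OF sq_u] square_integrable_measurable[OF sq_v] by auto

lemma L2_v: "t \<in> {0..<T} \<Longrightarrow> L2 (v t) = L2 (u t)"
  unfolding v_def by (intro L2_hilbert sq_u)

lemma L2_diff_u: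
  assumes "\<tau> \<in> {0..<T}" "t \<in> {0..<T}"
  shows "L2 (\<lambda>x. u \<tau> x - u t x) \<le> D \<tau> t"
  unfolding D_def using assms s by (intro L2_le_sobolev_norm(2) in_sobolev_diff sobolev_u) auto

lemma L2_diff_v:
  assumes "\<tau> \<in> {0..<T}" "t \<in> {0..<T}"
  shows "L2 (\<lambda>x. v \<tau> x - v t x) \<le> D \<tau> t"
proof -
  have "L2 (\<lambda>x. v \<tau> x - v t x) = L2 (hilbert (\<lambda>x. u \<tau> x - u t x))"
  proof (rule L2_cong_AE)
    show "AE x in lborel. v \<tau> x - v t x = hilbert (\<lambda>x. u \<tau> x - u t x) x"
      using hilbert_diff_AE[OF sq_u sq_u, OF assms] unfolding v_def by eventually_elim simp
  qed (intro square_integrable_measurable square_integrable_diff sq_v hilbert sq_u assms)+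
  also have "\<dots> = L2 (\<lambda>x. u \<tau> x - u t x)" by (intro L2_hilbert square_integrable_diff sq_u assms)
  finally show ?thesis using L2_diff_u[OF assms] by simp
qed

text \<open>The common pattern of the continuity proofs: linear quantities vary by at most D,
  quadratic ones by at most a multiple of D plus its square, where the factor may depend on the
  fixed time but not on the moving one.\<close>

lemma continuous_onI_D:
  fixes \<Phi> :: "real \<Rightarrow> 'b::real_normed_vector"
  assumes b: "\<And>t \<tau>. t \<in> {0..<T} \<Longrightarrow> \<tau> \<in> {0..<T} \<Longrightarrow> norm (\<Phi> \<tau> - \<Phi> t) \<le> K t * (D \<tau> t + (D \<tau> t)\<^sup>2)"
  shows "continuous_on {0..<T} \<Phi>"
  unfolding continuous_on_def
proof
  fix t assume t: "t \<in> {0..<T}"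
  have "((\<lambda>\<tau>. K t * (D \<tau> t + (D \<tau> t)\<^sup>2)) \<longlongrightarrow> K t * (0 + 0\<^sup>2)) (at t within {0..<T})"
    by (intro tendsto_intros D_tendsto t)
  then have l: "((\<lambda>\<tau>. K t * (D \<tau> t + (D \<tau> t)\<^sup>2)) \<longlongrightarrow> 0) (at t within {0..<T})" by simp
  have "((\<lambda>\<tau>. \<Phi> \<tau> - \<Phi> t) \<longlongrightarrow> 0) (at t within {0..<T})"
    by (rule Lim_null_comparison[OF _ l]) (use b[OF t] in \<open>auto simp: eventually_at_filter\<close>)
  then show "(\<Phi> \<longlongrightarrow> \<Phi> t) (at t within {0..<T})" by (simp add: LIM_zero_iff)
qed

lemma integrable_Q: "t \<in> {0..<T} \<Longrightarrow> integrable lborel (Q t)"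
  using square_integrable_sq[OF sq_u] square_integrable_sq[OF sq_v] unfolding Q_def[abs_def]
  by (intro Bochner_Integration.integrable_add) auto

lemma Q_nonneg: "0 \<le> Q t x"
  by (simp add: Q_def)

lemma integral_Q: "t \<in> {0..<T} \<Longrightarrow> (LINT x|lborel. Q t x) = 2 * (L2 (u t))\<^sup>2"
  using square_integrable_sq[OF sq_u, of t] square_integrable_sq[OF sq_v, of t] L2_v[of t]
    L2_sq[of "u t"] L2_sq[of "v t"] by (simp add: Q_def)

lemma integral_Q_diff:
  assumes "\<tau> \<in> {0..<T}" "t \<in> {0..<T}"
  shows "(LINT x|lborel. \<bar>Q \<tau> x - Q t x\<bar>) \<le> (2 + 4 * L2 (u t)) * (D \<tau> t + (D \<tau> t)\<^sup>2)"
proof -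
  note u = integral_sq_diff_le[OF sq_u sq_u, OF assms] and v = integral_sq_diff_le[OF sq_v sq_v, OF assms]
  have "(LINT x|lborel. \<bar>Q \<tau> x - Q t x\<bar>) \<le> (LINT x|lborel. \<bar>(u \<tau> x)\<^sup>2 - (u t x)\<^sup>2\<bar> + \<bar>(v \<tau> x)\<^sup>2 - (v t x)\<^sup>2\<bar>)"
  proof (rule integral_mono)
    show "integrable lborel (\<lambda>x. \<bar>Q \<tau> x - Q t x\<bar>)"
      by (intro integrable_abs Bochner_Integration.integrable_diff integrable_Q assms)
    show "integrable lborel (\<lambda>x. \<bar>(u \<tau> x)\<^sup>2 - (u t x)\<^sup>2\<bar> + \<bar>(v \<tau> x)\<^sup>2 - (v t x)\<^sup>2\<bar>)"
      by (rule Bochner_Integration.integrable_add[OF u(1) v(1)])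
  qed (auto simp: Q_def)
  also have "\<dots> = (LINT x|lborel. \<bar>(u \<tau> x)\<^sup>2 - (u t x)\<^sup>2\<bar>) + (LINT x|lborel. \<bar>(v \<tau> x)\<^sup>2 - (v t x)\<^sup>2\<bar>)"
    by (rule Bochner_Integration.integral_add[OF u(1) v(1)])
  also have "\<dots> \<le> ((D \<tau> t)\<^sup>2 + 2 * L2 (u t) * D \<tau> t) + ((D \<tau> t)\<^sup>2 + 2 * L2 (u t) * D \<tau> t)"
    using L2_diff_u[OF assms] L2_diff_v[OF assms] L2_v[OF assms(2)]
    by (intro add_mono order_trans[OF u(2)] order_trans[OF v(2)]) (auto intro!: add_mono mult_left_mono power_mono)
  also have "\<dots> = 2 * (D \<tau> t)\<^sup>2 + 4 * L2 (u t) * D \<tau> t" by simp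
  also have "\<dots> \<le> 2 * (D \<tau> t)\<^sup>2 + 4 * L2 (u t) * D \<tau> t + (2 * D \<tau> t + 4 * L2 (u t) * (D \<tau> t)\<^sup>2)" by simp
  also have "\<dots> = (2 + 4 * L2 (u t)) * (D \<tau> t + (D \<tau> t)\<^sup>2)" by (simp add: algebra_simps)
  finally show ?thesis .
qed

lemma continuous_pair_u:
  fixes \<psi> :: "real \<Rightarrow> real"
  assumes "square_integrable \<psi>"
  shows "continuous_on {0..<T} (\<lambda>t. LINT x|lborel. u t x * \<psi> x)" "continuous_on {0..<T} (\<lambda>t. LINT x|lborel. v t x * \<psi> x)"
proof -
  have *: "continuous_on {0..<T} (\<lambda>t. LINT x|lborel. w t x * \<psi> x)"
    if sq: "\<And>t. t \<in> {0..<T} \<Longrightarrow> square_integrable (w t)"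
      and d: "\<And>\<tau> t. \<tau> \<in> {0..<T} \<Longrightarrow> t \<in> {0..<T} \<Longrightarrow> L2 (\<lambda>x. w \<tau> x - w t x) \<le> D \<tau> t" for w
  proof (rule continuous_onI_D[where K="\<lambda>t. L2 \<psi>"])
    fix t \<tau> assume *: "t \<in> {0..<T}" "\<tau> \<in> {0..<T}"
    have "(LINT x|lborel. w \<tau> x * \<psi> x) - (LINT x|lborel. w t x * \<psi> x) = (LINT x|lborel. (w \<tau> x - w t x) * \<psi> x)"
      unfolding left_diff_distrib using assms * sq by (intro Bochner_Integration.integral_diff[symmetric] square_integrable_mult)
    also have "norm \<dots> \<le> L2 (\<lambda>x. w \<tau> x - w t x) * L2 \<psi>"
      by (intro cauchy_schwarz_mult square_integrable_diff sq * assms)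
    also have "\<dots> \<le> (D \<tau> t + (D \<tau> t)\<^sup>2) * L2 \<psi>" using d[OF *(2,1)] zero_le_power2[of "D \<tau> t"] by (intro mult_right_mono) (linarith, simp)
    finally show "norm ((LINT x|lborel. w \<tau> x * \<psi> x) - (LINT x|lborel. w t x * \<psi> x)) \<le> L2 \<psi> * (D \<tau> t + (D \<tau> t)\<^sup>2)"
      by (simp add: mult.commute)
  qed
  show "continuous_on {0..<T} (\<lambda>t. LINT x|lborel. u t x * \<psi> x)" "continuous_on {0..<T} (\<lambda>t. LINT x|lborel. v t x * \<psi> x)"
    by (rule *; simp add: sq_u sq_v L2_diff_u L2_diff_v)+
qed

lemma integrable_Q_mult:
  fixes \<psi> :: "real \<Rightarrow> real"
  assumes "t \<in> {0..<T}" "\<psi> \<in> borel_measurable borel" "\<And>x. \<bar>\<psi> x\<bar> \<le> C"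
  shows "integrable lborel (\<lambda>x. Q t x * \<psi> x)"
proof (rule Bochner_Integration.integrable_bound)
  show "integrable lborel (\<lambda>x. Q t x * C)" using integrable_Q[OF assms(1)] by simp
  show "AE x in lborel. norm (Q t x * \<psi> x) \<le> norm (Q t x * C)"
    using assms(3) Q_nonneg by (intro AE_I2) (auto simp: abs_mult intro!: mult_left_mono intro: order_trans[OF assms(3) abs_ge_self])
qed (use integrable_Q[OF assms(1)] assms(2) in simp)

lemma continuous_pair_Q:
  fixes \<psi> :: "real \<Rightarrow> real"
  assumes m: "\<psi> \<in> borel_measurable borel" and b: "\<And>x. \<bar>\<psi> x\<bar> \<le> C"
  shows "continuous_on {0..<T} (\<lambda>t. LINT x|lborel. Q t x * \<psi> x)"
proof (rule continuous_onI_D[where K="\<lambda>t. (2 + 4 * L2 (u t)) * C"])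
  have C: "0 \<le> C" using b[of 0] by linarith
  fix t \<tau> assume *: "t \<in> {0..<T}" "\<tau> \<in> {0..<T}"
  have "(LINT x|lborel. Q \<tau> x * \<psi> x) - (LINT x|lborel. Q t x * \<psi> x) = (LINT x|lborel. (Q \<tau> x - Q t x) * \<psi> x)"
    unfolding left_diff_distrib using * by (intro Bochner_Integration.integral_diff[symmetric] integrable_Q_mult[OF _ m b])
  also have "norm \<dots> \<le> (LINT x|lborel. norm ((Q \<tau> x - Q t x) * \<psi> x))" by (rule integral_norm_bound)
  also have "\<dots> \<le> (LINT x|lborel. \<bar>Q \<tau> x - Q t x\<bar> * C)"
    using integrable_Q * C b
    by (intro integral_mono_AE') (auto simp: abs_mult intro!: integrable_abs Bochner_Integration.integrable_diff mult_left_mono)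
  also have "\<dots> \<le> (2 + 4 * L2 (u t)) * (D \<tau> t + (D \<tau> t)\<^sup>2) * C"
    using integral_Q_diff[OF *(2,1)] C by (simp add: mult_right_mono)
  finally show "norm ((LINT x|lborel. Q \<tau> x * \<psi> x) - (LINT x|lborel. Q t x * \<psi> x)) \<le> (2 + 4 * L2 (u t)) * C * (D \<tau> t + (D \<tau> t)\<^sup>2)"
    by (simp add: mult_ac)
qed

text \<open>All representatives are replaced almost everywhere by the C^1 ones, for which the chain
  rule and classical integration by parts are available.\<close>

lemma nonlinear_pairing:
  fixes \<psi> :: "real \<Rightarrow> real"
  assumes t: "t \<in> {0..<T}" and \<psi>: "test_function UNIV \<psi>"
  shows "integrable lborel (\<lambda>x. (u t x * weak_deriv (u t) x + v t x * weak_deriv (v t) x) * \<psi> x)"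
    "(LINT x|lborel. (u t x * weak_deriv (u t) x + v t x * weak_deriv (v t) x) * \<psi> x) = - (1 / 2) * (LINT x|lborel. Q t x * deriv \<psi> x)"
proof -
  define F where "F x = (smooth_rep (u t) x)\<^sup>2 + (smooth_rep (v t) x)\<^sup>2" for x
  define F' where "F' x = 2 * (smooth_rep (u t) x * smooth_deriv (u t) x + smooth_rep (v t) x * smooth_deriv (v t) x)" for x
  note hu = sobolev_u[OF t] and hv = sobolev_v[OF t]
  have rc: "continuous_on UNIV (smooth_rep w)" if "in_sobolev s w" for w
    by (intro continuous_at_imp_continuous_on ballI DERIV_isCont[OF smooth_rep_DERIV[OF that s]])
  have D: "(F has_real_derivative F' x) (at x)" for x
    unfolding F_def[abs_def] F'_def
    by (auto intro!: derivative_eq_intros smooth_rep_DERIV[OF hu s] smooth_rep_DERIV[OF hv s])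
  have c: "continuous_on UNIV F'"
    unfolding F'_def by (intro continuous_intros rc continuous_smooth_deriv[OF _ s] hu hv)
  note i = ibp_test[OF D c \<psi>]
  have m: "u t \<in> borel_measurable borel" "v t \<in> borel_measurable borel" "weak_deriv (u t) \<in> borel_measurable borel"
    "weak_deriv (v t) \<in> borel_measurable borel" "\<psi> \<in> borel_measurable borel" "deriv \<psi> \<in> borel_measurable borel" "Q t \<in> borel_measurable borel"
    using measurable_u[OF t] measurable_v[OF t] weak_deriv(2)[OF hu s] weak_deriv(2)[OF hv s] integrable_Q[OF t]
      borel_measurable_continuous_onI[OF test_functionD(1)[OF \<psi>]]
      borel_measurable_continuous_onI[OF test_functionD(1)[OF test_functionD(3)[OF \<psi>]]] by auto
  have 1: "AE x in lborel. F' x * \<psi> x = 2 * ((u t x * weak_deriv (u t) x + v t x * weak_deriv (v t) x) * \<psi> x)"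
    using smooth_rep_AE[OF hu s] smooth_rep_AE[OF hv s] weak_deriv(1)[OF hu s] weak_deriv(1)[OF hv s]
    by eventually_elim (simp add: F'_def)
  have 2: "AE x in lborel. F x * deriv \<psi> x = Q t x * deriv \<psi> x"
    using smooth_rep_AE[OF hu s] smooth_rep_AE[OF hv s] by eventually_elim (simp add: F_def Q_def)
  have "integrable lborel (\<lambda>x. 2 * ((u t x * weak_deriv (u t) x + v t x * weak_deriv (v t) x) * \<psi> x))"
    by (rule integrable_cong_AE[THEN iffD1, OF _ _ 1 i(3)]) (use m i(3) in simp_all)
  then show "integrable lborel (\<lambda>x. (u t x * weak_deriv (u t) x + v t x * weak_deriv (v t) x) * \<psi> x)" by simp
  have "(LINT x|lborel. F' x * \<psi> x) = (LINT x|lborel. 2 * ((u t x * weak_deriv (u t) x + v t x * weak_deriv (v t) x) * \<psi> x))"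
    by (rule integral_cong_AE[OF _ _ 1]) (use m i(3) in auto)
  moreover have "(LINT x|lborel. F x * deriv \<psi> x) = (LINT x|lborel. Q t x * deriv \<psi> x)"
    by (rule integral_cong_AE[OF _ _ 2]) (use m i(2) in auto)
  ultimately show "(LINT x|lborel. (u t x * weak_deriv (u t) x + v t x * weak_deriv (v t) x) * \<psi> x) = - (1 / 2) * (LINT x|lborel. Q t x * deriv \<psi> x)"
    using i(1) by simp
qed

text \<open>Products \<theta>(t) \<psi>(x) separate the variables: the inner integral of the weak
  equation becomes - A \<theta>' + B \<theta> with A the pairing of u with \<psi>, and
  \<open>weak_ode\<close> integrates it in time.\<close>

lemma tested_equation:
  fixes \<psi> :: "real \<Rightarrow> real"
  assumes \<psi>: "test_function UNIV \<psi>" and rt: "0 < r" "r < t" "t < T"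
  defines "B \<equiv> \<lambda>\<tau>. - (1 / 2) * (LINT x|lborel. Q \<tau> x * deriv \<psi> x) + \<beta> * (LINT x|lborel. v \<tau> x * \<psi> x)
      - \<mu> * (LINT x|lborel. u \<tau> x * deriv (deriv \<psi>) x)"
  shows "(LINT x|lborel. u t x * \<psi> x) - (LINT x|lborel. u r x * \<psi> x) = - (LINT \<tau>:{r..t}|lborel. B \<tau>)"
    "continuous_on {0..<T} B"
proof -
  note t1 = test_functionD(3)[OF \<psi>] and t2 = test_functionD(3)[OF test_functionD(3)[OF \<psi>]]
  obtain C where C: "C > 0" "\<And>x. \<bar>deriv \<psi> x\<bar> \<le> C" using test_function_bounded[OF t1] by blast
  have m1: "deriv \<psi> \<in> borel_measurable borel" by (rule borel_measurable_continuous_onI[OF test_functionD(1)[OF t1]])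
  note sq = square_integrable_test[OF \<psi>] square_integrable_test[OF t2]
  show Bc: "continuous_on {0..<T} B"
    unfolding B_def by (intro continuous_intros continuous_pair_Q[OF m1 C(2)] continuous_pair_u sq)
  show "(LINT x|lborel. u t x * \<psi> x) - (LINT x|lborel. u r x * \<psi> x) = - (LINT \<tau>:{r..t}|lborel. B \<tau>)"
  proof (rule weak_ode[OF _ _ _ rt])
    show "continuous_on {0<..<T} (\<lambda>t. LINT x|lborel. u t x * \<psi> x)"
      by (rule continuous_on_subset[OF continuous_pair_u(1)[OF sq(1)]]) auto
    show "continuous_on {0<..<T} B" by (rule continuous_on_subset[OF Bc]) auto
    fix \<theta> assume \<theta>: "test_function {0<..<T} \<theta>"
    have \<theta>': "test_function UNIV \<theta>" using \<theta> by (simp add: test_function_def)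
    have "0 = (LINT t:{0<..<T}|lborel. LINT x|lborel.
         - u t x * deriv (\<lambda>\<tau>. \<theta> \<tau> * \<psi> x) t
         + (u t x * weak_deriv (u t) x + v t x * weak_deriv (v t) x + \<beta> * v t x) * (\<theta> t * \<psi> x)
         - \<mu> * u t x * deriv (deriv (\<lambda>y. \<theta> t * \<psi> y)) x)"
      using weak[unfolded solves_distributionally_def, rule_format, OF test_function_prod[OF \<theta> \<psi>]] by (simp add: v_def)
    also have "\<dots> = (LINT t:{0<..<T}|lborel. - (LINT x|lborel. u t x * \<psi> x) * deriv \<theta> t + B t * \<theta> t)"
      unfolding set_lebesgue_integral_def
    proof (rule Bochner_Integration.integral_cong[OF refl])
      fix t
      show "indicator {0<..<T} t *\<^sub>R (LINT x|lborel.
         - u t x * deriv (\<lambda>\<tau>. \<theta> \<tau> * \<psi> x) t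
         + (u t x * weak_deriv (u t) x + v t x * weak_deriv (v t) x + \<beta> * v t x) * (\<theta> t * \<psi> x)
         - \<mu> * u t x * deriv (deriv (\<lambda>y. \<theta> t * \<psi> y)) x)
        = indicator {0<..<T} t *\<^sub>R (- (LINT x|lborel. u t x * \<psi> x) * deriv \<theta> t + B t * \<theta> t)"
      proof (cases "t \<in> {0<..<T}")
        case True
        then have t: "t \<in> {0..<T}" by auto
        have d1: "deriv (\<lambda>\<tau>. \<theta> \<tau> * \<psi> x) t = deriv \<theta> t * \<psi> x" for x
          by (intro DERIV_imp_deriv DERIV_cmult_right test_functionD(2)[OF \<theta>'])
        have "deriv (\<lambda>y. \<theta> t * \<psi> y) = (\<lambda>y. \<theta> t * deriv \<psi> y)"
          by (intro ext DERIV_imp_deriv DERIV_cmult test_functionD(2)[OF \<psi>])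
        then have d2: "deriv (deriv (\<lambda>y. \<theta> t * \<psi> y)) x = \<theta> t * deriv (deriv \<psi>) x" for x
          by (simp only:) (intro DERIV_imp_deriv DERIV_cmult test_functionD(2)[OF t1])
        define P where "P x = (u t x * weak_deriv (u t) x + v t x * weak_deriv (v t) x) * \<psi> x" for x
        note i = nonlinear_pairing[OF t \<psi>, folded P_def] square_integrable_mult[OF sq_u[OF t] sq(1)]
          square_integrable_mult[OF sq_v[OF t] sq(1)] square_integrable_mult[OF sq_u[OF t] sq(2)]
        have "(LINT x|lborel. - u t x * deriv (\<lambda>\<tau>. \<theta> \<tau> * \<psi> x) t
           + (u t x * weak_deriv (u t) x + v t x * weak_deriv (v t) x + \<beta> * v t x) * (\<theta> t * \<psi> x)
           - \<mu> * u t x * deriv (deriv (\<lambda>y. \<theta> t * \<psi> y)) x)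
          = (LINT x|lborel. - deriv \<theta> t * (u t x * \<psi> x) + \<theta> t * P x + \<beta> * \<theta> t * (v t x * \<psi> x) - \<mu> * \<theta> t * (u t x * deriv (deriv \<psi>) x))"
          unfolding d1 d2 P_def by (intro Bochner_Integration.integral_cong) (auto simp: algebra_simps)
        also have "\<dots> = - deriv \<theta> t * (LINT x|lborel. u t x * \<psi> x) + \<theta> t * (LINT x|lborel. P x)
            + \<beta> * \<theta> t * (LINT x|lborel. v t x * \<psi> x) - \<mu> * \<theta> t * (LINT x|lborel. u t x * deriv (deriv \<psi>) x)"
          using i by (simp del: minus_mult_left mult_minus_left)
        also have "\<dots> = - (LINT x|lborel. u t x * \<psi> x) * deriv \<theta> t + B t * \<theta> t"
          unfolding i(2) B_def by (simp add: algebra_simps)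
        finally show ?thesis by simp
      qed simp
    qed
    finally show "(LINT t:{0<..<T}|lborel. - (LINT x|lborel. u t x * \<psi> x) * deriv \<theta> t + B t * \<theta> t) = 0" by simp
  qed
qed

end

section \<open>Spatial cut-offs on the Fourier side\<close>

definition dilate :: "nat \<Rightarrow> (real \<Rightarrow> real) \<Rightarrow> real \<Rightarrow> real"
  where "dilate n k x = k (x / real (Suc n))"

text \<open>Unlike \<open>fourier\<close>, this is an absolutely convergent integral, with a value
  at every frequency and continuous there. The cut-off is a parameter because its first two
  derivatives appear as cut-offs too.\<close>

definition cut_ft :: "nat \<Rightarrow> (real \<Rightarrow> real) \<Rightarrow> (real \<Rightarrow> real) \<Rightarrow> real \<Rightarrow> complex"
  where "cut_ft n k f \<xi> = ft (\<lambda>x. complex_of_real (dilate n k x * f x)) \<xi>"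

lemma test_function_dilate:
  assumes "test_function UNIV k"
  shows "test_function UNIV (dilate n k)"
proof -
  obtain R where R: "R > 0" "\<And>x. \<bar>x\<bar> \<ge> R \<Longrightarrow> k x = 0" using test_function_bounded_support[OF assms] by blast
  show ?thesis
  proof (rule test_functionI[where K="{- R * real (Suc n)..R * real (Suc n)}"])
    have "C_k j (\<lambda>x. k ((1 / real (Suc n)) * x + 0))" for j
      by (rule C_k_compose_affine[OF bounded_linear_mult_right]) (use assms in \<open>simp add: test_function_def\<close>)
    then show "C_k j (dilate n k)" for j by (simp add: dilate_def[abs_def])
    fix x assume *: "dilate n k x \<noteq> 0"
    then have "\<bar>x / real (Suc n)\<bar> < R" using R(2)[of "x / real (Suc n)"] unfolding dilate_def by linarith
    then have "\<bar>x\<bar> < R * real (Suc n)" by (simp add: abs_divide divide_less_eq del: of_nat_Suc)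
    then show "x \<in> {- R * real (Suc n)..R * real (Suc n)}" by (simp add: abs_less_iff del: of_nat_Suc)
  qed auto
qed

lemma test_function_trig:
  assumes "test_function UNIV k"
  shows "test_function UNIV (\<lambda>x. dilate n k x * (a * cos (x * \<xi>) + b * sin (x * \<xi>)))"
proof -
  have d: "test_function UNIV (dilate n k)" by (rule test_function_dilate[OF assms])
  obtain R where R: "R > 0" "\<And>x. \<bar>x\<bar> \<ge> R \<Longrightarrow> dilate n k x = 0" using test_function_bounded_support[OF d] by blast
  show ?thesis
  proof (rule test_functionI[where K="{- R..R}"])
    show "C_k j (\<lambda>x. dilate n k x * (a * cos (x * \<xi>) + b * sin (x * \<xi>)))" for j
      using d by (intro C_k_mult C_k_trig) (simp add: test_function_def)
    fix x assume "dilate n k x * (a * cos (x * \<xi>) + b * sin (x * \<xi>)) \<noteq> 0"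
    then have "\<bar>x\<bar> < R" using R(2)[of x] by fastforce
    then show "x \<in> {- R..R}" by (simp add: abs_less_iff)
  qed auto
qed

lemma DERIV_dilate:
  assumes "test_function UNIV k"
  shows "(dilate n k has_real_derivative dilate n (deriv k) x / real (Suc n)) (at x)"
proof -
  have "((\<lambda>x. k (x / real (Suc n))) has_real_derivative deriv k (x / real (Suc n)) * (1 / real (Suc n))) (at x)"
    by (rule DERIV_chain2[OF test_functionD(2)[OF assms]]) (auto intro!: derivative_eq_intros)
  then show ?thesis by (simp add: dilate_def[abs_def])
qed

text \<open>Writing the result again as cut-offs times combinations of cosine and sine lets the
  second derivative follow by applying the lemma to each summand.\<close>

lemma deriv_trig:
  assumes k: "test_function UNIV k"
  shows "deriv (\<lambda>x. dilate n k x * (a * cos (x * \<xi>) + b * sin (x * \<xi>))) x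
    = dilate n (deriv k) x * ((a / real (Suc n)) * cos (x * \<xi>) + (b / real (Suc n)) * sin (x * \<xi>))
      + dilate n k x * ((b * \<xi>) * cos (x * \<xi>) + (- a * \<xi>) * sin (x * \<xi>))"
proof (rule DERIV_imp_deriv)
  have "((\<lambda>x. a * cos (x * \<xi>) + b * sin (x * \<xi>)) has_real_derivative (b * \<xi>) * cos (x * \<xi>) + (- a * \<xi>) * sin (x * \<xi>)) (at x)"
    by (auto intro!: derivative_eq_intros)
  from DERIV_mult[OF DERIV_dilate[OF k] this]
  show "((\<lambda>x. dilate n k x * (a * cos (x * \<xi>) + b * sin (x * \<xi>))) has_real_derivative
      dilate n (deriv k) x * ((a / real (Suc n)) * cos (x * \<xi>) + (b / real (Suc n)) * sin (x * \<xi>))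
      + dilate n k x * ((b * \<xi>) * cos (x * \<xi>) + (- a * \<xi>) * sin (x * \<xi>))) (at x)"
    by (rule DERIV_cong) (simp add: algebra_simps add_divide_distrib)
qed

lemma deriv_deriv_trig:
  assumes k: "test_function UNIV k"
  shows "deriv (deriv (\<lambda>x. dilate n k x * (a * cos (x * \<xi>) + b * sin (x * \<xi>)))) x
    = dilate n (deriv (deriv k)) x * ((a / (real (Suc n))\<^sup>2) * cos (x * \<xi>) + (b / (real (Suc n))\<^sup>2) * sin (x * \<xi>))
      + dilate n (deriv k) x * ((2 * b * \<xi> / real (Suc n)) * cos (x * \<xi>) + (- 2 * a * \<xi> / real (Suc n)) * sin (x * \<xi>))
      + dilate n k x * ((- a * \<xi>\<^sup>2) * cos (x * \<xi>) + (- b * \<xi>\<^sup>2) * sin (x * \<xi>))"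
proof -
  note k1 = test_functionD(3)[OF k]
  have e: "deriv (\<lambda>x. dilate n k x * (a * cos (x * \<xi>) + b * sin (x * \<xi>)))
    = (\<lambda>x. dilate n (deriv k) x * ((a / real (Suc n)) * cos (x * \<xi>) + (b / real (Suc n)) * sin (x * \<xi>))
      + dilate n k x * ((b * \<xi>) * cos (x * \<xi>) + (- a * \<xi>) * sin (x * \<xi>)))"
    by (rule ext) (rule deriv_trig[OF k])
  have "deriv (\<lambda>x. dilate n (deriv k) x * ((a / real (Suc n)) * cos (x * \<xi>) + (b / real (Suc n)) * sin (x * \<xi>))
      + dilate n k x * ((b * \<xi>) * cos (x * \<xi>) + (- a * \<xi>) * sin (x * \<xi>))) x
    = deriv (\<lambda>x. dilate n (deriv k) x * ((a / real (Suc n)) * cos (x * \<xi>) + (b / real (Suc n)) * sin (x * \<xi>))) x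
      + deriv (\<lambda>x. dilate n k x * ((b * \<xi>) * cos (x * \<xi>) + (- a * \<xi>) * sin (x * \<xi>))) x"
    by (intro DERIV_imp_deriv DERIV_add test_functionD(2) test_function_trig k k1)
  then show ?thesis
    unfolding e deriv_trig[OF k] deriv_trig[OF k1] by (simp add: algebra_simps power2_eq_square del: of_nat_Suc)
qed

lemma dilate_measurable:
  "test_function UNIV k \<Longrightarrow> dilate n k \<in> borel_measurable borel"
  by (rule borel_measurable_continuous_onI[OF test_functionD(1)[OF test_function_dilate]])

lemma ft_of_real:
  fixes f :: "real \<Rightarrow> real"
  assumes "integrable lborel f"
  shows "ft (\<lambda>x. complex_of_real (f x)) \<xi> = of_real (LINT x|lborel. f x * cos (x * \<xi>)) - \<i> * of_real (LINT x|lborel. f x * sin (x * \<xi>))"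
proof -
  have [measurable]: "f \<in> borel_measurable borel" using assms by auto
  have i: "integrable lborel (\<lambda>x. f x * cos (x * \<xi>))" "integrable lborel (\<lambda>x. f x * sin (x * \<xi>))"
    by (rule Bochner_Integration.integrable_bound[OF assms]; auto simp: abs_mult intro!: mult_left_le)+
  have "ft (\<lambda>x. complex_of_real (f x)) \<xi> = (LINT x|lborel. complex_of_real (f x * cos (x * \<xi>)) - \<i> * complex_of_real (f x * sin (x * \<xi>)))"
    unfolding ft_def by (intro Bochner_Integration.integral_cong) (auto simp: complex_eq_iff)
  also have "\<dots> = (LINT x|lborel. complex_of_real (f x * cos (x * \<xi>))) - (LINT x|lborel. \<i> * complex_of_real (f x * sin (x * \<xi>)))"
    using i by (intro Bochner_Integration.integral_diff integrable_mult_right) (simp_all only: complex_of_real_integrable_eq)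
  also have "\<dots> = of_real (LINT x|lborel. f x * cos (x * \<xi>)) - \<i> * of_real (LINT x|lborel. f x * sin (x * \<xi>))"
    by (simp only: integral_mult_right_zero integral_complex_of_real)
  finally show ?thesis .
qed

text \<open>Integrating factor: the derivative of \<open>exp (- l * (t - x)) * a x\<close> in x is
  \<open>- exp (- l * (t - x)) * g x\<close>, because a' = - b = - l a - g.\<close>

lemma duhamel:
  fixes a b g :: "real \<Rightarrow> complex" and l :: complex
  assumes rt: "r \<le> t" and b: "continuous_on {r..t} b"
    and a: "\<And>x. x \<in> {r..t} \<Longrightarrow> a x - a r = - (LINT \<tau>:{r..x}|lborel. b \<tau>)"
    and g: "\<And>x. x \<in> {r..t} \<Longrightarrow> b x = l * a x + g x"
  shows "a t = exp (- l * of_real (t - r)) * a r - (LINT \<tau>:{r..t}|lborel. exp (- l * of_real (t - \<tau>)) * g \<tau>)"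
proof -
  have a': "a x = a r - integral {r..x} b" if "x \<in> {r..t}" for x
  proof -
    have "set_integrable lborel {r..x} b"
      by (rule borel_integrable_atLeastAtMost'[OF continuous_on_subset[OF b]]) (use that in auto)
    from set_borel_integral_eq_integral(2)[OF this] a[OF that] show ?thesis by (simp add: algebra_simps)
  qed
  have ad: "(a has_vector_derivative - b x) (at x within {r..t})" if x: "x \<in> {r..t}" for x
  proof (rule has_vector_derivative_transform[OF x])
    show "a y = a r - integral {r..y} b" if "y \<in> {r..t}" for y by (rule a'[OF that])
    show "((\<lambda>y. a r - integral {r..y} b) has_vector_derivative - b x) (at x within {r..t})"
      using has_vector_derivative_diff[OF has_vector_derivative_const integral_has_vector_derivative[OF b x]] by simp
  qed
  have ac: "continuous_on {r..t} a"
    unfolding continuous_on_eq_continuous_within using has_vector_derivative_continuous[OF ad] by blast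
  have ed: "((\<lambda>x. exp (- l * of_real (t - x))) has_vector_derivative l * exp (- l * of_real (t - x))) (at x within {r..t})" for x
  proof -
    have 1: "((\<lambda>z. - l * (of_real t - z)) has_field_derivative l) (at (of_real x))"
      by (rule derivative_eq_intros refl)+ simp
    from DERIV_chain2[OF DERIV_exp 1]
    have "((\<lambda>z. exp (- l * (of_real t - z))) has_field_derivative exp (- l * (of_real t - of_real x)) * l) (at (of_real x))" .
    from has_vector_derivative_real_field[OF this] show ?thesis by (simp only: of_real_diff mult.commute)
  qed
  have "(LINT x|lborel. indicator {r..t} x *\<^sub>R (exp (- l * of_real (t - x)) * - b x + l * exp (- l * of_real (t - x)) * a x))
      = exp (- l * of_real (t - t)) * a t - exp (- l * of_real (t - r)) * a r"
    by (rule integral_FTC_atLeastAtMost[OF rt has_vector_derivative_mult[OF ed ad]])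
      (auto intro!: continuous_intros b ac)
  also have "(LINT x|lborel. indicator {r..t} x *\<^sub>R (exp (- l * of_real (t - x)) * - b x + l * exp (- l * of_real (t - x)) * a x))
      = (LINT x|lborel. - (indicator {r..t} x *\<^sub>R (exp (- l * of_real (t - x)) * g x)))"
    by (intro Bochner_Integration.integral_cong) (auto simp: indicator_def g algebra_simps)
  finally show ?thesis by (simp add: set_lebesgue_integral_def algebra_simps)
qed

lemma integrable_cut:
  fixes f :: "real \<Rightarrow> real"
  assumes k: "test_function UNIV k" and f: "square_integrable f"
  shows "integrable lborel (\<lambda>x. dilate n k x * f x)"
  by (intro square_integrable_mult square_integrable_test test_function_dilate k f)

lemma square_integrable_cut:
  fixes f :: "real \<Rightarrow> real"
  assumes k: "test_function UNIV k" "\<And>x. \<bar>k x\<bar> \<le> K" and f: "square_integrable f"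
  shows "square_integrable (\<lambda>x. dilate n k x * f x)" "L2 (\<lambda>x. dilate n k x * f x) \<le> K * L2 f"
proof -
  have b: "norm (dilate n k x) \<le> K" for x using k(2) by (simp add: dilate_def)
  show "square_integrable (\<lambda>x. dilate n k x * f x)"
    by (rule square_integrable_mult_bounded(1)[OF f _ b]) (use dilate_measurable[OF k(1)] in simp)
  have K: "0 \<le> K" using k(2)[of 0] by linarith
  have "L2 (\<lambda>x. dilate n k x * f x) \<le> L2 (\<lambda>x. K *\<^sub>R f x)"
    using b K by (intro L2_mono_AE square_integrable_scaleR f) (auto simp: abs_mult intro!: mult_right_mono)
  then show "L2 (\<lambda>x. dilate n k x * f x) \<le> K * L2 f" using K L2_scaleR[of K f] by simp
qed

lemma cut_ft_L2:
  fixes f :: "real \<Rightarrow> real"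
  assumes k: "test_function UNIV k" "\<And>x. \<bar>k x\<bar> \<le> K" and f: "square_integrable f"
  shows "square_integrable (cut_ft n k f)" "L2 (cut_ft n k f) \<le> sqrt (2 * pi) * (K * L2 f)"
    "L2 (\<lambda>\<xi>. fourier f \<xi> - cut_ft n k f \<xi>) = sqrt (2 * pi) * L2 (\<lambda>x. f x - dilate n k x * f x)"
proof -
  let ?h = "\<lambda>x. complex_of_real (dilate n k x * f x)"
  have i: "integrable lborel ?h" using integrable_cut[OF k(1) f] by (simp only: complex_of_real_integrable_eq)
  have h: "square_integrable ?h" by (rule square_integrable_of_real[OF square_integrable_cut(1)[OF k f]])
  have e: "cut_ft n k f = ft ?h" by (rule ext) (simp add: cut_ft_def)
  show "square_integrable (cut_ft n k f)" unfolding e by (rule plancherel_bound[OF i h])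
  have "L2 (ft ?h) \<le> sqrt (2 * pi) * L2 ?h" by (rule plancherel_bound[OF i h])
  also have "L2 ?h \<le> K * L2 f" unfolding L2_of_real by (rule square_integrable_cut(2)[OF k f])
  finally show "L2 (cut_ft n k f) \<le> sqrt (2 * pi) * (K * L2 f)" unfolding e by (simp add: mult_left_mono)
  have "is_fourier (\<lambda>x. of_real (f x) - ?h x) (\<lambda>\<xi>. fourier f \<xi> - ft ?h \<xi>)"
    by (intro is_fourier_diff square_integrable_of_real f is_fourier_fourier h is_fourier_ft i)
  from fourier_plancherel[OF square_integrable_diff[OF square_integrable_of_real[OF f] h] this]
  have "(L2 (\<lambda>\<xi>. fourier f \<xi> - ft ?h \<xi>))\<^sup>2 = 2 * pi * (L2 (\<lambda>x. complex_of_real (f x - dilate n k x * f x)))\<^sup>2"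
    by (simp only: of_real_diff)
  also have "\<dots> = (sqrt (2 * pi) * L2 (\<lambda>x. f x - dilate n k x * f x))\<^sup>2"
    unfolding L2_of_real power_mult_distrib by simp
  finally show "L2 (\<lambda>\<xi>. fourier f \<xi> - cut_ft n k f \<xi>) = sqrt (2 * pi) * L2 (\<lambda>x. f x - dilate n k x * f x)"
    unfolding e by (rule power2_eq_imp_eq) simp_all
qed

lemma dilate_tendsto:
  assumes k: "test_function UNIV k" "k 0 = 1"
  shows "(\<lambda>n. dilate n k x) \<longlonglongrightarrow> 1"
proof -
  have "(\<lambda>n. x * inverse (real (Suc n))) \<longlonglongrightarrow> x * 0"
    by (intro tendsto_intros LIMSEQ_inverse_real_of_nat)
  then have "(\<lambda>n. x / real (Suc n)) \<longlonglongrightarrow> 0" by (simp add: divide_inverse)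
  from continuous_on_tendsto_compose[OF test_functionD(1)[OF k(1)] this] show ?thesis using k(2) by (simp add: dilate_def)
qed

lemma cut_tendsto_L2:
  fixes f :: "real \<Rightarrow> real"
  assumes k: "test_function UNIV k" "\<And>x. \<bar>k x\<bar> \<le> K" "k 0 = 1" and f: "square_integrable f"
  shows "(\<lambda>n. L2 (\<lambda>x. f x - dilate n k x * f x)) \<longlonglongrightarrow> 0"
    "L2 (\<lambda>x. f x - dilate n k x * f x) \<le> (1 + K) * L2 f"
proof -
  have b: "\<bar>dilate n k x\<bar> \<le> K" for n x using k(2) by (simp add: dilate_def)
  have c: "norm (f x - dilate n k x * f x) \<le> (1 + K) * norm (f x)" for n x
  proof -
    have "\<bar>f x - dilate n k x * f x\<bar> \<le> \<bar>f x\<bar> + \<bar>dilate n k x * f x\<bar>" by (rule abs_triangle_ineq4)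
    also have "\<bar>dilate n k x * f x\<bar> \<le> K * \<bar>f x\<bar>" using b[of n x] by (auto simp: abs_mult intro!: mult_right_mono)
    finally show ?thesis by (simp add: algebra_simps)
  qed
  show "(\<lambda>n. L2 (\<lambda>x. f x - dilate n k x * f x)) \<longlonglongrightarrow> 0"
  proof (rule L2_dominated[OF f _ c])
    show "(\<lambda>x. f x - dilate n k x * f x) \<in> borel_measurable lborel" for n
      using square_integrable_measurable[OF f] dilate_measurable[OF k(1)] by simp
    have "(\<lambda>n. f x - dilate n k x * f x) \<longlonglongrightarrow> f x - 1 * f x" for x by (intro tendsto_intros dilate_tendsto k)
    then show "(\<lambda>n. f x - dilate n k x * f x) \<longlonglongrightarrow> 0" for x by simp
  qed
  have K: "0 \<le> K" using k(2)[of 0] by linarith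
  have "L2 (\<lambda>x. f x - dilate n k x * f x) \<le> L2 (\<lambda>x. (1 + K) *\<^sub>R f x)"
    using c K by (intro L2_mono_AE square_integrable_scaleR f) (auto simp: abs_mult)
  then show "L2 (\<lambda>x. f x - dilate n k x * f x) \<le> (1 + K) * L2 f" using K L2_scaleR[of "1 + K" f] by simp
qed

lemma cut_ft_measurable:
  "integrable lborel (\<lambda>x. dilate n k x * f x) \<Longrightarrow> continuous_on UNIV (cut_ft n k f)"
  unfolding cut_ft_def[abs_def]
  by (rule continuous_on_ft) (simp only: complex_of_real_integrable_eq)

text \<open>Normalized at the origin, because the dilates converge pointwise to the value
  there.\<close>

definition bump :: "real \<Rightarrow> real"
  where "bump x = plateau 1 (- 1) 1 x / plateau 1 (- 1) 1 0"

lemma bump: "test_function UNIV bump" "bump 0 = 1"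
proof -
  have p: "plateau 1 (- 1) 1 0 \<noteq> 0" by (simp add: plateau_def flat_def)
  show "bump 0 = 1" using p by (simp add: bump_def)
  show "test_function UNIV bump"
  proof (rule test_functionI[where K="{-1..1}"])
    show "C_k k bump" for k
      using C_k_mult[OF C_k_plateau C_k_const, of k 1 "-1" 1 "1 / plateau 1 (- 1) 1 0"] by (simp add: bump_def[abs_def])
    show "x \<in> {-1..1}" if "bump x \<noteq> 0" for x
      using that plateau_support[of 1 "-1" 1 x] by (auto simp: bump_def)
  qed auto
qed

lemma bump_bounds:
  obtains K where "\<And>x. \<bar>bump x\<bar> \<le> K" "\<And>x. \<bar>deriv bump x\<bar> \<le> K" "\<And>x. \<bar>deriv (deriv bump) x\<bar> \<le> K"
proof -
  note t1 = test_functionD(3)[OF bump(1)]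
  obtain a where a: "\<And>x. \<bar>bump x\<bar> \<le> a" using test_function_bounded[OF bump(1)] by blast
  obtain b where b: "\<And>x. \<bar>deriv bump x\<bar> \<le> b" using test_function_bounded[OF t1] by blast
  obtain c where c: "\<And>x. \<bar>deriv (deriv bump) x\<bar> \<le> c" using test_function_bounded[OF test_functionD(3)[OF t1]] by blast
  show thesis by (rule that[of "max a (max b c)"]) (meson a b c max.coboundedI1 max.coboundedI2)+
qed

text \<open>Test functions are real, so the exponential is handled through combinations of cosine
  and sine with real coefficients, and the complex transform is reassembled from them.\<close>

lemma cut_trig_integral:
  fixes f :: "real \<Rightarrow> real" and \<xi> :: real
  assumes i: "integrable lborel (\<lambda>x. dilate n k x * f x)"
  defines "C \<equiv> LINT x|lborel. dilate n k x * f x * cos (x * \<xi>)" and "S \<equiv> LINT x|lborel. dilate n k x * f x * sin (x * \<xi>)"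
  shows "integrable lborel (\<lambda>x. f x * (dilate n k x * (a * cos (x * \<xi>) + b * sin (x * \<xi>))))"
    "(LINT x|lborel. f x * (dilate n k x * (a * cos (x * \<xi>) + b * sin (x * \<xi>)))) = a * C + b * S"
    "cut_ft n k f \<xi> = of_real C - \<i> * of_real S"
proof -
  let ?h = "\<lambda>x. dilate n k x * f x"
  have [measurable]: "?h \<in> borel_measurable borel" using i by auto
  have j: "integrable lborel (\<lambda>x. ?h x * cos (x * \<xi>))" "integrable lborel (\<lambda>x. ?h x * sin (x * \<xi>))"
    by (rule Bochner_Integration.integrable_bound[OF i], simp, simp add: abs_mult mult_left_le)+
  have e: "f x * (dilate n k x * (a * cos (x * \<xi>) + b * sin (x * \<xi>))) = a * (?h x * cos (x * \<xi>)) + b * (?h x * sin (x * \<xi>))" for x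
    by (simp add: algebra_simps)
  show "integrable lborel (\<lambda>x. f x * (dilate n k x * (a * cos (x * \<xi>) + b * sin (x * \<xi>))))"
    unfolding e by (intro Bochner_Integration.integrable_add integrable_mult_right j)
  show "(LINT x|lborel. f x * (dilate n k x * (a * cos (x * \<xi>) + b * sin (x * \<xi>)))) = a * C + b * S"
    unfolding e C_def S_def
    by (subst Bochner_Integration.integral_add) (auto intro!: integrable_mult_right j simp del: mult_eq_0_iff)
  show "cut_ft n k f \<xi> = of_real C - \<i> * of_real S"
    unfolding cut_ft_def C_def S_def by (rule ft_of_real[OF i])
qed

lemma norm_of_real_mult_diff:
  "norm (complex_of_real (a * p) - complex_of_real (a * q)) = \<bar>a\<bar> * \<bar>p - q\<bar>"
proof -
  have "complex_of_real (a * p) - complex_of_real (a * q) = complex_of_real (a * (p - q))"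
    by (simp add: right_diff_distrib)
  then show ?thesis by (simp only: norm_of_real abs_mult)
qed

text \<open>Cauchy-Schwarz with the indicator: on a bounded frequency window, smallness in mean
  square gives smallness of the integral.\<close>

lemma nn_integral_Icc_le_L2:
  fixes h :: "real \<Rightarrow> 'b::{real_normed_vector, second_countable_topology}"
  assumes h: "square_integrable h"
  shows "(\<integral>\<^sup>+\<xi>. indicator {-M..M} \<xi> * ennreal (norm (h \<xi>)) \<partial>lborel) \<le> ennreal (L2 (indicator {-M..M} :: real \<Rightarrow> real) * L2 h)"
proof -
  let ?I = "indicator {-M..M} :: real \<Rightarrow> real"
  have I: "square_integrable ?I"
  proof -
    have "(\<lambda>x. norm (indicator {-M..M} x :: complex)) = ?I" by (auto simp: indicator_def)
    then show ?thesis using square_integrable_norm[OF square_integrable_indicator[of "-M" M]] by simp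
  qed
  have "(\<integral>\<^sup>+\<xi>. indicator {-M..M} \<xi> * ennreal (norm (h \<xi>)) \<partial>lborel) = (\<integral>\<^sup>+\<xi>. ennreal (norm (?I \<xi>) * norm (h \<xi>)) \<partial>lborel)"
    by (intro nn_integral_cong) (auto simp: indicator_def)
  also have "\<dots> = ennreal (LINT \<xi>|lborel. norm (?I \<xi>) * norm (h \<xi>))"
    by (intro nn_integral_eq_integral square_integrable_norm_mult I h) simp
  also have "\<dots> \<le> ennreal (L2 ?I * L2 h)" by (intro ennreal_leI cauchy_schwarz I h)
  finally show ?thesis .
qed

lemma borel_measurable_strip:
  fixes h :: "real \<Rightarrow> real \<Rightarrow> complex"
  assumes "continuous_on ({r..t} \<times> UNIV) (\<lambda>p. h (fst p) (snd p))"
  shows "(\<lambda>p. indicator {r..t} (fst p) *\<^sub>R h (fst p) (snd p)) \<in> borel_measurable (borel \<Otimes>\<^sub>M borel)"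
proof -
  have "closed ({r..t} \<times> (UNIV :: real set))" by (intro closed_Times) auto
  then have "(\<lambda>p. indicator ({r..t} \<times> UNIV) p *\<^sub>R h (fst p) (snd p)) \<in> borel_measurable borel"
    by (intro borel_measurable_continuous_on_indicator assms) auto
  moreover have "indicator ({r..t} \<times> (UNIV :: real set)) p = (indicator {r..t} (fst p) :: real)" for p
    by (auto simp: indicator_def mem_Times_iff)
  ultimately show ?thesis unfolding borel_prod by simp
qed

section \<open>The truncated equation and its defect\<close>

context flow
begin

definition N :: "real \<Rightarrow> real \<Rightarrow> complex"
  where "N \<tau> \<xi> = ft (\<lambda>x. complex_of_real (Q \<tau> x)) \<xi>"

definition lam :: "real \<Rightarrow> complex"
  where "lam \<xi> = of_real (\<mu> * \<xi>\<^sup>2) - \<i> * of_real (\<beta> * sgn \<xi>)"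

lemma borel_measurable_lam [measurable]: "lam \<in> borel_measurable borel"
  unfolding lam_def[abs_def] by measurable

lemma norm_exp_lam: "norm (exp (- lam \<xi> * of_real c)) = exp (- (\<mu> * \<xi>\<^sup>2 * c))"
  by (simp add: lam_def norm_exp_eq_Re)

lemma integrable_cut_Q:
  assumes "t \<in> {0..<T}" "test_function UNIV k"
  shows "integrable lborel (\<lambda>x. dilate n k x * Q t x)"
proof -
  obtain C where C: "\<And>x. \<bar>k x\<bar> \<le> C" using test_function_bounded[OF assms(2)] by blast
  show ?thesis
    using integrable_Q_mult[OF assms(1) dilate_measurable[OF assms(2)], of n C] C by (simp add: dilate_def mult.commute)
qed

lemma integrable_Q_complex: "t \<in> {0..<T} \<Longrightarrow> integrable lborel (\<lambda>x. complex_of_real (Q t x))"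
  using integrable_Q by (simp only: complex_of_real_integrable_eq)

lemma norm_N_le: "t \<in> {0..<T} \<Longrightarrow> norm (N t \<xi>) \<le> 2 * (L2 (u t))\<^sup>2"
  unfolding N_def using ft_bound[of "\<lambda>x. complex_of_real (Q t x)" \<xi>] integral_Q[of t] Q_nonneg by simp

lemma continuous_D: "t \<in> {0..<T} \<Longrightarrow> continuous_on {0..<T} (\<lambda>\<tau>. D \<tau> t)"
proof (rule continuous_onI_D[where K="\<lambda>_. 1"])
  fix a b assume t: "t \<in> {0..<T}" and ab: "a \<in> {0..<T}" "b \<in> {0..<T}"
  have "\<bar>D b t - D a t\<bar> \<le> sobolev_norm s (\<lambda>x. (u b x - u t x) - (u a x - u t x))"
    unfolding D_def by (intro sobolev_norm_diff_abs in_sobolev_diff sobolev_u t ab)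
  also have "\<dots> = D b a" by (simp add: D_def)
  finally show "norm (D b t - D a t) \<le> 1 * (D b a + (D b a)\<^sup>2)" by (simp add: add_increasing2)
qed

lemma D_self: "t \<in> {0..<T} \<Longrightarrow> D t t = 0"
  unfolding D_def in_sobolev_diff(2)[OF sobolev_u sobolev_u] by (simp add: L2_def)

text \<open>Continuity in frequency at each time, together with continuity in time uniformly in the
  frequency, gives joint continuity. It is the source of the measurability in both variables needed
  for the exchange of integrals.\<close>

lemma joint_continuity:
  fixes h :: "real \<Rightarrow> real \<Rightarrow> complex"
  assumes c: "\<And>t. t \<in> {0..<T} \<Longrightarrow> continuous_on UNIV (h t)"
    and b: "\<And>t \<tau> \<xi>. t \<in> {0..<T} \<Longrightarrow> \<tau> \<in> {0..<T} \<Longrightarrow> norm (h \<tau> \<xi> - h t \<xi>) \<le> K t * (D \<tau> t + (D \<tau> t)\<^sup>2)"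
  shows "continuous_on ({0..<T} \<times> UNIV) (\<lambda>p. h (fst p) (snd p))"
  unfolding continuous_on_def
proof
  fix p :: "real \<times> real" assume p: "p \<in> {0..<T} \<times> UNIV"
  obtain t \<xi> where [simp]: "p = (t, \<xi>)" by (cases p)
  have t: "t \<in> {0..<T}" using p by simp
  let ?F = "at p within {0..<T} \<times> UNIV"
  have 1: "((\<lambda>q. D (fst q) t) \<longlongrightarrow> 0) ?F"
  proof -
    have "continuous_on ({0..<T} \<times> (UNIV :: real set)) (\<lambda>q. D (fst q) t)"
      by (rule continuous_on_compose2[OF continuous_D[OF t]]) (auto intro!: continuous_intros)
    from bspec[OF this[unfolded continuous_on_def] p] show ?thesis using D_self[OF t] by simp
  qed
  have 2: "((\<lambda>q. h t (snd q)) \<longlongrightarrow> h t \<xi>) ?F"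
  proof -
    have "continuous_on ({0..<T} \<times> (UNIV :: real set)) (\<lambda>q. h t (snd q))"
      by (rule continuous_on_compose2[OF c[OF t]]) (auto intro!: continuous_intros)
    from bspec[OF this[unfolded continuous_on_def] p] show ?thesis by simp
  qed
  have "((\<lambda>q. K t * (D (fst q) t + (D (fst q) t)\<^sup>2)) \<longlongrightarrow> K t * (0 + 0\<^sup>2)) ?F"
    by (intro tendsto_intros 1)
  then have l: "((\<lambda>q. K t * (D (fst q) t + (D (fst q) t)\<^sup>2)) \<longlongrightarrow> 0) ?F" by simp
  have "((\<lambda>q. h (fst q) (snd q) - h t (snd q)) \<longlongrightarrow> 0) ?F"
  proof (rule Lim_null_comparison[OF _ l])
    show "\<forall>\<^sub>F q in ?F. norm (h (fst q) (snd q) - h t (snd q)) \<le> K t * (D (fst q) t + (D (fst q) t)\<^sup>2)"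
      unfolding eventually_at_filter by (intro always_eventually allI impI b[OF t]) auto
  qed
  from tendsto_add[OF this 2] show "((\<lambda>p. h (fst p) (snd p)) \<longlongrightarrow> h (fst p) (snd p)) ?F" by simp
qed

lemma continuous_N: "continuous_on ({0..<T} \<times> UNIV) (\<lambda>p. N (fst p) (snd p))"
proof (rule joint_continuity[where K="\<lambda>t. 2 + 4 * L2 (u t)"])
  show "continuous_on UNIV (N t)" if "t \<in> {0..<T}" for t
    unfolding N_def[abs_def] by (rule continuous_on_ft[OF integrable_Q_complex[OF that]])
  fix t \<tau> \<xi> assume *: "t \<in> {0..<T}" "\<tau> \<in> {0..<T}"
  have "N \<tau> \<xi> - N t \<xi> = ft (\<lambda>x. complex_of_real (Q \<tau> x) - complex_of_real (Q t x)) \<xi>"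
    unfolding N_def by (intro ft_diff[symmetric] integrable_Q_complex *)
  also have "norm \<dots> \<le> (LINT x|lborel. norm (complex_of_real (Q \<tau> x) - complex_of_real (Q t x)))" by (rule ft_bound)
  also have "\<dots> = (LINT x|lborel. \<bar>Q \<tau> x - Q t x\<bar>)" by (simp only: of_real_diff[symmetric] norm_of_real)
  also note integral_Q_diff[OF *(2,1)]
  finally show "norm (N \<tau> \<xi> - N t \<xi>) \<le> (2 + 4 * L2 (u t)) * (D \<tau> t + (D \<tau> t)\<^sup>2)" .
qed

lemma continuous_cut_Q:
  assumes k: "test_function UNIV k"
  shows "continuous_on ({0..<T} \<times> UNIV) (\<lambda>p. cut_ft n k (Q (fst p)) (snd p))"
proof -
  obtain C where C: "C > 0" "\<And>x. \<bar>k x\<bar> \<le> C" using test_function_bounded[OF k] by blast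
  show ?thesis
  proof (rule joint_continuity[where K="\<lambda>t. C * (2 + 4 * L2 (u t))"])
    show "continuous_on UNIV (cut_ft n k (Q t))" if "t \<in> {0..<T}" for t
      by (rule cut_ft_measurable[OF integrable_cut_Q[OF that k]])
    fix t \<tau> \<xi> assume *: "t \<in> {0..<T}" "\<tau> \<in> {0..<T}"
    note i = integrable_cut_Q[OF *(1) k] integrable_cut_Q[OF *(2) k]
    have iq: "integrable lborel (\<lambda>x. \<bar>Q \<tau> x - Q t x\<bar>)"
      by (intro integrable_abs Bochner_Integration.integrable_diff integrable_Q *)
    have "cut_ft n k (Q \<tau>) \<xi> - cut_ft n k (Q t) \<xi> = ft (\<lambda>x. complex_of_real (dilate n k x * Q \<tau> x) - complex_of_real (dilate n k x * Q t x)) \<xi>"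
      unfolding cut_ft_def using i by (intro ft_diff[symmetric]) (simp_all only: complex_of_real_integrable_eq)
    then have "norm (cut_ft n k (Q \<tau>) \<xi> - cut_ft n k (Q t) \<xi>) \<le> (LINT x|lborel. norm (complex_of_real (dilate n k x * Q \<tau> x) - complex_of_real (dilate n k x * Q t x)))"
      by (simp only: ft_bound)
    also have "\<dots> \<le> (LINT x|lborel. C * \<bar>Q \<tau> x - Q t x\<bar>)"
    proof (rule integral_mono_AE')
      show "integrable lborel (\<lambda>x. C * \<bar>Q \<tau> x - Q t x\<bar>)" using iq by (rule integrable_mult_right)
      show "AE x in lborel. norm (complex_of_real (dilate n k x * Q \<tau> x) - complex_of_real (dilate n k x * Q t x)) \<le> C * \<bar>Q \<tau> x - Q t x\<bar>"
        unfolding norm_of_real_mult_diff dilate_def by (rule AE_I2, rule mult_right_mono, rule C(2)) simp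
    qed (use C(1) in simp)
    also have "\<dots> = C * (LINT x|lborel. \<bar>Q \<tau> x - Q t x\<bar>)" by (rule integral_mult_right_zero)
    also have "\<dots> \<le> C * ((2 + 4 * L2 (u t)) * (D \<tau> t + (D \<tau> t)\<^sup>2))"
      by (rule mult_left_mono[OF integral_Q_diff[OF *(2,1)]]) (use C(1) in simp)
    finally show "norm (cut_ft n k (Q \<tau>) \<xi> - cut_ft n k (Q t) \<xi>) \<le> C * (2 + 4 * L2 (u t)) * (D \<tau> t + (D \<tau> t)\<^sup>2)"
      by (simp only: mult.assoc)
  qed
qed

lemma continuous_cut_L2:
  assumes k: "test_function UNIV k" and sq: "\<And>t. t \<in> {0..<T} \<Longrightarrow> square_integrable (w t)"
    and d: "\<And>\<tau> t. \<tau> \<in> {0..<T} \<Longrightarrow> t \<in> {0..<T} \<Longrightarrow> L2 (\<lambda>x. w \<tau> x - w t x) \<le> D \<tau> t"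
  shows "continuous_on ({0..<T} \<times> UNIV) (\<lambda>p. cut_ft n k (w (fst p)) (snd p))"
proof (rule joint_continuity[where K="\<lambda>t. L2 (dilate n k)"])
  have dk: "square_integrable (dilate n k)" by (intro square_integrable_test test_function_dilate k)
  show "continuous_on UNIV (cut_ft n k (w t))" if "t \<in> {0..<T}" for t
    by (rule cut_ft_measurable[OF integrable_cut[OF k sq[OF that]]])
  fix t \<tau> \<xi> assume *: "t \<in> {0..<T}" "\<tau> \<in> {0..<T}"
  note i = integrable_cut[OF k sq[OF *(1)], of n] integrable_cut[OF k sq[OF *(2)], of n]
  have "cut_ft n k (w \<tau>) \<xi> - cut_ft n k (w t) \<xi> = ft (\<lambda>x. complex_of_real (dilate n k x * w \<tau> x) - complex_of_real (dilate n k x * w t x)) \<xi>"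
    unfolding cut_ft_def using i by (intro ft_diff[symmetric]) (simp_all only: complex_of_real_integrable_eq)
  also have "norm \<dots> \<le> (LINT x|lborel. norm (complex_of_real (dilate n k x * w \<tau> x) - complex_of_real (dilate n k x * w t x)))" by (rule ft_bound)
  also have "\<dots> = (LINT x|lborel. norm (dilate n k x) * norm (w \<tau> x - w t x))"
    by (simp only: norm_of_real_mult_diff real_norm_def)
  also have "\<dots> \<le> L2 (dilate n k) * L2 (\<lambda>x. w \<tau> x - w t x)"
    by (intro cauchy_schwarz dk square_integrable_diff sq *)
  also have "\<dots> \<le> L2 (dilate n k) * (D \<tau> t + (D \<tau> t)\<^sup>2)"
    using d[OF *(2,1)] zero_le_power2[of "D \<tau> t"] by (intro mult_left_mono) (linarith, simp)
  finally show "norm (cut_ft n k (w \<tau>) \<xi> - cut_ft n k (w t) \<xi>) \<le> L2 (dilate n k) * (D \<tau> t + (D \<tau> t)\<^sup>2)" .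
qed

lemmas continuous_cut_u = continuous_cut_L2[of _ u, OF _ sq_u L2_diff_u]
lemmas continuous_cut_v = continuous_cut_L2[of _ v, OF _ sq_v L2_diff_v]

text \<open>The equation tested against \<open>cis (- x \<xi>)\<close> times a cut-off \<open>bump (x / (n + 1))\<close>; letting \<open>n \<rightarrow> \<infinity>\<close> yields the mild formula.\<close>

definition cut_rhs :: "nat \<Rightarrow> real \<Rightarrow> real \<Rightarrow> complex"
  where "cut_rhs n \<tau> \<xi> =
    - (1 / 2) * (cut_ft n (deriv bump) (Q \<tau>) \<xi> / of_real (real (Suc n)) - \<i> * of_real \<xi> * cut_ft n bump (Q \<tau>) \<xi>)
    + of_real \<beta> * cut_ft n bump (v \<tau>) \<xi>
    - of_real \<mu> * (cut_ft n (deriv (deriv bump)) (u \<tau>) \<xi> / of_real ((real (Suc n))\<^sup>2)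
        - 2 * \<i> * of_real \<xi> / of_real (real (Suc n)) * cut_ft n (deriv bump) (u \<tau>) \<xi>
        - of_real (\<xi>\<^sup>2) * cut_ft n bump (u \<tau>) \<xi>)"

lemma cut_equation:
  assumes rt: "0 < r" "r \<le> t" "t < T"
  shows "cut_ft n bump (u t) \<xi> - cut_ft n bump (u r) \<xi> = - (LINT \<tau>:{r..t}|lborel. cut_rhs n \<tau> \<xi>)"
\<comment> \<open>\<open>tested_equation\<close> needs r < t, whereas Duhamel's formula also uses
  this identity at the left end point.\<close>
proof (cases "r = t")
  case True
  have "AE x in lborel. indicator {t..t} x *\<^sub>R cut_rhs n x \<xi> = 0"
    using AE_lborel_singleton[of t] by eventually_elim auto
  then have "(LINT \<tau>:{t..t}|lborel. cut_rhs n \<tau> \<xi>) = 0"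
    unfolding set_lebesgue_integral_def by (rule integral_eq_zero_AE)
  then show ?thesis using True by simp
next
  case False
  then have rt: "0 < r" "r < t" "t < T" using rt by auto
  define \<psi> where "\<psi> a b x = dilate n bump x * (a * cos (x * \<xi>) + b * sin (x * \<xi>))" for a b x
  have \<psi>: "test_function UNIV (\<psi> a b)" for a b
    unfolding \<psi>_def[abs_def] by (rule test_function_trig[OF bump(1)])
  define B where "B a b \<tau> = - (1 / 2) * (LINT x|lborel. Q \<tau> x * deriv (\<psi> a b) x) + \<beta> * (LINT x|lborel. v \<tau> x * \<psi> a b x)
      - \<mu> * (LINT x|lborel. u \<tau> x * deriv (deriv (\<psi> a b)) x)" for a b \<tau>
  note eq = tested_equation[OF \<psi> rt, folded B_def]
  note k1 = test_functionD(3)[OF bump(1)] and k2 = test_functionD(3)[OF test_functionD(3)[OF bump(1)]]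
  define CC where "CC k f = (LINT x|lborel. dilate n k x * f x * cos (x * \<xi>))" for k f
  define SS where "SS k f = (LINT x|lborel. dilate n k x * f x * sin (x * \<xi>))" for k f
  note tr = cut_trig_integral[where n=n and \<xi>=\<xi>, folded CC_def SS_def]
  \<comment> \<open>The coefficients (1, 0) and (0, -1) yield the real and the imaginary part, since
    \<open>cis (- (x * \<xi>))\<close> is the cosine minus \<i> times the sine of
    \<open>x * \<xi>\<close>.\<close>
  have rhs: "cut_rhs n \<tau> \<xi> = of_real (B 1 0 \<tau>) + \<i> * of_real (B 0 (-1) \<tau>)" if \<tau>: "\<tau> \<in> {0..<T}" for \<tau>
  proof -
    note iQ = integrable_cut_Q[OF \<tau>] and iu = integrable_cut[OF _ sq_u[OF \<tau>]] and iv = integrable_cut[OF _ sq_v[OF \<tau>]]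
    have 1: "(LINT x|lborel. Q \<tau> x * deriv (\<psi> a b) x) = (a / real (Suc n) * CC (deriv bump) (Q \<tau>) + b / real (Suc n) * SS (deriv bump) (Q \<tau>))
        + ((b * \<xi>) * CC bump (Q \<tau>) + (- a * \<xi>) * SS bump (Q \<tau>))" for a b
      unfolding \<psi>_def deriv_trig[OF bump(1)] distrib_left[of "Q _ _"]
      by (rule trans[OF Bochner_Integration.integral_add], rule tr(1)[OF iQ[OF k1]], rule tr(1)[OF iQ[OF bump(1)]],
        simp only: tr(2)[OF iQ[OF k1]] tr(2)[OF iQ[OF bump(1)]])
    have 2: "(LINT x|lborel. v \<tau> x * \<psi> a b x) = a * CC bump (v \<tau>) + b * SS bump (v \<tau>)" for a b
      unfolding \<psi>_def by (rule tr(2)[OF iv[OF bump(1)]])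
    have 3: "(LINT x|lborel. u \<tau> x * deriv (deriv (\<psi> a b)) x) = (a / (real (Suc n))\<^sup>2 * CC (deriv (deriv bump)) (u \<tau>) + b / (real (Suc n))\<^sup>2 * SS (deriv (deriv bump)) (u \<tau>))
        + (2 * b * \<xi> / real (Suc n) * CC (deriv bump) (u \<tau>) + - 2 * a * \<xi> / real (Suc n) * SS (deriv bump) (u \<tau>))
        + ((- a * \<xi>\<^sup>2) * CC bump (u \<tau>) + (- b * \<xi>\<^sup>2) * SS bump (u \<tau>))" for a b
      unfolding \<psi>_def[abs_def] deriv_deriv_trig[OF bump(1)] distrib_left[of "u _ _"]
      by (rule trans[OF Bochner_Integration.integral_add], rule Bochner_Integration.integrable_add,
        rule tr(1)[OF iu[OF k2]], rule tr(1)[OF iu[OF k1]], rule tr(1)[OF iu[OF bump(1)]],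
        rule arg_cong2[where f="(+)"], rule trans[OF Bochner_Integration.integral_add],
        rule tr(1)[OF iu[OF k2]], rule tr(1)[OF iu[OF k1]],
        simp only: tr(2)[OF iu[OF k2]] tr(2)[OF iu[OF k1]], rule tr(2)[OF iu[OF bump(1)]])
    show ?thesis
      unfolding cut_rhs_def B_def 1 2 3 tr(3)[OF iQ[OF k1]] tr(3)[OF iQ[OF bump(1)]] tr(3)[OF iv[OF bump(1)]]
        tr(3)[OF iu[OF k2]] tr(3)[OF iu[OF k1]] tr(3)[OF iu[OF bump(1)]]
      by (simp add: complex_eq_iff power2_eq_square Re_divide_of_real Im_divide_of_real algebra_simps add_divide_distrib diff_divide_distrib del: of_nat_Suc)
  qed
  have sub: "{r..t} \<subseteq> {0..<T}" using rt by auto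
  have lhs: "cut_ft n bump (u \<tau>) \<xi> = of_real (LINT x|lborel. u \<tau> x * \<psi> 1 0 x) + \<i> * of_real (LINT x|lborel. u \<tau> x * \<psi> 0 (-1) x)"
    if "\<tau> \<in> {0..<T}" for \<tau>
  proof -
    note iu = integrable_cut[OF bump(1) sq_u[OF that]]
    show ?thesis unfolding \<psi>_def tr(2)[OF iu] tr(3)[OF iu] by simp
  qed
  have i: "set_integrable lborel {r..t} (B a b)" for a b
    by (rule borel_integrable_atLeastAtMost'[OF continuous_on_subset[OF eq(2) sub]])
  have ic: "set_integrable lborel {r..t} (\<lambda>\<tau>. complex_of_real (B a b \<tau>))" for a b
  proof -
    have "integrable lborel (\<lambda>\<tau>. complex_of_real (indicator {r..t} \<tau> *\<^sub>R B a b \<tau>))"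
      using i[of a b] unfolding set_integrable_def by (simp only: complex_of_real_integrable_eq)
    then show ?thesis unfolding set_integrable_def by (simp add: scaleR_conv_of_real)
  qed
  have "(LINT \<tau>:{r..t}|lborel. cut_rhs n \<tau> \<xi>) = (LINT \<tau>:{r..t}|lborel. complex_of_real (B 1 0 \<tau>) + \<i> * complex_of_real (B 0 (-1) \<tau>))"
    using sub by (intro set_lebesgue_integral_cong) (auto intro!: rhs)
  also have "\<dots> = (LINT \<tau>:{r..t}|lborel. complex_of_real (B 1 0 \<tau>)) + \<i> * (LINT \<tau>:{r..t}|lborel. complex_of_real (B 0 (-1) \<tau>))"
    by (subst set_integral_add(2)[OF ic]) (auto intro!: set_integrable_mult_right ic)
  also have "\<dots> = of_real (LINT \<tau>:{r..t}|lborel. B 1 0 \<tau>) + \<i> * of_real (LINT \<tau>:{r..t}|lborel. B 0 (-1) \<tau>)"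
    by (simp only: set_integral_complex_of_real)
  finally show ?thesis
    using eq(1)[of 1 0] eq(1)[of 0 "-1"] lhs[of r] lhs[of t] rt by (simp add: algebra_simps complex_eq_iff)
qed

lemma continuous_L2_u: "continuous_on {0..<T} (\<lambda>t. L2 (u t))"
proof (rule continuous_onI_D[where K="\<lambda>_. 1"])
  fix t \<tau> assume *: "t \<in> {0..<T}" "\<tau> \<in> {0..<T}"
  have "\<bar>L2 (u \<tau>) - L2 (u t)\<bar> \<le> D \<tau> t"
    using L2_diff_abs[OF sq_u sq_u, OF *(2,1)] L2_diff_u[OF *(2,1)] by linarith
  then show "norm (L2 (u \<tau>) - L2 (u t)) \<le> 1 * (D \<tau> t + (D \<tau> t)\<^sup>2)" by (simp add: add_increasing2)
qed

lemma L2_u_bounded: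
  assumes "0 \<le> r" "t < T"
  obtains S where "S \<ge> 0" "\<And>\<tau>. \<tau> \<in> {r..t} \<Longrightarrow> L2 (u \<tau>) \<le> S"
proof -
  have "bounded ((\<lambda>t. L2 (u t)) ` {r..t})"
    using assms by (intro compact_imp_bounded compact_continuous_image continuous_on_subset[OF continuous_L2_u]) auto
  then obtain S where S: "\<forall>\<tau>\<in>{r..t}. \<bar>L2 (u \<tau>)\<bar> \<le> S" by (auto simp: bounded_iff)
  show thesis by (rule that[of "\<bar>S\<bar>"]) (use S in force)+
qed

lemma continuous_cut_rhs: "continuous_on ({0..<T} \<times> UNIV) (\<lambda>p. cut_rhs n (fst p) (snd p))"
  unfolding cut_rhs_def using test_functionD(3)[OF bump(1)] test_functionD(3)[OF test_functionD(3)[OF bump(1)]]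
  by (intro continuous_intros continuous_cut_Q continuous_cut_u continuous_cut_v bump(1)) (simp_all del: of_nat_Suc)

lemma continuous_slice:
  fixes h :: "real \<Rightarrow> real \<Rightarrow> complex"
  assumes "continuous_on ({0..<T} \<times> UNIV) (\<lambda>p. h (fst p) (snd p))" "A \<subseteq> {0..<T}"
  shows "continuous_on A (\<lambda>\<tau>. h \<tau> \<xi>)"
proof -
  have "continuous_on A (\<lambda>\<tau>. (\<tau>, \<xi>))" by (intro continuous_intros)
  from continuous_on_compose2[OF assms(1) this] assms(2) show ?thesis by auto
qed

text \<open>Two kinds of errors separate the truncated equation from the limiting one: terms in
  which derivatives fall on the cut-off, with a factor 1 / (n + 1) each time, and the error of
  truncating Q, u and v. The multiplier relation holds for the untruncated transforms of u and v
  only, so these are inserted to measure the commutator of cut-off and Hilbert transform.\<close>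

lemma cut_defect_identity:
  "cut_rhs n \<tau> \<xi> - lam \<xi> * cut_ft n bump (u \<tau>) \<xi> - \<i> * of_real \<xi> / 2 * N \<tau> \<xi>
    = - (1 / 2) * (cut_ft n (deriv bump) (Q \<tau>) \<xi> / of_real (real (Suc n)))
      + \<i> * of_real \<xi> / 2 * (cut_ft n bump (Q \<tau>) \<xi> - N \<tau> \<xi>)
      + of_real \<beta> * ((cut_ft n bump (v \<tau>) \<xi> - fourier (v \<tau>) \<xi>) + - \<i> * of_real (sgn \<xi>) * (fourier (u \<tau>) \<xi> - cut_ft n bump (u \<tau>) \<xi>))
      - of_real \<mu> * (cut_ft n (deriv (deriv bump)) (u \<tau>) \<xi> / of_real ((real (Suc n))\<^sup>2))
      + of_real \<mu> * (2 * \<i> * of_real \<xi> / of_real (real (Suc n)) * cut_ft n (deriv bump) (u \<tau>) \<xi>)"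
  if "fourier (v \<tau>) \<xi> = - \<i> * of_real (sgn \<xi>) * fourier (u \<tau>) \<xi>"
  unfolding cut_rhs_def lam_def that by (simp add: algebra_simps del: of_nat_Suc)

text \<open>The two terms with Q are bounded uniformly in the frequency through L1 norms. Those with
  u and v stay pointwise, as they are controlled only after integration over the window.\<close>

lemma cut_defect_bound:
  assumes \<tau>: "\<tau> \<in> {0..<T}" and M: "\<bar>\<xi>\<bar> \<le> M" and hil: "fourier (v \<tau>) \<xi> = - \<i> * of_real (sgn \<xi>) * fourier (u \<tau>) \<xi>"
    and K: "\<And>x. \<bar>deriv bump x\<bar> \<le> K"
  shows "norm (cut_rhs n \<tau> \<xi> - lam \<xi> * cut_ft n bump (u \<tau>) \<xi> - \<i> * of_real \<xi> / 2 * N \<tau> \<xi>)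
    \<le> K * (LINT x|lborel. Q \<tau> x) / real (Suc n) + M * (LINT x|lborel. \<bar>1 - dilate n bump x\<bar> * Q \<tau> x)
      + (\<bar>\<beta>\<bar> * norm (fourier (v \<tau>) \<xi> - cut_ft n bump (v \<tau>) \<xi>) + \<bar>\<beta>\<bar> * norm (fourier (u \<tau>) \<xi> - cut_ft n bump (u \<tau>) \<xi>)
      + \<mu> / (real (Suc n))\<^sup>2 * norm (cut_ft n (deriv (deriv bump)) (u \<tau>) \<xi>)
      + 2 * M * \<mu> / real (Suc n) * norm (cut_ft n (deriv bump) (u \<tau>) \<xi>))"
proof -
  define m where "m = real (Suc n)"
  have m: "m > 0" by (simp add: m_def)
  note k1 = test_functionD(3)[OF bump(1)]
  define q where "q = (LINT x|lborel. Q \<tau> x)"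
  define d where "d = (LINT x|lborel. \<bar>1 - dilate n bump x\<bar> * Q \<tau> x)"
  have iQ: "integrable lborel (\<lambda>x. dilate n k x * Q \<tau> x)" if "test_function UNIV k" for k
    by (rule integrable_cut_Q[OF \<tau> that])
  have 1: "norm (cut_ft n (deriv bump) (Q \<tau>) \<xi>) \<le> K * q"
  proof -
    have "norm (cut_ft n (deriv bump) (Q \<tau>) \<xi>) \<le> (LINT x|lborel. norm (complex_of_real (dilate n (deriv bump) x * Q \<tau> x)))"
      unfolding cut_ft_def by (rule ft_bound)
    also have "\<dots> \<le> (LINT x|lborel. K * Q \<tau> x)"
    proof (rule integral_mono)
      show "norm (complex_of_real (dilate n (deriv bump) x * Q \<tau> x)) \<le> K * Q \<tau> x" for x
        using K Q_nonneg[of \<tau> x] by (auto simp: dilate_def abs_mult norm_mult intro!: mult_right_mono)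
      show "integrable lborel (\<lambda>x. norm (complex_of_real (dilate n (deriv bump) x * Q \<tau> x)))"
        using iQ[OF k1] by (intro integrable_norm) (simp only: complex_of_real_integrable_eq)
    qed (use integrable_Q[OF \<tau>] in simp)
    finally show ?thesis by (simp add: q_def)
  qed
  have 2: "norm (cut_ft n bump (Q \<tau>) \<xi> - N \<tau> \<xi>) \<le> d"
  proof -
    have "cut_ft n bump (Q \<tau>) \<xi> - N \<tau> \<xi> = ft (\<lambda>x. complex_of_real (dilate n bump x * Q \<tau> x) - complex_of_real (Q \<tau> x)) \<xi>"
      unfolding cut_ft_def N_def using iQ[OF bump(1)] integrable_Q[OF \<tau>]
      by (intro ft_diff[symmetric]) (simp_all only: complex_of_real_integrable_eq)
    then have "norm (cut_ft n bump (Q \<tau>) \<xi> - N \<tau> \<xi>) \<le> (LINT x|lborel. norm (complex_of_real (dilate n bump x * Q \<tau> x) - complex_of_real (Q \<tau> x)))"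
      by (simp only: ft_bound)
    moreover have "norm (complex_of_real (dilate n bump x * Q \<tau> x) - complex_of_real (Q \<tau> x)) = \<bar>1 - dilate n bump x\<bar> * Q \<tau> x" for x
    proof -
      have "complex_of_real (dilate n bump x * Q \<tau> x) - complex_of_real (Q \<tau> x) = complex_of_real ((dilate n bump x - 1) * Q \<tau> x)"
        by (simp add: left_diff_distrib)
      then show ?thesis using Q_nonneg[of \<tau> x] by (simp only: norm_of_real abs_mult abs_of_nonneg abs_minus_commute)
    qed
    ultimately show ?thesis by (simp only: d_def)
  qed
  have M0: "0 \<le> M" using M by linarith
  define W where "W k f = cut_ft n k f \<xi>" for k f
  have "norm (cut_rhs n \<tau> \<xi> - lam \<xi> * cut_ft n bump (u \<tau>) \<xi> - \<i> * of_real \<xi> / 2 * N \<tau> \<xi>)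
    \<le> norm (- (1 / 2) * (W (deriv bump) (Q \<tau>) / of_real m)) + norm (\<i> * of_real \<xi> / 2 * (W bump (Q \<tau>) - N \<tau> \<xi>))
      + norm (of_real \<beta> * ((W bump (v \<tau>) - fourier (v \<tau>) \<xi>) + - \<i> * of_real (sgn \<xi>) * (fourier (u \<tau>) \<xi> - W bump (u \<tau>))))
      + norm (of_real \<mu> * (W (deriv (deriv bump)) (u \<tau>) / of_real (m\<^sup>2)))
      + norm (of_real \<mu> * (2 * \<i> * of_real \<xi> / of_real m * W (deriv bump) (u \<tau>)))"
  proof -
    have "norm (a + b + c - d + e) \<le> norm a + norm b + norm c + norm d + norm e" for a b c d e :: complex
      using norm_triangle_ineq[of "a + b + c - d" e] norm_triangle_ineq4[of "a + b + c" d]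
        norm_triangle_ineq[of "a + b" c] norm_triangle_ineq[of a b] by linarith
    then show ?thesis unfolding cut_defect_identity[OF hil] unfolding m_def[symmetric] W_def[symmetric] .
  qed
  also have "\<dots> \<le> K * q / m + M * d
      + (\<bar>\<beta>\<bar> * norm (fourier (v \<tau>) \<xi> - W bump (v \<tau>)) + \<bar>\<beta>\<bar> * norm (fourier (u \<tau>) \<xi> - W bump (u \<tau>)))
      + \<mu> / m\<^sup>2 * norm (W (deriv (deriv bump)) (u \<tau>)) + 2 * M * \<mu> / m * norm (W (deriv bump) (u \<tau>))"
  proof (intro add_mono)
    have "norm (- (1 / 2) * (W (deriv bump) (Q \<tau>) / of_real m)) = (1 / 2) * (norm (W (deriv bump) (Q \<tau>)) / m)"
      using m by (simp add: norm_mult norm_divide)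
    also have "\<dots> \<le> 1 * (K * q / m)" using 1 m unfolding W_def by (intro mult_mono divide_right_mono) auto
    finally show "norm (- (1 / 2) * (W (deriv bump) (Q \<tau>) / of_real m)) \<le> K * q / m" by simp
    have "norm (\<i> * of_real \<xi> / 2 * (W bump (Q \<tau>) - N \<tau> \<xi>)) = (\<bar>\<xi>\<bar> / 2) * norm (W bump (Q \<tau>) - N \<tau> \<xi>)"
      by (simp add: norm_mult norm_divide)
    also have "\<dots> \<le> M * d" using 2 M M0 unfolding W_def by (intro mult_mono) auto
    finally show "norm (\<i> * of_real \<xi> / 2 * (W bump (Q \<tau>) - N \<tau> \<xi>)) \<le> M * d" .
    have "norm (of_real \<beta> * ((W bump (v \<tau>) - fourier (v \<tau>) \<xi>) + - \<i> * of_real (sgn \<xi>) * (fourier (u \<tau>) \<xi> - W bump (u \<tau>))))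
      \<le> \<bar>\<beta>\<bar> * (norm (W bump (v \<tau>) - fourier (v \<tau>) \<xi>) + norm (- \<i> * of_real (sgn \<xi>) * (fourier (u \<tau>) \<xi> - W bump (u \<tau>))))"
      unfolding norm_mult[of "of_real \<beta>"] norm_of_real by (intro mult_left_mono norm_triangle_ineq) simp
    also have "\<dots> \<le> \<bar>\<beta>\<bar> * (norm (fourier (v \<tau>) \<xi> - W bump (v \<tau>)) + norm (fourier (u \<tau>) \<xi> - W bump (u \<tau>)))"
      by (intro mult_left_mono add_mono) (auto simp: norm_mult norm_minus_commute sgn_if)
    finally show "norm (of_real \<beta> * ((W bump (v \<tau>) - fourier (v \<tau>) \<xi>) + - \<i> * of_real (sgn \<xi>) * (fourier (u \<tau>) \<xi> - W bump (u \<tau>))))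
      \<le> \<bar>\<beta>\<bar> * norm (fourier (v \<tau>) \<xi> - W bump (v \<tau>)) + \<bar>\<beta>\<bar> * norm (fourier (u \<tau>) \<xi> - W bump (u \<tau>))"
      by (simp only: distrib_left)
    show "norm (of_real \<mu> * (W (deriv (deriv bump)) (u \<tau>) / of_real (m\<^sup>2))) \<le> \<mu> / m\<^sup>2 * norm (W (deriv (deriv bump)) (u \<tau>))"
      using mu m by (simp add: norm_mult norm_divide norm_power)
    have "norm (of_real \<mu> * (2 * \<i> * of_real \<xi> / of_real m * W (deriv bump) (u \<tau>))) = 2 * \<bar>\<xi>\<bar> * \<mu> / m * norm (W (deriv bump) (u \<tau>))"
      using mu m by (simp add: norm_mult norm_divide)
    also have "\<dots> \<le> 2 * M * \<mu> / m * norm (W (deriv bump) (u \<tau>))"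
      using M mu m by (intro mult_right_mono divide_right_mono) auto
    finally show "norm (of_real \<mu> * (2 * \<i> * of_real \<xi> / of_real m * W (deriv bump) (u \<tau>))) \<le> 2 * M * \<mu> / m * norm (W (deriv bump) (u \<tau>))" .
  qed
  finally show ?thesis unfolding W_def m_def q_def d_def by (simp only: add.assoc)
qed

text \<open>A majorant of the integral over \<open>[-M, M]\<close> of the defect of the truncated equation.\<close>

definition defect_bound :: "real \<Rightarrow> real \<Rightarrow> nat \<Rightarrow> real \<Rightarrow> real"
  where "defect_bound K M n \<tau> =
    2 * M * (K * (LINT x|lborel. Q \<tau> x) * (1 / real (Suc n)) + M * (LINT x|lborel. \<bar>1 - dilate n bump x\<bar> * Q \<tau> x))
    + L2 (indicator {-M..M} :: real \<Rightarrow> real) * sqrt (2 * pi) *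
      (\<bar>\<beta>\<bar> * L2 (\<lambda>x. v \<tau> x - dilate n bump x * v \<tau> x) + \<bar>\<beta>\<bar> * L2 (\<lambda>x. u \<tau> x - dilate n bump x * u \<tau> x)
      + \<mu> * (1 / real (Suc n)) * (1 / real (Suc n)) * (K * L2 (u \<tau>)) + 2 * M * \<mu> * (1 / real (Suc n)) * (K * L2 (u \<tau>)))"

lemma defect_bound_tendsto:
  assumes \<tau>: "\<tau> \<in> {0..<T}" and K: "\<And>x. \<bar>bump x\<bar> \<le> K"
  shows "(\<lambda>n. defect_bound K M n \<tau>) \<longlonglongrightarrow> 0"
proof -
  have m: "(\<lambda>n. 1 / real (Suc n)) \<longlonglongrightarrow> 0" using LIMSEQ_inverse_real_of_nat by (simp add: inverse_eq_divide)
  have d: "(\<lambda>n. LINT x|lborel. \<bar>1 - dilate n bump x\<bar> * Q \<tau> x) \<longlonglongrightarrow> (LINT x::real|lborel. 0)"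
  proof (rule integral_dominated_convergence)
    show "integrable lborel (\<lambda>x. (1 + K) * Q \<tau> x)" using integrable_Q[OF \<tau>] by simp
    have "(\<lambda>n. \<bar>1 - dilate n bump x\<bar> * Q \<tau> x) \<longlonglongrightarrow> \<bar>1 - 1\<bar> * Q \<tau> x" for x
      by (intro tendsto_intros dilate_tendsto bump)
    then show "AE x in lborel. (\<lambda>n. \<bar>1 - dilate n bump x\<bar> * Q \<tau> x) \<longlonglongrightarrow> 0" by simp
    show "AE x in lborel. norm (\<bar>1 - dilate n bump x\<bar> * Q \<tau> x) \<le> (1 + K) * Q \<tau> x" for n
    proof (rule AE_I2)
      fix x
      have "\<bar>1 - dilate n bump x\<bar> \<le> 1 + K" using K[of "x / real (Suc n)"] by (simp add: dilate_def)
      from mult_right_mono[OF this Q_nonneg[of \<tau> x]]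
      show "norm (\<bar>1 - dilate n bump x\<bar> * Q \<tau> x) \<le> (1 + K) * Q \<tau> x" using Q_nonneg[of \<tau> x] by (simp add: abs_mult)
    qed
    show "(\<lambda>x. \<bar>1 - dilate n bump x\<bar> * Q \<tau> x) \<in> borel_measurable lborel" for n
      using dilate_measurable[OF bump(1), of n] integrable_Q[OF \<tau>] by simp
  qed simp
  then have d: "(\<lambda>n. LINT x|lborel. \<bar>1 - dilate n bump x\<bar> * Q \<tau> x) \<longlonglongrightarrow> 0" by simp
  note u0 = cut_tendsto_L2(1)[OF bump(1) K bump(2) sq_u[OF \<tau>]] and v0 = cut_tendsto_L2(1)[OF bump(1) K bump(2) sq_v[OF \<tau>]]
  have "(\<lambda>n. defect_bound K M n \<tau>) \<longlonglongrightarrow>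
    2 * M * (K * (LINT x|lborel. Q \<tau> x) * 0 + M * 0)
    + L2 (indicator {-M..M} :: real \<Rightarrow> real) * sqrt (2 * pi) *
      (\<bar>\<beta>\<bar> * 0 + \<bar>\<beta>\<bar> * 0 + \<mu> * 0 * 0 * (K * L2 (u \<tau>)) + 2 * M * \<mu> * 0 * (K * L2 (u \<tau>)))"
    unfolding defect_bound_def by (intro tendsto_intros m d u0 v0)
  then show ?thesis by simp
qed

text \<open>Uniform in n and in all times at which S bounds the L2 norm: this is the majorant for
  dominated convergence in time.\<close>

lemma defect_bound_bounded:
  assumes \<tau>: "\<tau> \<in> {0..<T}" and K: "\<And>x. \<bar>bump x\<bar> \<le> K" and S: "L2 (u \<tau>) \<le> S" and M: "0 \<le> M"
  shows "defect_bound K M n \<tau> \<le> 2 * M * (K * (2 * S\<^sup>2) + M * ((1 + K) * (2 * S\<^sup>2)))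
    + L2 (indicator {-M..M} :: real \<Rightarrow> real) * sqrt (2 * pi) *
      (\<bar>\<beta>\<bar> * ((1 + K) * S) + \<bar>\<beta>\<bar> * ((1 + K) * S) + \<mu> * (K * S) + 2 * M * \<mu> * (K * S))"
proof -
  have K0: "0 \<le> K" using K[of 0] by linarith
  have S0: "0 \<le> S" using S L2_nonneg[of "u \<tau>"] by linarith
  have m: "0 \<le> 1 / real (Suc n)" "1 / real (Suc n) \<le> 1" by auto
  have q: "(LINT x|lborel. Q \<tau> x) \<le> 2 * S\<^sup>2" "0 \<le> (LINT x|lborel. Q \<tau> x)"
    using S by (simp_all add: integral_Q[OF \<tau>] power_mono)
  have d: "(LINT x|lborel. \<bar>1 - dilate n bump x\<bar> * Q \<tau> x) \<le> (1 + K) * (2 * S\<^sup>2)"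
  proof -
    have "(LINT x|lborel. \<bar>1 - dilate n bump x\<bar> * Q \<tau> x) \<le> (LINT x|lborel. (1 + K) * Q \<tau> x)"
    proof (rule integral_mono_AE')
      show "integrable lborel (\<lambda>x. (1 + K) * Q \<tau> x)" using integrable_Q[OF \<tau>] by simp
      show "AE x in lborel. \<bar>1 - dilate n bump x\<bar> * Q \<tau> x \<le> (1 + K) * Q \<tau> x"
      proof (intro AE_I2 mult_right_mono Q_nonneg)
        fix x show "\<bar>1 - dilate n bump x\<bar> \<le> 1 + K" using K[of "x / real (Suc n)"] by (simp add: dilate_def)
      qed
    qed (use K0 Q_nonneg in auto)
    also have "\<dots> = (1 + K) * (LINT x|lborel. Q \<tau> x)" by (rule integral_mult_right_zero)
    also have "\<dots> \<le> (1 + K) * (2 * S\<^sup>2)" using q K0 by (intro mult_left_mono) auto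
    finally show ?thesis .
  qed
  have L: "L2 (\<lambda>x. w x - dilate n bump x * w x) \<le> (1 + K) * S" if "square_integrable w" "L2 w \<le> S" for w
    by (rule order_trans[OF cut_tendsto_L2(2)[OF bump(1) K bump(2) that(1)] mult_left_mono[OF that(2)]]) (use K0 in simp)
  have q1: "K * (LINT x|lborel. Q \<tau> x) * (1 / real (Suc n)) \<le> K * (2 * S\<^sup>2)"
  proof -
    have "K * (LINT x|lborel. Q \<tau> x) * (1 / real (Suc n)) \<le> K * (LINT x|lborel. Q \<tau> x) * 1"
      using m K0 q by (intro mult_left_mono) auto
    also have "\<dots> \<le> K * (2 * S\<^sup>2)" using q(1) K0 by (simp add: mult_left_mono)
    finally show ?thesis .
  qed
  have c: "c * (1 / real (Suc n)) * (K * L2 (u \<tau>)) \<le> c * (K * S)" if "0 \<le> c" for c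
  proof -
    have "c * (1 / real (Suc n)) \<le> c" using mult_left_mono[OF m(2) that] by simp
    then show ?thesis using that S K0 m by (intro mult_mono) (auto intro: mult_left_mono)
  qed
  have c2: "\<mu> * (1 / real (Suc n)) * (1 / real (Suc n)) * (K * L2 (u \<tau>)) \<le> \<mu> * (K * S)"
  proof -
    have "\<mu> * (1 / real (Suc n)) \<le> \<mu>" using mult_left_mono[OF m(2), of \<mu>] mu by simp
    then have "\<mu> * (1 / real (Suc n)) * (K * S) \<le> \<mu> * (K * S)" using K0 S0 by (intro mult_right_mono) auto
    moreover have "\<mu> * (1 / real (Suc n)) * (1 / real (Suc n)) * (K * L2 (u \<tau>)) \<le> \<mu> * (1 / real (Suc n)) * (K * S)"
      using mu by (intro c) auto
    ultimately show ?thesis by linarith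
  qed
  show ?thesis
    unfolding defect_bound_def
    using L[OF sq_u[OF \<tau>] S] L[OF sq_v[OF \<tau>]] S L2_v[OF \<tau>] M mu
    by (intro add_mono mult_left_mono[of _ _ "2 * M"] mult_left_mono[of _ _ "L2 _ * sqrt _"] mult_left_mono[of _ _ "\<bar>\<beta>\<bar>"] mult_left_mono[of _ _ M] q1 d c c2) auto
qed

text \<open>The window [-M, M] serves twice: it bounds the factors \<xi> in the defect, and it turns
  the L2 errors of truncation into L1 bounds.\<close>

lemma defect_integral_bound:
  assumes \<tau>: "\<tau> \<in> {0..<T}" and M: "0 \<le> M"
    and K: "\<And>x. \<bar>bump x\<bar> \<le> K" "\<And>x. \<bar>deriv bump x\<bar> \<le> K" "\<And>x. \<bar>deriv (deriv bump) x\<bar> \<le> K"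
  shows "(\<integral>\<^sup>+\<xi>. indicator {-M..M} \<xi> * ennreal (norm (cut_rhs n \<tau> \<xi> - lam \<xi> * cut_ft n bump (u \<tau>) \<xi> - \<i> * of_real \<xi> / 2 * N \<tau> \<xi>)) \<partial>lborel)
    \<le> ennreal (defect_bound K M n \<tau>)"
proof -
  define m where "m = real (Suc n)"
  have m: "m > 0" by (simp add: m_def)
  note k1 = test_functionD(3)[OF bump(1)] and k2 = test_functionD(3)[OF test_functionD(3)[OF bump(1)]]
  define c where "c = K * (LINT x|lborel. Q \<tau> x) / m + M * (LINT x|lborel. \<bar>1 - dilate n bump x\<bar> * Q \<tau> x)"
  define h1 h2 h3 h4 where "h1 \<xi> = \<bar>\<beta>\<bar> *\<^sub>R norm (fourier (v \<tau>) \<xi> - cut_ft n bump (v \<tau>) \<xi>)"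
    and "h2 \<xi> = \<bar>\<beta>\<bar> *\<^sub>R norm (fourier (u \<tau>) \<xi> - cut_ft n bump (u \<tau>) \<xi>)"
    and "h3 \<xi> = (\<mu> / m\<^sup>2) *\<^sub>R norm (cut_ft n (deriv (deriv bump)) (u \<tau>) \<xi>)"
    and "h4 \<xi> = (2 * M * \<mu> / m) *\<^sub>R norm (cut_ft n (deriv bump) (u \<tau>) \<xi>)" for \<xi>
  define h where "h \<xi> = h1 \<xi> + h2 \<xi> + h3 \<xi> + h4 \<xi>" for \<xi>
  note su = sq_u[OF \<tau>] and sv = sq_v[OF \<tau>]
  have L2n: "L2 (\<lambda>\<xi>. c *\<^sub>R norm (f \<xi>)) = \<bar>c\<bar> * L2 f" for c :: real and f :: "real \<Rightarrow> complex"
    unfolding L2_scaleR by (simp add: L2_def)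
  have sq: "square_integrable h1" "square_integrable h2" "square_integrable h3" "square_integrable h4"
    unfolding h1_def h2_def h3_def h4_def
    by (intro square_integrable_scaleR square_integrable_norm square_integrable_diff square_integrable_fourier su sv
        cut_ft_L2(1)[OF bump(1) K(1)] cut_ft_L2(1)[OF k1 K(2)] cut_ft_L2(1)[OF k2 K(3)])+
  have hsq: "square_integrable h" unfolding h_def[abs_def] by (intro square_integrable_add sq)
  have c0: "0 \<le> c"
  proof -
    have "0 \<le> K" using K(1)[of 0] by linarith
    moreover have "0 \<le> (LINT x|lborel. Q \<tau> x)" "0 \<le> (LINT x|lborel. \<bar>1 - dilate n bump x\<bar> * Q \<tau> x)"
      by (intro integral_nonneg_AE AE_I2; simp add: Q_nonneg)+
    ultimately show ?thesis using m M by (simp add: c_def)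
  qed
  have h0: "0 \<le> h \<xi>" for \<xi> using mu M m by (simp add: h_def h1_def h2_def h3_def h4_def)
  have Lh: "L2 h \<le> sqrt (2 * pi) * (\<bar>\<beta>\<bar> * L2 (\<lambda>x. v \<tau> x - dilate n bump x * v \<tau> x) + \<bar>\<beta>\<bar> * L2 (\<lambda>x. u \<tau> x - dilate n bump x * u \<tau> x)
      + \<mu> * (1 / m) * (1 / m) * (K * L2 (u \<tau>)) + 2 * M * \<mu> * (1 / m) * (K * L2 (u \<tau>)))"
  proof -
    have 1: "L2 h1 = \<bar>\<beta>\<bar> * (sqrt (2 * pi) * L2 (\<lambda>x. v \<tau> x - dilate n bump x * v \<tau> x))"
      unfolding h1_def L2n cut_ft_L2(3)[OF bump(1) K(1) sv] by simp
    have 2: "L2 h2 = \<bar>\<beta>\<bar> * (sqrt (2 * pi) * L2 (\<lambda>x. u \<tau> x - dilate n bump x * u \<tau> x))"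
      unfolding h2_def L2n cut_ft_L2(3)[OF bump(1) K(1) su] by simp
    have 3: "L2 h3 \<le> \<mu> / m\<^sup>2 * (sqrt (2 * pi) * (K * L2 (u \<tau>)))"
      unfolding h3_def L2n using mu m cut_ft_L2(2)[OF k2 K(3) su, of n] by (simp add: divide_right_mono)
    have 4: "L2 h4 \<le> 2 * M * \<mu> / m * (sqrt (2 * pi) * (K * L2 (u \<tau>)))"
      unfolding h4_def L2n using mu m M cut_ft_L2(2)[OF k1 K(2) su, of n] by (auto intro!: divide_right_mono mult_left_mono)
    have "L2 h \<le> L2 (\<lambda>\<xi>. h1 \<xi> + h2 \<xi> + h3 \<xi>) + L2 h4"
      unfolding h_def[abs_def] by (intro L2_triangle square_integrable_add sq)
    also have "L2 (\<lambda>\<xi>. h1 \<xi> + h2 \<xi> + h3 \<xi>) \<le> L2 (\<lambda>\<xi>. h1 \<xi> + h2 \<xi>) + L2 h3"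
      by (intro L2_triangle square_integrable_add sq)
    also have "L2 (\<lambda>\<xi>. h1 \<xi> + h2 \<xi>) \<le> L2 h1 + L2 h2" by (intro L2_triangle sq)
    finally have "L2 h \<le> L2 h1 + L2 h2 + L2 h3 + L2 h4" by simp
    also have "\<dots> \<le> L2 h1 + L2 h2 + \<mu> / m\<^sup>2 * (sqrt (2 * pi) * (K * L2 (u \<tau>))) + 2 * M * \<mu> / m * (sqrt (2 * pi) * (K * L2 (u \<tau>)))"
      using 3 4 by simp
    finally show ?thesis unfolding 1 2 by (simp add: algebra_simps power2_eq_square)
  qed
  have "(\<integral>\<^sup>+\<xi>. indicator {-M..M} \<xi> * ennreal (norm (cut_rhs n \<tau> \<xi> - lam \<xi> * cut_ft n bump (u \<tau>) \<xi> - \<i> * of_real \<xi> / 2 * N \<tau> \<xi>)) \<partial>lborel)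
     \<le> (\<integral>\<^sup>+\<xi>. ennreal c * indicator {-M..M} \<xi> + indicator {-M..M} \<xi> * ennreal (norm (h \<xi>)) \<partial>lborel)"
  proof (rule nn_integral_mono_AE)
    show "AE \<xi> in lborel. indicator {-M..M} \<xi> * ennreal (norm (cut_rhs n \<tau> \<xi> - lam \<xi> * cut_ft n bump (u \<tau>) \<xi> - \<i> * of_real \<xi> / 2 * N \<tau> \<xi>))
       \<le> ennreal c * indicator {-M..M} \<xi> + indicator {-M..M} \<xi> * ennreal (norm (h \<xi>))"
      using hilbert(2)[OF su]
    proof eventually_elim
      case (elim \<xi>)
      show ?case
      proof (cases "\<xi> \<in> {-M..M}")
        case True
        have "norm (cut_rhs n \<tau> \<xi> - lam \<xi> * cut_ft n bump (u \<tau>) \<xi> - \<i> * of_real \<xi> / 2 * N \<tau> \<xi>) \<le> c + h \<xi>"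
          using cut_defect_bound[OF \<tau> _ elim[folded v_def] K(2), of M n, folded m_def] True
          by (simp add: c_def h_def h1_def h2_def h3_def h4_def abs_le_iff)
        then have "ennreal (norm (cut_rhs n \<tau> \<xi> - lam \<xi> * cut_ft n bump (u \<tau>) \<xi> - \<i> * of_real \<xi> / 2 * N \<tau> \<xi>)) \<le> ennreal (c + norm (h \<xi>))"
          using h0[of \<xi>] by (intro ennreal_leI) simp
        also have "\<dots> = ennreal c + ennreal (norm (h \<xi>))" using c0 by (intro ennreal_plus) auto
        finally show ?thesis using True by simp
      qed simp
    qed
  qed
  also have "\<dots> = (\<integral>\<^sup>+\<xi>. ennreal c * indicator {-M..M} \<xi> \<partial>lborel) + (\<integral>\<^sup>+\<xi>. indicator {-M..M} \<xi> * ennreal (norm (h \<xi>)) \<partial>lborel)"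
    by (rule nn_integral_add) (use square_integrable_measurable[OF hsq] in simp_all)
  also have "\<dots> \<le> ennreal (c * (2 * M)) + ennreal (L2 (indicator {-M..M} :: real \<Rightarrow> real) * L2 h)"
  proof (rule add_mono[OF _ nn_integral_Icc_le_L2[OF hsq]])
    have "(\<integral>\<^sup>+\<xi>. ennreal c * indicator {-M..M} \<xi> \<partial>lborel) = ennreal c * ennreal (2 * M)"
      using M by (simp add: nn_integral_cmult_indicator)
    also have "\<dots> = ennreal (c * (2 * M))" using c0 M by (simp only: ennreal_mult)
    finally show "(\<integral>\<^sup>+\<xi>. ennreal c * indicator {-M..M} \<xi> \<partial>lborel) \<le> ennreal (c * (2 * M))" by simp
  qed
  also have "\<dots> = ennreal (c * (2 * M) + L2 (indicator {-M..M} :: real \<Rightarrow> real) * L2 h)"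
    using c0 M by (intro ennreal_plus[symmetric]) auto
  also have "\<dots> \<le> ennreal (defect_bound K M n \<tau>)"
  proof (rule ennreal_leI)
    have "c * (2 * M) + L2 (indicator {-M..M} :: real \<Rightarrow> real) * L2 h \<le> 2 * M * c + L2 (indicator {-M..M} :: real \<Rightarrow> real) * (sqrt (2 * pi) * (\<bar>\<beta>\<bar> * L2 (\<lambda>x. v \<tau> x - dilate n bump x * v \<tau> x) + \<bar>\<beta>\<bar> * L2 (\<lambda>x. u \<tau> x - dilate n bump x * u \<tau> x)
      + \<mu> * (1 / m) * (1 / m) * (K * L2 (u \<tau>)) + 2 * M * \<mu> * (1 / m) * (K * L2 (u \<tau>))))"
      using Lh by (intro add_mono mult_left_mono) auto
    also have "\<dots> = defect_bound K M n \<tau>"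
      unfolding defect_bound_def c_def m_def by (simp only: mult.assoc divide_inverse mult_1_left)
    finally show "c * (2 * M) + L2 (indicator {-M..M} :: real \<Rightarrow> real) * L2 h \<le> defect_bound K M n \<tau>" .
  qed
  finally show ?thesis .
qed

text \<open>Apart from the one chosen transform at time r, an explicit expression at every t and
  \<xi>; regularity in t can therefore be proved for it, in contrast to
  \<open>fourier (u t)\<close>, which is chosen independently at each t.\<close>

definition mild_rhs :: "real \<Rightarrow> real \<Rightarrow> real \<Rightarrow> complex"
  where "mild_rhs r t \<xi> = exp (- lam \<xi> * of_real (t - r)) * fourier (u r) \<xi>
    - (LINT \<tau>:{r..t}|lborel. exp (- lam \<xi> * of_real (t - \<tau>)) * (\<i> * of_real \<xi> / 2 * N \<tau> \<xi>))"

section \<open>The mild formula\<close>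

lemma fourier_u_measurable: "t \<in> {0..<T} \<Longrightarrow> fourier (u t) \<in> borel_measurable borel"
  using square_integrable_measurable[OF square_integrable_fourier[OF sq_u]] by simp

lemma borel_measurable_N_strip:
  assumes "0 \<le> r" "t < T"
  shows "(\<lambda>p. indicator {r..t} (fst p) *\<^sub>R N (fst p) (snd p)) \<in> borel_measurable (borel \<Otimes>\<^sub>M borel)"
  by (rule borel_measurable_strip, rule continuous_on_subset[OF continuous_N]) (use assms in auto)

lemma mild_integrand_measurable:
  assumes "0 \<le> r" "t < T"
  shows "(\<lambda>(\<xi>, \<tau>). indicator {r..t} \<tau> *\<^sub>R (exp (- lam \<xi> * of_real (c - \<tau>)) * (\<i> * of_real \<xi> / 2 * N \<tau> \<xi>))) \<in> borel_measurable (borel \<Otimes>\<^sub>M borel)"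
proof -
  have sw: "(\<lambda>q :: real \<times> real. (snd q, fst q)) \<in> borel \<Otimes>\<^sub>M borel \<rightarrow>\<^sub>M borel \<Otimes>\<^sub>M borel" by measurable
  have 1: "(\<lambda>q. indicator {r..t} (snd q) *\<^sub>R N (snd q) (fst q)) \<in> borel_measurable (borel \<Otimes>\<^sub>M borel)"
    using measurable_compose[OF sw borel_measurable_N_strip[OF assms]] by simp
  have 2: "(\<lambda>q :: real \<times> real. exp (- lam (fst q) * of_real (c - snd q)) * (\<i> * of_real (fst q) / 2)) \<in> borel_measurable (borel \<Otimes>\<^sub>M borel)"
    by measurable
  from borel_measurable_times[OF 2 1] show ?thesis
    by (rule measurable_cong[THEN iffD1, rotated]) (auto simp: indicator_def)
qed

lemma mild_rhs_measurable:
  assumes "0 \<le> r" "r < T" "t < T"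
  shows "mild_rhs r t \<in> borel_measurable borel"
proof -
  have "(\<lambda>\<xi>. LINT \<tau>|lborel. indicator {r..t} \<tau> *\<^sub>R (exp (- lam \<xi> * of_real (t - \<tau>)) * (\<i> * of_real \<xi> / 2 * N \<tau> \<xi>))) \<in> borel_measurable borel"
    by (rule lborel.borel_measurable_lebesgue_integral) (use mild_integrand_measurable[OF assms(1,3), of t] in simp)
  then show ?thesis
    unfolding mild_rhs_def[abs_def] set_lebesgue_integral_def using fourier_u_measurable[of r] assms by simp
qed

lemma mild_integrand_continuous:
  assumes "A \<subseteq> {0..<T}"
  shows "continuous_on A (\<lambda>\<tau>. exp (- lam \<xi> * of_real (c - \<tau>)) * (\<i> * of_real \<xi> / 2 * N \<tau> \<xi>))"
  by (intro continuous_intros continuous_slice[OF continuous_N assms])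

text \<open>Duhamel's formula for the truncated equation bounds the deviation \<open>Df\<close> by
  the truncation errors at the times r and t and the time integral of the defect. Integrated over a
  frequency window, all three tend to 0, so \<open>Df\<close> vanishes almost everywhere on each
  window.\<close>

theorem mild_formula:
  assumes rt: "0 < r" "r \<le> t" "t < T"
  shows "AE \<xi> in lborel. fourier (u t) \<xi> = mild_rhs r t \<xi>"
proof -
  obtain K where K: "\<And>x. \<bar>bump x\<bar> \<le> K" "\<And>x. \<bar>deriv bump x\<bar> \<le> K" "\<And>x. \<bar>deriv (deriv bump) x\<bar> \<le> K"
    using bump_bounds by blast
  have sub: "{r..t} \<subseteq> {0..<T}" using rt by auto
  have r: "r \<in> {0..<T}" and t: "t \<in> {0..<T}" using rt by auto
  obtain S where S: "S \<ge> 0" "\<And>\<tau>. \<tau> \<in> {r..t} \<Longrightarrow> L2 (u \<tau>) \<le> S"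
    using L2_u_bounded[of r t] rt by auto
  define g where "g \<tau> \<xi> = \<i> * of_real \<xi> / 2 * N \<tau> \<xi>" for \<tau> \<xi>
  define gn where "gn n \<tau> \<xi> = cut_rhs n \<tau> \<xi> - lam \<xi> * cut_ft n bump (u \<tau>) \<xi>" for n \<tau> \<xi>
  define e where "e c \<xi> = exp (- lam \<xi> * of_real c)" for c \<xi>
  have e1: "norm (e c \<xi>) \<le> 1" if "0 \<le> c" for c \<xi>
    unfolding e_def norm_exp_lam using mu that by simp
  define Df where "Df \<xi> = fourier (u t) \<xi> - mild_rhs r t \<xi>" for \<xi>
  have Dm: "Df \<in> borel_measurable borel"
    using fourier_u_measurable[OF t] mild_rhs_measurable[of r t] rt unfolding Df_def[abs_def] by simp
  define F where "F n q = indicator {r..t} (fst q) *\<^sub>R (gn n (fst q) (snd q) - g (fst q) (snd q))" for n and q :: "real \<times> real"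
  have Fm: "F n \<in> borel_measurable (borel \<Otimes>\<^sub>M borel)" for n
  proof -
    have 1: "(\<lambda>p. indicator {r..t} (fst p) *\<^sub>R cut_rhs n (fst p) (snd p)) \<in> borel_measurable (borel \<Otimes>\<^sub>M borel)"
      by (rule borel_measurable_strip, rule continuous_on_subset[OF continuous_cut_rhs]) (use sub in auto)
    have 2: "(\<lambda>p. indicator {r..t} (fst p) *\<^sub>R cut_ft n bump (u (fst p)) (snd p)) \<in> borel_measurable (borel \<Otimes>\<^sub>M borel)"
      by (rule borel_measurable_strip[where h="\<lambda>\<tau>. cut_ft n bump (u \<tau>)"], rule continuous_on_subset[OF continuous_cut_u[OF bump(1)]]) (use sub in auto)
    have 3: "(\<lambda>p. indicator {r..t} (fst p) *\<^sub>R N (fst p) (snd p)) \<in> borel_measurable (borel \<Otimes>\<^sub>M borel)"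
      by (rule borel_measurable_N_strip) (use rt in auto)
    have "(\<lambda>p. indicator {r..t} (fst p) *\<^sub>R cut_rhs n (fst p) (snd p) - lam (snd p) * (indicator {r..t} (fst p) *\<^sub>R cut_ft n bump (u (fst p)) (snd p))
        - \<i> * of_real (snd p) / 2 * (indicator {r..t} (fst p) *\<^sub>R N (fst p) (snd p))) \<in> borel_measurable (borel \<Otimes>\<^sub>M borel)"
      using 1 2 3 by measurable
    then show ?thesis
      by (rule measurable_cong[THEN iffD1, rotated]) (auto simp: F_def gn_def g_def indicator_def)
  qed
  have cont_gn: "continuous_on {r..t} (\<lambda>\<tau>. gn n \<tau> \<xi>)" for n \<xi>
    unfolding gn_def
    by (intro continuous_intros continuous_slice[OF continuous_cut_rhs sub]
        continuous_slice[where h="\<lambda>\<tau>. cut_ft n bump (u \<tau>)", OF continuous_cut_u[OF bump(1)] sub])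
  have cont_g: "continuous_on {r..t} (\<lambda>\<tau>. g \<tau> \<xi>)" for \<xi>
    unfolding g_def by (rule continuous_on_mult[OF continuous_on_const continuous_slice[OF continuous_N sub]])
  \<comment> \<open>The exponentials have modulus at most 1 because \<open>lam\<close> has
    nonnegative real part, so the three errors are estimated without them.\<close>
  have pointwise: "ennreal (norm (Df \<xi>)) \<le> ennreal (norm (fourier (u t) \<xi> - cut_ft n bump (u t) \<xi>))
      + ennreal (norm (fourier (u r) \<xi> - cut_ft n bump (u r) \<xi>)) + (\<integral>\<^sup>+\<tau>. ennreal (norm (F n (\<tau>, \<xi>))) \<partial>lborel)" for n \<xi>
  proof -
    have duh: "cut_ft n bump (u t) \<xi> = e (t - r) \<xi> * cut_ft n bump (u r) \<xi> - (LINT \<tau>:{r..t}|lborel. e (t - \<tau>) \<xi> * gn n \<tau> \<xi>)"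
      unfolding e_def
    proof (rule duhamel[where b="\<lambda>\<tau>. cut_rhs n \<tau> \<xi>"])
      show "continuous_on {r..t} (\<lambda>\<tau>. cut_rhs n \<tau> \<xi>)" by (rule continuous_slice[OF continuous_cut_rhs sub])
      show "cut_ft n bump (u x) \<xi> - cut_ft n bump (u r) \<xi> = - (LINT \<tau>:{r..x}|lborel. cut_rhs n \<tau> \<xi>)" if "x \<in> {r..t}" for x
        by (rule cut_equation) (use that rt in auto)
    qed (use rt in \<open>auto simp: gn_def\<close>)
    have ec: "continuous_on {r..t} (\<lambda>\<tau>. e (t - \<tau>) \<xi>)" unfolding e_def by (intro continuous_intros)
    have i: "set_integrable lborel {r..t} (\<lambda>\<tau>. e (t - \<tau>) \<xi> * gn n \<tau> \<xi>)" "set_integrable lborel {r..t} (\<lambda>\<tau>. e (t - \<tau>) \<xi> * g \<tau> \<xi>)"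
      by (intro borel_integrable_atLeastAtMost' continuous_on_mult ec cont_gn cont_g)+
    have "Df \<xi> = (fourier (u t) \<xi> - cut_ft n bump (u t) \<xi>) - e (t - r) \<xi> * (fourier (u r) \<xi> - cut_ft n bump (u r) \<xi>)
       - ((LINT \<tau>:{r..t}|lborel. e (t - \<tau>) \<xi> * gn n \<tau> \<xi>) - (LINT \<tau>:{r..t}|lborel. e (t - \<tau>) \<xi> * g \<tau> \<xi>))"
      unfolding Df_def mild_rhs_def g_def[symmetric] e_def[symmetric] duh by (simp add: algebra_simps)
    also have "(LINT \<tau>:{r..t}|lborel. e (t - \<tau>) \<xi> * gn n \<tau> \<xi>) - (LINT \<tau>:{r..t}|lborel. e (t - \<tau>) \<xi> * g \<tau> \<xi>)
      = (LINT \<tau>:{r..t}|lborel. e (t - \<tau>) \<xi> * gn n \<tau> \<xi> - e (t - \<tau>) \<xi> * g \<tau> \<xi>)"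
      by (rule set_integral_diff(2)[OF i, symmetric])
    also have "\<dots> = (LINT \<tau>|lborel. e (t - \<tau>) \<xi> * F n (\<tau>, \<xi>))"
      unfolding set_lebesgue_integral_def F_def by (intro Bochner_Integration.integral_cong) (auto simp: right_diff_distrib indicator_def)
    finally have Deq: "Df \<xi> = (fourier (u t) \<xi> - cut_ft n bump (u t) \<xi>) - e (t - r) \<xi> * (fourier (u r) \<xi> - cut_ft n bump (u r) \<xi>)
       - (LINT \<tau>|lborel. e (t - \<tau>) \<xi> * F n (\<tau>, \<xi>))" .
    define A B I where "A = fourier (u t) \<xi> - cut_ft n bump (u t) \<xi>" and "B = fourier (u r) \<xi> - cut_ft n bump (u r) \<xi>"
      and "I = (LINT \<tau>|lborel. e (t - \<tau>) \<xi> * F n (\<tau>, \<xi>))"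
    have "norm (Df \<xi>) \<le> norm A + norm (e (t - r) \<xi> * B) + norm I"
      unfolding Deq A_def[symmetric] B_def[symmetric] I_def[symmetric]
      using norm_triangle_ineq4[of "A - e (t - r) \<xi> * B" I] norm_triangle_ineq4[of A "e (t - r) \<xi> * B"] by linarith
    also have "norm (e (t - r) \<xi> * B) \<le> norm B"
      using e1[of "t - r" \<xi>] rt by (simp add: norm_mult mult_left_le_one_le)
    finally have "ennreal (norm (Df \<xi>)) \<le> ennreal (norm A + norm B + norm I)" by (intro ennreal_leI) simp
    also have "\<dots> = ennreal (norm A) + ennreal (norm B) + ennreal (norm I)" by simp
    also have "ennreal (norm I) \<le> (\<integral>\<^sup>+\<tau>. ennreal (norm (e (t - \<tau>) \<xi> * F n (\<tau>, \<xi>))) \<partial>lborel)"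
      unfolding I_def by (rule integral_norm_bound_nn)
    also have "\<dots> \<le> (\<integral>\<^sup>+\<tau>. ennreal (norm (F n (\<tau>, \<xi>))) \<partial>lborel)"
    proof (intro nn_integral_mono ennreal_leI)
      fix \<tau>
      show "norm (e (t - \<tau>) \<xi> * F n (\<tau>, \<xi>)) \<le> norm (F n (\<tau>, \<xi>))"
      proof (cases "\<tau> \<in> {r..t}")
        case True then show ?thesis using e1[of "t - \<tau>" \<xi>] by (simp add: norm_mult mult_left_le_one_le)
      qed (simp add: F_def)
    qed
    finally show ?thesis by (simp add: A_def B_def add_left_mono)
  qed
  have "AE \<xi> in lborel. \<xi> \<in> {- real M..real M} \<longrightarrow> Df \<xi> = 0" for M :: nat
  proof -
    let ?I = "\<lambda>\<xi>. indicator {- real M..real M} \<xi> :: ennreal"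
    let ?c = "L2 (indicator {- real M..real M} :: real \<Rightarrow> real)"
    define X where "X w n = ennreal (?c * (sqrt (2 * pi) * L2 (\<lambda>x. w x - dilate n bump x * w x)))" for w n
    define Y where "Y n = (\<integral>\<^sup>+\<tau>. (\<integral>\<^sup>+\<xi>. ?I \<xi> * ennreal (norm (F n (\<tau>, \<xi>))) \<partial>lborel) \<partial>lborel)" for n
    have X: "(\<integral>\<^sup>+\<xi>. ?I \<xi> * ennreal (norm (fourier w \<xi> - cut_ft n bump w \<xi>)) \<partial>lborel) \<le> X w n" if "square_integrable w" for w n
      using nn_integral_Icc_le_L2[OF square_integrable_diff[OF square_integrable_fourier cut_ft_L2(1)[OF bump(1) K(1)]], OF that that, of "real M" n]
      unfolding X_def cut_ft_L2(3)[OF bump(1) K(1) that] by simp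
    have X0: "X w \<longlonglongrightarrow> 0" if "square_integrable w" for w
    proof -
      have "(\<lambda>n. ?c * (sqrt (2 * pi) * L2 (\<lambda>x. w x - dilate n bump x * w x))) \<longlonglongrightarrow> ?c * (sqrt (2 * pi) * 0)"
        by (intro tendsto_intros cut_tendsto_L2(1)[OF bump(1) K(1) bump(2) that])
      then have "(\<lambda>n. ennreal (?c * (sqrt (2 * pi) * L2 (\<lambda>x. w x - dilate n bump x * w x)))) \<longlonglongrightarrow> ennreal 0"
        by (intro tendsto_ennrealI) simp
      then show ?thesis unfolding X_def[abs_def] by simp
    qed
    have inner: "(\<integral>\<^sup>+\<xi>. ?I \<xi> * ennreal (norm (F n (\<tau>, \<xi>))) \<partial>lborel) \<le> indicator {r..t} \<tau> * ennreal (defect_bound K (real M) n \<tau>)" for n \<tau>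
    proof (cases "\<tau> \<in> {r..t}")
      case True
      then have "\<tau> \<in> {0..<T}" using sub by auto
      from defect_integral_bound[OF this _ K, of "real M" n] True show ?thesis by (simp add: F_def gn_def g_def)
    qed (simp add: F_def)
    have "\<exists>H. \<forall>n. \<forall>\<tau>\<in>{r..t}. defect_bound K (real M) n \<tau> \<le> H"
      by (rule exI, intro allI ballI, rule defect_bound_bounded[OF _ K(1) S(2)]) (use sub in auto)
    then obtain H where H: "\<And>n \<tau>. \<tau> \<in> {r..t} \<Longrightarrow> defect_bound K (real M) n \<tau> \<le> H" by blast
    have sets: "borel_measurable (lborel \<Otimes>\<^sub>M lborel) = borel_measurable (borel \<Otimes>\<^sub>M (borel :: real measure) :: (real \<times> real) measure)"
      by (intro measurable_cong_sets sets_pair_measure_cong) simp_all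
    have Fm': "(\<lambda>q. ennreal (norm (F n q))) \<in> borel_measurable (lborel \<Otimes>\<^sub>M lborel)" for n
      unfolding sets using Fm[of n] by measurable
    have IFm: "(\<lambda>(\<tau>, \<xi>). ?I \<xi> * ennreal (norm (F n (\<tau>, \<xi>)))) \<in> borel_measurable (lborel \<Otimes>\<^sub>M lborel)" for n
      using Fm'[of n] by (simp add: case_prod_beta)
    \<comment> \<open>At each time the frequency integral tends to 0, and H times the indicator of
      [r, t] dominates it.\<close>
    have Y0: "Y \<longlonglongrightarrow> 0"
    proof -
      have "(\<lambda>n. \<integral>\<^sup>+\<tau>. (\<integral>\<^sup>+\<xi>. ?I \<xi> * ennreal (norm (F n (\<tau>, \<xi>))) \<partial>lborel) \<partial>lborel) \<longlonglongrightarrow> (\<integral>\<^sup>+\<tau>. 0 \<partial>(lborel :: real measure))"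
      proof (rule nn_integral_dominated_convergence[where w="\<lambda>\<tau>. ennreal H * indicator {r..t} \<tau>"])
        show "(\<lambda>\<tau>. \<integral>\<^sup>+\<xi>. ?I \<xi> * ennreal (norm (F n (\<tau>, \<xi>))) \<partial>lborel) \<in> borel_measurable lborel" for n
          using lborel.borel_measurable_nn_integral[OF IFm[of n]] by simp
        show "AE \<tau> in lborel. (\<integral>\<^sup>+\<xi>. ?I \<xi> * ennreal (norm (F n (\<tau>, \<xi>))) \<partial>lborel) \<le> ennreal H * indicator {r..t} \<tau>" for n
        proof (rule AE_I2)
          fix \<tau>
          show "(\<integral>\<^sup>+\<xi>. ?I \<xi> * ennreal (norm (F n (\<tau>, \<xi>))) \<partial>lborel) \<le> ennreal H * indicator {r..t} \<tau>"
            by (rule order_trans[OF inner]) (auto simp: indicator_def intro!: ennreal_leI H)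
        qed
        show "(\<integral>\<^sup>+\<tau>. ennreal H * indicator {r..t} \<tau> \<partial>lborel) < \<infinity>"
          using rt by (simp add: nn_integral_cmult_indicator ennreal_mult_less_top)
        show "AE \<tau> in lborel. (\<lambda>n. \<integral>\<^sup>+\<xi>. ?I \<xi> * ennreal (norm (F n (\<tau>, \<xi>))) \<partial>lborel) \<longlonglongrightarrow> 0"
        proof (rule AE_I2)
          fix \<tau>
          have l: "(\<lambda>n. indicator {r..t} \<tau> * ennreal (defect_bound K (real M) n \<tau>)) \<longlonglongrightarrow> 0"
          proof (cases "\<tau> \<in> {r..t}")
            case True
            then have "\<tau> \<in> {0..<T}" using sub by auto
            from tendsto_ennrealI[OF defect_bound_tendsto[OF this K(1)]] True show ?thesis by simp
          qed simp
          show "(\<lambda>n. \<integral>\<^sup>+\<xi>. ?I \<xi> * ennreal (norm (F n (\<tau>, \<xi>))) \<partial>lborel) \<longlonglongrightarrow> 0"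
            by (rule tendsto_sandwich[OF _ _ tendsto_const l]) (use inner in auto)
        qed
      qed simp_all
      then show ?thesis unfolding Y_def[abs_def] by simp
    qed
    have le: "(\<integral>\<^sup>+\<xi>. ?I \<xi> * ennreal (norm (Df \<xi>)) \<partial>lborel) \<le> X (u t) n + X (u r) n + Y n" for n
    proof -
      let ?a = "\<lambda>\<xi>. ?I \<xi> * ennreal (norm (fourier (u t) \<xi> - cut_ft n bump (u t) \<xi>))"
      let ?b = "\<lambda>\<xi>. ?I \<xi> * ennreal (norm (fourier (u r) \<xi> - cut_ft n bump (u r) \<xi>))"
      let ?y = "\<lambda>\<xi>. \<integral>\<^sup>+\<tau>. ?I \<xi> * ennreal (norm (F n (\<tau>, \<xi>))) \<partial>lborel"
      have m: "cut_ft n bump (u \<tau>) \<in> borel_measurable borel" if "\<tau> \<in> {0..<T}" for \<tau>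
        using square_integrable_measurable[OF cut_ft_L2(1)[OF bump(1) K(1) sq_u[OF that]]] by simp
      have am: "?a \<in> borel_measurable lborel" "?b \<in> borel_measurable lborel"
        using fourier_u_measurable[OF t] fourier_u_measurable[OF r] m[OF t] m[OF r] by measurable
      have IFm2: "(\<lambda>(\<xi>, \<tau>). ?I \<xi> * ennreal (norm (F n (\<tau>, \<xi>)))) \<in> borel_measurable (lborel \<Otimes>\<^sub>M lborel)"
        using measurable_compose[OF measurable_pair_swap' IFm[of n]] by (simp add: case_prod_beta)
      have ym: "?y \<in> borel_measurable lborel"
        using lborel.borel_measurable_nn_integral[OF IFm2] by simp
      have Fs: "(\<lambda>\<tau>. ennreal (norm (F n (\<tau>, \<xi>)))) \<in> borel_measurable lborel" for \<xi>
        using measurable_compose[OF measurable_Pair2' Fm'[of n], of \<xi>] by simp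
      have "(\<integral>\<^sup>+\<xi>. ?I \<xi> * ennreal (norm (Df \<xi>)) \<partial>lborel) \<le> (\<integral>\<^sup>+\<xi>. ?a \<xi> + ?b \<xi> + ?y \<xi> \<partial>lborel)"
      proof (rule nn_integral_mono)
        fix \<xi>
        have "?y \<xi> = ?I \<xi> * (\<integral>\<^sup>+\<tau>. ennreal (norm (F n (\<tau>, \<xi>))) \<partial>lborel)"
          by (rule nn_integral_cmult[OF Fs])
        then show "?I \<xi> * ennreal (norm (Df \<xi>)) \<le> ?a \<xi> + ?b \<xi> + ?y \<xi>"
          using mult_left_mono[OF pointwise[of \<xi> n], of "?I \<xi>"] by (simp only: distrib_left zero_le)
      qed
      also have "\<dots> = (\<integral>\<^sup>+\<xi>. ?a \<xi> \<partial>lborel) + (\<integral>\<^sup>+\<xi>. ?b \<xi> \<partial>lborel) + (\<integral>\<^sup>+\<xi>. ?y \<xi> \<partial>lborel)"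
        using am ym by (simp only: nn_integral_add borel_measurable_add)
      \<comment> \<open>The pointwise bound integrates in time first, the defect estimate in
        frequency first; Tonelli's theorem reconciles the two.\<close>
      also have "(\<integral>\<^sup>+\<xi>. ?y \<xi> \<partial>lborel) = Y n"
        unfolding Y_def by (rule lborel_pair.Fubini'[OF IFm[of n]])
      also have "(\<integral>\<^sup>+\<xi>. ?a \<xi> \<partial>lborel) + (\<integral>\<^sup>+\<xi>. ?b \<xi> \<partial>lborel) + Y n \<le> X (u t) n + X (u r) n + Y n"
        by (intro add_mono X sq_u t r order_refl)
      finally show ?thesis .
    qed
    have "(\<lambda>n. X (u t) n + X (u r) n + Y n) \<longlonglongrightarrow> 0 + 0 + 0" by (intro tendsto_add X0 Y0 sq_u t r)
    then have "(\<integral>\<^sup>+\<xi>. ?I \<xi> * ennreal (norm (Df \<xi>)) \<partial>lborel) \<le> 0"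
      by (intro LIMSEQ_le_const[of _ 0]) (use le in auto)
    then have "(\<integral>\<^sup>+\<xi>. ?I \<xi> * ennreal (norm (Df \<xi>)) \<partial>lborel) = 0" by simp
    then have "AE \<xi> in lborel. ?I \<xi> * ennreal (norm (Df \<xi>)) = 0"
      using Dm by (subst (asm) nn_integral_0_iff_AE) auto
    then show ?thesis by eventually_elim (auto simp: indicator_def)
  qed
  \<comment> \<open>Countably many windows exhaust the line, so the exceptional sets still form a
    null set.\<close>
  then have "AE \<xi> in lborel. \<forall>M::nat. \<xi> \<in> {- real M..real M} \<longrightarrow> Df \<xi> = 0" by (intro AE_all_countable[THEN iffD2] allI)
  then show ?thesis
  proof eventually_elim
    case (elim \<xi>)
    obtain M :: nat where "\<bar>\<xi>\<bar> \<le> real M" using real_arch_simple by blast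
    then have "Df \<xi> = 0" using elim by (auto simp: abs_le_iff)
    then show ?case by (simp add: Df_def)
  qed
qed

end

section \<open>Smoothing\<close>

lemma exp_integral_le:
  fixes c :: real
  assumes "c > 0" "r \<le> t"
  shows "(LINT \<tau>:{r..t}|lborel. exp (- (c * (t - \<tau>)))) \<le> 1 / c"
proof -
  have "(LINT x|lborel. indicator {r..t} x *\<^sub>R exp (- (c * (t - x)))) = exp (- (c * (t - t))) / c - exp (- (c * (t - r))) / c"
  proof (rule integral_FTC_atLeastAtMost[OF assms(2)])
    fix x
    have "((\<lambda>x. exp (- (c * (t - x))) / c) has_real_derivative exp (- (c * (t - x)))) (at x within {r..t})"
      using assms by (auto intro!: derivative_eq_intros)
    then show "((\<lambda>x. exp (- (c * (t - x))) / c) has_vector_derivative exp (- (c * (t - x)))) (at x within {r..t})"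
      by (simp add: has_real_derivative_iff_has_vector_derivative)
  qed (intro continuous_intros)
  then show ?thesis using assms by (simp add: set_lebesgue_integral_def)
qed

text \<open>Since \<xi> is the difference of \<eta> and \<eta> - \<xi>, the bracket of \<xi> is at
  most twice the larger of the other two; the maximum is then replaced by the sum.\<close>

lemma bracket_triangle:
  assumes "0 \<le> \<sigma>"
  shows "bracket \<sigma> \<xi> \<le> 2 powr \<sigma> * (bracket \<sigma> \<eta> + bracket \<sigma> (\<eta> - \<xi>))"
proof -
  define M where "M = max (1 + \<eta>\<^sup>2) (1 + (\<eta> - \<xi>)\<^sup>2)"
  have M1: "M \<ge> 1" by (simp add: M_def le_max_iff_disj)
  \<comment> \<open>The difference of the two sides is 3 plus the square of 2 \<eta> -
    \<xi>.\<close>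
  have "1 + \<xi>\<^sup>2 \<le> 2 * (1 + \<eta>\<^sup>2) + 2 * (1 + (\<eta> - \<xi>)\<^sup>2)"
    using zero_le_power2[of "2 * \<eta> - \<xi>"] by (simp add: power2_eq_square algebra_simps)
  also have "\<dots> \<le> 4 * M"
  proof -
    have *: "2 * a + 2 * b \<le> 4 * M" if "a \<le> M" "b \<le> M" for a b using that by linarith
    show ?thesis by (rule *) (simp_all add: M_def)
  qed
  finally have "bracket \<sigma> \<xi> \<le> (4 * M) powr (\<sigma> / 2)"
    unfolding bracket_def using assms one_plus_sq_pos[of \<xi>] by (intro powr_mono2) auto
  also have "\<dots> = 4 powr (\<sigma> / 2) * M powr (\<sigma> / 2)" using M1 by (simp add: powr_mult)
  also have "4 powr (\<sigma> / 2) = 2 powr \<sigma>"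
  proof -
    have "(4::real) = 2 powr 2" by simp
    then show ?thesis by (simp only: powr_powr) simp
  qed
  also have "M powr (\<sigma> / 2) \<le> bracket \<sigma> \<eta> + bracket \<sigma> (\<eta> - \<xi>)"
    unfolding M_def max_def bracket_def by auto
  finally show ?thesis by simp
qed

text \<open>By Parseval for w and a modulated copy of w, the transform of the square is an
  autocorrelation of the transform. \<open>bracket_triangle\<close> puts the whole weight on one of
  the two factors, and Cauchy-Schwarz then bounds the integral uniformly in \<xi>.\<close>

lemma ft_square_bound:
  fixes w :: "real \<Rightarrow> real"
  assumes w: "in_sobolev \<sigma> w" and \<sigma>: "0 \<le> \<sigma>"
  shows "bracket \<sigma> \<xi> * norm (ft (\<lambda>x. complex_of_real ((w x)\<^sup>2)) \<xi>) \<le> 2 powr \<sigma> * (sobolev_norm \<sigma> w)\<^sup>2"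
proof -
  have sq: "square_integrable w" using w by (simp add: in_sobolev_iff)
  let ?w = "\<lambda>x. complex_of_real (w x)" and ?W = "fourier w"
  note cs = square_integrable_of_real[OF sq] and W = square_integrable_fourier[OF sq]
  have Wt: "square_integrable (\<lambda>\<eta>. ?W (\<eta> - \<xi>))" by (rule square_integrable_translate[OF W])
  define b where "b \<eta> = bracket \<sigma> \<eta> *\<^sub>R ?W \<eta>" for \<eta>
  have bsq: "square_integrable b" using w by (simp add: in_sobolev_iff b_def[abs_def])
  have bt: "square_integrable (\<lambda>\<eta>. b (\<eta> - \<xi>))" by (rule square_integrable_translate[OF bsq])
  have b: "L2 b = sobolev_norm \<sigma> w" by (simp add: sobolev_norm_eq b_def[abs_def])
  have "ft (\<lambda>x. complex_of_real ((w x)\<^sup>2)) \<xi> = (LINT x|lborel. ?w x * cnj (cis (\<xi> * x) * ?w x))"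
    unfolding ft_def by (rule Bochner_Integration.integral_cong[OF refl]) (simp add: cis_cnj power2_eq_square mult_ac)
  then have "2 * pi * ft (\<lambda>x. complex_of_real ((w x)\<^sup>2)) \<xi> = 2 * pi * (LINT x|lborel. ?w x * cnj (cis (\<xi> * x) * ?w x))"
    by (simp only:)
  also have "\<dots> = (LINT \<eta>|lborel. ?W \<eta> * cnj (?W (\<eta> - \<xi>)))"
    by (rule fourier_parseval[OF cs is_fourier_fourier[OF sq] square_integrable_cis_mult[OF cs] is_fourier_modulate[OF cs is_fourier_fourier[OF sq]], symmetric])
  finally have eq: "2 * pi * ft (\<lambda>x. complex_of_real ((w x)\<^sup>2)) \<xi> = (LINT \<eta>|lborel. ?W \<eta> * cnj (?W (\<eta> - \<xi>)))" .
  have "bracket \<sigma> \<xi> * norm (2 * pi * ft (\<lambda>x. complex_of_real ((w x)\<^sup>2)) \<xi>) \<le> bracket \<sigma> \<xi> * (LINT \<eta>|lborel. norm (?W \<eta> * cnj (?W (\<eta> - \<xi>))))"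
    unfolding eq by (intro mult_left_mono integral_norm_bound) simp
  also have "\<dots> = (LINT \<eta>|lborel. bracket \<sigma> \<xi> * (norm (?W \<eta>) * norm (?W (\<eta> - \<xi>))))"
    by (simp add: norm_mult)
  also have "\<dots> \<le> (LINT \<eta>|lborel. 2 powr \<sigma> * (norm (b \<eta>) * norm (?W (\<eta> - \<xi>)) + norm (?W \<eta>) * norm (b (\<eta> - \<xi>))))"
  proof (rule integral_mono)
    show "integrable lborel (\<lambda>\<eta>. bracket \<sigma> \<xi> * (norm (?W \<eta>) * norm (?W (\<eta> - \<xi>))))"
      by (intro integrable_mult_right square_integrable_norm_mult W Wt)
    show "integrable lborel (\<lambda>\<eta>. 2 powr \<sigma> * (norm (b \<eta>) * norm (?W (\<eta> - \<xi>)) + norm (?W \<eta>) * norm (b (\<eta> - \<xi>))))"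
      by (intro integrable_mult_right Bochner_Integration.integrable_add square_integrable_norm_mult W Wt bsq bt)
    show "bracket \<sigma> \<xi> * (norm (?W \<eta>) * norm (?W (\<eta> - \<xi>))) \<le> 2 powr \<sigma> * (norm (b \<eta>) * norm (?W (\<eta> - \<xi>)) + norm (?W \<eta>) * norm (b (\<eta> - \<xi>)))" for \<eta>
      using mult_right_mono[OF bracket_triangle[OF \<sigma>, of \<xi> \<eta>], of "norm (?W \<eta>) * norm (?W (\<eta> - \<xi>))"]
      by (simp add: b_def algebra_simps)
  qed
  also have "\<dots> = 2 powr \<sigma> * ((LINT \<eta>|lborel. norm (b \<eta>) * norm (?W (\<eta> - \<xi>))) + (LINT \<eta>|lborel. norm (?W \<eta>) * norm (b (\<eta> - \<xi>))))"
    using square_integrable_norm_mult[OF bsq Wt] square_integrable_norm_mult[OF W bt] by simp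
  also have "\<dots> \<le> 2 powr \<sigma> * (L2 b * L2 ?W + L2 ?W * L2 b)"
    using cauchy_schwarz[OF bsq Wt] cauchy_schwarz[OF W bt] L2_translate[of ?W \<xi>] L2_translate[of b \<xi>]
    by (intro mult_left_mono add_mono) auto
  also have "\<dots> \<le> 2 powr \<sigma> * (sobolev_norm \<sigma> w * sobolev_norm \<sigma> w + sobolev_norm \<sigma> w * sobolev_norm \<sigma> w)"
    unfolding b using L2_le_sobolev_norm(1)[OF w \<sigma>] by (intro mult_left_mono add_mono mult_right_mono) auto
  finally have "2 * pi * (bracket \<sigma> \<xi> * norm (ft (\<lambda>x. complex_of_real ((w x)\<^sup>2)) \<xi>)) \<le> 2 * (2 powr \<sigma> * (sobolev_norm \<sigma> w)\<^sup>2)"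
    by (simp add: norm_mult power2_eq_square algebra_simps)
  moreover have "2 * (bracket \<sigma> \<xi> * norm (ft (\<lambda>x. complex_of_real ((w x)\<^sup>2)) \<xi>)) \<le> 2 * pi * (bracket \<sigma> \<xi> * norm (ft (\<lambda>x. complex_of_real ((w x)\<^sup>2)) \<xi>))"
    using pi_ge_two by (intro mult_right_mono) auto
  ultimately show ?thesis by linarith
qed

lemma in_sobolev_mono:
  assumes f: "in_sobolev s f" and \<sigma>: "\<sigma> \<le> s"
  shows "in_sobolev \<sigma> f" "sobolev_norm \<sigma> f \<le> sobolev_norm s f"
proof -
  have sq: "square_integrable f" and b: "square_integrable (\<lambda>\<xi>. bracket s \<xi> *\<^sub>R fourier f \<xi>)"
    using f by (simp_all add: in_sobolev_iff)
  have le: "norm (bracket \<sigma> \<xi> *\<^sub>R fourier f \<xi>) \<le> norm (bracket s \<xi> *\<^sub>R fourier f \<xi>)" for \<xi>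
    using bracket_mono[OF \<sigma>, of \<xi>] by (simp add: mult_right_mono)
  have m: "(\<lambda>\<xi>. bracket \<sigma> \<xi> *\<^sub>R fourier f \<xi>) \<in> borel_measurable lborel"
    using square_integrable_measurable[OF square_integrable_fourier[OF sq]] by simp
  show "in_sobolev \<sigma> f"
    unfolding in_sobolev_iff using sq square_integrable_bound[OF m b] le by auto
  show "sobolev_norm \<sigma> f \<le> sobolev_norm s f"
    unfolding sobolev_norm_eq by (rule L2_mono_AE[OF b]) (use le in auto)
qed

section \<open>Bounds for the Duhamel term\<close>

context flow
begin

text \<open>N splits into the transforms of the squares of u and v, and the Hilbert transform
  preserves the Sobolev norm; so the bound for a square counts twice.\<close>

lemma N_bound:
  assumes t: "t \<in> {0..<T}" and \<sigma>: "0 \<le> \<sigma>" "\<sigma> \<le> s"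
  shows "norm (N t \<xi>) \<le> 2 * 2 powr \<sigma> * (sobolev_norm \<sigma> (u t))\<^sup>2 * bracket (- \<sigma>) \<xi>"
proof -
  have su: "in_sobolev \<sigma> (u t)" by (rule in_sobolev_mono[OF sobolev_u[OF t] \<sigma>(2)])
  then have sv: "in_sobolev \<sigma> (v t)" "sobolev_norm \<sigma> (v t) = sobolev_norm \<sigma> (u t)"
    unfolding v_def by (auto intro: in_sobolev_hilbert)
  have i: "integrable lborel (\<lambda>x. complex_of_real ((u t x)\<^sup>2))" "integrable lborel (\<lambda>x. complex_of_real ((v t x)\<^sup>2))"
    using square_integrable_sq[OF sq_u[OF t]] square_integrable_sq[OF sq_v[OF t]]
    by (simp_all only: complex_of_real_integrable_eq real_norm_def power2_abs)
  have "N t \<xi> = (LINT x|lborel. cis (- (x * \<xi>)) * complex_of_real ((u t x)\<^sup>2) + cis (- (x * \<xi>)) * complex_of_real ((v t x)\<^sup>2))"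
    unfolding N_def ft_def by (intro Bochner_Integration.integral_cong) (auto simp: Q_def distrib_left)
  also have "\<dots> = ft (\<lambda>x. complex_of_real ((u t x)\<^sup>2)) \<xi> + ft (\<lambda>x. complex_of_real ((v t x)\<^sup>2)) \<xi>"
    unfolding ft_def by (intro Bochner_Integration.integral_add integrable_cis_mult i) simp_all
  finally have "bracket \<sigma> \<xi> * norm (N t \<xi>) \<le> bracket \<sigma> \<xi> * (norm (ft (\<lambda>x. complex_of_real ((u t x)\<^sup>2)) \<xi>) + norm (ft (\<lambda>x. complex_of_real ((v t x)\<^sup>2)) \<xi>))"
    by (simp add: norm_triangle_ineq mult_left_mono)
  also have "\<dots> \<le> 2 powr \<sigma> * (sobolev_norm \<sigma> (u t))\<^sup>2 + 2 powr \<sigma> * (sobolev_norm \<sigma> (u t))\<^sup>2"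
    using ft_square_bound[OF su \<sigma>(1), of \<xi>] ft_square_bound[OF sv(1) \<sigma>(1), of \<xi>] sv(2) by (simp add: distrib_left)
  finally have "bracket \<sigma> \<xi> * norm (N t \<xi>) \<le> 2 * 2 powr \<sigma> * (sobolev_norm \<sigma> (u t))\<^sup>2" by simp
  from mult_right_mono[OF this, of "bracket (- \<sigma>) \<xi>"] have "(bracket \<sigma> \<xi> * bracket (- \<sigma>) \<xi>) * norm (N t \<xi>) \<le> 2 * 2 powr \<sigma> * (sobolev_norm \<sigma> (u t))\<^sup>2 * bracket (- \<sigma>) \<xi>"
    by (simp add: mult_ac)
  then show ?thesis by (simp add: bracket_mult)
qed

text \<open>A bound for |\<xi>| times the integral of
  \<open>exp (- (\<mu> * \<xi>\<^sup>2 * \<tau>))\<close> over a time interval of length \<delta>: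
  viscosity pays for the derivative in the nonlinearity and leaves decay like 1 / |\<xi>|. At \<xi>
  = 0 the quotient has the default value 0, and the outer factor gives 0 anyway.\<close>

definition kern :: "real \<Rightarrow> real \<Rightarrow> real"
  where "kern \<delta> \<xi> = \<bar>\<xi>\<bar> * min \<delta> (1 / (\<mu> * \<xi>\<^sup>2))"

lemma kern_nonneg: "0 \<le> \<delta> \<Longrightarrow> 0 \<le> kern \<delta> \<xi>"
  using mu by (simp add: kern_def)

lemma kern_mono: "\<delta> \<le> \<delta>' \<Longrightarrow> kern \<delta> \<xi> \<le> kern \<delta>' \<xi>"
  by (simp add: kern_def mult_left_mono min.coboundedI1)

lemma borel_measurable_kern [measurable]: "kern \<delta> \<in> borel_measurable borel"
  unfolding kern_def[abs_def] by measurable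

text \<open>Low frequencies use the entry \<delta> of the minimum, high ones the entry
  \<open>1 / (\<mu> * \<xi>\<^sup>2)\<close>; the factor sqrt 2 compares the bracket with 1 or with
  |\<xi>|.\<close>

lemma kern_le_bracket:
  assumes "0 \<le> \<delta>"
  shows "kern \<delta> \<xi> \<le> sqrt 2 * (\<delta> + 1 / \<mu>) * bracket (- 1) \<xi>"
proof -
  define b where "b = sqrt (1 + \<xi>\<^sup>2)"
  have b: "b > 0" unfolding b_def by (rule real_sqrt_gt_zero[OF one_plus_sq_pos(1)])
  have e: "bracket (- 1) \<xi> = 1 / b"
    using bracket_mult[of 1 \<xi> "-1"] b by (simp add: bracket_1 b_def[symmetric] field_simps)
  have "kern \<delta> \<xi> * b \<le> sqrt 2 * (\<delta> + 1 / \<mu>)"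
  proof (cases "\<bar>\<xi>\<bar> \<le> 1")
    case True
    have "\<xi>\<^sup>2 \<le> 1" using True by (simp add: abs_square_le_1)
    then have "b \<le> sqrt 2" unfolding b_def by (intro real_sqrt_le_mono) simp
    have "kern \<delta> \<xi> \<le> 1 * \<delta>" unfolding kern_def using True assms mu by (intro mult_mono) auto
    also have "\<dots> \<le> \<delta> + 1 / \<mu>" using mu by simp
    finally have "kern \<delta> \<xi> * b \<le> (\<delta> + 1 / \<mu>) * sqrt 2"
      using \<open>b \<le> sqrt 2\<close> b assms mu kern_nonneg[OF assms, of \<xi>] by (intro mult_mono) auto
    then show ?thesis by (simp add: mult.commute)
  next
    case False
    then have x: "\<bar>\<xi>\<bar> > 1" by simp
    then have "1 \<le> \<bar>\<xi>\<bar>\<^sup>2" by (intro one_le_power) simp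
    then have "1 \<le> \<xi>\<^sup>2" by (simp only: power2_abs)
    have "b \<le> sqrt (2 * \<xi>\<^sup>2)" unfolding b_def using \<open>1 \<le> \<xi>\<^sup>2\<close> by (intro real_sqrt_le_mono) simp
    then have bb: "b \<le> sqrt 2 * \<bar>\<xi>\<bar>" by (simp add: real_sqrt_mult)
    have "kern \<delta> \<xi> \<le> \<bar>\<xi>\<bar> * (1 / (\<mu> * \<xi>\<^sup>2))" unfolding kern_def by (intro mult_left_mono) auto
    also have "\<dots> = 1 / (\<mu> * \<bar>\<xi>\<bar>)"
    proof -
      have "y * (1 / (\<mu> * y\<^sup>2)) = 1 / (\<mu> * y)" if "y > 0" for y
        using that mu by (simp add: power2_eq_square)
      from this[of "\<bar>\<xi>\<bar>"] x show ?thesis by simp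
    qed
    finally have "kern \<delta> \<xi> * b \<le> 1 / (\<mu> * \<bar>\<xi>\<bar>) * (sqrt 2 * \<bar>\<xi>\<bar>)"
      using bb b mu x by (intro mult_mono) auto
    also have "\<dots> = sqrt 2 * (1 / \<mu>)" using x mu by simp
    also have "\<dots> \<le> sqrt 2 * (\<delta> + 1 / \<mu>)" using assms by (intro mult_left_mono) auto
    finally show ?thesis .
  qed
  then show ?thesis unfolding e using b by (simp add: pos_le_divide_eq)
qed

lemma square_integrable_kern:
  assumes "0 \<le> \<delta>"
  shows "square_integrable (kern \<delta>)"
proof (rule square_integrable_bound)
  show "square_integrable (\<lambda>\<xi>. (sqrt 2 * (\<delta> + 1 / \<mu>)) *\<^sub>R bracket (- 1) \<xi>)"
    by (intro square_integrable_scaleR square_integrable_bracket) simp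
  show "AE \<xi> in lborel. norm (kern \<delta> \<xi>) \<le> norm ((sqrt 2 * (\<delta> + 1 / \<mu>)) *\<^sub>R bracket (- 1) \<xi>)"
  proof (rule AE_I2)
    fix \<xi>
    have "norm (kern \<delta> \<xi>) = kern \<delta> \<xi>" using kern_nonneg[OF assms, of \<xi>] by simp
    also note kern_le_bracket[OF assms, of \<xi>]
    finally show "norm (kern \<delta> \<xi>) \<le> norm ((sqrt 2 * (\<delta> + 1 / \<mu>)) *\<^sub>R bracket (- 1) \<xi>)" by simp
  qed
qed simp

text \<open>Dominated convergence under \<open>kern 1\<close> along \<delta> = 1 / (n + 1);
  monotonicity in \<delta> extends the bound to all shorter intervals.\<close>

lemma L2_kern_small:
  assumes "e > 0"
  obtains \<delta> where "\<delta> > 0" "\<And>\<delta>'. 0 \<le> \<delta>' \<Longrightarrow> \<delta>' \<le> \<delta> \<Longrightarrow> L2 (kern \<delta>') < e"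
proof -
  have "(\<lambda>n. L2 (kern (1 / real (Suc n)))) \<longlonglongrightarrow> 0"
  proof (rule L2_dominated[OF square_integrable_kern[of 1], where C=1])
    show "norm (kern (1 / real (Suc n)) \<xi>) \<le> 1 * norm (kern 1 \<xi>)" for n \<xi>
      using kern_nonneg[of "1 / real (Suc n)" \<xi>] kern_mono[of "1 / real (Suc n)" 1 \<xi>] by simp
    show "(\<lambda>n. kern (1 / real (Suc n)) \<xi>) \<longlonglongrightarrow> 0" for \<xi>
    proof (rule tendsto_sandwich[OF _ _ tendsto_const])
      show "(\<lambda>n. \<bar>\<xi>\<bar> * inverse (real (Suc n))) \<longlonglongrightarrow> 0"
        using tendsto_mult[OF tendsto_const LIMSEQ_inverse_real_of_nat, of "\<bar>\<xi>\<bar>"] by simp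
      show "\<forall>\<^sub>F n in sequentially. kern (1 / real (Suc n)) \<xi> \<le> \<bar>\<xi>\<bar> * inverse (real (Suc n))"
        unfolding kern_def inverse_eq_divide by (intro always_eventually allI mult_left_mono min.cobounded1) simp
      show "\<forall>\<^sub>F n in sequentially. 0 \<le> kern (1 / real (Suc n)) \<xi>"
        by (intro always_eventually allI kern_nonneg) simp
    qed
  qed simp_all
  from order_tendstoD(2)[OF this assms] obtain n where n: "L2 (kern (1 / real (Suc n))) < e"
    by (auto simp: eventually_sequentially)
  show thesis
  proof (rule that[of "1 / real (Suc n)"])
    fix \<delta>' :: real assume d: "0 \<le> \<delta>'" "\<delta>' \<le> 1 / real (Suc n)"
    have "L2 (kern \<delta>') \<le> L2 (kern (1 / real (Suc n)))"
      using d kern_nonneg[OF d(1)] kern_nonneg[of "1 / real (Suc n)"] kern_mono[OF d(2)]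
      by (intro L2_mono_AE square_integrable_kern) auto
    then show "L2 (kern \<delta>') < e" using n by simp
  qed simp
qed

text \<open>The modulus of the exponential sees only the dissipative part of \<open>lam\<close>. Its
  time integral is at most the length of the interval and at most
  \<open>1 / (\<mu> * \<xi>\<^sup>2)\<close>, the two entries of the minimum in
  \<open>kern\<close>.\<close>

lemma mild_integral_bound:
  assumes rt: "0 \<le> r" "r \<le> t" "t < T" and B: "\<And>\<tau>. \<tau> \<in> {r..t} \<Longrightarrow> norm (N \<tau> \<xi>) \<le> B"
  shows "norm (LINT \<tau>:{r..t}|lborel. exp (- lam \<xi> * of_real (t - \<tau>)) * (\<i> * of_real \<xi> / 2 * N \<tau> \<xi>)) \<le> B / 2 * kern (t - r) \<xi>"
proof -
  have B0: "0 \<le> B" using B[of r] norm_ge_zero[of "N r \<xi>"] rt by (simp add: order_trans[OF norm_ge_zero])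
  let ?f = "\<lambda>\<tau>. exp (- (\<mu> * \<xi>\<^sup>2 * (t - \<tau>)))"
  have i: "set_integrable lborel {r..t} ?f" by (intro borel_integrable_atLeastAtMost' continuous_intros)
  have "norm (LINT \<tau>:{r..t}|lborel. exp (- lam \<xi> * of_real (t - \<tau>)) * (\<i> * of_real \<xi> / 2 * N \<tau> \<xi>))
      \<le> (LINT \<tau>|lborel. norm (indicator {r..t} \<tau> *\<^sub>R (exp (- lam \<xi> * of_real (t - \<tau>)) * (\<i> * of_real \<xi> / 2 * N \<tau> \<xi>))))"
    unfolding set_lebesgue_integral_def by (rule integral_norm_bound)
  also have "\<dots> \<le> (LINT \<tau>|lborel. (B / 2 * \<bar>\<xi>\<bar>) * (indicator {r..t} \<tau> *\<^sub>R ?f \<tau>))"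
  proof (rule integral_mono_AE')
    show "integrable lborel (\<lambda>\<tau>. (B / 2 * \<bar>\<xi>\<bar>) * (indicator {r..t} \<tau> *\<^sub>R ?f \<tau>))"
      using i unfolding set_integrable_def by (rule integrable_mult_right)
    show "AE \<tau> in lborel. norm (indicator {r..t} \<tau> *\<^sub>R (exp (- lam \<xi> * of_real (t - \<tau>)) * (\<i> * of_real \<xi> / 2 * N \<tau> \<xi>))) \<le> (B / 2 * \<bar>\<xi>\<bar>) * (indicator {r..t} \<tau> *\<^sub>R ?f \<tau>)"
    proof (rule AE_I2)
      fix \<tau>
      show "norm (indicator {r..t} \<tau> *\<^sub>R (exp (- lam \<xi> * of_real (t - \<tau>)) * (\<i> * of_real \<xi> / 2 * N \<tau> \<xi>))) \<le> (B / 2 * \<bar>\<xi>\<bar>) * (indicator {r..t} \<tau> *\<^sub>R ?f \<tau>)"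
      proof (cases "\<tau> \<in> {r..t}")
        case True
        have "norm (exp (- lam \<xi> * of_real (t - \<tau>)) * (\<i> * of_real \<xi> / 2 * N \<tau> \<xi>)) = ?f \<tau> * (\<bar>\<xi>\<bar> / 2 * norm (N \<tau> \<xi>))"
          unfolding norm_mult norm_exp_lam by (simp add: norm_mult norm_divide)
        also have "\<dots> \<le> ?f \<tau> * (\<bar>\<xi>\<bar> / 2 * B)" using B[OF True] by (intro mult_left_mono) auto
        finally show ?thesis using True by (simp add: mult_ac)
      qed simp
    qed
  qed (use B0 in \<open>auto intro!: AE_I2 mult_nonneg_nonneg\<close>)
  also have "\<dots> = (B / 2 * \<bar>\<xi>\<bar>) * (LINT \<tau>:{r..t}|lborel. ?f \<tau>)"
    unfolding set_lebesgue_integral_def by (rule integral_mult_right_zero)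
  also have "\<dots> \<le> B / 2 * kern (t - r) \<xi>"
  proof (cases "\<xi> = 0")
    case False
    have "(LINT \<tau>:{r..t}|lborel. ?f \<tau>) \<le> (LINT \<tau>:{r..t}|lborel. 1)"
    proof (rule set_integral_mono[OF i])
      show "set_integrable lborel {r..t} (\<lambda>\<tau>. 1 :: real)" by (intro borel_integrable_atLeastAtMost' continuous_on_const)
    qed (use mu in auto)
    also have "\<dots> = t - r" using rt by (simp add: set_lebesgue_integral_def)
    finally have 1: "(LINT \<tau>:{r..t}|lborel. ?f \<tau>) \<le> t - r" .
    have "(LINT \<tau>:{r..t}|lborel. ?f \<tau>) \<le> 1 / (\<mu> * \<xi>\<^sup>2)"
      by (rule exp_integral_le) (use mu False rt in auto)
    with 1 have "(LINT \<tau>:{r..t}|lborel. ?f \<tau>) \<le> min (t - r) (1 / (\<mu> * \<xi>\<^sup>2))" by simp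
    from mult_left_mono[OF this, of "B / 2 * \<bar>\<xi>\<bar>"] B0 show ?thesis by (simp add: kern_def mult_ac)
  qed (simp add: kern_def)
  finally show ?thesis .
qed

lemma mild_rhs_bound:
  assumes rt: "0 \<le> r" "r \<le> t" "t < T" and B: "\<And>\<tau>. \<tau> \<in> {r..t} \<Longrightarrow> norm (N \<tau> \<xi>) \<le> B"
  shows "norm (mild_rhs r t \<xi>) \<le> norm (fourier (u r) \<xi>) + B / 2 * kern (t - r) \<xi>"
proof -
  have "norm (exp (- lam \<xi> * of_real (t - r)) * fourier (u r) \<xi>) = exp (- (\<mu> * \<xi>\<^sup>2 * (t - r))) * norm (fourier (u r) \<xi>)"
    unfolding norm_mult norm_exp_lam ..
  also have "\<dots> \<le> norm (fourier (u r) \<xi>)" using mu rt by (intro mult_left_le_one_le) auto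
  finally show ?thesis
    unfolding mild_rhs_def using mild_integral_bound[OF rt B] norm_triangle_ineq4 by (smt (verit))
qed

text \<open>The Duhamel term gains the factor \<open>\<langle>\<xi>\<rangle>\<^bsup>- \<sigma> - 1\<^esup>\<close> pointwise, and \<open>\<langle>\<xi>\<rangle>\<^bsup>1/4 - 1\<^esup>\<close> is square integrable.\<close>

lemma sobolev_gain:
  assumes r: "0 < r" and \<sigma>: "0 \<le> \<sigma>" "\<sigma> \<le> s" and \<sigma>': "\<sigma>' \<le> s" "\<sigma>' \<le> \<sigma> + 1 / 4"
    and k: "\<And>t. t \<in> {r..<T} \<Longrightarrow> sobolev_norm \<sigma> (u t) \<le> k"
  shows "\<exists>k'. \<forall>t\<in>{r..<T}. sobolev_norm \<sigma>' (u t) \<le> k'"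
proof (cases "r < T")
  case True
  \<comment> \<open>B and C collect the constants of \<open>N_bound\<close> and
    \<open>kern_le_bracket\<close>, the latter with T in place of t - r so that it is uniform in
    t.\<close>
  define B where "B = 2 * 2 powr \<sigma> * k\<^sup>2"
  define C where "C = sqrt 2 * (T + 1 / \<mu>)"
  have T: "0 < T" using r True by simp
  have B0: "0 \<le> B" by (simp add: B_def)
  have C0: "0 \<le> C" using T mu by (simp add: C_def)
  have bsq: "square_integrable (\<lambda>\<xi>. (B / 2 * C) *\<^sub>R bracket (\<sigma>' - \<sigma> - 1) \<xi>)"
    using \<sigma>' by (intro square_integrable_scaleR square_integrable_bracket) simp
  have rr: "r \<in> {0..<T}" using r True by simp
  have hsq: "square_integrable (\<lambda>\<xi>. norm (bracket s \<xi> *\<^sub>R fourier (u r) \<xi>))"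
    using sobolev_u[OF rr] by (intro square_integrable_norm) (simp add: in_sobolev_iff)
  have "sobolev_norm \<sigma>' (u t) \<le> L2 (\<lambda>\<xi>. norm (bracket s \<xi> *\<^sub>R fourier (u r) \<xi>)) + L2 (\<lambda>\<xi>. (B / 2 * C) *\<^sub>R bracket (\<sigma>' - \<sigma> - 1) \<xi>)"
    if t: "t \<in> {r..<T}" for t
  proof -
    have NB: "norm (N \<tau> \<xi>) \<le> B * bracket (- \<sigma>) \<xi>" if "\<tau> \<in> {r..t}" for \<tau> \<xi>
    proof -
      have \<tau>: "\<tau> \<in> {0..<T}" "\<tau> \<in> {r..<T}" using that t r by auto
      have "(sobolev_norm \<sigma> (u \<tau>))\<^sup>2 \<le> k\<^sup>2" using k[OF \<tau>(2)] by (intro power_mono) auto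
      then have "2 * 2 powr \<sigma> * (sobolev_norm \<sigma> (u \<tau>))\<^sup>2 * bracket (- \<sigma>) \<xi> \<le> B * bracket (- \<sigma>) \<xi>"
        unfolding B_def by (intro mult_right_mono mult_left_mono) auto
      with N_bound[OF \<tau>(1) \<sigma>, of \<xi>] show ?thesis by linarith
    qed
    have "sobolev_norm \<sigma>' (u t) = L2 (\<lambda>\<xi>. bracket \<sigma>' \<xi> *\<^sub>R fourier (u t) \<xi>)" by (rule sobolev_norm_eq)
    also have "\<dots> \<le> L2 (\<lambda>\<xi>. norm (bracket s \<xi> *\<^sub>R fourier (u r) \<xi>) + (B / 2 * C) *\<^sub>R bracket (\<sigma>' - \<sigma> - 1) \<xi>)"
    proof (rule L2_mono_AE[OF square_integrable_add[OF hsq bsq]])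
      have "AE \<xi> in lborel. fourier (u t) \<xi> = mild_rhs r t \<xi>" by (rule mild_formula) (use r t in auto)
      then show "AE \<xi> in lborel. norm (bracket \<sigma>' \<xi> *\<^sub>R fourier (u t) \<xi>) \<le> norm (norm (bracket s \<xi> *\<^sub>R fourier (u r) \<xi>) + (B / 2 * C) *\<^sub>R bracket (\<sigma>' - \<sigma> - 1) \<xi>)"
      proof eventually_elim
        case (elim \<xi>)
        have "norm (fourier (u t) \<xi>) \<le> norm (fourier (u r) \<xi>) + B * bracket (- \<sigma>) \<xi> / 2 * kern (t - r) \<xi>"
          unfolding elim by (rule mild_rhs_bound[OF _ _ _ NB]) (use r t in auto)
        also have "kern (t - r) \<xi> \<le> C * bracket (- 1) \<xi>"
          using kern_mono[of "t - r" T \<xi>] kern_le_bracket[of T \<xi>] T r t unfolding C_def by (auto intro: order_trans)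
        finally have "norm (fourier (u t) \<xi>) \<le> norm (fourier (u r) \<xi>) + B * bracket (- \<sigma>) \<xi> / 2 * (C * bracket (- 1) \<xi>)"
          using B0 by (simp add: mult_left_mono)
        from mult_left_mono[OF this, of "bracket \<sigma>' \<xi>"]
        have "norm (bracket \<sigma>' \<xi> *\<^sub>R fourier (u t) \<xi>) \<le> bracket \<sigma>' \<xi> * norm (fourier (u r) \<xi>) + (B / 2 * C) * (bracket \<sigma>' \<xi> * bracket (- \<sigma>) \<xi> * bracket (- 1) \<xi>)"
          by (simp add: algebra_simps)
        also have "bracket \<sigma>' \<xi> * bracket (- \<sigma>) \<xi> * bracket (- 1) \<xi> = bracket (\<sigma>' - \<sigma> - 1) \<xi>"
          by (simp add: bracket_mult)
        also have "bracket \<sigma>' \<xi> * norm (fourier (u r) \<xi>) \<le> norm (bracket s \<xi> *\<^sub>R fourier (u r) \<xi>)"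
          using bracket_mono[OF \<sigma>'(1), of \<xi>] by (simp add: mult_right_mono)
        finally show ?case using B0 C0 by simp
      qed
    qed
    also have "\<dots> \<le> L2 (\<lambda>\<xi>. norm (bracket s \<xi> *\<^sub>R fourier (u r) \<xi>)) + L2 (\<lambda>\<xi>. (B / 2 * C) *\<^sub>R bracket (\<sigma>' - \<sigma> - 1) \<xi>)"
      by (rule L2_triangle[OF hsq bsq])
    finally show ?thesis .
  qed
  then show ?thesis by blast
qed simp

text \<open>Finitely many applications of \<open>sobolev_gain\<close>, along the orders n / 4. They
  are capped at s, the regularity available at the starting time r.\<close>

lemma sobolev_bounded_of_L2_bounded:
  assumes r: "0 < r" and S: "\<And>t. t \<in> {r..<T} \<Longrightarrow> L2 (u t) \<le> S"
  shows "\<exists>k. \<forall>t\<in>{r..<T}. sobolev_norm s (u t) \<le> k"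
proof -
  have *: "\<exists>k. \<forall>t\<in>{r..<T}. sobolev_norm (min s (real n / 4)) (u t) \<le> k" for n
  proof (induction n)
    case 0
    have "sobolev_norm (min s (real 0 / 4)) (u t) \<le> sqrt (2 * pi) * S" if "t \<in> {r..<T}" for t
    proof -
      have "t \<in> {0..<T}" using that r by auto
      then show ?thesis using s S[OF that] by (simp add: sobolev_norm_eq L2_fourier[OF sq_u] mult_left_mono)
    qed
    then show ?case by blast
  next
    case (Suc n)
    then obtain k where "\<And>t. t \<in> {r..<T} \<Longrightarrow> sobolev_norm (min s (real n / 4)) (u t) \<le> k" by blast
    then show ?case
      using s by (intro sobolev_gain[OF r, where \<sigma>="min s (real n / 4)" and k=k]) (auto simp: min_def)
  qed
  obtain n :: nat where "4 * s \<le> real n" using real_arch_simple by blast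
  then have "min s (real n / 4) = s" by simp
  with *[of n] show ?thesis by simp
qed

text \<open>Here the nonlinearity enters only through the uniform bound \<open>2 * R\<^sup>2\<close>
  on N, so the increment is quadratic in R with a coefficient that vanishes with the length of the
  interval. The factor sqrt (2 \<pi>), at least 1, is inserted in the last term so that it cancels
  throughout.\<close>

lemma L2_growth:
  assumes rt: "0 < r" "r \<le> t" "t < T" and R: "\<And>\<tau>. \<tau> \<in> {r..t} \<Longrightarrow> L2 (u \<tau>) \<le> R"
  shows "L2 (u t) \<le> L2 (u r) + R\<^sup>2 * L2 (kern (t - r))"
proof -
  have r: "r \<in> {0..<T}" and t: "t \<in> {0..<T}" using rt by auto
  have NB: "norm (N \<tau> \<xi>) \<le> 2 * R\<^sup>2" if "\<tau> \<in> {r..t}" for \<tau> \<xi>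
  proof -
    have "\<tau> \<in> {0..<T}" using that rt by auto
    from norm_N_le[OF this, of \<xi>] power_mono[OF R[OF that] L2_nonneg, of 2] show ?thesis by simp
  qed
  have hsq: "square_integrable (\<lambda>\<xi>. norm (fourier (u r) \<xi>))" by (intro square_integrable_norm square_integrable_fourier sq_u r)
  have ksq: "square_integrable (\<lambda>\<xi>. R\<^sup>2 *\<^sub>R kern (t - r) \<xi>)" using rt by (intro square_integrable_scaleR square_integrable_kern) simp
  have "sqrt (2 * pi) * L2 (u t) = L2 (fourier (u t))" by (rule L2_fourier[OF sq_u[OF t], symmetric])
  also have "\<dots> \<le> L2 (\<lambda>\<xi>. norm (fourier (u r) \<xi>) + R\<^sup>2 *\<^sub>R kern (t - r) \<xi>)"
  proof (rule L2_mono_AE[OF square_integrable_add[OF hsq ksq]])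
    show "AE \<xi> in lborel. norm (fourier (u t) \<xi>) \<le> norm (norm (fourier (u r) \<xi>) + R\<^sup>2 *\<^sub>R kern (t - r) \<xi>)"
      using mild_formula[OF rt]
    proof eventually_elim
      case (elim \<xi>)
      have "norm (fourier (u t) \<xi>) \<le> norm (fourier (u r) \<xi>) + 2 * R\<^sup>2 / 2 * kern (t - r) \<xi>"
        unfolding elim by (rule mild_rhs_bound[OF _ _ _ NB]) (use rt in auto)
      then show ?case using kern_nonneg[of "t - r" \<xi>] rt by simp
    qed
  qed
  also have "\<dots> \<le> L2 (\<lambda>\<xi>. norm (fourier (u r) \<xi>)) + L2 (\<lambda>\<xi>. R\<^sup>2 *\<^sub>R kern (t - r) \<xi>)"
    by (rule L2_triangle[OF hsq ksq])
  also have "L2 (\<lambda>\<xi>. norm (fourier (u r) \<xi>)) = L2 (fourier (u r))" by (simp add: L2_def)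
  also have "\<dots> = sqrt (2 * pi) * L2 (u r)" by (rule L2_fourier[OF sq_u[OF r]])
  also have "L2 (\<lambda>\<xi>. R\<^sup>2 *\<^sub>R kern (t - r) \<xi>) = R\<^sup>2 * L2 (kern (t - r))" using L2_scaleR[of "R\<^sup>2" "kern (t - r)"] by simp
  also have "\<dots> \<le> sqrt (2 * pi) * (R\<^sup>2 * L2 (kern (t - r)))"
    using mult_right_mono[of 1 "sqrt (2 * pi)" "R\<^sup>2 * L2 (kern (t - r))"] pi_ge_two by simp
  finally have "sqrt (2 * pi) * L2 (u t) \<le> sqrt (2 * pi) * (L2 (u r) + R\<^sup>2 * L2 (kern (t - r)))"
    by (simp add: distrib_left)
  then show ?thesis by (simp add: mult_le_cancel_left_pos)
qed

text \<open>The length \<open>\<delta>\<close> depends on \<open>M\<close> only, so the \<open>L\<^sup>2\<close> norm cannot diverge at \<open>T\<close> while returning below \<open>M\<close> arbitrarily late.\<close>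

lemma L2_bounded_near_end:
  assumes "M \<ge> 0"
  obtains \<delta> where "\<delta> > 0" "\<And>r t. \<lbrakk>0 < r; T - \<delta> < r; L2 (u r) \<le> M; r \<le> t; t < T\<rbrakk> \<Longrightarrow> L2 (u t) \<le> M + 1"
proof -
  define R where "R = M + 1"
  have R: "R > 0" using assms by (simp add: R_def)
  \<comment> \<open>With this choice \<open>L2_growth\<close> permits an increment less than 1 as
    long as the norm stays below R = M + 1.\<close>
  obtain \<delta> where \<delta>: "\<delta> > 0" "\<And>\<delta>'. 0 \<le> \<delta>' \<Longrightarrow> \<delta>' \<le> \<delta> \<Longrightarrow> L2 (kern \<delta>') < 1 / R\<^sup>2"
    using L2_kern_small[of "1 / R\<^sup>2"] R by auto
  show thesis
  proof (rule that[OF \<delta>(1)])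
    fix r t assume r: "0 < r" "T - \<delta> < r" "L2 (u r) \<le> M" and t: "r \<le> t" "t < T"
    show "L2 (u t) \<le> M + 1"
    proof (rule ccontr)
      assume "\<not> L2 (u t) \<le> M + 1"
      then have big: "R < L2 (u t)" by (simp add: R_def)
      have c: "continuous_on {r..t} (\<lambda>t. L2 (u t))" by (rule continuous_on_subset[OF continuous_L2_u]) (use r t in auto)
      \<comment> \<open>The least element of Z is the first time at which the norm reaches R. Up to
        that time R is a valid bound, so growth by a full unit since r contradicts the choice of
        \<delta>.\<close>
      define Z where "Z = {x \<in> {r..t}. L2 (u x) = R}"
      have ivt: "\<exists>x\<ge>r. x \<le> y \<and> L2 (u x) = R" if "r \<le> y" "y \<le> t" "R \<le> L2 (u y)" for y
        by (rule IVT'[where f="\<lambda>t. L2 (u t)"]) (use that r c in \<open>auto simp: R_def intro: continuous_on_subset\<close>)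
      have "closed Z"
        unfolding Z_def using continuous_closed_preimage_constant[OF c closed_atLeastAtMost, of R] by simp
      moreover have "Z \<subseteq> {r..t}" by (auto simp: Z_def)
      ultimately have "compact ({r..t} \<inter> Z)" "{r..t} \<inter> Z = Z" by (auto intro: compact_Int_closed)
      then have cZ: "compact Z" by simp
      obtain z where "r \<le> z" "z \<le> t" "L2 (u z) = R" using ivt[of t] t big by auto
      then have "Z \<noteq> {}" by (auto simp: Z_def)
      from compact_attains_inf[OF cZ this] obtain x where x: "x \<in> Z" "\<And>y. y \<in> Z \<Longrightarrow> x \<le> y" by auto
      have xr: "r \<le> x" "x \<le> t" "L2 (u x) = R" using x(1) by (auto simp: Z_def)
      have "L2 (u \<tau>) \<le> R" if "\<tau> \<in> {r..x}" for \<tau>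
      proof (rule ccontr)
        assume *: "\<not> L2 (u \<tau>) \<le> R"
        have "\<exists>y\<ge>r. y \<le> \<tau> \<and> L2 (u y) = R" by (rule ivt) (use that xr * in auto)
        then obtain y where y: "r \<le> y" "y \<le> \<tau>" "L2 (u y) = R" by auto
        then have "y \<in> Z" using that xr by (auto simp: Z_def)
        then have "x \<le> y" by (rule x(2))
        then have "\<tau> = x" using y that by auto
        then show False using * xr by simp
      qed
      from L2_growth[OF r(1) xr(1) _ this] have "R \<le> L2 (u r) + R\<^sup>2 * L2 (kern (x - r))" using xr t by simp
      moreover have "R\<^sup>2 * L2 (kern (x - r)) < R\<^sup>2 * (1 / R\<^sup>2)"
        using \<delta>(2)[of "x - r"] xr r t R by (intro mult_strict_left_mono) auto
      ultimately show False using r(3) R by (simp add: R_def)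
    qed
  qed
qed

end

section \<open>The energy inequality and blow-up\<close>

text \<open>Stated in integral form, the form in which the energy inequality is obtained. With z the
  right side of the hypothesis, z times the exponential of minus the integral of m is nonincreasing,
  because z' = m y \<le> m z.\<close>

lemma gronwall:
  fixes y m :: "real \<Rightarrow> real"
  assumes rt: "r \<le> t" and y: "continuous_on {r..t} y" and m: "continuous_on {r..t} m" "\<And>x. x \<in> {r..t} \<Longrightarrow> 0 \<le> m x"
    and le: "\<And>x. x \<in> {r..t} \<Longrightarrow> y x \<le> y r + (LINT \<tau>:{r..x}|lborel. m \<tau> * y \<tau>)"
  shows "y t \<le> y r * exp (LINT \<tau>:{r..t}|lborel. m \<tau>)"
proof -
  have my: "continuous_on {r..t} (\<lambda>\<tau>. m \<tau> * y \<tau>)" by (intro continuous_intros m y)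
  have eq: "(LINT \<tau>:{r..x}|lborel. f \<tau>) = integral {r..x} f" if "continuous_on {r..t} f" "x \<in> {r..t}" for f :: "real \<Rightarrow> real" and x
    by (rule set_borel_integral_eq_integral(2), rule borel_integrable_atLeastAtMost', rule continuous_on_subset[OF that(1)])
      (use that(2) in auto)
  define z where "z x = y r + integral {r..x} (\<lambda>\<tau>. m \<tau> * y \<tau>)" for x
  define w where "w x = z x * exp (- integral {r..x} m)" for x
  have d: "((\<lambda>x. integral {r..x} f) has_real_derivative f x) (at x within {r..t})"
    if "continuous_on {r..t} f" "x \<in> {r..t}" for f :: "real \<Rightarrow> real" and x
    using integral_has_vector_derivative[OF that] by (simp add: has_real_derivative_iff_has_vector_derivative)
  have wd: "(w has_real_derivative (m x * y x - m x * z x) * exp (- integral {r..x} m)) (at x within {r..t})" if x: "x \<in> {r..t}" for x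
    unfolding w_def[abs_def] z_def[abs_def]
    by (rule derivative_eq_intros d[OF my x] d[OF m(1) x] refl)+ (simp add: z_def algebra_simps)
  have wc: "continuous_on {r..t} w"
    unfolding continuous_on_eq_continuous_within using DERIV_continuous[OF wd] by blast
  have "w t \<le> w r"
  proof (rule DERIV_nonpos_imp_decreasing_open[OF rt _ wc])
    fix x assume x: "r < x" "x < t"
    then have xi: "x \<in> {r..t}" by simp
    have "DERIV w x :> (m x * y x - m x * z x) * exp (- integral {r..x} m)"
      using wd[OF xi] x by (simp add: at_within_Icc_at)
    moreover have "(m x * y x - m x * z x) * exp (- integral {r..x} m) \<le> 0"
    proof (rule mult_nonpos_nonneg)
      have "y x \<le> z x" using le[OF xi] eq[OF my xi] by (simp add: z_def)
      then show "m x * y x - m x * z x \<le> 0" using m(2)[OF xi] by (simp add: mult_left_mono)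
    qed simp
    ultimately show "\<exists>d. DERIV w x :> d \<and> d \<le> 0" by blast
  qed
  then have "z t * exp (- integral {r..t} m) \<le> y r" by (simp add: w_def z_def)
  then have "z t \<le> y r * exp (integral {r..t} m)" by (simp add: exp_minus field_simps)
  moreover have "y t \<le> z t" using le[of t] eq[OF my, of t] rt by (simp add: z_def)
  ultimately show ?thesis using eq[OF m(1), of t] rt by simp
qed

section \<open>The energy estimate\<close>

context flow
begin

text \<open>The Sobolev embedding makes the norm finite on [0, T), so passing from
  \<open>ennreal\<close> to real numbers keeps its value there.\<close>

definition sup_deriv :: "real \<Rightarrow> real"
  where "sup_deriv t = enn2real (Linfty_norm (weak_deriv (u t)))"

lemma sup_deriv_nonneg [simp]: "0 \<le> sup_deriv t"
  by (simp add: sup_deriv_def)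

lemma Linfty_eq_sup_deriv: "t \<in> {0..<T} \<Longrightarrow> Linfty_norm (weak_deriv (u t)) = ennreal (sup_deriv t)"
  unfolding sup_deriv_def using le_less_trans[OF Linfty_bound[OF sobolev_u s], of t top] by simp

lemma continuous_sup_deriv: "continuous_on {0..<T} sup_deriv"
proof (rule continuous_onI_D[where K="\<lambda>_. sobolev_const s"])
  fix t \<tau> assume *: "t \<in> {0..<T}" "\<tau> \<in> {0..<T}"
  have "norm (sup_deriv \<tau> - sup_deriv t) \<le> sobolev_const s * D \<tau> t"
    unfolding sup_deriv_def D_def real_norm_def by (rule Linfty_diff[OF sobolev_u[OF *(2)] sobolev_u[OF *(1)] s])
  also have "\<dots> \<le> sobolev_const s * (D \<tau> t + (D \<tau> t)\<^sup>2)"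
    by (intro mult_left_mono) (auto simp: sobolev_const_def)
  finally show "norm (sup_deriv \<tau> - sup_deriv t) \<le> sobolev_const s * (D \<tau> t + (D \<tau> t)\<^sup>2)" .
qed

lemma continuous_sobolev_norm: "continuous_on {0..<T} (\<lambda>t. sobolev_norm s (u t))"
proof (rule continuous_onI_D[where K="\<lambda>_. 1"])
  fix t \<tau> assume *: "t \<in> {0..<T}" "\<tau> \<in> {0..<T}"
  have "\<bar>sobolev_norm s (u \<tau>) - sobolev_norm s (u t)\<bar> \<le> D \<tau> t"
    unfolding D_def by (rule sobolev_norm_diff_abs[OF sobolev_u[OF *(2)] sobolev_u[OF *(1)]])
  then show "norm (sobolev_norm s (u \<tau>) - sobolev_norm s (u t)) \<le> 1 * (D \<tau> t + (D \<tau> t)\<^sup>2)" by (simp add: add_increasing2)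
qed

lemma sobolev_norm_bounded:
  assumes "0 \<le> r" "t < T"
  obtains k where "\<And>\<tau>. \<tau> \<in> {r..t} \<Longrightarrow> sobolev_norm s (u \<tau>) \<le> k"
proof -
  have "bounded ((\<lambda>t. sobolev_norm s (u t)) ` {r..t})"
    using assms by (intro compact_imp_bounded compact_continuous_image continuous_on_subset[OF continuous_sobolev_norm]) auto
  then obtain k where "\<forall>\<tau>\<in>{r..t}. \<bar>sobolev_norm s (u \<tau>)\<bar> \<le> k" by (auto simp: bounded_iff)
  then show thesis by (intro that[of k]) force
qed

text \<open>The embedding bounds u and v pointwise, so Q is a bounded factor times square integrable
  ones. Parseval for Q against the derivative of u requires this, and the bound enters the majorant
  for Fubini's theorem.\<close>

lemma square_integrable_Q:
  assumes t: "t \<in> {0..<T}"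
  shows "square_integrable (Q t)" "L2 (Q t) \<le> sobolev_const s * sobolev_norm s (u t) * (2 * L2 (u t))"
proof -
  define k where "k = sobolev_const s * sobolev_norm s (u t)"
  have k0: "0 \<le> k" by (simp add: k_def sobolev_const_def)
  note hu = sobolev_u[OF t] and hv = sobolev_v[OF t]
  have kv: "sobolev_const s * sobolev_norm s (v t) = k"
    unfolding k_def v_def by (simp add: in_sobolev_hilbert(2)[OF hu])
  have sq: "square_integrable (\<lambda>x. norm (u t x) + norm (v t x))"
    by (intro square_integrable_add square_integrable_norm sq_u sq_v t)
  have le: "AE x in lborel. norm (Q t x) \<le> norm (k *\<^sub>R (norm (u t x) + norm (v t x)))"
    using smooth_rep_AE[OF hu s] smooth_rep_AE[OF hv s]
  proof eventually_elim
    case (elim x)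
    have "\<bar>u t x\<bar> \<le> k" "\<bar>v t x\<bar> \<le> k"
      using smooth_rep_bound[OF hu s, of x] smooth_rep_bound[OF hv s, of x] elim kv by (simp_all add: k_def)
    then have "\<bar>u t x\<bar> * \<bar>u t x\<bar> + \<bar>v t x\<bar> * \<bar>v t x\<bar> \<le> k * \<bar>u t x\<bar> + k * \<bar>v t x\<bar>"
      by (intro add_mono mult_right_mono) auto
    then show ?case using k0 by (simp add: Q_def power2_eq_square distrib_left)
  qed
  show "square_integrable (Q t)"
    by (rule square_integrable_bound[OF _ square_integrable_scaleR[OF sq] le]) (use integrable_Q[OF t] in simp)
  have "L2 (Q t) \<le> L2 (\<lambda>x. k *\<^sub>R (norm (u t x) + norm (v t x)))"
    by (rule L2_mono_AE[OF square_integrable_scaleR[OF sq] le])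
  also have "\<dots> = k * L2 (\<lambda>x. norm (u t x) + norm (v t x))" unfolding L2_scaleR using k0 by simp
  also have "\<dots> \<le> k * (L2 (\<lambda>x. norm (u t x)) + L2 (\<lambda>x. norm (v t x)))"
    by (intro mult_left_mono L2_triangle square_integrable_norm sq_u sq_v t k0)
  also have "\<dots> = k * (2 * L2 (u t))" using L2_v[OF t] by (simp add: L2_def)
  finally show "L2 (Q t) \<le> sobolev_const s * sobolev_norm s (u t) * (2 * L2 (u t))" by (simp add: k_def)
qed

lemma is_fourier_N:
  assumes t: "t \<in> {0..<T}"
  shows "is_fourier (\<lambda>x. complex_of_real (Q t x)) (N t)"
  unfolding N_def[abs_def] by (intro is_fourier_ft integrable_Q_complex t square_integrable_of_real square_integrable_Q(1))

text \<open>The energy flux: \<open>\<integral> u\<^sub>x (u\<^sup>2 + (H u)\<^sup>2)\<close> on the Fourier side.\<close>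

lemma flux_bound:
  assumes t: "t \<in> {0..<T}"
  shows "integrable lborel (\<lambda>\<xi>. N t \<xi> * cnj (\<i> * of_real \<xi> * fourier (u t) \<xi>))"
    "Re (LINT \<xi>|lborel. N t \<xi> * cnj (\<i> * of_real \<xi> * fourier (u t) \<xi>)) \<le> 2 * pi * (2 * sup_deriv t * (L2 (u t))\<^sup>2)"
    "(LINT \<xi>|lborel. norm (N t \<xi> * cnj (\<i> * of_real \<xi> * fourier (u t) \<xi>))) \<le> L2 (N t) * sobolev_norm s (u t)"
proof -
  note hu = sobolev_u[OF t]
  have Nsq: "square_integrable (N t)" by (rule is_fourier_sq[OF is_fourier_N[OF t]])
  have gsq: "square_integrable (\<lambda>\<xi>. \<i> * of_real \<xi> * fourier (u t) \<xi>)" by (rule square_integrable_i_fourier[OF hu s])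
  show i: "integrable lborel (\<lambda>\<xi>. N t \<xi> * cnj (\<i> * of_real \<xi> * fourier (u t) \<xi>))"
    by (intro square_integrable_mult Nsq square_integrable_cnj gsq)
  have d: "square_integrable (smooth_deriv (u t))" by (rule smooth_deriv_fourier(2)[OF hu s])
  have "(LINT \<xi>|lborel. N t \<xi> * cnj (\<i> * of_real \<xi> * fourier (u t) \<xi>))
      = 2 * pi * (LINT x|lborel. complex_of_real (Q t x) * cnj (complex_of_real (smooth_deriv (u t) x)))"
    by (rule fourier_parseval[OF square_integrable_of_real[OF square_integrable_Q(1)[OF t]] is_fourier_N[OF t]
        square_integrable_of_real[OF d] smooth_deriv_fourier(1)[OF hu s]])
  also have "(LINT x|lborel. complex_of_real (Q t x) * cnj (complex_of_real (smooth_deriv (u t) x))) = of_real (LINT x|lborel. Q t x * smooth_deriv (u t) x)"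
    by (simp flip: of_real_mult)
  finally have "Re (LINT \<xi>|lborel. N t \<xi> * cnj (\<i> * of_real \<xi> * fourier (u t) \<xi>)) = 2 * pi * (LINT x|lborel. Q t x * smooth_deriv (u t) x)"
    by simp
  also have "\<dots> \<le> 2 * pi * (LINT x|lborel. sup_deriv t * Q t x)"
  proof (intro mult_left_mono integral_mono_AE)
    show "integrable lborel (\<lambda>x. Q t x * smooth_deriv (u t) x)" by (intro square_integrable_mult square_integrable_Q t d)
    show "integrable lborel (\<lambda>x. sup_deriv t * Q t x)" using integrable_Q[OF t] by simp
    show "AE x in lborel. Q t x * smooth_deriv (u t) x \<le> sup_deriv t * Q t x"
      using smooth_deriv_le_Linfty[OF hu s]
    proof eventually_elim
      case (elim x)
      then have "smooth_deriv (u t) x \<le> sup_deriv t" unfolding sup_deriv_def by linarith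
      from mult_left_mono[OF this Q_nonneg[of t x]] show ?case by (simp add: mult.commute)
    qed
  qed simp
  \<comment> \<open>The factor 2 arises here: u and its Hilbert transform contribute equally to the
    integral of Q.\<close>
  also have "(LINT x|lborel. sup_deriv t * Q t x) = sup_deriv t * (LINT x|lborel. Q t x)" by (rule integral_mult_right_zero)
  also have "\<dots> = 2 * sup_deriv t * (L2 (u t))\<^sup>2" by (simp add: integral_Q[OF t])
  finally show "Re (LINT \<xi>|lborel. N t \<xi> * cnj (\<i> * of_real \<xi> * fourier (u t) \<xi>)) \<le> 2 * pi * (2 * sup_deriv t * (L2 (u t))\<^sup>2)" .
  have "(LINT \<xi>|lborel. norm (N t \<xi> * cnj (\<i> * of_real \<xi> * fourier (u t) \<xi>))) = (LINT \<xi>|lborel. norm (N t \<xi>) * norm (\<i> * of_real \<xi> * fourier (u t) \<xi>))"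
    by (simp add: norm_mult)
  also have "\<dots> \<le> L2 (N t) * L2 (\<lambda>\<xi>. \<i> * of_real \<xi> * fourier (u t) \<xi>)" by (rule cauchy_schwarz[OF Nsq gsq])
  also have "\<dots> \<le> L2 (N t) * sobolev_norm s (u t)"
  proof (rule mult_left_mono)
    show "L2 (\<lambda>\<xi>. \<i> * of_real \<xi> * fourier (u t) \<xi>) \<le> sobolev_norm s (u t)"
      unfolding sobolev_norm_eq
    proof (rule L2_mono_AE)
      show "square_integrable (\<lambda>\<xi>. bracket s \<xi> *\<^sub>R fourier (u t) \<xi>)" using hu by (simp add: in_sobolev_iff)
      have "\<bar>\<xi>\<bar> \<le> bracket s \<xi>" for \<xi> using abs_le_bracket[of \<xi>] bracket_mono[of 1 s \<xi>] s by linarith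
      then show "AE \<xi> in lborel. norm (\<i> * of_real \<xi> * fourier (u t) \<xi>) \<le> norm (bracket s \<xi> *\<^sub>R fourier (u t) \<xi>)"
        by (auto simp: norm_mult intro!: mult_right_mono)
    qed
  qed simp
  finally show "(LINT \<xi>|lborel. norm (N t \<xi> * cnj (\<i> * of_real \<xi> * fourier (u t) \<xi>))) \<le> L2 (N t) * sobolev_norm s (u t)" .
qed

text \<open>The factor \<open>exp (- lam \<xi> * t)\<close> is taken out of the Duhamel integral so that the latter can be differentiated in \<open>t\<close>.\<close>

definition mild_source :: "real \<Rightarrow> real \<Rightarrow> real \<Rightarrow> complex"
  where "mild_source r \<xi> \<sigma> = exp (- lam \<xi> * of_real (r - \<sigma>)) * (\<i> * of_real \<xi> / 2 * N \<sigma> \<xi>)"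

lemma mild_rhs_factor:
  "mild_rhs r t \<xi> = exp (- lam \<xi> * of_real (t - r)) * (fourier (u r) \<xi> - (LINT \<sigma>:{r..t}|lborel. mild_source r \<xi> \<sigma>))"
proof -
  have "(LINT \<tau>:{r..t}|lborel. exp (- lam \<xi> * of_real (t - \<tau>)) * (\<i> * of_real \<xi> / 2 * N \<tau> \<xi>))
      = (LINT \<tau>|lborel. exp (- lam \<xi> * of_real (t - r)) * (indicator {r..t} \<tau> *\<^sub>R mild_source r \<xi> \<tau>))"
    unfolding set_lebesgue_integral_def
  proof (rule Bochner_Integration.integral_cong[OF refl])
    fix \<tau>
    have "exp (- lam \<xi> * of_real (t - \<tau>)) = exp (- lam \<xi> * of_real (t - r)) * exp (- lam \<xi> * of_real (r - \<tau>))"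
      by (simp add: algebra_simps flip: exp_add)
    then show "indicator {r..t} \<tau> *\<^sub>R (exp (- lam \<xi> * of_real (t - \<tau>)) * (\<i> * of_real \<xi> / 2 * N \<tau> \<xi>))
        = exp (- lam \<xi> * of_real (t - r)) * (indicator {r..t} \<tau> *\<^sub>R mild_source r \<xi> \<tau>)"
      by (simp only: mild_source_def mult.assoc mult_scaleR_right)
  qed
  also have "\<dots> = exp (- lam \<xi> * of_real (t - r)) * (LINT \<sigma>:{r..t}|lborel. mild_source r \<xi> \<sigma>)"
    unfolding set_lebesgue_integral_def by (rule integral_mult_right_zero)
  finally show ?thesis unfolding mild_rhs_def by (simp only: right_diff_distrib)
qed

lemma mild_rhs_derivative:
  assumes rt: "0 \<le> r" "t < T" and x: "x \<in> {r..t}"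
  shows "((\<lambda>\<tau>. mild_rhs r \<tau> \<xi>) has_vector_derivative - lam \<xi> * mild_rhs r x \<xi> - \<i> * of_real \<xi> / 2 * N x \<xi>) (at x within {r..t})"
proof -
  have sub: "{r..t} \<subseteq> {0..<T}" using rt by auto
  have c: "continuous_on {r..t} (mild_source r \<xi>)"
    unfolding mild_source_def[abs_def] by (rule mild_integrand_continuous[OF sub])
  let ?J = "\<lambda>y. integral {r..y} (mild_source r \<xi>)"
  have J: "mild_rhs r y \<xi> = exp (- lam \<xi> * of_real (y - r)) * (fourier (u r) \<xi> - ?J y)" if "y \<in> {r..t}" for y
  proof -
    have "set_integrable lborel {r..y} (mild_source r \<xi>)"
      by (rule borel_integrable_atLeastAtMost'[OF continuous_on_subset[OF c]]) (use that in auto)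
    from set_borel_integral_eq_integral(2)[OF this] show ?thesis unfolding mild_rhs_factor by simp
  qed
  have 1: "((\<lambda>z. - lam \<xi> * (z - of_real r)) has_field_derivative - lam \<xi>) (at (of_real x))"
    by (rule derivative_eq_intros refl)+ simp
  from has_vector_derivative_real_field[OF DERIV_chain2[OF DERIV_exp 1]]
  have e: "((\<lambda>y. exp (- lam \<xi> * of_real (y - r))) has_vector_derivative exp (- lam \<xi> * of_real (x - r)) * - lam \<xi>) (at x within {r..t})"
    by (simp only: of_real_diff)
  have j: "((\<lambda>y. fourier (u r) \<xi> - ?J y) has_vector_derivative - mild_source r \<xi> x) (at x within {r..t})"
    using has_vector_derivative_diff[OF has_vector_derivative_const integral_has_vector_derivative[OF c x]] by simp
  have s1: "exp (- lam \<xi> * of_real (x - r)) * mild_source r \<xi> x = \<i> * of_real \<xi> / 2 * N x \<xi>"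
  proof -
    have "exp (- lam \<xi> * of_real (x - r)) * exp (- lam \<xi> * of_real (r - x)) = 1"
      by (simp add: algebra_simps flip: exp_add)
    then show ?thesis unfolding mild_source_def by (simp only: mult.assoc[symmetric] mult_1_left)
  qed
  have eq: "exp (- lam \<xi> * of_real (x - r)) * - mild_source r \<xi> x + exp (- lam \<xi> * of_real (x - r)) * - lam \<xi> * (fourier (u r) \<xi> - ?J x)
     = - lam \<xi> * mild_rhs r x \<xi> - \<i> * of_real \<xi> / 2 * N x \<xi>"
    unfolding J[OF x] s1[symmetric] by (simp add: algebra_simps)
  show ?thesis
    by (rule has_vector_derivative_transform[OF x J has_vector_derivative_mult[OF e j, unfolded eq]])
qed

text \<open>The time derivative of the squared modulus of U is
  \<open>- 2 * \<mu> * \<xi>\<^sup>2\<close> times that square plus the flux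
  \<open>Re (N \<tau> \<xi> * cnj (\<i> * of_real \<xi> * U \<tau>))\<close>. The imaginary part of
  \<open>lam\<close>, which carries \<beta>, cancels in the real part, and the dissipative term is
  dropped.\<close>

lemma energy_pointwise:
  assumes rt: "0 \<le> r" "r \<le> t" "t < T"
  shows "(norm (mild_rhs r t \<xi>))\<^sup>2 - (norm (mild_rhs r r \<xi>))\<^sup>2
    \<le> (LINT \<tau>:{r..t}|lborel. Re (N \<tau> \<xi> * cnj (\<i> * of_real \<xi> * mild_rhs r \<tau> \<xi>)))"
proof -
  have sub: "{r..t} \<subseteq> {0..<T}" using rt by auto
  define U where "U \<tau> = mild_rhs r \<tau> \<xi>" for \<tau>
  define U' where "U' \<tau> = - lam \<xi> * U \<tau> - \<i> * of_real \<xi> / 2 * N \<tau> \<xi>" for \<tau>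
  have d: "(U has_vector_derivative U' x) (at x within {r..t})" if "x \<in> {r..t}" for x
    unfolding U_def[abs_def] U'_def by (rule mild_rhs_derivative[OF rt(1,3) that])
  have Uc: "continuous_on {r..t} U"
    unfolding continuous_on_eq_continuous_within using has_vector_derivative_continuous[OF d] by blast
  have Nc: "continuous_on {r..t} (\<lambda>\<tau>. N \<tau> \<xi>)" by (rule continuous_slice[OF continuous_N sub])
  have U'c: "continuous_on {r..t} U'"
    unfolding U'_def by (intro continuous_on_diff continuous_on_mult continuous_on_const Uc Nc)
  define G where "G x = 2 * (Re (U x) * Re (U' x) + Im (U x) * Im (U' x))" for x
  have Gc: "continuous_on {r..t} G" unfolding G_def by (intro continuous_intros Uc U'c)
  have "(LINT x|lborel. indicator {r..t} x *\<^sub>R G x) = (norm (U t))\<^sup>2 - (norm (U r))\<^sup>2"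
  proof (rule integral_FTC_atLeastAtMost[OF rt(2) _ Gc])
    fix x assume x: "r \<le> x" "x \<le> t"
    then have xi: "x \<in> {r..t}" by simp
    have 1: "((\<lambda>x. Re (U x)) has_real_derivative Re (U' x)) (at x within {r..t})"
      "((\<lambda>x. Im (U x)) has_real_derivative Im (U' x)) (at x within {r..t})"
      using bounded_linear.has_vector_derivative[OF bounded_linear_Re d[OF xi]] bounded_linear.has_vector_derivative[OF bounded_linear_Im d[OF xi]]
      by (simp_all add: has_real_derivative_iff_has_vector_derivative)
    have "((\<lambda>x. (Re (U x))\<^sup>2 + (Im (U x))\<^sup>2) has_real_derivative G x) (at x within {r..t})"
      by (rule derivative_eq_intros 1 refl)+ (simp add: G_def algebra_simps)
    then show "((\<lambda>x. (norm (U x))\<^sup>2) has_vector_derivative G x) (at x within {r..t})"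
      by (simp add: cmod_power2 has_real_derivative_iff_has_vector_derivative)
  qed
  then have "(norm (U t))\<^sup>2 - (norm (U r))\<^sup>2 = (LINT x:{r..t}|lborel. G x)" by (simp add: set_lebesgue_integral_def)
  also have "\<dots> \<le> (LINT \<tau>:{r..t}|lborel. Re (N \<tau> \<xi> * cnj (\<i> * of_real \<xi> * U \<tau>)))"
  proof (rule set_integral_mono)
    show "set_integrable lborel {r..t} G" by (rule borel_integrable_atLeastAtMost'[OF Gc])
    show "set_integrable lborel {r..t} (\<lambda>\<tau>. Re (N \<tau> \<xi> * cnj (\<i> * of_real \<xi> * U \<tau>)))"
      by (intro borel_integrable_atLeastAtMost' continuous_intros Nc Uc)
    fix x
    have "G x = - 2 * (\<mu> * \<xi>\<^sup>2) * ((Re (U x))\<^sup>2 + (Im (U x))\<^sup>2) + Re (N x \<xi> * cnj (\<i> * of_real \<xi> * U x))"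
      by (simp add: G_def U'_def lam_def power2_eq_square algebra_simps)
    then show "G x \<le> Re (N x \<xi> * cnj (\<i> * of_real \<xi> * U x))" using mu by simp
  qed
  finally show ?thesis by (simp add: U_def)
qed

text \<open>The upper limit of the Duhamel integral moves with \<tau>. Encoding it as the factor
  \<open>of_bool (\<sigma> \<le> \<tau>)\<close> over the fixed interval [r, t] leaves a parameter
  integral of a function measurable in three variables.\<close>

lemma mild_rhs_joint_measurable:
  assumes rt: "0 \<le> r" "r < T" "t < T"
  shows "(\<lambda>(\<tau>, \<xi>). indicator {r..t} \<tau> *\<^sub>R mild_rhs r \<tau> \<xi>) \<in> borel_measurable (lborel \<Otimes>\<^sub>M lborel)"
proof -
  have sets: "borel_measurable (lborel \<Otimes>\<^sub>M lborel) = borel_measurable (borel \<Otimes>\<^sub>M (borel :: real measure) :: (real \<times> real) measure)"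
    by (intro measurable_cong_sets sets_pair_measure_cong) simp_all
  have sets3: "borel_measurable ((lborel \<Otimes>\<^sub>M lborel) \<Otimes>\<^sub>M lborel) = borel_measurable ((borel \<Otimes>\<^sub>M (borel :: real measure)) \<Otimes>\<^sub>M borel :: ((real \<times> real) \<times> real) measure)"
    by (intro measurable_cong_sets sets_pair_measure_cong) simp_all
  have m1: "(\<lambda>q :: (real \<times> real) \<times> real. (snd (fst q), snd q)) \<in> (borel \<Otimes>\<^sub>M borel) \<Otimes>\<^sub>M borel \<rightarrow>\<^sub>M borel \<Otimes>\<^sub>M borel" by measurable
  have m2: "(\<lambda>q :: (real \<times> real) \<times> real. indicator {r..t} (snd q) *\<^sub>R mild_source r (snd (fst q)) (snd q)) \<in> borel_measurable ((borel \<Otimes>\<^sub>M borel) \<Otimes>\<^sub>M borel)"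
    using measurable_compose[OF m1 mild_integrand_measurable[OF rt(1,3), of r]] by (simp add: mild_source_def case_prod_beta)
  have m3: "(\<lambda>q :: (real \<times> real) \<times> real. complex_of_real (of_bool (snd q \<le> fst (fst q)))) \<in> borel_measurable ((borel \<Otimes>\<^sub>M borel) \<Otimes>\<^sub>M borel)"
    by measurable
  have "(\<lambda>q. complex_of_real (of_bool (snd q \<le> fst (fst q))) * (indicator {r..t} (snd q) *\<^sub>R mild_source r (snd (fst q)) (snd q))) \<in> borel_measurable ((lborel \<Otimes>\<^sub>M lborel) \<Otimes>\<^sub>M lborel)"
    unfolding sets3 by (rule borel_measurable_times[OF m3 m2])
  then have "(\<lambda>(p, \<sigma>). complex_of_real (of_bool (\<sigma> \<le> fst p)) * (indicator {r..t} \<sigma> *\<^sub>R mild_source r (snd p) \<sigma>)) \<in> borel_measurable ((lborel \<Otimes>\<^sub>M lborel) \<Otimes>\<^sub>M lborel)"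
    by (simp add: case_prod_beta)
  from lborel.borel_measurable_lebesgue_integral[OF this]
  have V: "(\<lambda>p. LINT \<sigma>|lborel. complex_of_real (of_bool (\<sigma> \<le> fst p)) * (indicator {r..t} \<sigma> *\<^sub>R mild_source r (snd p) \<sigma>)) \<in> borel_measurable (borel \<Otimes>\<^sub>M borel)"
    unfolding sets .
  have fm: "fourier (u r) \<in> borel_measurable borel" using fourier_u_measurable[of r] rt by simp
  have "(\<lambda>p. indicator {r..t} (fst p) *\<^sub>R (exp (- lam (snd p) * of_real (fst p - r)) * (fourier (u r) (snd p)
      - (LINT \<sigma>|lborel. complex_of_real (of_bool (\<sigma> \<le> fst p)) * (indicator {r..t} \<sigma> *\<^sub>R mild_source r (snd p) \<sigma>))))) \<in> borel_measurable (borel \<Otimes>\<^sub>M borel)"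
    using V fm by measurable
  moreover have "indicator {r..t} (fst p) *\<^sub>R (exp (- lam (snd p) * of_real (fst p - r)) * (fourier (u r) (snd p)
      - (LINT \<sigma>|lborel. complex_of_real (of_bool (\<sigma> \<le> fst p)) * (indicator {r..t} \<sigma> *\<^sub>R mild_source r (snd p) \<sigma>))))
    = (case p of (\<tau>, \<xi>) \<Rightarrow> indicator {r..t} \<tau> *\<^sub>R mild_rhs r \<tau> \<xi>)" for p :: "real \<times> real"
  proof (cases "fst p \<in> {r..t}")
    case True
    have "(LINT \<sigma>|lborel. complex_of_real (of_bool (\<sigma> \<le> fst p)) * (indicator {r..t} \<sigma> *\<^sub>R mild_source r (snd p) \<sigma>))
        = (LINT \<sigma>:{r..fst p}|lborel. mild_source r (snd p) \<sigma>)"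
      unfolding set_lebesgue_integral_def using True by (intro Bochner_Integration.integral_cong) (auto simp: indicator_def)
    then show ?thesis by (simp add: mild_rhs_factor case_prod_beta)
  qed (simp add: case_prod_beta)
  ultimately show ?thesis unfolding sets by (simp only:)
qed

text \<open>The inequality at each frequency is integrated over \<xi>, and the order of integration
  is exchanged. At each fixed time \<open>mild_rhs\<close> then agrees almost everywhere with the
  transform of u, so \<open>flux_bound\<close> applies; the factors 2 \<pi> of Plancherel and
  Parseval cancel.\<close>

theorem energy_inequality:
  assumes rt: "0 < r" "r \<le> t" "t < T"
  shows "(L2 (u t))\<^sup>2 \<le> (L2 (u r))\<^sup>2 + (LINT \<tau>:{r..t}|lborel. 2 * sup_deriv \<tau> * (L2 (u \<tau>))\<^sup>2)"
proof -
  have sub: "{r..t} \<subseteq> {0..<T}" using rt by auto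
  have r: "r \<in> {0..<T}" and t: "t \<in> {0..<T}" using rt by auto
  define P where "P \<tau> \<xi> = N \<tau> \<xi> * cnj (\<i> * of_real \<xi> * mild_rhs r \<tau> \<xi>)" for \<tau> \<xi>
  define P' where "P' \<tau> \<xi> = N \<tau> \<xi> * cnj (\<i> * of_real \<xi> * fourier (u \<tau>) \<xi>)" for \<tau> \<xi>
  \<comment> \<open>F uses \<open>mild_rhs\<close> for the sake of joint measurability;
    \<open>P'\<close> is its counterpart with the transform of u, equal to it for almost every
    frequency at each time in [r, t].\<close>
  define F where "F = (\<lambda>(\<tau>, \<xi>). indicator {r..t} \<tau> *\<^sub>R P \<tau> \<xi>)"
  have sets: "borel_measurable (lborel \<Otimes>\<^sub>M lborel) = borel_measurable (borel \<Otimes>\<^sub>M (borel :: real measure) :: (real \<times> real) measure)"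
    by (intro measurable_cong_sets sets_pair_measure_cong) simp_all
  have Fm: "F \<in> borel_measurable (lborel \<Otimes>\<^sub>M lborel)"
  proof -
    have 1: "(\<lambda>p. indicator {r..t} (fst p) *\<^sub>R N (fst p) (snd p)) \<in> borel_measurable (borel \<Otimes>\<^sub>M borel)"
      by (rule borel_measurable_N_strip) (use rt in auto)
    have 2: "(\<lambda>p. indicator {r..t} (fst p) *\<^sub>R mild_rhs r (fst p) (snd p)) \<in> borel_measurable (borel \<Otimes>\<^sub>M borel)"
      using mild_rhs_joint_measurable[of r t] rt unfolding sets by (simp add: case_prod_beta)
    have "(\<lambda>p. (indicator {r..t} (fst p) *\<^sub>R N (fst p) (snd p)) * cnj (\<i> * of_real (snd p) * (indicator {r..t} (fst p) *\<^sub>R mild_rhs r (fst p) (snd p)))) \<in> borel_measurable (borel \<Otimes>\<^sub>M borel)"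
      using 1 2 by measurable
    then show ?thesis
      unfolding sets by (rule measurable_cong[THEN iffD1, rotated]) (auto simp: F_def P_def indicator_def case_prod_beta)
  qed
  have Fs: "(\<lambda>\<xi>. F (\<tau>, \<xi>)) \<in> borel_measurable lborel" for \<tau>
    using measurable_compose[OF measurable_Pair1' Fm, of \<tau>] by simp
  have AE_eq: "AE \<xi> in lborel. F (\<tau>, \<xi>) = indicator {r..t} \<tau> *\<^sub>R P' \<tau> \<xi>" for \<tau>
  proof (cases "\<tau> \<in> {r..t}")
    case True
    have "AE \<xi> in lborel. fourier (u \<tau>) \<xi> = mild_rhs r \<tau> \<xi>" by (rule mild_formula) (use True rt in auto)
    then show ?thesis by eventually_elim (simp add: F_def P_def P'_def)
  qed (simp add: F_def)
  have iP': "integrable lborel (\<lambda>\<xi>. indicator {r..t} \<tau> *\<^sub>R P' \<tau> \<xi>)" for \<tau>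
    unfolding P'_def using flux_bound(1)[of \<tau>] sub by (cases "\<tau> \<in> {r..t}") auto
  have iF: "integrable lborel (\<lambda>\<xi>. F (\<tau>, \<xi>))" for \<tau>
    by (rule integrable_cong_AE[THEN iffD2, OF Fs _ AE_eq iP']) (use iP' in simp)
  obtain k where k: "\<And>\<tau>. \<tau> \<in> {r..t} \<Longrightarrow> sobolev_norm s (u \<tau>) \<le> k" using sobolev_norm_bounded[of r t] rt by auto
  define C where "C = sqrt (2 * pi) * (sobolev_const s * k * (2 * k)) * k"
  have k0: "0 \<le> k" using order_trans[OF sobolev_norm_nonneg k[of r]] rt by simp
  \<comment> \<open>A bound uniform in time, from the bound k on the Sobolev norm over the compact
    interval; it makes F integrable on the product.\<close>
  have C: "(LINT \<xi>|lborel. norm (F (\<tau>, \<xi>))) \<le> C * indicator {r..t} \<tau>" for \<tau>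
  proof (cases "\<tau> \<in> {r..t}")
    case True
    then have \<tau>: "\<tau> \<in> {0..<T}" using sub by auto
    have "(LINT \<xi>|lborel. norm (F (\<tau>, \<xi>))) = (LINT \<xi>|lborel. norm (P' \<tau> \<xi>))"
    proof (rule integral_cong_AE)
      show "AE \<xi> in lborel. norm (F (\<tau>, \<xi>)) = norm (P' \<tau> \<xi>)"
        using AE_eq[of \<tau>] by eventually_elim (use True in simp)
      show "(\<lambda>\<xi>. norm (F (\<tau>, \<xi>))) \<in> borel_measurable lborel" using Fs[of \<tau>] by simp
      show "(\<lambda>\<xi>. norm (P' \<tau> \<xi>)) \<in> borel_measurable lborel" using iP'[of \<tau>] True by simp
    qed
    also have "\<dots> \<le> L2 (N \<tau>) * sobolev_norm s (u \<tau>)" unfolding P'_def by (rule flux_bound(3)[OF \<tau>])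
    also have "L2 (N \<tau>) = sqrt (2 * pi) * L2 (Q \<tau>)"
    proof -
      have "(L2 (N \<tau>))\<^sup>2 = 2 * pi * (L2 (\<lambda>x. complex_of_real (Q \<tau> x)))\<^sup>2"
        by (rule fourier_plancherel[OF square_integrable_of_real[OF square_integrable_Q(1)[OF \<tau>]] is_fourier_N[OF \<tau>]])
      also have "\<dots> = (sqrt (2 * pi) * L2 (Q \<tau>))\<^sup>2" unfolding L2_of_real power_mult_distrib by simp
      finally show ?thesis by (rule power2_eq_imp_eq) simp_all
    qed
    also have "sqrt (2 * pi) * L2 (Q \<tau>) * sobolev_norm s (u \<tau>) \<le> C"
      unfolding C_def
    proof (intro mult_mono mult_left_mono order_trans[OF square_integrable_Q(2)[OF \<tau>]])
      show "L2 (u \<tau>) \<le> k" using L2_le_sobolev_norm(2)[OF sobolev_u[OF \<tau>]] s k[OF True] by simp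
    qed (use k[OF True] k0 in \<open>auto simp: sobolev_const_def\<close>)
    finally show ?thesis using True by simp
  qed (simp add: F_def)
  have int: "integrable (lborel \<Otimes>\<^sub>M lborel) F"
  proof (rule lborel_pair.Fubini_integrable[OF Fm])
    show "integrable lborel (\<lambda>\<tau>. LINT \<xi>|lborel. norm (F (\<tau>, \<xi>)))"
    proof (rule Bochner_Integration.integrable_bound)
      have "integrable lborel (indicator {r..t} :: real \<Rightarrow> real)"
        by (intro integrable_real_indicator) (auto simp: emeasure_lborel_Icc_eq)
      then show "integrable lborel (\<lambda>\<tau>. C * indicator {r..t} \<tau>)" by simp
      have "(\<lambda>(\<tau>, \<xi>). norm (F (\<tau>, \<xi>))) \<in> borel_measurable (lborel \<Otimes>\<^sub>M lborel)"
        using measurable_compose[OF Fm borel_measurable_norm] by (simp add: case_prod_beta)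
      from lborel.borel_measurable_lebesgue_integral[OF this]
      show "(\<lambda>\<tau>. LINT \<xi>|lborel. norm (F (\<tau>, \<xi>))) \<in> borel_measurable lborel" .
      show "AE \<tau> in lborel. norm (LINT \<xi>|lborel. norm (F (\<tau>, \<xi>))) \<le> norm (C * indicator {r..t} \<tau>)"
        using C by (intro AE_I2) (simp add: order_trans[OF C abs_ge_self])
    qed
  qed (use iF in simp)
  have int': "integrable (lborel \<Otimes>\<^sub>M lborel) (case_prod (\<lambda>\<tau> \<xi>. F (\<tau>, \<xi>)))" using int by simp
  have U: "AE \<xi> in lborel. fourier (u t) \<xi> = mild_rhs r t \<xi>" "AE \<xi> in lborel. fourier (u r) \<xi> = mild_rhs r r \<xi>"
    using mild_formula[OF rt] mild_formula[of r r] rt by auto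
  have su: "integrable lborel (\<lambda>\<xi>. (norm (fourier (u t) \<xi>))\<^sup>2)" "integrable lborel (\<lambda>\<xi>. (norm (fourier (u r) \<xi>))\<^sup>2)"
    by (intro square_integrable_sq square_integrable_fourier sq_u t r)+
  have "2 * pi * ((L2 (u t))\<^sup>2 - (L2 (u r))\<^sup>2) = (L2 (fourier (u t)))\<^sup>2 - (L2 (fourier (u r)))\<^sup>2"
    by (simp add: L2_fourier[OF sq_u[OF t]] L2_fourier[OF sq_u[OF r]] power_mult_distrib right_diff_distrib)
  also have "\<dots> = (LINT \<xi>|lborel. (norm (fourier (u t) \<xi>))\<^sup>2 - (norm (fourier (u r) \<xi>))\<^sup>2)"
    unfolding L2_sq by (rule Bochner_Integration.integral_diff[OF su, symmetric])
  also have "\<dots> \<le> (LINT \<xi>|lborel. Re (LINT \<tau>|lborel. F (\<tau>, \<xi>)))"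
  proof (rule integral_mono_AE)
    show "integrable lborel (\<lambda>\<xi>. (norm (fourier (u t) \<xi>))\<^sup>2 - (norm (fourier (u r) \<xi>))\<^sup>2)"
      by (rule Bochner_Integration.integrable_diff[OF su])
    show "integrable lborel (\<lambda>\<xi>. Re (LINT \<tau>|lborel. F (\<tau>, \<xi>)))"
      by (intro integrable_Re lborel_pair.integrable_snd[OF int'])
    show "AE \<xi> in lborel. (norm (fourier (u t) \<xi>))\<^sup>2 - (norm (fourier (u r) \<xi>))\<^sup>2 \<le> Re (LINT \<tau>|lborel. F (\<tau>, \<xi>))"
      using U lborel_pair.AE_integrable_snd[OF int']
    proof eventually_elim
      case (elim \<xi>)
      have "(norm (fourier (u t) \<xi>))\<^sup>2 - (norm (fourier (u r) \<xi>))\<^sup>2 \<le> (LINT \<tau>:{r..t}|lborel. Re (P \<tau> \<xi>))"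
        unfolding elim(1,2) P_def by (rule energy_pointwise) (use rt in auto)
      also have "\<dots> = (LINT \<tau>|lborel. Re (F (\<tau>, \<xi>)))"
        unfolding set_lebesgue_integral_def F_def by simp
      also have "\<dots> = Re (LINT \<tau>|lborel. F (\<tau>, \<xi>))" by (rule integral_Re[OF elim(3)])
      finally show ?case .
    qed
  qed
  also have "\<dots> = Re (LINT \<xi>|lborel. LINT \<tau>|lborel. F (\<tau>, \<xi>))"
    by (rule integral_Re[OF lborel_pair.integrable_snd[OF int']])
  also have "(LINT \<xi>|lborel. LINT \<tau>|lborel. F (\<tau>, \<xi>)) = (LINT \<tau>|lborel. LINT \<xi>|lborel. F (\<tau>, \<xi>))"
    by (rule lborel_pair.Fubini_integral[OF int'])
  also have "Re \<dots> = (LINT \<tau>|lborel. Re (LINT \<xi>|lborel. F (\<tau>, \<xi>)))"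
    by (rule integral_Re[OF lborel_pair.integrable_fst[OF int'], symmetric])
  also have "\<dots> \<le> (LINT \<tau>|lborel. (2 * pi) * (indicator {r..t} \<tau> *\<^sub>R (2 * sup_deriv \<tau> * (L2 (u \<tau>))\<^sup>2)))"
  proof (rule integral_mono)
    show "integrable lborel (\<lambda>\<tau>. Re (LINT \<xi>|lborel. F (\<tau>, \<xi>)))" by (intro integrable_Re lborel_pair.integrable_fst[OF int'])
    have "continuous_on {r..t} (\<lambda>\<tau>. 2 * sup_deriv \<tau> * (L2 (u \<tau>))\<^sup>2)"
      by (intro continuous_intros continuous_on_subset[OF continuous_sup_deriv sub] continuous_on_subset[OF continuous_L2_u sub])
    from borel_integrable_atLeastAtMost'[OF this]
    show "integrable lborel (\<lambda>\<tau>. (2 * pi) * (indicator {r..t} \<tau> *\<^sub>R (2 * sup_deriv \<tau> * (L2 (u \<tau>))\<^sup>2)))"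
      unfolding set_integrable_def by (rule integrable_mult_right)
    fix \<tau>
    have "(LINT \<xi>|lborel. F (\<tau>, \<xi>)) = (LINT \<xi>|lborel. indicator {r..t} \<tau> *\<^sub>R P' \<tau> \<xi>)"
      by (rule integral_cong_AE[OF Fs _ AE_eq]) (use iP' in simp)
    then show "Re (LINT \<xi>|lborel. F (\<tau>, \<xi>)) \<le> (2 * pi) * (indicator {r..t} \<tau> *\<^sub>R (2 * sup_deriv \<tau> * (L2 (u \<tau>))\<^sup>2))"
      using flux_bound(2)[of \<tau>, folded P'_def] sub by (cases "\<tau> \<in> {r..t}") auto
  qed
  also have "\<dots> = 2 * pi * (LINT \<tau>:{r..t}|lborel. 2 * sup_deriv \<tau> * (L2 (u \<tau>))\<^sup>2)"
    unfolding set_lebesgue_integral_def by (rule integral_mult_right_zero)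
  finally have "(L2 (u t))\<^sup>2 - (L2 (u r))\<^sup>2 \<le> (LINT \<tau>:{r..t}|lborel. 2 * sup_deriv \<tau> * (L2 (u \<tau>))\<^sup>2)"
    by (rule mult_le_cancel_left_pos[THEN iffD1, rotated]) simp
  then show ?thesis by simp
qed

text \<open>Gronwall's inequality for the squared norm with rate \<open>2 * sup_deriv\<close>. The
  exponent never exceeds 2 I, whatever t < T, so the bound is uniform up to T.\<close>

lemma L2_bounded_of_sup_deriv_integrable:
  assumes r: "0 < r" and fin: "(\<integral>\<^sup>+t\<in>{0..<T}. Linfty_norm (weak_deriv (u t)) \<partial>lborel) < \<infinity>"
  shows "\<exists>S. \<forall>t\<in>{r..<T}. L2 (u t) \<le> S"
proof -
  define I where "I = enn2real (\<integral>\<^sup>+t\<in>{0..<T}. Linfty_norm (weak_deriv (u t)) \<partial>lborel)"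
  have I: "(\<integral>\<^sup>+t\<in>{0..<T}. Linfty_norm (weak_deriv (u t)) \<partial>lborel) = ennreal I"
    unfolding I_def using fin by (simp add: top_ennreal_def less_top)
  have I0: "0 \<le> I" by (simp add: I_def)
  have "L2 (u t) \<le> sqrt ((L2 (u r))\<^sup>2 * exp (2 * I))" if t: "t \<in> {r..<T}" for t
  proof -
    have rt: "r \<le> t" "t < T" and sub: "{r..t} \<subseteq> {0..<T}" using t r by auto
    have mc: "continuous_on {r..t} sup_deriv" by (rule continuous_on_subset[OF continuous_sup_deriv sub])
    have "(L2 (u t))\<^sup>2 \<le> (L2 (u r))\<^sup>2 * exp (LINT \<tau>:{r..t}|lborel. 2 * sup_deriv \<tau>)"
    proof (rule gronwall[OF rt(1)])
      show "continuous_on {r..t} (\<lambda>t. (L2 (u t))\<^sup>2)" by (intro continuous_intros continuous_on_subset[OF continuous_L2_u sub])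
      show "continuous_on {r..t} (\<lambda>\<tau>. 2 * sup_deriv \<tau>)" by (intro continuous_intros mc)
      show "(L2 (u x))\<^sup>2 \<le> (L2 (u r))\<^sup>2 + (LINT \<tau>:{r..x}|lborel. 2 * sup_deriv \<tau> * (L2 (u \<tau>))\<^sup>2)" if "x \<in> {r..t}" for x
        by (rule energy_inequality) (use that r rt in auto)
    qed simp
    also have "(LINT \<tau>:{r..t}|lborel. 2 * sup_deriv \<tau>) = 2 * (LINT \<tau>:{r..t}|lborel. sup_deriv \<tau>)"
      by (rule set_integral_mult_right)
    also have "(LINT \<tau>:{r..t}|lborel. sup_deriv \<tau>) \<le> I"
    proof -
      have i: "integrable lborel (\<lambda>\<tau>. indicator {r..t} \<tau> *\<^sub>R sup_deriv \<tau>)"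
        using borel_integrable_atLeastAtMost'[OF mc] by (simp add: set_integrable_def)
      have "ennreal (LINT \<tau>:{r..t}|lborel. sup_deriv \<tau>) = (\<integral>\<^sup>+\<tau>. ennreal (indicator {r..t} \<tau> *\<^sub>R sup_deriv \<tau>) \<partial>lborel)"
        unfolding set_lebesgue_integral_def by (rule nn_integral_eq_integral[OF i, symmetric]) simp
      also have "\<dots> \<le> (\<integral>\<^sup>+t\<in>{0..<T}. Linfty_norm (weak_deriv (u t)) \<partial>lborel)"
        using sub by (intro nn_integral_mono) (auto simp: indicator_def Linfty_eq_sup_deriv)
      finally show ?thesis unfolding I using I0 by (simp add: ennreal_le_iff)
    qed
    finally have "(L2 (u t))\<^sup>2 \<le> (L2 (u r))\<^sup>2 * exp (2 * I)" by (simp add: mult_left_mono)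
    then show ?thesis by (rule real_le_rsqrt)
  qed
  then show ?thesis by blast
qed

section \<open>The blow-up criterion\<close>

theorem blowup_iff:
  assumes T: "0 < T"
  shows "filterlim (\<lambda>t. sobolev_norm s (u t)) at_top (at_left T) \<longleftrightarrow>
    (\<integral>\<^sup>+t\<in>{0..<T}. Linfty_norm (weak_deriv (u t)) \<partial>lborel) = \<infinity>"
proof
  assume lim: "filterlim (\<lambda>t. sobolev_norm s (u t)) at_top (at_left T)"
  show "(\<integral>\<^sup>+t\<in>{0..<T}. Linfty_norm (weak_deriv (u t)) \<partial>lborel) = \<infinity>"
  proof (rule ccontr)
    assume "(\<integral>\<^sup>+t\<in>{0..<T}. Linfty_norm (weak_deriv (u t)) \<partial>lborel) \<noteq> \<infinity>"
    then have "(\<integral>\<^sup>+t\<in>{0..<T}. Linfty_norm (weak_deriv (u t)) \<partial>lborel) < \<infinity>" by (simp add: less_top)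
    from L2_bounded_of_sup_deriv_integrable[OF half_gt_zero[OF T] this]
    obtain S where "\<And>t. t \<in> {T / 2..<T} \<Longrightarrow> L2 (u t) \<le> S" by blast
    from sobolev_bounded_of_L2_bounded[OF half_gt_zero[OF T] this]
    obtain k where k: "\<And>t. t \<in> {T / 2..<T} \<Longrightarrow> sobolev_norm s (u t) \<le> k" by blast
    have "\<forall>\<^sub>F t in at_left T. k + 1 \<le> sobolev_norm s (u t)" using lim by (simp add: filterlim_at_top)
    moreover have "\<forall>\<^sub>F t in at_left T. t \<in> {T / 2<..<T}" using T by (intro eventually_at_leftI[of "T / 2"]) auto
    ultimately have "\<forall>\<^sub>F t in at_left T. False"
    proof eventually_elim
      case (elim t)
      then show ?case using k[of t] by simp
    qed
    then show False by simp
  qed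
next
  assume inf: "(\<integral>\<^sup>+t\<in>{0..<T}. Linfty_norm (weak_deriv (u t)) \<partial>lborel) = \<infinity>"
  show "filterlim (\<lambda>t. sobolev_norm s (u t)) at_top (at_left T)"
  proof (rule ccontr)
    assume "\<not> filterlim (\<lambda>t. sobolev_norm s (u t)) at_top (at_left T)"
    \<comment> \<open>Failure to diverge means that some level Z is missed at times arbitrarily
      close to T, which provides a restart time r in the final stretch of length \<delta>. The
      absolute value of Z is taken below because \<open>L2_bounded_near_end\<close> asks for a
      nonnegative level.\<close>
    then obtain Z where Z: "\<not> (\<forall>\<^sub>F t in at_left T. Z \<le> sobolev_norm s (u t))" by (auto simp: filterlim_at_top)
    obtain \<delta> where \<delta>: "\<delta> > 0" "\<And>r t. \<lbrakk>0 < r; T - \<delta> < r; L2 (u r) \<le> \<bar>Z\<bar>; r \<le> t; t < T\<rbrakk> \<Longrightarrow> L2 (u t) \<le> \<bar>Z\<bar> + 1"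
      using L2_bounded_near_end[of "\<bar>Z\<bar>"] by auto
    have "\<exists>r. max 0 (T - \<delta>) < r \<and> r < T \<and> \<not> Z \<le> sobolev_norm s (u r)"
    proof (rule ccontr)
      assume *: "\<nexists>r. max 0 (T - \<delta>) < r \<and> r < T \<and> \<not> Z \<le> sobolev_norm s (u r)"
      have "\<forall>\<^sub>F t in at_left T. Z \<le> sobolev_norm s (u t)"
        by (rule eventually_at_leftI[of "max 0 (T - \<delta>)"]) (use * T \<delta>(1) in auto)
      with Z show False by blast
    qed
    then obtain r where r: "0 < r" "T - \<delta> < r" "r < T" "sobolev_norm s (u r) < Z" by auto
    have "L2 (u r) \<le> sobolev_norm s (u r)" by (rule L2_le_sobolev_norm(2)[OF sobolev_u]) (use r s in auto)
    then have "L2 (u r) \<le> \<bar>Z\<bar>" using r by linarith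
    then have "\<And>t. t \<in> {r..<T} \<Longrightarrow> L2 (u t) \<le> \<bar>Z\<bar> + 1" using \<delta>(2) r by auto
    from sobolev_bounded_of_L2_bounded[OF r(1) this]
    obtain k where k: "\<And>t. t \<in> {r..<T} \<Longrightarrow> sobolev_norm s (u t) \<le> k" by blast
    \<comment> \<open>The bound k holds from r on; on the compact interval before r the norm is
      bounded by continuity.\<close>
    obtain k' where k': "\<And>t. t \<in> {0..r} \<Longrightarrow> sobolev_norm s (u t) \<le> k'" using sobolev_norm_bounded[of 0 r] r by auto
    define c where "c = sobolev_const s * max k k'"
    have c: "Linfty_norm (weak_deriv (u t)) \<le> ennreal c" if t: "t \<in> {0..<T}" for t
    proof -
      have "sobolev_norm s (u t) \<le> max k k'"
        using k[of t] k'[of t] t by (cases "t \<le> r") (auto simp: le_max_iff_disj)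
      then have "sobolev_const s * sobolev_norm s (u t) \<le> c"
        unfolding c_def by (intro mult_left_mono) (simp_all add: sobolev_const_def)
      then show ?thesis by (rule order_trans[OF Linfty_bound[OF sobolev_u[OF t] s] ennreal_leI])
    qed
    have "(\<integral>\<^sup>+t\<in>{0..<T}. Linfty_norm (weak_deriv (u t)) \<partial>lborel) \<le> (\<integral>\<^sup>+t. ennreal c * indicator {0..<T} t \<partial>lborel)"
      using c by (intro nn_integral_mono) (auto simp: indicator_def)
    also have "\<dots> = ennreal c * ennreal T" using T by (simp add: nn_integral_cmult_indicator)
    also have "\<dots> < \<infinity>" by (simp add: ennreal_mult_less_top)
    finally show False using inf by simp
  qed
qed

end

theorem proposition1p2:
  fixes \<beta> \<mu> s T\<^sub>0 Tstar :: real
    and u\<^sub>0 :: "real \<Rightarrow> real"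
    and u :: "real \<Rightarrow> real \<Rightarrow> real"
  assumes "\<beta> \<noteq> 0" and "\<mu> > 0" and "s > 3 / 2"
    and "in_sobolev s u\<^sub>0"
    and "0 < T\<^sub>0" and "solution_on \<beta> \<mu> s u\<^sub>0 {0..T\<^sub>0} u"
    and "T\<^sub>0 < Tstar" and "solution_on \<beta> \<mu> s u\<^sub>0 {0..<Tstar} u"
  shows "filterlim (\<lambda>t. sobolev_norm s (u t)) at_top (at_left Tstar) \<longleftrightarrow>
    (\<integral>\<^sup>+t\<in>{0..<Tstar}. Linfty_norm (weak_deriv (u t)) \<partial>lborel) = \<infinity>"
proof -
  \<comment> \<open>The interior of the half-open interval is the open interval on which the locale
    expects the equation.\<close>
  interpret flow \<beta> \<mu> s Tstar u
    using assms by unfold_locales (simp_all add: solution_on_def)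
  show ?thesis using assms by (intro blowup_iff) simp
qed

end
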